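(* There is a constant $C_{B,6}=2.9\,C_{\ell_2}C_{\phi,6}\ge2.9$, independent of $d$, $n$ and of the probability distribution of the $X_i$ ($C_{\ell_2}$, $C_{\phi,6}$ are numerical constants as described in the context), such that the following holds. Let $X_1,\dots,X_n$ be i.i.d. random vectors in $\mathbb{R}^d$ with $\mathbb{E}X_i=0$, $\mathbb{E}|X_i^{\otimes6}|<\infty$ and positive definite $\Sigma=\operatorname{Var}(X_i)$. Let $X=(x_1,\dots,x_d)$ be an independent copy of $X_i$ and assume that $\mathbb{E}\,p(x_1,\dots,x_d)=0$ for every monomial $p:\mathbb{R}^d\to\mathbb{R}$ of degree $\le5$ that contains an odd power of $x_j$ for at least one $j\in\{1,\dots,d\}$. Assume in addition that there exist a random vector $U_L$ in $\mathbb{R}^d$ with $\mathbb{E}|U_L^{\otimes6}|<\infty$ and a positive definite matrix $\Sigma_L\in\mathbb{R}^{d\times d}$ such that, for $Z_{\Sigma_L}\sim\mathcal N(0,\Sigma_L)$ independent of $U_L$ and $L=Z_{\Sigma_L}+U_L$, $$\mathbb{E}(L^{\otimes j})=\mathbb{E}(X_i^{\otimes j})\quad\text{for all }j\in\{1,\dots,5\}.$$ Let $\lambda_z^2>0$ be the smallest eigenvalue of $\Sigma_L$, $L_1$ a copy of $L$, $Z_\Sigma\sim\mathcal N(0,\Sigma)$ and $S_n=n^{-1/2}\sum_{i=1}^nX_i$. Then $$\Delta_{\mathscr B}(S_n,Z_\Sigma)\le C_{B,6}\bigl\{\lambda_z^{-6}\mathbb{E}(\|X_1\|^6+\|L_1\|^6)\bigr\}^{1/4}n^{-1/2}+(4!)^{-1/2}\lambda_z^{-4}\|\mathbb{E}(X_1^{\otimes4})-\mathbb{E}(Z_\Sigma^{\otimes4})\|_{\mathrm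 F}\,n^{-1}$$ $$\qquad+(6!)^{-1/2}\lambda_z^{-6}\bigl\{\mathbb{E}\|U_L\|^6+\mathbb{E}\|Z_\Sigma\|^6\bigr\}n^{-2}.$$ Moreover, if $m_{6,sym}$ denotes the maximum of the 6-th moments of the coordinates of $X_1,L_1,Z_\Sigma$, then $$\Delta_{\mathscr B}(S_n,Z_\Sigma)\le(4!)^{-1/2}\lambda_z^{-4}\|\mathbb{E}(X_1^{\otimes4})-\mathbb{E}(Z_\Sigma^{\otimes4})\|_{\mathrm F}\,n^{-1}+C_{B,6}(\lambda_z^{-6}m_{6,sym})^{1/4}d^{3/4}n^{-1/2}+(6!)^{-1/2}(\lambda_z^{-6}m_{6,sym})d^3n^{-2}$$ $$\le8^{-1/2}\lambda_z^{-4}\|\mathbb{E}(X_1^{\otimes4})-\mathbb{E}(Z_\Sigma^{\otimes4})\|_{\max}\,d\,n^{-1}+C_{B,6}(\lambda_z^{-6}m_{6,sym})^{1/4}d^{3/4}n^{-1/2}+(6!)^{-1/2}(\lambda_z^{-6}m_{6,sym})d^3n^{-2}.$$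
   Context: Notation. $\|\cdot\|$ is the Euclidean norm of a vector. $\mathbb{E}|X^{\otimes k}|<\infty$ means that $\mathbb{E}|x_{i_1}\cdots x_{i_k}|<\infty$ for all coordinate indices. For a tensor $A\in(\mathbb{R}^d)^{\otimes k}$ with elements $a_{i_1,\dots,i_k}$: $\|A\|_{\mathrm F}=(\sum a_{i_1,\dots,i_k}^2)^{1/2}$, $\|A\|_{\max}=\max|a_{i_1,\dots,i_k}|$. $f^{(s)}(x)h^s=(h^T\nabla)^sf(x)$. $\Delta_{\mathscr{B}}(X,Y)=\sup_{r\ge0,\,t\in\mathbb{R}^d}|\mathbb{P}(\|X-t\|\le r)-\mathbb{P}(\|Y-t\|\le r)|$. Form of the constants: $C_{\ell_2}=\max\{1,\tilde C\}$, where $\tilde C>0$ is a numerical constant such that $\sup_{B}\mathbb{P}(Z\in B^{\varepsilon}\setminus B)\le\varepsilon\tilde C/\lambda$ for every $d$, every $\varepsilon>0$ and every Gaussian vector $Z$ in $\mathbb{R}^d$ with positive definite covariance whose smallest eigenvalue is $\lambda^2$ ($B=B(x_0,r)$ ranges over closed Euclidean balls, $B^\varepsilon=B(x_0,r+\varepsilon)$). $C_{\phi,6}=\max\{1,C_{\phi,1,4},C_{\phi,1,5}\}$, where for a fixed sufficiently smooth $\phi:\mathbb{R}\to[0,1]$ with $\phi=1$ on $(-\infty,0]$ and $\phi=0$ on $[1,\infty)$, and $\psi(x;B)=\phi\bigl((\|x-x_0\|^2-r^2)\mathbb 1\{x\notin B\}/(\varepsilon^2+2r\varepsilon)\bigr)$,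 the numerical constants $C_{\phi,1,j}$ satisfy $|\psi^{(j)}(x;B)h^j|\le C_{\phi,1,j}\|h\|^j(\varepsilon/2)^{-j}\mathbb 1\{x\in B(x_0,r+\varepsilon)\setminus B\}$ for all $B$, $\varepsilon>0$, $x,h\in\mathbb{R}^d$. *)

theory Defs
  imports "HOL-Probability.Probability" "Jordan_Normal_Form.Char_Poly"
begin

text \<open>
  The constants of the theorem do not depend on the dimension, so the dimension has to be a
  natural number \<open>d\<close> that can be quantified over inside a formula.  Points of d-dimensional
  space are functions \<open>nat \<Rightarrow> real\<close> of which only the coordinates below \<open>d\<close> are used; matrices
  are those of the theory \<open>Matrix\<close>.
\<close>

unbundle no inner_syntax
no_notation vec_nth (infixl \<open>$\<close> 90)

abbreviation Rd :: "nat \<Rightarrow> (nat \<Rightarrow> real) measure" where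
  "Rd d \<equiv> Pi\<^sub>M {..<d} (\<lambda>_. borel)"

abbreviation enorm :: "nat \<Rightarrow> (nat \<Rightarrow> real) \<Rightarrow> real" where
  "enorm d x \<equiv> L2_set x {..<d}"

definition eball :: "nat \<Rightarrow> (nat \<Rightarrow> real) \<Rightarrow> real \<Rightarrow> (nat \<Rightarrow> real) set" where
  "eball d x0 r = {x. enorm d (\<lambda>k. x k - x0 k) \<le> r}"

definition pos_def_mat :: "nat \<Rightarrow> real mat \<Rightarrow> bool" where
  "pos_def_mat d A \<longleftrightarrow> A \<in> carrier_mat d d \<and> transpose_mat A = A \<and>
     (\<forall>u\<in>carrier_vec d. u \<noteq> 0\<^sub>v d \<longrightarrow> u \<bullet> (A *\<^sub>v u) > 0)"

definition smallest_eigenvalue :: "real mat \<Rightarrow> real \<Rightarrow> bool" where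
  "smallest_eigenvalue A l \<longleftrightarrow> eigenvalue A l \<and> (\<forall>l'. eigenvalue A l' \<longrightarrow> l \<le> l')"

definition random_vector :: "'a measure \<Rightarrow> nat \<Rightarrow> ('a \<Rightarrow> nat \<Rightarrow> real) \<Rightarrow> bool" where
  "random_vector M d Y \<longleftrightarrow> prob_space M \<and> Y \<in> measurable M (Rd d)"

text \<open>
  Nondegenerate multivariate normal law with mean \<open>m\<close> and covariance \<open>A\<close>: every nonzero linear
  functional is univariate normal.  Only meaningful for positive definite \<open>A\<close>.
\<close>

definition gaussian_vector ::
    "'a measure \<Rightarrow> nat \<Rightarrow> (nat \<Rightarrow> real) \<Rightarrow> real mat \<Rightarrow> ('a \<Rightarrow> nat \<Rightarrow> real) \<Rightarrow> bool" where
  "gaussian_vector M d m A Z \<longleftrightarrow> random_vector M d Z \<and>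
     (\<forall>u\<in>carrier_vec d. u \<noteq> 0\<^sub>v d \<longrightarrow>
        distributed M lborel (\<lambda>\<omega>. \<Sum>k<d. u $ k * Z \<omega> k)
          (normal_density (\<Sum>k<d. u $ k * m k) (sqrt (u \<bullet> (A *\<^sub>v u)))))"

definition cov_mat :: "'a measure \<Rightarrow> nat \<Rightarrow> ('a \<Rightarrow> nat \<Rightarrow> real) \<Rightarrow> real mat" where
  "cov_mat M d Y = mat d d (\<lambda>(i, j).
     \<integral>\<omega>. (Y \<omega> i - (\<integral>\<omega>'. Y \<omega>' i \<partial>M)) * (Y \<omega> j - (\<integral>\<omega>'. Y \<omega>' j \<partial>M)) \<partial>M)"

text \<open>A tensor of order \<open>k\<close> is a function on the multi-indices in \<open>multi_idx d k\<close>.\<close>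

definition multi_idx :: "nat \<Rightarrow> nat \<Rightarrow> nat list set" where
  "multi_idx d k = {is. length is = k \<and> set is \<subseteq> {..<d}}"

definition finite_moments :: "'a measure \<Rightarrow> nat \<Rightarrow> nat \<Rightarrow> ('a \<Rightarrow> nat \<Rightarrow> real) \<Rightarrow> bool" where
  "finite_moments M d k Y \<longleftrightarrow>
     (\<forall>is\<in>multi_idx d k. integrable M (\<lambda>\<omega>. \<Prod>i\<leftarrow>is. Y \<omega> i))"

definition tensor_moment :: "'a measure \<Rightarrow> ('a \<Rightarrow> nat \<Rightarrow> real) \<Rightarrow> nat list \<Rightarrow> real" where
  "tensor_moment M Y is = (\<integral>\<omega>. (\<Prod>i\<leftarrow>is. Y \<omega> i) \<partial>M)"

definition frob_norm :: "nat \<Rightarrow> nat \<Rightarrow> (nat list \<Rightarrow> real) \<Rightarrow> real" where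
  "frob_norm d k T = sqrt (\<Sum>is\<in>multi_idx d k. (T is)\<^sup>2)"

definition max_norm :: "nat \<Rightarrow> nat \<Rightarrow> (nat list \<Rightarrow> real) \<Rightarrow> real" where
  "max_norm d k T = Max ((\<lambda>is. \<bar>T is\<bar>) ` multi_idx d k)"

text \<open>The two random vectors may live on different probability spaces.\<close>

definition ball_dist ::
    "nat \<Rightarrow> 'a measure \<Rightarrow> ('a \<Rightarrow> nat \<Rightarrow> real) \<Rightarrow> 'b measure \<Rightarrow> ('b \<Rightarrow> nat \<Rightarrow> real) \<Rightarrow> real" where
  "ball_dist d M X N Y = (SUP (r, t)\<in>{0..} \<times> UNIV.
     \<bar>measure M {\<omega>\<in>space M. enorm d (\<lambda>k. X \<omega> k - t k) \<le> r} -
      measure N {\<omega>\<in>space N. enorm d (\<lambda>k. Y \<omega> k - t k) \<le> r}\<bar>)"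

text \<open>
  The sample space type \<open>nat \<Rightarrow> real\<close> loses no generality: every law on d-dimensional space is
  realised on \<open>Rd d\<close>.
\<close>

definition gaussian_ball_const :: "real \<Rightarrow> bool" where
  "gaussian_ball_const C \<longleftrightarrow> C > 0 \<and>
     (\<forall>d (M :: (nat \<Rightarrow> real) measure) m A Z l \<epsilon> x0 r.
        d \<ge> 1 \<and> pos_def_mat d A \<and> gaussian_vector M d m A Z \<and>
        l > 0 \<and> smallest_eigenvalue A (l\<^sup>2) \<and> \<epsilon> > 0 \<and> r \<ge> 0 \<longrightarrow>
        measure M {\<omega>\<in>space M. Z \<omega> \<in> eball d x0 (r + \<epsilon>) - eball d x0 r} \<le> \<epsilon> * C / l)"

text \<open>
  ``Sufficiently smooth'' is read as five times continuously differentiable, which is what the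
  fifth derivative in the definition of the constants requires.
\<close>

definition smooth_cutoff :: "(real \<Rightarrow> real) \<Rightarrow> bool" where
  "smooth_cutoff \<phi> \<longleftrightarrow>
     (\<forall>j<5. (deriv ^^ j) \<phi> differentiable_on UNIV) \<and> continuous_on UNIV ((deriv ^^ 5) \<phi>) \<and>
     (\<forall>x. 0 \<le> \<phi> x \<and> \<phi> x \<le> 1) \<and> (\<forall>x\<le>0. \<phi> x = 1) \<and> (\<forall>x\<ge>1. \<phi> x = 0)"

definition ball_smoother ::
    "(real \<Rightarrow> real) \<Rightarrow> nat \<Rightarrow> (nat \<Rightarrow> real) \<Rightarrow> real \<Rightarrow> real \<Rightarrow> (nat \<Rightarrow> real) \<Rightarrow> real" where
  "ball_smoother \<phi> d x0 r \<epsilon> x =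
     \<phi> (((enorm d (\<lambda>k. x k - x0 k))\<^sup>2 - r\<^sup>2) * indicator (- eball d x0 r) x / (\<epsilon>\<^sup>2 + 2 * r * \<epsilon>))"

text \<open>The operator \<open>h\<^sup>T\<nabla>\<close>; its \<open>s\<close>-fold iterate gives \<open>f\<^sup>(\<^sup>s\<^sup>)(x) h\<^sup>s\<close>.\<close>

definition dir_deriv ::
    "nat \<Rightarrow> (nat \<Rightarrow> real) \<Rightarrow> ((nat \<Rightarrow> real) \<Rightarrow> real) \<Rightarrow> (nat \<Rightarrow> real) \<Rightarrow> real" where
  "dir_deriv d h f x = (\<Sum>i<d. h i * deriv (\<lambda>t. f (x(i := t))) (x i))"

definition cutoff_const :: "(real \<Rightarrow> real) \<Rightarrow> nat \<Rightarrow> real \<Rightarrow> bool" where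
  "cutoff_const \<phi> j C \<longleftrightarrow>
     (\<forall>d x0 r \<epsilon> x h. d \<ge> 1 \<and> r \<ge> 0 \<and> \<epsilon> > 0 \<longrightarrow>
        \<bar>(dir_deriv d h ^^ j) (ball_smoother \<phi> d x0 r \<epsilon>) x\<bar>
          \<le> C * enorm d h ^ j / (\<epsilon> / 2) ^ j * indicator (eball d x0 (r + \<epsilon>) - eball d x0 r) x)"

text \<open>
  \<open>Ct\<close> is an anti-concentration constant for Gaussian vectors, and \<open>c4\<close>, \<open>c5\<close> are derivative
  bounds for a fixed cutoff \<open>\<phi>\<close>; all of them serve every dimension at once.
\<close>

definition admissible_consts :: "real \<Rightarrow> (real \<Rightarrow> real) \<Rightarrow> real \<Rightarrow> real \<Rightarrow> bool" where
  "admissible_consts Ct \<phi> c4 c5 \<longleftrightarrow>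
     gaussian_ball_const Ct \<and> smooth_cutoff \<phi> \<and> cutoff_const \<phi> 4 c4 \<and> cutoff_const \<phi> 5 c5"

definition C_l2 :: "real \<Rightarrow> real" where
  "C_l2 Ct = max 1 Ct"

definition C_phi6 :: "real \<Rightarrow> real \<Rightarrow> real" where
  "C_phi6 c4 c5 = Max {1, c4, c5}"

definition C_B6 :: "real \<Rightarrow> real \<Rightarrow> real \<Rightarrow> real" where
  "C_B6 Ct c4 c5 = 2.9 * C_l2 Ct * C_phi6 c4 c5"

definition max_sixth_moment ::
    "nat \<Rightarrow> 'a measure \<Rightarrow> ('a \<Rightarrow> nat \<Rightarrow> real) \<Rightarrow> 'b measure \<Rightarrow> ('b \<Rightarrow> nat \<Rightarrow> real) \<Rightarrow>
     'c measure \<Rightarrow> ('c \<Rightarrow> nat \<Rightarrow> real) \<Rightarrow> real" where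
  "max_sixth_moment d M X N L K Z =
     Max ((\<lambda>k. \<integral>\<omega>. X \<omega> k ^ 6 \<partial>M) ` {..<d} \<union> (\<lambda>k. \<integral>\<omega>. L \<omega> k ^ 6 \<partial>N) ` {..<d} \<union>
          (\<lambda>k. \<integral>\<omega>. Z \<omega> k ^ 6 \<partial>K) ` {..<d})"

end

theory Submission
  imports Defs "HOL-Library.Function_Algebras"
begin

text \<open>
  A Lindeberg exchange argument.  Let \<open>\<mu>\<close>, \<open>\<nu>\<close>, \<open>\<rho>\<close> be the laws of \<open>X\<^sub>1\<close>, \<open>L\<close>, \<open>Z\<close>; sums are kept
  unnormalised, so that the distribution function of a sum on a ball \<open>B\<close> is the \<open>n\<close>-fold average
  \<open>(avg \<mu> ^^ n) 1\<^sub>B\<close>.  The law \<open>\<nu>\<close> contains a Gaussian of scale \<open>l\<close>, hence \<open>\<nu>\<close>-averages of an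
  indicator are smooth and Gaussian Taylor expansion controls an exchange of \<open>\<mu>\<close> for \<open>\<nu>\<close> by sixth
  moments.  The first exchanges, where too little Gaussian mass is available, are made with a
  smoothed indicator of the ball and anti-concentration on an annulus, inductively in \<open>n\<close>; this gives
  a distance of at most \<open>87 a b / sqrt n\<close> with \<open>a = max 1 Ct\<close> and \<open>b\<^sup>4 l\<^sup>6 = E \<parallel>X\<parallel>\<^sup>6 + E \<parallel>L\<parallel>\<^sup>6\<close>.
  Passing from \<open>\<nu>\<close> to \<open>\<rho>\<close>, only the fourth moments differ; by orthogonality of the Hermite
  polynomials they contribute the Frobenius norm with the factor \<open>1 / sqrt (4!)\<close>.

  The numerical constants leave room because a fifth-order Taylor expansion forces \<open>60 \<le> c5\<close> for every
  admissible cutoff, so that \<open>C_B6 \<ge> 174 a\<close>.  Admissible constants exist: anti-concentration for a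
  standard Gaussian follows by comparing two concentric balls through a dilation.
\<close>

section \<open>Averages over laws of random vectors\<close>

text \<open>Anti-concentration is available only for sums with Gaussian mass, whereas a smoothed
  exchange costs the probability that a mixed sum, with few Gaussian summands, hits an annulus. That
  probability is moved to a pure \<nu>-sum at the price of the very distance to be bounded, taken
  for fewer summands; hence the induction. The width \<open>29 * b * l\<close> closes it: one
  smoothed exchange costs O(b^4 l^6 / \<epsilon>^6) times an annulus probability O(a b / sqrt n),
  that is O(a b / sqrt n) divided by b^2, and about b^2 of them are made. Behind k Gaussian summands
  an exchange costs O(b^4 / k^3), so those with k > b^2 add up to a small multiple of the same unit.

  The smoothing uses a cutoff constructed here with six continuous derivatives, so its constants are
  absolute numbers; the cutoff of the statement enters only through a lower bound on
  \<open>c5\<close>.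

  Points are functions on all of nat and laws are Borel measures there, so that vectors can be
  added; functions invariant under \<open>trunc d\<close> see only the first d coordinates.\<close>

definition trunc :: "nat \<Rightarrow> (nat \<Rightarrow> real) \<Rightarrow> nat \<Rightarrow> real" where
  "trunc d x = (\<lambda>k. if k < d then x k else 0)"

definition scale :: "real \<Rightarrow> (nat \<Rightarrow> real) \<Rightarrow> nat \<Rightarrow> real" where
  "scale c x = (\<lambda>k. c * x k)"

definition dot :: "nat \<Rightarrow> (nat \<Rightarrow> real) \<Rightarrow> (nat \<Rightarrow> real) \<Rightarrow> real" where
  "dot d u x = (\<Sum>k<d. u k * x k)"

abbreviation nsq :: "nat \<Rightarrow> (nat \<Rightarrow> real) \<Rightarrow> real" where
  "nsq d u \<equiv> dot d u u"

definition law :: "(nat \<Rightarrow> real) measure \<Rightarrow> bool" where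
  "law \<mu> \<longleftrightarrow> prob_space \<mu> \<and> sets \<mu> = sets borel"

definition test_fun :: "nat \<Rightarrow> real \<Rightarrow> ((nat \<Rightarrow> real) \<Rightarrow> real) \<Rightarrow> bool" where
  "test_fun d M f \<longleftrightarrow> f \<in> borel_measurable borel \<and> (\<forall>x. f (trunc d x) = f x) \<and> (\<forall>x. \<bar>f x\<bar> \<le> M)"

text \<open>Convolution with a law acts on functions as a commuting operator, so a sum of
  independent summands is a composition of averages and the exchange of summands is algebra in these
  operators.\<close>

definition avg :: "(nat \<Rightarrow> real) measure \<Rightarrow> ((nat \<Rightarrow> real) \<Rightarrow> real) \<Rightarrow> (nat \<Rightarrow> real) \<Rightarrow> real" where
  "avg \<mu> f x = (\<integral>y. f (x + y) \<partial>\<mu>)"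

section \<open>Truncation, scaling and the inner product\<close>

lemma fun_plus_apply [simp]: "(x + y) k = x k + (y k :: real)" for x y :: "nat \<Rightarrow> real"
  by simp

lemma scale_apply [simp]: "scale c x k = c * x k"
  by (simp add: scale_def)

lemma measurable_fun_plus [measurable (raw)]:
  fixes f g :: "'a \<Rightarrow> nat \<Rightarrow> real"
  assumes [measurable]: "f \<in> borel_measurable M" "g \<in> borel_measurable M"
  shows "(\<lambda>x. f x + g x) \<in> borel_measurable M"
proof (rule measurable_coordinatewise_then_product)
  fix i
  have "(\<lambda>x. f x i) \<in> borel_measurable M" "(\<lambda>x. g x i) \<in> borel_measurable M"
    by (auto intro: measurable_compose[OF assms(1) measurable_product_coordinates]
       measurable_compose[OF assms(2) measurable_product_coordinates])
  then show "(\<lambda>x. (f x + g x) i) \<in> borel_measurable M" by simp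
qed

lemma measurable_coord:
  fixes f :: "'a \<Rightarrow> nat \<Rightarrow> real"
  assumes "f \<in> borel_measurable M"
  shows "(\<lambda>x. f x i) \<in> borel_measurable M"
  by (rule measurable_compose[OF assms measurable_product_coordinates])

lemma measurable_scale [measurable (raw)]:
  fixes f :: "'a \<Rightarrow> nat \<Rightarrow> real"
  assumes [measurable]: "f \<in> borel_measurable M" "c \<in> borel_measurable M"
  shows "(\<lambda>x. scale (c x) (f x)) \<in> borel_measurable M"
proof (rule measurable_coordinatewise_then_product)
  fix i
  note [measurable] = measurable_coord[OF assms(1), of i]
  show "(\<lambda>x. scale (c x) (f x) i) \<in> borel_measurable M" by simp
qed

lemma measurable_trunc [measurable (raw)]:
  fixes f :: "'a \<Rightarrow> nat \<Rightarrow> real"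
  assumes [measurable]: "f \<in> borel_measurable M"
  shows "(\<lambda>x. trunc d (f x)) \<in> borel_measurable M"
  using measurable_coord[OF assms]
  by (intro measurable_coordinatewise_then_product) (simp add: trunc_def)

lemma measurable_dot [measurable (raw)]:
  fixes f g :: "'a \<Rightarrow> nat \<Rightarrow> real"
  assumes [measurable]: "f \<in> borel_measurable M" "g \<in> borel_measurable M"
  shows "(\<lambda>x. dot d (f x) (g x)) \<in> borel_measurable M"
  unfolding dot_def using measurable_coord[OF assms(1)] measurable_coord[OF assms(2)]
  by (intro borel_measurable_sum borel_measurable_times)

lemma measurable_trunc_Rd [measurable]: "trunc d \<in> measurable (Rd d) borel"
proof (rule measurable_coordinatewise_then_product)
  fix i
  show "(\<lambda>x. trunc d x i) \<in> borel_measurable (Rd d)"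
    by (cases "i < d") (simp_all add: trunc_def)
qed

lemma trunc_trunc [simp]: "trunc d (trunc d x) = trunc d x"
  by (auto simp: trunc_def)

lemma trunc_add: "trunc d (x + y) = trunc d x + trunc d y"
  by (auto simp: trunc_def)

lemma trunc_scale: "trunc d (scale c x) = scale c (trunc d x)"
  by (auto simp: trunc_def)

lemma scale_add: "scale c (x + y) = scale c x + scale c y"
  by (auto simp: algebra_simps)

lemma scale_scale: "scale a (scale b x) = scale (a * b) x"
  by (auto simp: algebra_simps)

lemma scale_1 [simp]: "scale 1 x = x"
  by (auto simp: scale_def)

lemma dot_trunc [simp]: "dot d (trunc d u) x = dot d u x" "dot d u (trunc d x) = dot d u x"
  by (auto simp: dot_def trunc_def intro!: sum.cong)

lemma dot_add: "dot d u (x + y) = dot d u x + dot d u y" "dot d (x + y) u = dot d x u + dot d y u"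
  by (auto simp: dot_def sum.distrib algebra_simps)

lemma dot_scale: "dot d u (scale c x) = c * dot d u x" "dot d (scale c x) u = c * dot d x u"
  by (auto simp: dot_def sum_distrib_left algebra_simps)

lemma dot_commute: "dot d u x = dot d x u"
  by (simp add: dot_def mult.commute)

lemma nsq_nonneg [simp]: "0 \<le> nsq d u"
  by (auto simp: dot_def intro!: sum_nonneg)

lemma enorm_eq: "enorm d x = sqrt (nsq d x)"
  by (simp add: L2_set_def dot_def power2_eq_square)

lemma enorm_sq: "(enorm d x)\<^sup>2 = nsq d x"
  by (simp add: enorm_eq)

lemma dot_eq_enorm_bound: "\<bar>dot d u x\<bar> \<le> enorm d u * enorm d x"
proof -
  have "\<bar>dot d u x\<bar> \<le> (\<Sum>k<d. \<bar>u k\<bar> * \<bar>x k\<bar>)"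
    unfolding dot_def by (rule order_trans[OF sum_abs]) (simp add: abs_mult)
  also have "\<dots> \<le> enorm d u * enorm d x" by (rule L2_set_mult_ineq)
  finally show ?thesis .
qed

section \<open>Averages of bounded functions and their compositions\<close>

lemma law_prob: "law \<mu> \<Longrightarrow> prob_space \<mu>"
  and law_sets: "law \<mu> \<Longrightarrow> sets \<mu> = sets borel"
  by (auto simp: law_def)

lemma law_space [simp]: "law \<mu> \<Longrightarrow> space \<mu> = UNIV"
  using sets_eq_imp_space_eq[OF law_sets] by simp

lemma law_measurable: "law \<mu> \<Longrightarrow> f \<in> borel_measurable borel \<Longrightarrow> f \<in> borel_measurable \<mu>"
  using measurable_cong_sets[OF law_sets refl] by blast

lemma law_distr: "prob_space M \<Longrightarrow> f \<in> borel_measurable M \<Longrightarrow> law (distr M borel f)"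
  by (simp add: law_def prob_space.prob_space_distr)

lemma test_funD:
  assumes "test_fun d M f"
  shows "f \<in> borel_measurable borel" "f (trunc d x) = f x" "\<bar>f x\<bar> \<le> M"
  using assms by (auto simp: test_fun_def)

lemma test_fun_bound_nonneg: "test_fun d M f \<Longrightarrow> 0 \<le> M"
  using test_funD(3)[of d M f 0] by linarith

lemma test_fun_diff: "test_fun d M f \<Longrightarrow> test_fun d M' g \<Longrightarrow> test_fun d (M + M') (\<lambda>x. f x - g x)"
  unfolding test_fun_def by (auto intro!: order_trans[OF abs_triangle_ineq4] add_mono)

lemma test_fun_integrable:
  assumes "test_fun d M f" "prob_space P" "g \<in> borel_measurable P"
  shows "integrable P (\<lambda>y. f (g y))"
proof -
  interpret prob_space P by fact
  have "(\<lambda>y. f (g y)) \<in> borel_measurable P"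
    using measurable_compose[OF assms(3) test_funD(1)[OF assms(1)]] .
  then show ?thesis
    by (intro integrable_const_bound[where B=M]) (auto simp: test_funD(3)[OF assms(1)])
qed

lemma test_fun_law_integrable:
  assumes "test_fun d M f" "law \<mu>"
  shows "integrable \<mu> (\<lambda>y. f (x + y))"
  by (rule test_fun_integrable[OF assms(1) law_prob[OF assms(2)]])
     (rule law_measurable[OF assms(2)], measurable)

lemma prob_integral_abs_le:
  assumes "prob_space P" "\<And>x. x \<in> space P \<Longrightarrow> \<bar>f x\<bar> \<le> M" "0 \<le> (M::real)"
  shows "\<bar>\<integral>x. f x \<partial>P\<bar> \<le> M"
proof -
  interpret prob_space P by fact
  show ?thesis
  proof (cases "integrable P f")
    case True
    have "\<bar>\<integral>x. f x \<partial>P\<bar> \<le> (\<integral>x. \<bar>f x\<bar> \<partial>P)" by simp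
    also have "\<dots> \<le> (\<integral>x. M \<partial>P)" using True assms(2) by (intro integral_mono) auto
    finally show ?thesis by (simp add: prob_space)
  \<comment> \<open>Without integrability the integral is 0 by convention, which 0 \<le> M
    covers.\<close>
  qed (use assms in \<open>simp add: not_integrable_integral_eq\<close>)
qed

lemma test_fun_avg:
  assumes f: "test_fun d M f" and \<mu>: "law \<mu>"
  shows "test_fun d M (avg \<mu> f)"
proof -
  interpret prob_space \<mu> using law_prob[OF \<mu>] .
  note [measurable_cong] = law_sets[OF \<mu>]
  note [measurable] = test_funD(1)[OF f]
  have "f (trunc d x + y) = f (x + y)" for x y
    using test_funD(2)[OF f, of "trunc d x + y"] test_funD(2)[OF f, of "x + y"] by (simp add: trunc_add)
  moreover have "(\<lambda>x. \<integral>y. f (x + y) \<partial>\<mu>) \<in> borel_measurable borel"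
    by measurable
  moreover have "\<bar>\<integral>y. f (x + y) \<partial>\<mu>\<bar> \<le> M" for x
    by (rule prob_integral_abs_le[OF law_prob[OF \<mu>]]) (auto simp: test_funD[OF f] test_fun_bound_nonneg[OF f])
  ultimately show ?thesis by (simp add: test_fun_def avg_def[abs_def])
qed

lemma test_fun_avg_pow:
  assumes f: "test_fun d M f" and \<mu>: "law \<mu>"
  shows "test_fun d M ((avg \<mu> ^^ n) f)"
  by (induction n) (auto simp: f test_fun_avg[OF _ \<mu>])

lemma avg_commute:
  assumes f: "test_fun d M f" and \<mu>: "law \<mu>" and \<nu>: "law \<nu>"
  shows "avg \<mu> (avg \<nu> f) = avg \<nu> (avg \<mu> f)"
proof
  fix x
  interpret A: prob_space \<mu> using law_prob[OF \<mu>] .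
  interpret B: prob_space \<nu> using law_prob[OF \<nu>] .
  interpret pair_prob_space \<mu> \<nu> ..
  note [measurable_cong] = law_sets[OF \<mu>] law_sets[OF \<nu>]
  note [measurable] = test_funD(1)[OF f]
  have "integrable (\<mu> \<Otimes>\<^sub>M \<nu>) (\<lambda>p. f (x + fst p + snd p))"
    by (rule test_fun_integrable[OF f P.prob_space_axioms]) measurable
  then have "integrable (\<mu> \<Otimes>\<^sub>M \<nu>) (\<lambda>(y, z). f (x + y + z))" by (simp add: split_beta')
  from Fubini_integral[OF this] show "avg \<mu> (avg \<nu> f) x = avg \<nu> (avg \<mu> f) x"
    by (simp add: avg_def add_ac)
qed

lemma avg_diff:
  assumes "test_fun d M f" "test_fun d' M' g" "law \<mu>"
  shows "avg \<mu> (\<lambda>x. f x - g x) x = avg \<mu> f x - avg \<mu> g x"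
  unfolding avg_def using assms by (intro Bochner_Integration.integral_diff test_fun_law_integrable)

lemma avg_mono:
  assumes "test_fun d M f" "test_fun d' M' g" "law \<mu>" "\<And>x. f x \<le> g x"
  shows "avg \<mu> f x \<le> avg \<mu> g x"
  unfolding avg_def using assms by (intro integral_mono test_fun_law_integrable)

lemma avg_pow_mono:
  assumes "test_fun d M f" "test_fun d M' g" "law \<mu>" "\<And>x. f x \<le> g x"
  shows "(avg \<mu> ^^ n) f x \<le> (avg \<mu> ^^ n) g x"
proof (induction n arbitrary: x)
  case (Suc n)
  then show ?case
    using avg_mono[OF test_fun_avg_pow[OF assms(1,3)] test_fun_avg_pow[OF assms(2,3)] assms(3)] by simp
qed (use assms in auto)

lemma avg_pow_diff:
  assumes "test_fun d M f" "test_fun d M' g" "law \<mu>"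
  shows "(avg \<mu> ^^ n) (\<lambda>x. f x - g x) x = (avg \<mu> ^^ n) f x - (avg \<mu> ^^ n) g x"
proof (induction n arbitrary: x)
  case (Suc n)
  then have "(avg \<mu> ^^ n) (\<lambda>x. f x - g x) = (\<lambda>x. (avg \<mu> ^^ n) f x - (avg \<mu> ^^ n) g x)" by auto
  then show ?case
    using avg_diff[OF test_fun_avg_pow[OF assms(1,3)] test_fun_avg_pow[OF assms(2,3)] assms(3)] by simp
qed auto

lemma avg_pow_commute1:
  assumes "test_fun d M f" "law \<mu>" "law \<nu>"
  shows "avg \<mu> ((avg \<nu> ^^ n) f) = (avg \<nu> ^^ n) (avg \<mu> f)"
proof (induction n)
  case (Suc n)
  then show ?case
    using avg_commute[OF test_fun_avg_pow[OF assms(1,3), of n] assms(2,3)] by simp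
qed auto

lemma avg_pow_commute:
  assumes "test_fun d M f" "law \<mu>" "law \<nu>"
  shows "(avg \<mu> ^^ m) ((avg \<nu> ^^ n) f) = (avg \<nu> ^^ n) ((avg \<mu> ^^ m) f)"
proof (induction m)
  case (Suc m)
  then show ?case
    using avg_pow_commute1[OF test_fun_avg_pow[OF assms(1,2), of m] assms(2,3), of n] by simp
qed auto

text \<open>The Lindeberg telescope. It may stop after m of the n exchanges, because the first
  exchanges and the later ones are estimated with different functions f.\<close>

lemma avg_pow_telescope:
  assumes f: "test_fun d M f" and \<mu>: "law \<mu>" and \<nu>: "law \<nu>" and m: "m \<le> n"
  shows "(avg \<mu> ^^ n) f x - (avg \<mu> ^^ (n - m)) ((avg \<nu> ^^ m) f) x =
    (\<Sum>k<m. avg \<mu> ((avg \<mu> ^^ (n - 1 - k)) ((avg \<nu> ^^ k) f)) x - avg \<nu> ((avg \<mu> ^^ (n - 1 - k)) ((avg \<nu> ^^ k) f)) x)"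
  using m
proof (induction m)
  case (Suc m)
  have 1: "avg \<mu> ((avg \<mu> ^^ (n - 1 - m)) ((avg \<nu> ^^ m) f)) = (avg \<mu> ^^ (n - m)) ((avg \<nu> ^^ m) f)"
    using Suc.prems by (subst funpow.simps(2)[symmetric, unfolded o_def, THEN fun_cong])
       (simp add: Suc_diff_Suc)
  have 2: "avg \<nu> ((avg \<mu> ^^ (n - 1 - m)) ((avg \<nu> ^^ m) f)) = (avg \<mu> ^^ (n - Suc m)) ((avg \<nu> ^^ Suc m) f)"
    using avg_pow_commute1[OF test_fun_avg_pow[OF f \<nu>, of m] \<nu> \<mu>, of "n - 1 - m"] by simp
  show ?case using Suc.IH Suc.prems unfolding 1 2 sum.lessThan_Suc by linarith
qed simp

section \<open>Convolution of two laws\<close>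

definition conv :: "(nat \<Rightarrow> real) measure \<Rightarrow> (nat \<Rightarrow> real) measure \<Rightarrow> (nat \<Rightarrow> real) measure" where
  "conv \<mu> \<nu> = distr (\<mu> \<Otimes>\<^sub>M \<nu>) borel (\<lambda>p. fst p + snd p)"

lemma law_conv:
  assumes \<mu>: "law \<mu>" and \<nu>: "law \<nu>"
  shows "law (conv \<mu> \<nu>)"
proof -
  interpret A: prob_space \<mu> using law_prob[OF \<mu>] .
  interpret B: prob_space \<nu> using law_prob[OF \<nu>] .
  interpret pair_prob_space \<mu> \<nu> ..
  note [measurable_cong] = law_sets[OF \<mu>] law_sets[OF \<nu>]
  show ?thesis unfolding conv_def by (rule law_distr[OF P.prob_space_axioms]) measurable
qed

lemma integral_conv:
  fixes f :: "_ \<Rightarrow> real"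
  assumes \<mu>: "law \<mu>" and \<nu>: "law \<nu>" and f: "f \<in> borel_measurable borel" and b: "\<And>x. \<bar>f x\<bar> \<le> M"
  shows "(\<integral>x. f x \<partial>conv \<mu> \<nu>) = (\<integral>x. \<integral>y. f (x + y) \<partial>\<nu> \<partial>\<mu>)"
proof -
  interpret A: prob_space \<mu> using law_prob[OF \<mu>] .
  interpret B: prob_space \<nu> using law_prob[OF \<nu>] .
  interpret pair_prob_space \<mu> \<nu> ..
  note [measurable_cong] = law_sets[OF \<mu>] law_sets[OF \<nu>]
  note [measurable] = f
  have "integrable (\<mu> \<Otimes>\<^sub>M \<nu>) (\<lambda>p. f (fst p + snd p))"
    by (rule P.integrable_const_bound[where B=M]) (auto simp: b)
  then have "integrable (\<mu> \<Otimes>\<^sub>M \<nu>) (\<lambda>(y, z). f (y + z))" by (simp add: split_beta')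
  from integral_fst'[OF this] show ?thesis
    unfolding conv_def by (subst integral_distr) (auto simp: split_beta')
qed

lemma avg_conv:
  assumes \<mu>: "law \<mu>" and \<nu>: "law \<nu>" and f: "test_fun d M f"
  shows "avg (conv \<mu> \<nu>) f = avg \<mu> (avg \<nu> f)"
proof
  fix x
  note [measurable] = test_funD(1)[OF f]
  show "avg (conv \<mu> \<nu>) f x = avg \<mu> (avg \<nu> f) x"
    unfolding avg_def using integral_conv[OF \<mu> \<nu>, of "\<lambda>y. f (x + y)" M]
    by (simp add: test_funD(3)[OF f] add_ac)
qed

section \<open>The standard Gaussian measure\<close>

abbreviation std_prod :: "nat \<Rightarrow> (nat \<Rightarrow> real) measure" where
  "std_prod d \<equiv> Pi\<^sub>M {..<d} (\<lambda>_. std_normal_distribution)"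

definition gam :: "nat \<Rightarrow> (nat \<Rightarrow> real) measure" where
  "gam d = distr (std_prod d) borel (trunc d)"

lemma prob_std: "prob_space std_normal_distribution"
  by (rule prob_space_normal_density) simp

lemma sigma_finite_std: "product_sigma_finite (\<lambda>_. std_normal_distribution)"
  by (simp add: product_sigma_finite_def prob_space_imp_sigma_finite prob_std)

lemma prob_std_prod: "prob_space (std_prod d)"
  by (intro prob_space_PiM prob_std)

lemma sets_std_prod: "sets (std_prod d) = sets (Rd d)"
  by (intro sets_PiM_cong) auto

lemma measurable_trunc_std_prod [measurable]: "trunc d \<in> measurable (std_prod d) borel"
  using measurable_cong_sets[OF sets_std_prod refl] measurable_trunc_Rd by blast

lemma law_gam: "law (gam d)"
  unfolding gam_def by (intro law_distr prob_std_prod) measurable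

lemma gam_measurable [measurable_cong]: "sets (gam d) = sets borel"
  using law_sets[OF law_gam] .

lemma space_gam [simp]: "space (gam d) = UNIV"
  using law_space[OF law_gam] .

lemma prob_gam: "prob_space (gam d)"
  using law_prob[OF law_gam] .

text \<open>Coordinatewise changes of measure multiply; applied to translations and to dilations.\<close>

lemma std_prod_distr_density:
  assumes [measurable]: "\<And>i. \<phi> i \<in> borel_measurable borel" "\<And>i. r i \<in> borel_measurable borel"
    and eq: "\<And>i. i < d \<Longrightarrow> distr std_normal_distribution borel (\<phi> i) = density std_normal_distribution (r i)"
  shows "distr (std_prod d) (Rd d) (\<lambda>x. \<lambda>i\<in>{..<d}. \<phi> i (x i)) = density (std_prod d) (\<lambda>x. \<Prod>i<d. r i (x i))"
proof -
  interpret S: product_sigma_finite "\<lambda>_::nat. std_normal_distribution" by (rule sigma_finite_std)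
  \<comment> \<open>The product locale needs a family over all indices, so the family is continued
    by the standard normal law beyond d.\<close>
  define N where "N i = (if i < d then density std_normal_distribution (r i) else std_normal_distribution)" for i
  have pN: "prob_space (N i)" for i
  proof (cases "i < d")
    case True
    have "prob_space (distr std_normal_distribution borel (\<phi> i))"
      by (intro prob_space.prob_space_distr prob_std) simp
    then show ?thesis using True by (simp add: N_def eq)
  qed (simp add: N_def prob_std)
  interpret N: product_sigma_finite N
    by (simp add: product_sigma_finite_def prob_space_imp_sigma_finite pN)
  have sN: "sets (N i) = sets borel" for i by (simp add: N_def)
  have sets: "sets (Pi\<^sub>M {..<d} N) = sets (Rd d)" by (intro sets_PiM_cong) (auto simp: sN)
  have m1: "(\<lambda>x. \<lambda>i\<in>{..<d}. \<phi> i (x i)) \<in> measurable (std_prod d) (Rd d)"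
    by (intro measurable_restrict) simp
  have "distr (std_prod d) (Rd d) (\<lambda>x. \<lambda>i\<in>{..<d}. \<phi> i (x i)) = Pi\<^sub>M {..<d} N"
  proof (rule N.PiM_eqI)
    fix A assume A: "\<And>i. i \<in> {..<d} \<Longrightarrow> A i \<in> sets (N i)"
    then have [measurable]: "\<And>i. i < d \<Longrightarrow> A i \<in> sets borel" by (simp add: sN)
    have "emeasure (distr (std_prod d) (Rd d) (\<lambda>x. \<lambda>i\<in>{..<d}. \<phi> i (x i))) (Pi\<^sub>E {..<d} A)
       = emeasure (std_prod d) ((\<lambda>x. \<lambda>i\<in>{..<d}. \<phi> i (x i)) -` (Pi\<^sub>E {..<d} A) \<inter> space (std_prod d))"
      by (rule emeasure_distr[OF m1]) (auto intro!: sets_PiM_I_finite)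
    also have "(\<lambda>x. \<lambda>i\<in>{..<d}. \<phi> i (x i)) -` (Pi\<^sub>E {..<d} A) \<inter> space (std_prod d) = Pi\<^sub>E {..<d} (\<lambda>i. \<phi> i -` A i)"
      by (auto simp: space_PiM PiE_def Pi_def extensional_def split: if_splits)
    also have "emeasure (std_prod d) \<dots> = (\<Prod>i<d. emeasure std_normal_distribution (\<phi> i -` A i))"
      by (rule S.emeasure_PiM) (auto intro: measurable_sets_borel[OF assms(1)])
    also have "\<dots> = (\<Prod>i<d. emeasure (N i) (A i))"
      by (intro prod.cong refl) (simp add: N_def eq[symmetric] emeasure_distr)
    finally show "emeasure (distr (std_prod d) (Rd d) (\<lambda>x. \<lambda>i\<in>{..<d}. \<phi> i (x i))) (Pi\<^sub>E {..<d} A)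
       = (\<Prod>i\<in>{..<d}. emeasure (N i) (A i))" .
  qed (simp_all add: sets)
  moreover have "density (std_prod d) (\<lambda>x. \<Prod>i<d. r i (x i)) = Pi\<^sub>M {..<d} N"
  proof (rule N.PiM_eqI)
    fix A assume A: "\<And>i. i \<in> {..<d} \<Longrightarrow> A i \<in> sets (N i)"
    then have [measurable]: "\<And>i. i < d \<Longrightarrow> A i \<in> sets borel" by (simp add: sN)
    have "emeasure (density (std_prod d) (\<lambda>x. \<Prod>i<d. r i (x i))) (Pi\<^sub>E {..<d} A)
       = (\<integral>\<^sup>+x. (\<Prod>i<d. r i (x i)) * indicator (Pi\<^sub>E {..<d} A) x \<partial>std_prod d)"
      by (rule emeasure_density) (auto simp: sets_std_prod intro!: sets_PiM_I_finite)
    also have "\<dots> = (\<integral>\<^sup>+x. (\<Prod>i<d. r i (x i) * indicator (A i) (x i)) \<partial>std_prod d)"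
    proof (rule nn_integral_cong)
      fix x assume "x \<in> space (std_prod d)"
      then have "indicator (Pi\<^sub>E {..<d} A) x = (\<Prod>i<d. indicator (A i) (x i) :: ennreal)"
        by (auto simp: indicator_def space_PiM PiE_def prod_zero_iff Pi_def)
      then show "(\<Prod>i<d. r i (x i)) * indicator (Pi\<^sub>E {..<d} A) x = (\<Prod>i<d. r i (x i) * indicator (A i) (x i))"
        by (simp add: prod.distrib)
    qed
    also have "\<dots> = (\<Prod>i<d. \<integral>\<^sup>+x. r i x * indicator (A i) x \<partial>std_normal_distribution)"
      by (rule S.product_nn_integral_prod) auto
    also have "\<dots> = (\<Prod>i<d. emeasure (N i) (A i))"
      by (intro prod.cong refl) (simp add: N_def emeasure_density)
    finally show "emeasure (density (std_prod d) (\<lambda>x. \<Prod>i<d. r i (x i))) (Pi\<^sub>E {..<d} A)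
       = (\<Prod>i\<in>{..<d}. emeasure (N i) (A i))" .
  qed (simp_all add: sets sets_std_prod)
  ultimately show ?thesis by simp
qed

lemma gam_distr_density:
  assumes [measurable]: "\<And>i. \<phi> i \<in> borel_measurable borel" "\<And>i. r i \<in> borel_measurable borel"
    and eq: "\<And>i. i < d \<Longrightarrow> distr std_normal_distribution borel (\<phi> i) = density std_normal_distribution (r i)"
  shows "distr (gam d) borel (\<lambda>x. trunc d (\<lambda>i. \<phi> i (x i))) = density (gam d) (\<lambda>x. \<Prod>i<d. r i (x i))"
proof -
  have m1: "(\<lambda>x. \<lambda>i\<in>{..<d}. \<phi> i (x i)) \<in> measurable (std_prod d) (Rd d)"
    by (intro measurable_restrict) simp
  have [measurable]: "(\<lambda>x. trunc d (\<lambda>i. \<phi> i (x i))) \<in> borel_measurable borel"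
  proof (rule measurable_coordinatewise_then_product)
    fix i
    show "(\<lambda>x. trunc d (\<lambda>i. \<phi> i (x i)) i) \<in> borel_measurable borel" by (simp add: trunc_def)
  qed
  have m2: "(\<lambda>x. \<Prod>i<d. r i (x i)) \<in> borel_measurable borel"
    by measurable
  have "distr (gam d) borel (\<lambda>x. trunc d (\<lambda>i. \<phi> i (x i))) = distr (std_prod d) borel (\<lambda>x. trunc d (\<lambda>i. \<phi> i (trunc d x i)))"
    unfolding gam_def by (subst distr_distr) (auto simp: o_def)
  also have "\<dots> = distr (std_prod d) borel (\<lambda>x. trunc d (\<lambda>i\<in>{..<d}. \<phi> i (x i)))"
    by (intro distr_cong) (auto simp: trunc_def)
  also have "\<dots> = distr (distr (std_prod d) (Rd d) (\<lambda>x. \<lambda>i\<in>{..<d}. \<phi> i (x i))) borel (trunc d)"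
    using m1 by (subst distr_distr) (auto simp: o_def)
  also have "\<dots> = distr (density (std_prod d) (\<lambda>x. \<Prod>i<d. r i (x i))) borel (trunc d)"
    by (subst std_prod_distr_density[OF assms]) auto
  also have "\<dots> = distr (density (std_prod d) (\<lambda>x. \<Prod>i<d. r i (trunc d x i))) borel (trunc d)"
    by (intro arg_cong[where f="\<lambda>f. distr (density _ f) _ _"] ext prod.cong) (auto simp: trunc_def)
  also have "\<dots> = density (gam d) (\<lambda>x. \<Prod>i<d. r i (x i))"
    unfolding gam_def by (rule density_distr[symmetric]) (use m2 in auto)
  finally show ?thesis .
qed

text \<open>Here r is the likelihood ratio of a normal law against the standard one. Translations
  are the case \<sigma> = 1, dilations the case \<sigma> = 1 / s.\<close>

lemma std_distr_density:
  assumes [measurable]: "\<phi> \<in> borel_measurable borel" "r \<in> borel_measurable borel" and r: "\<And>x. 0 \<le> r x"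
    and \<sigma>: "0 < \<sigma>"
    and \<phi>: "\<And>x. \<phi> x = \<beta> + \<sigma> * x"
    and eq: "\<And>x. normal_density \<beta> \<sigma> x = std_normal_density x * r x"
  shows "distr std_normal_distribution borel \<phi> = density std_normal_distribution (\<lambda>x. ennreal (r x))"
proof -
  interpret prob_space std_normal_distribution by (rule prob_std)
  have "distributed std_normal_distribution lborel (\<lambda>x. x) std_normal_density"
    by (auto simp: distributed_def intro!: distr_id2)
  from normal_density_affine[OF this, of \<sigma> \<beta>] \<sigma>
  have "distributed std_normal_distribution lborel \<phi> (normal_density \<beta> \<sigma>)"
    by (simp add: \<phi>[abs_def])
  then have "distr std_normal_distribution borel \<phi> = density lborel (normal_density \<beta> \<sigma>)"
    by (auto simp: distributed_def cong: distr_cong)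
  also have "\<dots> = density std_normal_distribution (\<lambda>x. ennreal (r x))"
    by (subst density_density_eq) (auto simp: eq ennreal_mult r intro!: density_cong)
  finally show ?thesis .
qed

text \<open>The Cameron-Martin formula: a shift in the argument of a merely bounded function becomes
  a smooth weight, which can be differentiated in the size of the shift.\<close>

lemma gam_cameron_martin:
  "distr (gam d) borel (\<lambda>g. g + trunc d h) = density (gam d) (\<lambda>g. ennreal (exp (dot d h g - nsq d h / 2)))"
proof -
  have "distr std_normal_distribution borel (\<lambda>x. x + h i)
      = density std_normal_distribution (\<lambda>x. ennreal (exp (h i * x - (h i)\<^sup>2 / 2)))" for i
    by (rule std_distr_density[where \<sigma>=1 and \<beta>="h i"])
       (auto simp: normal_density_def exp_add[symmetric] power2_eq_square field_simps)
  then have "distr (gam d) borel (\<lambda>g. trunc d (\<lambda>i. g i + h i))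
    = density (gam d) (\<lambda>g. \<Prod>i<d. ennreal (exp (h i * g i - (h i)\<^sup>2 / 2)))"
    by (intro gam_distr_density[where \<phi>="\<lambda>i x. x + h i" and r="\<lambda>i x. ennreal (exp (h i * x - (h i)\<^sup>2 / 2))"]) auto
  moreover have "(\<Prod>i<d. ennreal (exp (h i * g i - (h i)\<^sup>2 / 2))) = ennreal (exp (dot d h g - nsq d h / 2))" for g
    by (simp add: prod_ennreal exp_sum[symmetric] dot_def sum_subtractf sum_divide_distrib power2_eq_square)
  moreover have "distr (gam d) borel (\<lambda>g. trunc d (\<lambda>i. g i + h i)) = distr (gam d) borel (\<lambda>g. g + trunc d h)"
  proof -
    have *: "trunc d (\<lambda>i. trunc d x i + h i) = trunc d x + trunc d h" for x
      by (auto simp: trunc_def)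
    have [measurable]: "(\<lambda>g. trunc d (\<lambda>i. g i + h i)) \<in> borel_measurable borel"
      by (rule measurable_coordinatewise_then_product) (simp add: trunc_def)
    show ?thesis unfolding gam_def by (subst (1 2) distr_distr) (auto simp: o_def *)
  qed
  ultimately show ?thesis by simp
qed

lemma gam_cameron_martin_integral:
  fixes F :: "(nat \<Rightarrow> real) \<Rightarrow> real"
  assumes [measurable]: "F \<in> borel_measurable borel"
  shows "(\<integral>g. F (g + trunc d h) \<partial>gam d) = (\<integral>g. exp (dot d h g - nsq d h / 2) * F g \<partial>gam d)"
    and "(\<integral>\<^sup>+g. ennreal (F (g + trunc d h)) \<partial>gam d) = (\<integral>\<^sup>+g. ennreal (exp (dot d h g - nsq d h / 2)) * ennreal (F g) \<partial>gam d)"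
proof -
  have "(\<integral>g. F (g + trunc d h) \<partial>gam d) = (\<integral>g. F g \<partial>distr (gam d) borel (\<lambda>g. g + trunc d h))"
    by (subst integral_distr) auto
  then show "(\<integral>g. F (g + trunc d h) \<partial>gam d) = (\<integral>g. exp (dot d h g - nsq d h / 2) * F g \<partial>gam d)"
    unfolding gam_cameron_martin by (subst (asm) integral_density) auto
  have "(\<integral>\<^sup>+g. ennreal (F (g + trunc d h)) \<partial>gam d) = (\<integral>\<^sup>+g. ennreal (F g) \<partial>distr (gam d) borel (\<lambda>g. g + trunc d h))"
    by (subst nn_integral_distr) auto
  then show "(\<integral>\<^sup>+g. ennreal (F (g + trunc d h)) \<partial>gam d) = (\<integral>\<^sup>+g. ennreal (exp (dot d h g - nsq d h / 2)) * ennreal (F g) \<partial>gam d)"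
    unfolding gam_cameron_martin by (subst (asm) nn_integral_density) auto
qed

section \<open>Characteristic function and one-dimensional marginals of the Gaussian measure\<close>

lemma gam_char: "(\<integral>g. iexp (dot d h g) \<partial>gam d) = complex_of_real (exp (- nsq d h / 2))"
proof -
  interpret S: product_sigma_finite "\<lambda>_::nat. std_normal_distribution" by (rule sigma_finite_std)
  have "(\<integral>g. iexp (dot d h g) \<partial>gam d) = (\<integral>x. (\<Prod>k<d. iexp (h k * x k)) \<partial>std_prod d)"
    unfolding gam_def by (subst integral_distr) (auto simp: exp_sum[symmetric] dot_def sum_distrib_left trunc_def intro!: Bochner_Integration.integral_cong)
  also have "\<dots> = (\<Prod>k<d. \<integral>x. iexp (h k * x) \<partial>std_normal_distribution)"
    by (intro S.product_integral_prod prob_space.integrable_iexp[OF prob_std]) auto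
  also have "\<dots> = (\<Prod>k<d. complex_of_real (exp (- (h k)\<^sup>2 / 2)))"
    using char_std_normal_distribution by (intro prod.cong refl) (auto simp: char_def dest!: fun_cong)
  also have "\<dots> = complex_of_real (exp (- nsq d h / 2))"
    by (simp add: exp_sum[symmetric] dot_def sum_divide_distrib sum_negf power2_eq_square of_real_prod[symmetric] del: of_real_prod)
  finally show ?thesis .
qed

text \<open>Both characteristic functions are explicit. Integrals of a function of one linear
  functional thereby become one-dimensional normal integrals.\<close>

lemma gam_dot_distr: "distr (gam d) borel (dot d h) = distr std_normal_distribution borel (\<lambda>x. enorm d h * x)"
proof (rule Levy_uniqueness)
  interpret G: prob_space "gam d" by (rule prob_gam)
  interpret S: prob_space std_normal_distribution by (rule prob_std)
  show "real_distribution (distr (gam d) borel (dot d h))"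
    by (intro real_distribution.intro G.prob_space_distr) (auto simp: real_distribution_axioms_def)
  show "real_distribution (distr std_normal_distribution borel (\<lambda>x. enorm d h * x))"
    by (intro real_distribution.intro S.prob_space_distr) (auto simp: real_distribution_axioms_def)
  show "char (distr (gam d) borel (dot d h)) = char (distr std_normal_distribution borel (\<lambda>x. enorm d h * x))"
  proof
    fix t
    have "char (distr (gam d) borel (dot d h)) t = (\<integral>g. iexp (dot d (scale t h) g) \<partial>gam d)"
      unfolding char_def by (subst integral_distr) (auto simp: dot_scale)
    also have "\<dots> = complex_of_real (exp (- ((t * enorm d h)\<^sup>2) / 2))"
      unfolding gam_char by (simp add: dot_scale power_mult_distrib enorm_sq power2_eq_square[of t])
    also have "\<dots> = char std_normal_distribution (t * enorm d h)"
      by (simp add: char_std_normal_distribution)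
    also have "\<dots> = char (distr std_normal_distribution borel (\<lambda>x. enorm d h * x)) t"
      unfolding char_def by (subst integral_distr) (auto simp: mult.assoc)
    finally show "char (distr (gam d) borel (dot d h)) t = char (distr std_normal_distribution borel (\<lambda>x. enorm d h * x)) t" .
  qed
qed

lemma gam_dot_integral:
  fixes F :: "real \<Rightarrow> real"
  assumes [measurable]: "F \<in> borel_measurable borel"
  shows "(\<integral>g. F (dot d h g) \<partial>gam d) = (\<integral>x. F (enorm d h * x) \<partial>std_normal_distribution)"
    and "integrable (gam d) (\<lambda>g. F (dot d h g)) \<longleftrightarrow> integrable std_normal_distribution (\<lambda>x. F (enorm d h * x))"
proof -
  have "(\<integral>g. F (dot d h g) \<partial>gam d) = (\<integral>y. F y \<partial>distr (gam d) borel (dot d h))"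
    by (subst integral_distr) auto
  also have "\<dots> = (\<integral>x. F (enorm d h * x) \<partial>std_normal_distribution)"
    unfolding gam_dot_distr by (subst integral_distr) auto
  finally show "(\<integral>g. F (dot d h g) \<partial>gam d) = (\<integral>x. F (enorm d h * x) \<partial>std_normal_distribution)" .
  have "integrable (gam d) (\<lambda>g. F (dot d h g)) \<longleftrightarrow> integrable (distr (gam d) borel (dot d h)) F"
    by (subst integrable_distr_eq) auto
  also have "\<dots> \<longleftrightarrow> integrable std_normal_distribution (\<lambda>x. F (enorm d h * x))"
    unfolding gam_dot_distr by (subst integrable_distr_eq) auto
  finally show "integrable (gam d) (\<lambda>g. F (dot d h g)) \<longleftrightarrow> integrable std_normal_distribution (\<lambda>x. F (enorm d h * x))" .
qed

lemma gam_dot_power_integrable: "integrable (gam d) (\<lambda>g. dot d h g ^ k)"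
  using integrable_std_normal_distribution_moment[of k]
  by (subst gam_dot_integral(2)[where F="\<lambda>x. x ^ k"]) (auto simp: power_mult_distrib)

lemma std_even_moment:
  "(\<integral>x. x ^ (2 * k) \<partial>std_normal_distribution) = fact (2 * k) / (2 ^ k * fact k)"
  by (rule std_normal_distribution_even_moments)

lemma gam_dot_even_moment:
  "(\<integral>g. dot d h g ^ (2 * k) \<partial>gam d) = fact (2 * k) / (2 ^ k * fact k) * nsq d h ^ k"
  by (subst gam_dot_integral(1)[where F="\<lambda>x. x ^ (2 * k)"])
     (auto simp: power_mult_distrib std_even_moment power_mult[of "enorm d h" 2] enorm_sq)

text \<open>The variance of the absolute value of X is nonnegative.\<close>

lemma prob_abs_le_sqrt:
  assumes "prob_space P" and [simp]: "integrable P (\<lambda>x. (X x)\<^sup>2)" and [measurable]: "X \<in> borel_measurable P"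
  shows "integrable P X" "(\<integral>x. \<bar>X x\<bar> \<partial>P) \<le> sqrt (\<integral>x. (X x :: real)\<^sup>2 \<partial>P)"
proof -
  interpret prob_space P by fact
  show X: "integrable P X"
    by (rule square_integrable_imp_integrable) auto
  then have [simp]: "integrable P (\<lambda>x. \<bar>X x\<bar>)" by simp
  define m where "m = (\<integral>x. \<bar>X x\<bar> \<partial>P)"
  have "0 \<le> (\<integral>x. (\<bar>X x\<bar> - m)\<^sup>2 \<partial>P)" by simp
  also have "\<dots> = (\<integral>x. (X x)\<^sup>2 - 2 * m * \<bar>X x\<bar> + m\<^sup>2 \<partial>P)"
    by (intro Bochner_Integration.integral_cong) (auto simp: power2_eq_square algebra_simps)
  also have "\<dots> = (\<integral>x. (X x)\<^sup>2 \<partial>P) - 2 * m * m + m\<^sup>2"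
    by (simp add: prob_space flip: m_def)
  also have "\<dots> = (\<integral>x. (X x)\<^sup>2 \<partial>P) - m\<^sup>2"
    by (simp add: power2_eq_square)
  finally show "(\<integral>x. \<bar>X x\<bar> \<partial>P) \<le> sqrt (\<integral>x. (X x)\<^sup>2 \<partial>P)"
    unfolding m_def[symmetric] by (intro real_le_rsqrt) simp
qed

section \<open>Gaussian Taylor expansion\<close>

text \<open>Hermite polynomials with a variance parameter, c^(k/2) He_k(x / sqrt c) for c > 0.
  Keeping c as a variable makes \<open>herm k (dot d h g) (nsq d h)\<close> a homogeneous polynomial
  of degree k in h, with no exception at h = 0.\<close>

fun herm :: "nat \<Rightarrow> real \<Rightarrow> real \<Rightarrow> real" where
  "herm 0 x c = 1"
| "herm (Suc 0) x c = x"
| "herm (Suc (Suc k)) x c = x * herm (Suc k) x c - real (Suc k) * c * herm k x c"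

lemma herm_deriv:
  "((\<lambda>x. herm k x c) has_real_derivative (real k * herm (k - 1) x c)) (at x)"
proof (induction k rule: induct_nat_012)
  case (ge2 n)
  have "((\<lambda>x. x * herm (Suc n) x c - real (Suc n) * c * herm n x c) has_real_derivative
     (1 * herm (Suc n) x c + (real (Suc n) * herm n x c) * x) - real (Suc n) * c * (real n * herm (n - 1) x c)) (at x)"
    using ge2 by (intro DERIV_diff DERIV_mult DERIV_ident DERIV_cmult) auto
  moreover have "(1 * herm (Suc n) x c + (real (Suc n) * herm n x c) * x) - real (Suc n) * c * (real n * herm (n - 1) x c)
     = real (Suc (Suc n)) * herm (Suc n) x c"
    by (cases n) (auto simp: algebra_simps)
  ultimately show ?case by simp
qed (auto intro!: derivative_eq_intros)

text \<open>The exponential is the generating function of the Hermite polynomials. For a = <k, g>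
  and c = |k|^2 it is the Cameron-Martin density of the shift by t k, so this computes all
  derivatives of that density in t.\<close>

lemma herm_exp_deriv:
  "((\<lambda>t. herm k (a - c * t) c * exp (a * t - c * t\<^sup>2 / 2)) has_real_derivative
     (herm (Suc k) (a - c * t) c * exp (a * t - c * t\<^sup>2 / 2))) (at t within S)"
proof -
  have "((\<lambda>t. herm k (a - c * t) c) has_real_derivative (real k * herm (k - 1) (a - c * t) c * (- c))) (at t within S)"
    by (rule DERIV_chain2[OF herm_deriv]) (auto intro!: derivative_eq_intros)
  then show ?thesis
    by (cases k) (auto intro!: derivative_eq_intros simp: algebra_simps)
qed

lemma continuous_on_herm [continuous_intros]:
  "continuous_on S f \<Longrightarrow> continuous_on S (\<lambda>x. herm k (f x) c)"
  by (rule continuous_on_compose2[of UNIV "\<lambda>x. herm k x c"])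
     (auto intro!: DERIV_continuous_on herm_deriv)

lemma measurable_herm [measurable (raw)]:
  assumes "f \<in> borel_measurable M" "g \<in> borel_measurable M"
  shows "(\<lambda>x. herm k (f x) (g x)) \<in> borel_measurable M"
proof (induction k rule: induct_nat_012)
  case (ge2 n)
  note [measurable] = ge2 assms
  show ?case by simp
qed (use assms in auto)

lemma herm_numeral:
  "herm 2 x c = x ^ 2 - c"
  "herm 3 x c = x ^ 3 - 3 * c * x"
  "herm 4 x c = x ^ 4 - 6 * c * x ^ 2 + 3 * c ^ 2"
  "herm 5 x c = x ^ 5 - 10 * c * x ^ 3 + 15 * c ^ 2 * x"
  "herm 6 x c = x ^ 6 - 15 * c * x ^ 4 + 45 * c ^ 2 * x ^ 2 - 15 * c ^ 3"
  by (simp_all add: eval_nat_numeral algebra_simps)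

text \<open>Taylor's formula with integral remainder in t, followed by Fubini in the remainder: the
  sixth derivative is bounded only on average over z, uniformly in t, and not pointwise. Both kinds
  of exchange rest on this.\<close>

lemma taylor_average:
  fixes D :: "nat \<Rightarrow> real \<Rightarrow> 'a \<Rightarrow> real"
  assumes P: "prob_space P"
    and der: "\<And>z m t. z \<in> space P \<Longrightarrow> m < 6 \<Longrightarrow> 0 \<le> t \<Longrightarrow> t \<le> 1 \<Longrightarrow>
        ((\<lambda>t. D m t z) has_real_derivative D (Suc m) t z) (at t within {0..1})"
    and cont: "\<And>z. z \<in> space P \<Longrightarrow> continuous_on {0..1} (\<lambda>t. D 6 t z)"
    and meas [measurable]: "(\<lambda>p. D 6 (fst p) (snd p)) \<in> borel_measurable (borel \<Otimes>\<^sub>M P)"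
    and bound: "\<And>t. 0 \<le> t \<Longrightarrow> t \<le> 1 \<Longrightarrow> (\<integral>\<^sup>+z. ennreal \<bar>D 6 t z\<bar> \<partial>P) \<le> ennreal B"
    and B: "0 \<le> B"
    and int1: "integrable P (D 0 1)" and int0: "\<And>i. i < 6 \<Longrightarrow> integrable P (D i 0)"
  shows "\<bar>(\<integral>z. D 0 1 z \<partial>P) - (\<Sum>i<6. (\<integral>z. D i 0 z \<partial>P) / fact i)\<bar> \<le> B / 720"
proof -
  interpret prob_space P by fact
  interpret pair_sigma_finite lborel P
    by (simp add: pair_sigma_finite_def sigma_finite_measure_axioms lborel.sigma_finite_measure_axioms)
  define w where "w t = (1 - t) ^ 5 / 120" for t :: real
  have w0: "0 \<le> w t" if "t \<le> 1" for t using that by (simp add: w_def)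
  have [measurable]: "w \<in> borel_measurable borel" by (simp add: w_def[abs_def])
  define R where "R z = D 0 1 z - (\<Sum>i<6. D i 0 z / fact i)" for z
  have R: "ennreal \<bar>R z\<bar> \<le> (\<integral>\<^sup>+t. ennreal (indicator {0..1} t * (w t * \<bar>D 6 t z\<bar>)) \<partial>lborel)" if z: "z \<in> space P" for z
  proof -
    have "((\<lambda>t. ((1 - t) ^ (6 - 1) / fact (6 - 1)) *\<^sub>R D 6 t z) has_integral
         D 0 1 z - (\<Sum>i<6. ((1 - 0) ^ i / fact i) *\<^sub>R D i 0 z)) {0..1}"
      by (rule Taylor_has_integral)
         (use der[OF z] in \<open>auto simp: has_real_derivative_iff_has_vector_derivative\<close>)
    then have hi: "((\<lambda>t. w t * D 6 t z) has_integral R z) {0..1}"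
      by (simp add: R_def w_def[abs_def] fact_numeral)
    have ci: "continuous_on {0..1} (\<lambda>t. w t * D 6 t z)"
      using cont[OF z] unfolding w_def by (intro continuous_intros) auto
    then have si: "set_integrable lborel {0..1} (\<lambda>t. w t * D 6 t z)"
      by (intro borel_integrable_atLeastAtMost')
    have "R z = (LINT t:{0..1}|lborel. w t * D 6 t z)"
      using set_borel_integral_eq_integral(2)[OF si] hi by (simp add: integral_unique)
    then have "\<bar>R z\<bar> = norm (\<integral>t. indicator {0..1} t * (w t * D 6 t z) \<partial>lborel)"
      by (simp add: set_lebesgue_integral_def)
    also have "ennreal \<dots> \<le> (\<integral>\<^sup>+t. ennreal (norm (indicator {0..1} t * (w t * D 6 t z))) \<partial>lborel)"
      using si by (intro integral_norm_bound_ennreal) (simp add: set_integrable_def)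
    also have "\<dots> = (\<integral>\<^sup>+t. ennreal (indicator {0..1} t * (w t * \<bar>D 6 t z\<bar>)) \<partial>lborel)"
      by (intro nn_integral_cong) (auto simp: indicator_def abs_mult w0)
    finally show ?thesis .
  qed
  have [simp]: "integrable P (\<lambda>z. \<Sum>i<6. D i 0 z / fact i)"
    by (intro Bochner_Integration.integrable_sum integrable_divide int0) auto
  have intR: "integrable P R"
    unfolding R_def using int1 by (intro Bochner_Integration.integrable_diff) auto
  have "ennreal \<bar>\<integral>z. R z \<partial>P\<bar> \<le> (\<integral>\<^sup>+z. ennreal \<bar>R z\<bar> \<partial>P)"
    using integral_norm_bound_ennreal[OF intR] by simp
  also have "\<dots> \<le> (\<integral>\<^sup>+z. (\<integral>\<^sup>+t. ennreal (indicator {0..1} t * (w t * \<bar>D 6 t z\<bar>)) \<partial>lborel) \<partial>P)"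
    by (intro nn_integral_mono R)
  also have "\<dots> = (\<integral>\<^sup>+t. (\<integral>\<^sup>+z. ennreal (indicator {0..1} t * (w t * \<bar>D 6 t z\<bar>)) \<partial>P) \<partial>lborel)"
    by (rule Fubini') simp
  also have "\<dots> \<le> (\<integral>\<^sup>+t. ennreal (w t * B) * indicator {0..1} t \<partial>lborel)"
  proof (intro nn_integral_mono)
    fix t :: real
    show "(\<integral>\<^sup>+z. ennreal (indicator {0..1} t * (w t * \<bar>D 6 t z\<bar>)) \<partial>P) \<le> ennreal (w t * B) * indicator {0..1} t"
    proof (cases "t \<in> {0..1}")
      case True
      have "(\<lambda>z. D 6 t z) \<in> borel_measurable P"
        using measurable_compose[OF _ meas, of "\<lambda>z. (t, z)" P] by simp
      then have "(\<integral>\<^sup>+z. ennreal (w t * \<bar>D 6 t z\<bar>) \<partial>P) = ennreal (w t) * (\<integral>\<^sup>+z. ennreal \<bar>D 6 t z\<bar> \<partial>P)"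
        using True by (subst nn_integral_cmult[symmetric]) (auto simp: ennreal_mult w0)
      also have "\<dots> \<le> ennreal (w t) * ennreal B"
        using True by (intro mult_left_mono bound) auto
      finally show ?thesis using True B by (simp add: ennreal_mult w0)
    qed simp
  qed
  \<comment> \<open>The weight (1 - t)^5 / 5! has the primitive - (1 - t)^6 / 6!.\<close>
  also have "\<dots> = ennreal (- ((1 - 1) ^ 6 / 720 * B) - (- ((1 - 0) ^ 6 / 720 * B)))"
    using B by (intro nn_integral_FTC_Icc)
      (auto simp: w_def intro!: derivative_eq_intros)
  also have "\<dots> = ennreal (B / 720)" by simp
  finally have "\<bar>\<integral>z. R z \<partial>P\<bar> \<le> B / 720" using B by (simp add: ennreal_le_iff)
  moreover have "(\<integral>z. R z \<partial>P) = (\<integral>z. D 0 1 z \<partial>P) - (\<Sum>i<6. (\<integral>z. D i 0 z \<partial>P) / fact i)"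
    unfolding R_def using int1
    by (subst Bochner_Integration.integral_diff) (auto simp: int0 Bochner_Integration.integral_sum)
  ultimately show ?thesis by simp
qed

section \<open>Norms of the sixth Hermite polynomial\<close>

lemma std_moments:
  "(\<integral>x. x ^ 2 \<partial>std_normal_distribution) = 1"
  "(\<integral>x. x ^ 4 \<partial>std_normal_distribution) = 3"
  "(\<integral>x. x ^ 6 \<partial>std_normal_distribution) = 15"
  "(\<integral>x. x ^ 8 \<partial>std_normal_distribution) = 105"
  "(\<integral>x. x ^ 10 \<partial>std_normal_distribution) = 945"
  "(\<integral>x. x ^ 12 \<partial>std_normal_distribution) = 10395"
  using std_even_moment[of 1] std_even_moment[of 2] std_even_moment[of 3] std_even_moment[of 4]
    std_even_moment[of 5] std_even_moment[of 6]
  by (simp_all add: fact_numeral)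

text \<open>The case E He_6^2 = 6! of Hermite orthogonality, obtained by expanding the square and
  inserting the even normal moments.\<close>

lemma herm6_square_std:
  "integrable std_normal_distribution (\<lambda>x. (herm 6 (s * x) (s\<^sup>2))\<^sup>2)"
  "(\<integral>x. (herm 6 (s * x) (s\<^sup>2))\<^sup>2 \<partial>std_normal_distribution) = 720 * s ^ 12"
proof -
  interpret prob_space std_normal_distribution by (rule prob_std)
  have eq: "(herm 6 (s * x) (s\<^sup>2))\<^sup>2 = s ^ 12 * (x ^ 12 - 30 * x ^ 10 + 315 * x ^ 8 - 1380 * x ^ 6 + 2475 * x ^ 4 - 1350 * x ^ 2 + 225)" for x
  proof -
    have "herm 6 (s * x) (s\<^sup>2) = s ^ 6 * (x ^ 6 - 15 * x ^ 4 + 45 * x ^ 2 - 15)"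
      by (simp add: herm_numeral power_mult_distrib algebra_simps flip: power_mult power_add)
    moreover have "(x ^ 6 - 15 * x ^ 4 + 45 * x ^ 2 - 15)\<^sup>2 =
      x ^ 12 - 30 * x ^ 10 + 315 * x ^ 8 - 1380 * x ^ 6 + 2475 * x ^ 4 - 1350 * x ^ 2 + 225"
      by (simp add: power2_eq_square algebra_simps power_numeral_reduce)
    ultimately show ?thesis by (simp add: power_mult_distrib flip: power_mult)
  qed
  note [simp] = integrable_std_normal_distribution_moment
  show "integrable std_normal_distribution (\<lambda>x. (herm 6 (s * x) (s\<^sup>2))\<^sup>2)"
    unfolding eq by simp
  show "(\<integral>x. (herm 6 (s * x) (s\<^sup>2))\<^sup>2 \<partial>std_normal_distribution) = 720 * s ^ 12"
    unfolding eq by (simp add: std_moments prob_space[simplified])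
qed

text \<open>Bounding the first absolute moment by the square root of the second turns the Taylor
  factor 1 / 6! into 1 / sqrt (6!).\<close>

lemma gam_herm6_abs:
  "integrable (gam d) (\<lambda>g. herm 6 (dot d h g) (nsq d h))"
  "(\<integral>g. \<bar>herm 6 (dot d h g) (nsq d h)\<bar> \<partial>gam d) \<le> sqrt 720 * nsq d h ^ 3"
proof -
  let ?F = "\<lambda>x. (herm 6 x (nsq d h))\<^sup>2"
  have i: "integrable (gam d) (\<lambda>g. ?F (dot d h g))"
    using herm6_square_std(1)[of "enorm d h"] by (subst gam_dot_integral(2)[where F="?F"]) (auto simp: enorm_sq)
  have "(\<integral>g. ?F (dot d h g) \<partial>gam d) = 720 * enorm d h ^ 12"
    using herm6_square_std(2)[of "enorm d h"] by (subst gam_dot_integral(1)[where F="?F"]) (auto simp: enorm_sq)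
  also have "\<dots> = 720 * (nsq d h ^ 3)\<^sup>2"
    using power_mult[of "enorm d h" 2 6] by (simp add: enorm_sq)
  finally have *: "(\<integral>g. ?F (dot d h g) \<partial>gam d) = 720 * (nsq d h ^ 3)\<^sup>2" .
  show "integrable (gam d) (\<lambda>g. herm 6 (dot d h g) (nsq d h))"
    by (rule prob_abs_le_sqrt(1)[OF prob_gam i]) simp
  show "(\<integral>g. \<bar>herm 6 (dot d h g) (nsq d h)\<bar> \<partial>gam d) \<le> sqrt 720 * nsq d h ^ 3"
    using prob_abs_le_sqrt(2)[OF prob_gam i] unfolding * real_sqrt_mult real_sqrt_abs by simp
qed

lemma gam_herm_integrable: "integrable (gam d) (\<lambda>g. herm k (dot d h g) c)"
proof -
  \<comment> \<open>The additional power absorbs the multiplication by x in the Hermite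
    recursion.\<close>
  have "integrable (gam d) (\<lambda>g. dot d h g ^ j * herm k (dot d h g) c)" for j
  proof (induction k arbitrary: j rule: induct_nat_012)
    case 0
    then show ?case by (simp add: gam_dot_power_integrable)
  next
    case 1
    then show ?case using gam_dot_power_integrable[of d h "Suc j"] by (simp add: mult.commute)
  next
    case (ge2 n)
    have "integrable (gam d) (\<lambda>g. dot d h g ^ Suc j * herm (Suc n) (dot d h g) c - real (Suc n) * c * (dot d h g ^ j * herm n (dot d h g) c))"
      by (intro Bochner_Integration.integrable_diff integrable_mult_right ge2)
    then show ?case by (simp add: algebra_simps)
  qed
  from this[of 0] show ?thesis by simp
qed

lemma nn_integral_eq_integral_le:
  assumes "integrable P f" "(\<integral>x. \<bar>f x\<bar> \<partial>P) \<le> (B::real)"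
  shows "(\<integral>\<^sup>+x. ennreal \<bar>f x\<bar> \<partial>P) \<le> ennreal B"
  using assms by (subst nn_integral_eq_integral) (auto intro: ennreal_leI)

text \<open>No smoothness of e is used. The shift t h is moved from e to the Gaussian density, whose
  t-derivatives are Hermite polynomials times the density; in the remainder it is moved back, which
  leaves the sixth Hermite polynomial at an unshifted Gaussian point, with an L1 norm independent of
  t.\<close>

lemma gaussian_taylor:
  assumes e: "test_fun d M e" and s: "0 < s"
  shows "\<bar>(\<integral>g. e (x + h + scale s g) \<partial>gam d)
      - (\<Sum>i<6. (\<integral>g. e (x + scale s g) * herm i (dot d h g / s) (nsq d h / s\<^sup>2) \<partial>gam d) / fact i)\<bar>
      \<le> M * (sqrt 720 * (nsq d h / s\<^sup>2) ^ 3) / 720"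
proof -
  \<comment> \<open>The shift measured in units of the Gaussian scale.\<close>
  define k where "k = scale (1 / s) h"
  have dk: "dot d h g / s = dot d k g" for g by (simp add: k_def dot_scale)
  have nk: "nsq d h / s\<^sup>2 = nsq d k" by (simp add: k_def dot_scale power2_eq_square)
  have M: "0 \<le> M" using test_fun_bound_nonneg[OF e] .
  note [measurable] = test_funD(1)[OF e]
  define D where "D m t g = e (x + scale s g) * (herm m (dot d k g - nsq d k * t) (nsq d k) * exp (dot d k g * t - nsq d k * t\<^sup>2 / 2))" for m t g
  define E where "E t g = exp (dot d (scale t k) g - nsq d (scale t k) / 2)" for t g
  have Eeq: "E t g = exp (dot d k g * t - nsq d k * t\<^sup>2 / 2)" for t g
    by (simp add: E_def dot_scale power2_eq_square mult_ac)
  have sh: "e (x + scale s (g + trunc d (scale t k))) = e (x + scale t h + scale s g)" for t g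
  proof -
    have "scale s (scale t k) = scale t h" using s by (simp add: k_def scale_scale)
    then have "trunc d (x + scale s (g + trunc d (scale t k))) = trunc d (x + scale t h + scale s g)"
      by (simp add: trunc_add scale_add trunc_scale[symmetric] add_ac)
    then show ?thesis using test_funD(2)[OF e] by metis
  qed
  \<comment> \<open>Moving the shift back restores the plain argument, as <k, g + t k> - t |k|^2 =
    <k, g>.\<close>
  have hs: "herm m (dot d k (g + trunc d (scale t k)) - nsq d k * t) (nsq d k) = herm m (dot d k g) (nsq d k)" for m t g
    by (simp add: dot_add dot_scale)
  have shift: "(\<integral>g. E t g * (e (x + scale s g) * H (herm m (dot d k g - nsq d k * t) (nsq d k))) \<partial>gam d)
     = (\<integral>g. e (x + scale t h + scale s g) * H (herm m (dot d k g) (nsq d k)) \<partial>gam d)"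
    if [measurable]: "H \<in> borel_measurable borel" for m t H
    unfolding E_def
    by (subst gam_cameron_martin_integral(1)[symmetric]) (auto simp: sh hs)
  have intk: "integrable (gam d) (\<lambda>g. e (y + scale s g) * herm m (dot d k g) (nsq d k))" for m y
    by (rule Bochner_Integration.integrable_bound[OF integrable_mult_right[OF gam_herm_integrable[of d m k "nsq d k"], of M]])
       (auto simp: abs_mult M intro!: mult_right_mono test_funD[OF e])
  have int1: "integrable (gam d) (D 0 1)"
  proof -
    have "integrable (density (gam d) (\<lambda>g. ennreal (E 1 g))) (\<lambda>g. e (x + scale s g))"
      unfolding E_def gam_cameron_martin[symmetric]
      by (rule test_fun_integrable[OF e]) (auto intro!: prob_space.prob_space_distr prob_gam)
    then have "integrable (gam d) (\<lambda>g. E 1 g * e (x + scale s g))"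
      unfolding E_def by (subst (asm) integrable_density) auto
    then show ?thesis by (simp add: D_def[abs_def] Eeq mult.commute)
  qed
  have "\<bar>(\<integral>g. D 0 1 g \<partial>gam d) - (\<Sum>i<6. (\<integral>g. D i 0 g \<partial>gam d) / fact i)\<bar> \<le> M * (sqrt 720 * nsq d k ^ 3) / 720"
  proof (rule taylor_average[OF prob_gam])
    fix z :: "nat \<Rightarrow> real" and m t
    show "((\<lambda>t. D m t z) has_real_derivative D (Suc m) t z) (at t within {0..1})"
      unfolding D_def by (intro DERIV_cmult herm_exp_deriv)
    show "continuous_on {0..1} (\<lambda>t. D 6 t z)"
      unfolding D_def by (intro continuous_intros) simp_all
  next
    show "(\<lambda>p. D 6 (fst p) (snd p)) \<in> borel_measurable (borel \<Otimes>\<^sub>M gam d)"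
      unfolding D_def by measurable
  next
    fix t :: real
    have "(\<integral>\<^sup>+g. ennreal \<bar>D 6 t g\<bar> \<partial>gam d)
       = (\<integral>\<^sup>+g. ennreal (E t g) * ennreal \<bar>e (x + scale s g) * herm 6 (dot d k g - nsq d k * t) (nsq d k)\<bar> \<partial>gam d)"
      by (intro nn_integral_cong) (simp add: D_def Eeq ennreal_mult'[symmetric] abs_mult mult_ac)
    also have "\<dots> = (\<integral>\<^sup>+g. ennreal \<bar>e (x + scale t h + scale s g) * herm 6 (dot d k g) (nsq d k)\<bar> \<partial>gam d)"
      unfolding E_def by (subst gam_cameron_martin_integral(2)[symmetric]) (auto simp: sh hs)
    also have "\<dots> \<le> (\<integral>\<^sup>+g. ennreal \<bar>M * herm 6 (dot d k g) (nsq d k)\<bar> \<partial>gam d)"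
      by (intro nn_integral_mono ennreal_leI) (auto simp: abs_mult M intro!: mult_right_mono test_funD[OF e])
    also have "\<dots> \<le> ennreal (M * (sqrt 720 * nsq d k ^ 3))"
      by (rule nn_integral_eq_integral_le)
         (auto simp: gam_herm6_abs(1) abs_mult M intro!: mult_left_mono gam_herm6_abs(2))
    finally show "(\<integral>\<^sup>+g. ennreal \<bar>D 6 t g\<bar> \<partial>gam d) \<le> ennreal (M * (sqrt 720 * nsq d k ^ 3))" .
  next
    show "0 \<le> M * (sqrt 720 * nsq d k ^ 3)" using M by simp
  next
    show "integrable (gam d) (D 0 1)" by fact
  next
    fix i
    show "integrable (gam d) (D i 0)" using intk[of x i] by (simp add: D_def[abs_def])
  qed
  moreover have "(\<integral>g. D 0 1 g \<partial>gam d) = (\<integral>g. e (x + h + scale s g) \<partial>gam d)"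
    using shift[of "\<lambda>_. 1" 1 0] by (simp add: D_def Eeq mult.commute)
  moreover have "D i 0 g = e (x + scale s g) * herm i (dot d h g / s) (nsq d h / s\<^sup>2)" for i g
    by (simp add: D_def dk nk)
  ultimately show ?thesis by (simp add: nk)
qed

section \<open>Moments and the exchange of one summand\<close>

lemma finite_multi_idx [simp]: "finite (multi_idx d k)"
proof -
  have "multi_idx d k = {xs. set xs \<subseteq> {..<d} \<and> length xs = k}" by (auto simp: multi_idx_def)
  then show ?thesis using finite_lists_length_eq[of "{..<d}" k] by simp
qed

lemma multi_idx_0 [simp]: "multi_idx d 0 = {[]}"
  by (auto simp: multi_idx_def)

lemma sum_multi_idx_Suc:
  "(\<Sum>is\<in>multi_idx d (Suc k). F is) = (\<Sum>i<d. \<Sum>is\<in>multi_idx d k. F (i # is))"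
proof -
  have "multi_idx d (Suc k) = (\<lambda>(i, is). i # is) ` ({..<d} \<times> multi_idx d k)"
    by (auto simp: multi_idx_def length_Suc_conv image_iff)
  then have "(\<Sum>is\<in>multi_idx d (Suc k). F is) = (\<Sum>p\<in>{..<d} \<times> multi_idx d k. F (fst p # snd p))"
    by (simp add: sum.reindex inj_on_def split_beta' o_def)
  then show ?thesis by (simp add: sum.cartesian_product split_beta')
qed

lemma sum_multi_idx_add:
  "(\<Sum>is\<in>multi_idx d (p + q). F (take p is) (drop p is)) = (\<Sum>is\<in>multi_idx d p. \<Sum>js\<in>multi_idx d q. F is js)"
proof (induction p arbitrary: F)
  case (Suc p)
  have "(\<Sum>is\<in>multi_idx d (p + q). F (i # take p is) (drop p is)) = (\<Sum>is\<in>multi_idx d p. \<Sum>js\<in>multi_idx d q. F (i # is) js)" for i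
    using Suc[of "\<lambda>is. F (i # is)"] .
  then show ?case by (simp add: sum_multi_idx_Suc)
qed simp

lemma dot_power:
  "dot d h g ^ k = (\<Sum>is\<in>multi_idx d k. (\<Prod>i\<leftarrow>is. h i) * (\<Prod>i\<leftarrow>is. g i))"
proof (induction k)
  case (Suc k)
  have "dot d h g ^ Suc k = (\<Sum>i<d. \<Sum>is\<in>multi_idx d k. (h i * g i) * ((\<Prod>i\<leftarrow>is. h i) * (\<Prod>i\<leftarrow>is. g i)))"
    by (simp only: power_Suc Suc) (simp add: dot_def sum_product)
  also have "\<dots> = (\<Sum>is\<in>multi_idx d (Suc k). (\<Prod>i\<leftarrow>is. h i) * (\<Prod>i\<leftarrow>is. g i))"
    by (simp add: sum_multi_idx_Suc mult_ac)
  finally show ?case .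
qed simp

text \<open>Homogeneous polynomials given by a coefficient tensor. Every Taylor term is of this kind
  in the increment h, and its expectation depends only on the moments of order k.\<close>

definition hom_poly :: "nat \<Rightarrow> nat \<Rightarrow> ((nat \<Rightarrow> real) \<Rightarrow> real) \<Rightarrow> bool" where
  "hom_poly d k Q \<longleftrightarrow> (\<exists>c. \<forall>h. Q h = (\<Sum>is\<in>multi_idx d k. c is * (\<Prod>i\<leftarrow>is. h i)))"

lemma hom_polyI: "(\<And>h. Q h = (\<Sum>is\<in>multi_idx d k. c is * (\<Prod>i\<leftarrow>is. h i))) \<Longrightarrow> hom_poly d k Q"
  by (auto simp: hom_poly_def)

lemma hom_poly_add: "hom_poly d k P \<Longrightarrow> hom_poly d k Q \<Longrightarrow> hom_poly d k (\<lambda>h. P h + Q h)"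
proof (unfold hom_poly_def, elim exE)
  fix a b
  assume "\<forall>h. P h = (\<Sum>is\<in>multi_idx d k. a is * (\<Prod>i\<leftarrow>is. h i))" "\<forall>h. Q h = (\<Sum>is\<in>multi_idx d k. b is * (\<Prod>i\<leftarrow>is. h i))"
  then show "\<exists>c. \<forall>h. P h + Q h = (\<Sum>is\<in>multi_idx d k. c is * (\<Prod>i\<leftarrow>is. h i))"
    by (intro exI[of _ "\<lambda>is. a is + b is"]) (simp add: sum.distrib algebra_simps)
qed

lemma hom_poly_cmult: "hom_poly d k P \<Longrightarrow> hom_poly d k (\<lambda>h. a * P h)"
proof (unfold hom_poly_def, elim exE)
  fix b
  assume "\<forall>h. P h = (\<Sum>is\<in>multi_idx d k. b is * (\<Prod>i\<leftarrow>is. h i))"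
  then show "\<exists>c. \<forall>h. a * P h = (\<Sum>is\<in>multi_idx d k. c is * (\<Prod>i\<leftarrow>is. h i))"
    by (intro exI[of _ "\<lambda>is. a * b is"]) (simp add: sum_distrib_left mult_ac)
qed

lemma hom_poly_diff: "hom_poly d k P \<Longrightarrow> hom_poly d k Q \<Longrightarrow> hom_poly d k (\<lambda>h. P h - Q h)"
  using hom_poly_add[of d k P "\<lambda>h. (-1) * Q h"] hom_poly_cmult[of d k Q "-1"] by simp

lemma hom_poly_mult: "hom_poly d k P \<Longrightarrow> hom_poly d l Q \<Longrightarrow> hom_poly d (k + l) (\<lambda>h. P h * Q h)"
proof (unfold hom_poly_def, elim exE)
  fix a b
  assume *: "\<forall>h. P h = (\<Sum>is\<in>multi_idx d k. a is * (\<Prod>i\<leftarrow>is. h i))" "\<forall>h. Q h = (\<Sum>is\<in>multi_idx d l. b is * (\<Prod>i\<leftarrow>is. h i))"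
  have split: "(\<Prod>i\<leftarrow>take k is. h i) * (\<Prod>i\<leftarrow>drop k is. h i) = (\<Prod>i\<leftarrow>is. h i)" for "is" and h :: "nat \<Rightarrow> real"
    by (metis append_take_drop_id map_append prod_list.append)
  have "P h * Q h = (\<Sum>is\<in>multi_idx d (k + l). (a (take k is) * b (drop k is)) * (\<Prod>i\<leftarrow>is. h i))" for h
    using sum_multi_idx_add[where F="\<lambda>is js. a is * b js * ((\<Prod>i\<leftarrow>is. h i) * (\<Prod>i\<leftarrow>js. h i))" and p=k and q=l and d=d]
    unfolding split by (simp add: * sum_product mult_ac)
  then show "\<exists>c. \<forall>h. P h * Q h = (\<Sum>is\<in>multi_idx d (k + l). c is * (\<Prod>i\<leftarrow>is. h i))"
    by (intro exI[of _ "\<lambda>is. a (take k is) * b (drop k is)"]) blast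
qed

lemma hom_poly_sum: "finite I \<Longrightarrow> (\<And>i. i \<in> I \<Longrightarrow> hom_poly d k (P i)) \<Longrightarrow> hom_poly d k (\<lambda>h. \<Sum>i\<in>I. P i h)"
proof (induction I rule: finite_induct)
  case empty
  show ?case by (rule hom_polyI[where c="\<lambda>_. 0"]) simp
qed (auto intro: hom_poly_add)

lemma hom_poly_const: "hom_poly d 0 (\<lambda>h. c)"
  by (rule hom_polyI[where c="\<lambda>_. c"]) simp

lemma hom_poly_coord: "i < d \<Longrightarrow> hom_poly d 1 (\<lambda>h. h i)"
  by (rule hom_polyI[where c="\<lambda>is. if is = [i] then 1 else 0"])
     (simp add: sum_multi_idx_Suc if_distrib[of "\<lambda>x. x * _"] sum.delta cong: if_cong)

lemma hom_poly_dot: "hom_poly d 1 (\<lambda>h. dot d y h)"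
  unfolding dot_def by (intro hom_poly_sum hom_poly_cmult hom_poly_coord) auto

lemma hom_poly_nsq: "hom_poly d 2 (\<lambda>h. nsq d h)"
  unfolding dot_def using hom_poly_mult[OF hom_poly_coord hom_poly_coord, of _ d]
  by (intro hom_poly_sum) (auto simp: numeral_2_eq_2)

lemma hom_poly_power: "hom_poly d k P \<Longrightarrow> hom_poly d (m * k) (\<lambda>h. P h ^ m)"
  by (induction m) (auto simp: hom_poly_const intro: hom_poly_mult)

text \<open>A product of \<open>k\<close> coordinates is dominated by the \<open>k\<close>-th power of the largest one.\<close>

lemma abs_monomial_le:
  fixes h :: "nat \<Rightarrow> real"
  assumes "is \<in> multi_idx d k" "0 < k"
  shows "\<bar>\<Prod>i\<leftarrow>is. h i\<bar> \<le> (\<Sum>i<d. \<bar>h i\<bar> ^ k)"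
proof -
  define m where "m = Max ((\<lambda>i. \<bar>h i\<bar>) ` set is)"
  have ne: "set is \<noteq> {}" and len: "length is = k" and sub: "set is \<subseteq> {..<d}" using assms by (auto simp: multi_idx_def)
  have "m \<in> (\<lambda>i. \<bar>h i\<bar>) ` set is" unfolding m_def using ne by (intro Max_in) auto
  then obtain j where j: "j \<in> set is" "m = \<bar>h j\<bar>" by auto
  have le: "\<bar>h i\<bar> \<le> m" if "i \<in> set is" for i unfolding m_def using that by (intro Max_ge) auto
  have "\<bar>\<Prod>i\<leftarrow>js. h i\<bar> \<le> m ^ length js" if "set js \<subseteq> set is" for js
    using that by (induction js) (auto simp: abs_mult j(2) intro!: mult_mono le[unfolded j(2)])
  from this[of "is"] have "\<bar>\<Prod>i\<leftarrow>is. h i\<bar> \<le> \<bar>h j\<bar> ^ k" by (simp add: len j(2))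
  also have "\<dots> \<le> (\<Sum>i<d. \<bar>h i\<bar> ^ k)"
    using j sub by (intro member_le_sum) auto
  finally show ?thesis .
qed

section \<open>Finite sixth moments and matching moments\<close>

definition sixth_moments :: "nat \<Rightarrow> (nat \<Rightarrow> real) measure \<Rightarrow> bool" where
  "sixth_moments d \<mu> \<longleftrightarrow> law \<mu> \<and> (\<forall>i<d. integrable \<mu> (\<lambda>x. x i ^ 6))"

lemma sixth_moments_law: "sixth_moments d \<mu> \<Longrightarrow> law \<mu>"
  by (simp add: sixth_moments_def)

lemma measurable_monomial: "(\<lambda>x::nat \<Rightarrow> real. \<Prod>i\<leftarrow>is. x i) \<in> borel_measurable borel"
  by (induction "is") auto

lemma monomial_integrable:
  assumes \<mu>: "sixth_moments d \<mu>" and "is": "is \<in> multi_idx d k" and k: "k \<le> 6"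
  shows "integrable \<mu> (\<lambda>x. \<Prod>i\<leftarrow>is. x i)"
proof (cases "k = 0")
  case True
  interpret prob_space \<mu> using \<mu> by (simp add: sixth_moments_def law_def)
  show ?thesis using True "is" by (simp add: multi_idx_def)
next
  case False
  interpret prob_space \<mu> using \<mu> by (simp add: sixth_moments_def law_def)
  have i: "integrable \<mu> (\<lambda>x. \<Sum>i<d. 1 + x i ^ 6)"
    using \<mu> by (intro Bochner_Integration.integrable_sum) (auto simp: sixth_moments_def)
  have le: "\<bar>t\<bar> ^ k \<le> 1 + t ^ 6" for t :: real
  proof (cases "\<bar>t\<bar> \<le> 1")
    case True
    then have "\<bar>t\<bar> ^ k \<le> 1" by (intro power_le_one) auto
    moreover have "0 \<le> t ^ 6" by simp
    ultimately show ?thesis by linarith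
  next
    case False
    then have "\<bar>t\<bar> ^ k \<le> \<bar>t\<bar> ^ 6" using k by (intro power_increasing) auto
    then show ?thesis by simp
  qed
  show ?thesis
  proof (rule Bochner_Integration.integrable_bound[OF i])
    show "(\<lambda>x. \<Prod>i\<leftarrow>is. x i) \<in> borel_measurable \<mu>"
      using measurable_monomial by (rule law_measurable[OF sixth_moments_law[OF \<mu>]])
    have "\<bar>\<Prod>i\<leftarrow>is. x i\<bar> \<le> (\<Sum>i<d. 1 + x i ^ 6)" for x :: "nat \<Rightarrow> real"
      using abs_monomial_le[OF "is", of x] False le by (intro order_trans[OF abs_monomial_le[OF "is"] sum_mono]) auto
    then show "AE x in \<mu>. norm (\<Prod>i\<leftarrow>is. x i) \<le> norm (\<Sum>i<d. 1 + x i ^ 6)"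
      by (auto intro!: AE_I2 order_trans[OF _ abs_ge_self])
  qed
qed

lemma hom_poly_integrable:
  assumes \<mu>: "sixth_moments d \<mu>" and Q: "hom_poly d k Q" and k: "k \<le> 6"
  shows "integrable \<mu> Q"
proof -
  obtain c where c: "\<And>h. Q h = (\<Sum>is\<in>multi_idx d k. c is * (\<Prod>i\<leftarrow>is. h i))" using Q by (auto simp: hom_poly_def)
  show ?thesis unfolding c[abs_def]
    by (intro Bochner_Integration.integrable_sum integrable_mult_right monomial_integrable[OF \<mu> _ k])
qed

lemma nsq_cube_integrable: "sixth_moments d \<mu> \<Longrightarrow> integrable \<mu> (\<lambda>x. nsq d x ^ 3)"
  using hom_poly_integrable[OF _ hom_poly_power[OF hom_poly_nsq, of d 3]] by simp

definition same_moments :: "nat \<Rightarrow> nat \<Rightarrow> (nat \<Rightarrow> real) measure \<Rightarrow> (nat \<Rightarrow> real) measure \<Rightarrow> bool" where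
  "same_moments d k \<mu> \<nu> \<longleftrightarrow> (\<forall>is\<in>multi_idx d k. (\<integral>x. (\<Prod>i\<leftarrow>is. x i) \<partial>\<mu>) = (\<integral>x. (\<Prod>i\<leftarrow>is. x i) \<partial>\<nu>))"

lemma hom_poly_same_moments:
  assumes \<mu>: "sixth_moments d \<mu>" and \<nu>: "sixth_moments d \<nu>" and Q: "hom_poly d k Q" and k: "k \<le> 6"
    and "same_moments d k \<mu> \<nu>"
  shows "(\<integral>h. Q h \<partial>\<mu>) = (\<integral>h. Q h \<partial>\<nu>)"
proof -
  obtain c where c: "\<And>h. Q h = (\<Sum>is\<in>multi_idx d k. c is * (\<Prod>i\<leftarrow>is. h i))" using Q by (auto simp: hom_poly_def)
  show ?thesis unfolding c
    using assms monomial_integrable[OF \<mu> _ k] monomial_integrable[OF \<nu> _ k]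
    by (subst (1 2) Bochner_Integration.integral_sum) (auto simp: same_moments_def intro!: sum.cong)
qed

lemma same_moments_0:
  assumes "law \<mu>" "law \<nu>"
  shows "same_moments d 0 \<mu> \<nu>"
proof -
  interpret A: prob_space \<mu> using assms by (simp add: law_def)
  interpret B: prob_space \<nu> using assms by (simp add: law_def)
  show ?thesis using A.prob_space B.prob_space by (simp add: same_moments_def)
qed

section \<open>Gaussian smoothing and the exchange of one summand behind it\<close>

definition gauss :: "nat \<Rightarrow> real \<Rightarrow> (nat \<Rightarrow> real) measure" where
  "gauss d s = distr (gam d) borel (scale s)"

lemma measurable_scale_const [measurable]: "scale s \<in> borel_measurable borel"
  using measurable_scale[of "\<lambda>x. x" borel "\<lambda>_. s"] by simp

lemma law_gauss: "law (gauss d s)"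
  unfolding gauss_def by (rule law_distr[OF prob_gam]) simp

lemma avg_gauss:
  assumes e: "test_fun d M e"
  shows "avg (gauss d s) e x = (\<integral>g. e (x + scale s g) \<partial>gam d)"
proof -
  note [measurable] = test_funD(1)[OF e]
  show ?thesis unfolding avg_def gauss_def by (subst integral_distr) auto
qed

text \<open>For s > 0 this is the i-th derivative of \<open>avg (gauss d s) e\<close> at x in
  direction h, with all derivatives moved onto the Gaussian density.\<close>

definition hermite_coeff :: "nat \<Rightarrow> ((nat \<Rightarrow> real) \<Rightarrow> real) \<Rightarrow> real \<Rightarrow> (nat \<Rightarrow> real) \<Rightarrow> nat \<Rightarrow> (nat \<Rightarrow> real) \<Rightarrow> real" where
  "hermite_coeff d e s x i h = (\<integral>g. e (x + scale s g) * herm i (dot d h g / s) (nsq d h / s\<^sup>2) \<partial>gam d)"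

lemma gam_monomial_integrable:
  assumes "is \<in> multi_idx d k"
  shows "integrable (gam d) (\<lambda>x. \<Prod>i\<leftarrow>is. x i)"
proof (cases "k = 0")
  case True
  interpret prob_space "gam d" by (rule prob_gam)
  show ?thesis using True assms by (simp add: multi_idx_def)
next
  case False
  have *: "integrable (gam d) (\<lambda>x. \<bar>x i\<bar> ^ k)" if "i < d" for i
    using gam_dot_power_integrable[of d "\<lambda>k. if k = i then 1 else 0" k] that
    by (simp add: dot_def if_distrib[of "\<lambda>x. x * _"] sum.delta power_abs[symmetric] cong: if_cong)
  show ?thesis
  proof (rule Bochner_Integration.integrable_bound)
    show "integrable (gam d) (\<lambda>x. \<Sum>i<d. \<bar>x i\<bar> ^ k)"
      by (intro Bochner_Integration.integrable_sum *) auto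
    show "(\<lambda>x. \<Prod>i\<leftarrow>is. x i) \<in> borel_measurable (gam d)"
      using measurable_monomial by (rule law_measurable[OF law_gam])
    show "AE x in gam d. norm (\<Prod>i\<leftarrow>is. x i) \<le> norm (\<Sum>i<d. \<bar>x i\<bar> ^ k)"
      using abs_monomial_le[OF assms] False by (auto intro!: AE_I2 order_trans[OF _ abs_ge_self])
  qed
qed

lemma test_fun_mult_integrable:
  assumes e: "test_fun d M e" and f: "integrable (gam d) f"
  shows "integrable (gam d) (\<lambda>g. e (x + scale s g) * f g)"
proof (rule Bochner_Integration.integrable_bound[OF integrable_mult_right[OF f, of M]])
  note [measurable] = test_funD(1)[OF e] borel_measurable_integrable[OF f]
  show "(\<lambda>g. e (x + scale s g) * f g) \<in> borel_measurable (gam d)" by measurable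
  show "AE g in gam d. norm (e (x + scale s g) * f g) \<le> norm (M * f g)"
    using test_fun_bound_nonneg[OF e] by (auto simp: abs_mult intro!: mult_right_mono test_funD[OF e])
qed

text \<open>Homogeneity in h is what lets matching moments cancel the Taylor terms after averaging
  over h.\<close>

lemma hermite_coeff_hom_poly:
  assumes e: "test_fun d M e"
  shows "hom_poly d i (hermite_coeff d e s x i)"
proof -
  have int: "integrable (gam d) (\<lambda>g. (dot d h g / s) ^ j * herm k (dot d h g / s) c)" for h j k c
  proof (induction k arbitrary: j rule: induct_nat_012)
    case 0
    then show ?case using gam_dot_power_integrable[of d h j] by (simp add: power_divide)
  next
    case 1
    then show ?case using gam_dot_power_integrable[of d h "Suc j"] by (simp add: power_divide mult.commute)
  next
    case (ge2 n)
    have "integrable (gam d) (\<lambda>g. (dot d h g / s) ^ Suc j * herm (Suc n) (dot d h g / s) c - real (Suc n) * c * ((dot d h g / s) ^ j * herm n (dot d h g / s) c))"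
      by (intro Bochner_Integration.integrable_diff integrable_mult_right ge2)
    then show ?case by (simp add: algebra_simps)
  qed
  have base: "hom_poly d j (\<lambda>h. \<integral>g. e (x + scale s g) * (dot d h g / s) ^ j \<partial>gam d)" for j
  proof (rule hom_polyI)
    fix h
    have "(\<integral>g. e (x + scale s g) * (dot d h g / s) ^ j \<partial>gam d)
      = (\<integral>g. (\<Sum>is\<in>multi_idx d j. (\<Prod>i\<leftarrow>is. h i) * ((e (x + scale s g) * (\<Prod>i\<leftarrow>is. g i)) / s ^ j)) \<partial>gam d)"
      by (intro Bochner_Integration.integral_cong refl)
         (simp add: power_divide dot_power sum_distrib_left sum_divide_distrib mult_ac)
    also have "\<dots> = (\<Sum>is\<in>multi_idx d j. (\<Prod>i\<leftarrow>is. h i) * (\<integral>g. (e (x + scale s g) * (\<Prod>i\<leftarrow>is. g i)) / s ^ j \<partial>gam d))"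
      by (subst Bochner_Integration.integral_sum)
         (auto intro!: integrable_divide test_fun_mult_integrable[OF e] gam_monomial_integrable)
    finally show "(\<integral>g. e (x + scale s g) * (dot d h g / s) ^ j \<partial>gam d)
      = (\<Sum>is\<in>multi_idx d j. (\<integral>g. (e (x + scale s g) * (\<Prod>i\<leftarrow>is. g i)) / s ^ j \<partial>gam d) * (\<Prod>i\<leftarrow>is. h i))"
      by (simp only: mult.commute)
  qed
  \<comment> \<open>The claim carries an additional power of the linear functional, so that the
    factor x of the Hermite recursion can be absorbed.\<close>
  have "hom_poly d (j + k) (\<lambda>h. \<integral>g. e (x + scale s g) * ((dot d h g / s) ^ j * herm k (dot d h g / s) (nsq d h / s\<^sup>2)) \<partial>gam d)" for j k
  proof (induction k arbitrary: j rule: induct_nat_012)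
    case 0
    show ?case using base[of j] by (simp only: herm.simps mult_1_right add_0_right)
  next
    case 1
    then show ?case using base[of "Suc j"]
      by (simp only: herm.simps One_nat_def power_Suc2 add_Suc_right add_0_right)
  next
    case (ge2 n)
    let ?I = "\<lambda>j k h. \<integral>g. e (x + scale s g) * ((dot d h g / s) ^ j * herm k (dot d h g / s) (nsq d h / s\<^sup>2)) \<partial>gam d"
    have eq: "?I j (Suc (Suc n)) h = ?I (Suc j) (Suc n) h - (real (Suc n) / s\<^sup>2) * (nsq d h * ?I j n h)" for h
    proof -
      have "?I j (Suc (Suc n)) h = (\<integral>g. e (x + scale s g) * ((dot d h g / s) ^ Suc j * herm (Suc n) (dot d h g / s) (nsq d h / s\<^sup>2))
         - (real (Suc n) / s\<^sup>2 * nsq d h) * (e (x + scale s g) * ((dot d h g / s) ^ j * herm n (dot d h g / s) (nsq d h / s\<^sup>2))) \<partial>gam d)"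
        by (intro Bochner_Integration.integral_cong refl) (simp add: algebra_simps)
      also have "\<dots> = ?I (Suc j) (Suc n) h - (real (Suc n) / s\<^sup>2 * nsq d h) * ?I j n h"
        by (subst Bochner_Integration.integral_diff)
           (auto intro!: integrable_mult_right test_fun_mult_integrable[OF e] int simp del: power_Suc)
      finally show ?thesis by (simp add: mult.assoc)
    qed
    have a: "hom_poly d (j + Suc (Suc n)) (?I (Suc j) (Suc n))"
      using ge2(2)[of "Suc j"] by (simp only: add_Suc add_Suc_right)
    have b: "hom_poly d (j + Suc (Suc n)) (\<lambda>h. nsq d h * ?I j n h)"
      using hom_poly_mult[OF hom_poly_nsq ge2(1)[of j]]
      by (simp only: numeral_2_eq_2 add_Suc add_Suc_right add_0)
    show ?case unfolding eq by (rule hom_poly_diff[OF a hom_poly_cmult[OF b]])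
  qed
  from this[of 0 i] show ?thesis
    unfolding hermite_coeff_def[abs_def] by (simp only: power_0 mult_1_left add_0)
qed

lemma sqrt_720: "sqrt 720 / 720 = 1 / sqrt 720"
  by (simp add: field_simps)

lemma gaussian_taylor_avg:
  assumes e: "test_fun d M e" and s: "0 < s" and \<mu>: "sixth_moments d \<mu>"
  shows "\<bar>avg \<mu> (avg (gauss d s) e) x - (\<Sum>i<6. (\<integral>h. hermite_coeff d e s x i h \<partial>\<mu>) / fact i)\<bar>
     \<le> M / (sqrt 720 * s ^ 6) * (\<integral>h. nsq d h ^ 3 \<partial>\<mu>)"
proof -
  let ?q = "hermite_coeff d e s x"
  have int: "integrable \<mu> (\<lambda>h. \<Sum>i<6. ?q i h / fact i)"
    by (intro Bochner_Integration.integrable_sum integrable_divide hom_poly_integrable[OF \<mu> hermite_coeff_hom_poly[OF e]]) auto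
  have int2: "integrable \<mu> (\<lambda>h. avg (gauss d s) e (x + h))"
    by (rule test_fun_law_integrable[OF test_fun_avg[OF e law_gauss] sixth_moments_law[OF \<mu>]])
  have bd: "\<bar>avg (gauss d s) e (x + h) - (\<Sum>i<6. ?q i h / fact i)\<bar> \<le> M / (sqrt 720 * s ^ 6) * nsq d h ^ 3" for h
  proof -
    have "M * (sqrt 720 * (nsq d h / s\<^sup>2) ^ 3) / 720 = M * (sqrt 720 / 720) * nsq d h ^ 3 / s ^ 6"
      by (simp add: power_divide flip: power_mult)
    also have "\<dots> = M / (sqrt 720 * s ^ 6) * nsq d h ^ 3"
      unfolding sqrt_720 by simp
    finally show ?thesis
      using gaussian_taylor[OF e s, of x h] unfolding avg_gauss[OF e] hermite_coeff_def by simp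
  qed
  have "avg \<mu> (avg (gauss d s) e) x - (\<Sum>i<6. (\<integral>h. ?q i h \<partial>\<mu>) / fact i)
     = (\<integral>h. avg (gauss d s) e (x + h) - (\<Sum>i<6. ?q i h / fact i) \<partial>\<mu>)"
    unfolding avg_def[of \<mu>] using int int2 hom_poly_integrable[OF \<mu> hermite_coeff_hom_poly[OF e, of _ s x]]
    by (subst Bochner_Integration.integral_diff) (auto simp: Bochner_Integration.integral_sum)
  then have "\<bar>avg \<mu> (avg (gauss d s) e) x - (\<Sum>i<6. (\<integral>h. ?q i h \<partial>\<mu>) / fact i)\<bar>
     \<le> (\<integral>h. \<bar>avg (gauss d s) e (x + h) - (\<Sum>i<6. ?q i h / fact i)\<bar> \<partial>\<mu>)"
    by (simp only: integral_abs_bound)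
  also have "\<dots> \<le> (\<integral>h. M / (sqrt 720 * s ^ 6) * nsq d h ^ 3 \<partial>\<mu>)"
    by (intro integral_mono integrable_mult_right nsq_cube_integrable[OF \<mu>] integrable_abs
       Bochner_Integration.integrable_diff int int2 bd)
  finally show ?thesis by simp
qed

text \<open>Order 4 is exempt from matching, since it is the order at which X and Z may differ; its
  term is kept as it stands for a sharper estimate.\<close>

lemma gaussian_swap_bound:
  assumes e: "test_fun d M e" and s: "0 < s" and \<mu>: "sixth_moments d \<mu>" and \<nu>: "sixth_moments d \<nu>"
    and same: "\<And>k. k \<le> 5 \<Longrightarrow> k \<noteq> 4 \<Longrightarrow> same_moments d k \<mu> \<nu>"
  shows "\<bar>avg \<mu> (avg (gauss d s) e) x - avg \<nu> (avg (gauss d s) e) x\<bar>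
     \<le> \<bar>(\<integral>h. hermite_coeff d e s x 4 h \<partial>\<mu>) - (\<integral>h. hermite_coeff d e s x 4 h \<partial>\<nu>)\<bar> / 24 +
       M / (sqrt 720 * s ^ 6) * ((\<integral>h. nsq d h ^ 3 \<partial>\<mu>) + (\<integral>h. nsq d h ^ 3 \<partial>\<nu>))"
proof -
  let ?I = "\<lambda>\<mu> i. \<integral>h. hermite_coeff d e s x i h \<partial>\<mu>"
  have eq: "?I \<mu> i = ?I \<nu> i" if "i \<le> 5" "i \<noteq> 4" for i
    using that by (intro hom_poly_same_moments[OF \<mu> \<nu> hermite_coeff_hom_poly[OF e]] same) auto
  have "(\<Sum>i<6. ?I \<mu> i / fact i) - (\<Sum>i<6. ?I \<nu> i / fact i) = (?I \<mu> 4 - ?I \<nu> 4) / 24"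
    by (simp add: eval_nat_numeral eq fact_numeral diff_divide_distrib)
  moreover have "\<bar>a - b\<bar> \<le> \<bar>p\<bar> / 24 + C * (m + m')"
    if "A - B = p / 24" "\<bar>a - A\<bar> \<le> C * m" "\<bar>b - B\<bar> \<le> C * m'" for a b A B p C m m' :: real
    using that unfolding distrib_left abs_le_iff by (simp add: abs_if)
  ultimately show ?thesis
    using gaussian_taylor_avg[OF e s \<mu>, of x] gaussian_taylor_avg[OF e s \<nu>, of x] by blast
qed

section \<open>The fourth-order term and the Frobenius norm\<close>

lemma gam_hom_poly_integrable:
  assumes Q: "hom_poly d k Q"
  shows "integrable (gam d) Q"
proof -
  obtain c where c: "\<And>h. Q h = (\<Sum>is\<in>multi_idx d k. c is * (\<Prod>i\<leftarrow>is. h i))" using Q by (auto simp: hom_poly_def)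
  show ?thesis unfolding c[abs_def]
    by (intro Bochner_Integration.integrable_sum integrable_mult_right gam_monomial_integrable)
qed

lemma gam_dot_powers_integrable: "integrable (gam d) (\<lambda>g. dot d h g ^ a * dot d k g ^ b)"
  by (rule gam_hom_poly_integrable[OF hom_poly_mult[OF hom_poly_power hom_poly_power]]) (rule hom_poly_dot)+

text \<open>Mixed Gaussian moments are read off the even moments of \<open>t h + k\<close> by comparing coefficients in \<open>t\<close>.\<close>

lemma gam_mixed_even:
  fixes d h k
  defines "E \<equiv> \<lambda>a b. \<integral>g. dot d h g ^ a * dot d k g ^ b \<partial>gam d"
    and "Q \<equiv> \<lambda>t. t ^ 2 * nsq d h + 2 * t * dot d h k + nsq d k"
  shows "(\<Sum>i\<le>2 * n. real (2 * n choose i) * t ^ i * E i (2 * n - i)) = fact (2 * n) / (2 ^ n * fact n) * Q t ^ n"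
proof -
  have "nsq d (scale t h + k) = Q t"
    by (simp add: Q_def dot_add dot_scale power2_eq_square dot_commute[of d k h] algebra_simps)
  then have "fact (2 * n) / (2 ^ n * fact n) * Q t ^ n = (\<integral>g. dot d (scale t h + k) g ^ (2 * n) \<partial>gam d)"
    by (simp add: gam_dot_even_moment)
  also have "\<dots> = (\<integral>g. (\<Sum>i\<le>2 * n. real (2 * n choose i) * t ^ i * (dot d h g ^ i * dot d k g ^ (2 * n - i))) \<partial>gam d)"
    by (intro Bochner_Integration.integral_cong refl)
       (simp add: dot_add dot_scale binomial_ring power_mult_distrib mult_ac)
  also have "\<dots> = (\<Sum>i\<le>2 * n. real (2 * n choose i) * t ^ i * E i (2 * n - i))"
    unfolding E_def by (subst Bochner_Integration.integral_sum) (auto intro: gam_dot_powers_integrable)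
  finally show ?thesis ..
qed

text \<open>Adding the identities at t and - t leaves the even powers of t. The values t = 1, t = 2
  and t = 3 then give enough linear equations for the mixed moments of order up to 8.\<close>

lemma gam_mixed_moments:
  fixes d h k
  defines "E \<equiv> \<lambda>a b. \<integral>g. dot d h g ^ a * dot d k g ^ b \<partial>gam d"
    and "A \<equiv> nsq d h" and "B \<equiv> nsq d k" and "r \<equiv> dot d h k"
  shows "E 2 2 = A * B + 2 * r ^ 2"
    and "E 4 2 = 3 * A ^ 2 * B + 12 * A * r ^ 2"
    and "E 2 4 = 3 * A * B ^ 2 + 12 * B * r ^ 2"
    and "E 4 4 = 9 * A ^ 2 * B ^ 2 + 72 * A * B * r ^ 2 + 24 * r ^ 4"
    and "E 4 0 = 3 * A ^ 2" and "E 0 4 = 3 * B ^ 2" and "E 2 0 = A" and "E 0 2 = B"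
proof -
  have pure: "E (2 * n) 0 = fact (2 * n) / (2 ^ n * fact n) * A ^ n" "E 0 (2 * n) = fact (2 * n) / (2 ^ n * fact n) * B ^ n" for n
    by (simp_all add: E_def A_def B_def gam_dot_even_moment)
  show p: "E 4 0 = 3 * A ^ 2" "E 0 4 = 3 * B ^ 2" "E 2 0 = A" "E 0 2 = B"
    using pure[of 1] pure[of 2] by (simp_all add: fact_numeral)
  have p': "E 6 0 = 15 * A ^ 3" "E 0 6 = 15 * B ^ 3" "E 8 0 = 105 * A ^ 4" "E 0 8 = 105 * B ^ 4"
    using pure[of 3] pure[of 4] by (simp_all add: fact_numeral)
  have m: "(\<Sum>i\<le>2 * n. real (2 * n choose i) * t ^ i * E i (2 * n - i))
     = fact (2 * n) / (2 ^ n * fact n) * (t ^ 2 * A + 2 * t * r + B) ^ n" for n t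
    unfolding E_def A_def B_def r_def by (rule gam_mixed_even)
  have sets: "{..4::nat} = {0, 1, 2, 3, 4}" "{..6::nat} = {0, 1, 2, 3, 4, 5, 6}" "{..8::nat} = {0, 1, 2, 3, 4, 5, 6, 7, 8}"
    by auto
  have bin: "(4 choose 2) = (6::nat)" "(4 choose 3) = (4::nat)"
    "(6 choose 2) = (15::nat)" "(6 choose 3) = (20::nat)" "(6 choose 4) = (15::nat)" "(6 choose 5) = (6::nat)"
    "(8 choose 2) = (28::nat)" "(8 choose 3) = (56::nat)" "(8 choose 4) = (70::nat)" "(8 choose 5) = (56::nat)"
    "(8 choose 6) = (28::nat)" "(8 choose 7) = (8::nat)"
    by (simp_all add: eval_nat_numeral)
  have m2: "E 0 4 + 4 * t * E 1 3 + 6 * t ^ 2 * E 2 2 + 4 * t ^ 3 * E 3 1 + t ^ 4 * E 4 0 = 3 * (t ^ 2 * A + 2 * t * r + B) ^ 2" for t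
    using m[of 2 t] by (simp add: sets bin fact_numeral)
  have m3: "E 0 6 + 6 * t * E 1 5 + 15 * t ^ 2 * E 2 4 + 20 * t ^ 3 * E 3 3 + 15 * t ^ 4 * E 4 2 + 6 * t ^ 5 * E 5 1 + t ^ 6 * E 6 0
     = 15 * (t ^ 2 * A + 2 * t * r + B) ^ 3" for t
    using m[of 3 t] by (simp add: sets bin fact_numeral)
  have m4: "E 0 8 + 8 * t * E 1 7 + 28 * t ^ 2 * E 2 6 + 56 * t ^ 3 * E 3 5 + 70 * t ^ 4 * E 4 4 + 56 * t ^ 5 * E 5 3
      + 28 * t ^ 6 * E 6 2 + 8 * t ^ 7 * E 7 1 + t ^ 8 * E 8 0
     = 105 * (t ^ 2 * A + 2 * t * r + B) ^ 4" for t
    using m[of 4 t] by (simp add: sets bin fact_numeral)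
  have q2: "(A + 2 * r + B) ^ 2 + (A - 2 * r + B) ^ 2 = 2 * (A + B) ^ 2 + 8 * r ^ 2"
    by (simp add: power2_eq_square algebra_simps)
  have "E 0 4 + 6 * E 2 2 + E 4 0 = 3 * (A + B) ^ 2 + 12 * r ^ 2"
    using m2[of 1] m2[of "-1"] q2 by simp
  then show "E 2 2 = A * B + 2 * r ^ 2"
    unfolding p by (simp add: power2_eq_square algebra_simps)
  have q3: "(x + y) ^ 3 + (x - y) ^ 3 = 2 * x ^ 3 + 6 * x * y ^ 2" for x y :: real
    by (simp add: power2_eq_square power3_eq_cube algebra_simps)
  have e3: "E 0 6 + 15 * t ^ 2 * E 2 4 + 15 * t ^ 4 * E 4 2 + t ^ 6 * E 6 0 = 15 * (t ^ 2 * A + B) ^ 3 + 180 * (t ^ 2 * A + B) * t ^ 2 * r ^ 2" for t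
  proof -
    define X Y where "X = t ^ 2 * A + B" and "Y = 2 * t * r"
    have XY: "t ^ 2 * A + 2 * t * r + B = X + Y" "(- t) ^ 2 * A + 2 * (- t) * r + B = X - Y" "Y ^ 2 = 4 * t ^ 2 * r ^ 2"
      by (simp_all add: X_def Y_def power_mult_distrib)
    have "15 * (X + Y) ^ 3 + 15 * (X - Y) ^ 3 = 30 * X ^ 3 + 360 * X * t ^ 2 * r ^ 2"
      using q3[of X Y] by (simp add: XY(3))
    then show ?thesis
      using m3[of t, unfolded XY(1)] m3[of "-t", unfolded XY(2)] unfolding X_def[symmetric] by simp
  qed
  have 31: "E 2 4 + E 4 2 = 3 * A ^ 2 * B + 3 * A * B ^ 2 + 12 * A * r ^ 2 + 12 * B * r ^ 2"
    using e3[of 1] unfolding p' by (simp add: power2_eq_square power3_eq_cube algebra_simps)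
  have 32: "E 2 4 + 4 * E 4 2 = 12 * A ^ 2 * B + 3 * A * B ^ 2 + 48 * A * r ^ 2 + 12 * B * r ^ 2"
    using e3[of 2] unfolding p' by (simp add: power2_eq_square power3_eq_cube algebra_simps)
  show "E 4 2 = 3 * A ^ 2 * B + 12 * A * r ^ 2" "E 2 4 = 3 * A * B ^ 2 + 12 * B * r ^ 2"
    using 31 32 by linarith+
  have q4: "(x + y) ^ 4 + (x - y) ^ 4 = 2 * x ^ 4 + 12 * x ^ 2 * y ^ 2 + 2 * y ^ 4" for x y :: real
    by (simp add: power_numeral_reduce algebra_simps)
  have e4: "E 0 8 + 28 * t ^ 2 * E 2 6 + 70 * t ^ 4 * E 4 4 + 28 * t ^ 6 * E 6 2 + t ^ 8 * E 8 0
     = 105 * (t ^ 2 * A + B) ^ 4 + 2520 * (t ^ 2 * A + B) ^ 2 * (t ^ 2 * r ^ 2) + 1680 * (t ^ 4 * r ^ 4)" for t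
  proof -
    define X Y where "X = t ^ 2 * A + B" and "Y = 2 * t * r"
    have XY: "t ^ 2 * A + 2 * t * r + B = X + Y" "(- t) ^ 2 * A + 2 * (- t) * r + B = X - Y"
      "Y ^ 2 = 4 * (t ^ 2 * r ^ 2)" "Y ^ 4 = 16 * (t ^ 4 * r ^ 4)"
      by (simp_all add: X_def Y_def power_mult_distrib)
    have "105 * (X + Y) ^ 4 + 105 * (X - Y) ^ 4 = 210 * X ^ 4 + 5040 * X ^ 2 * (t ^ 2 * r ^ 2) + 3360 * (t ^ 4 * r ^ 4)"
      using q4[of X Y] by (simp add: XY(3,4))
    then show ?thesis
      using m4[of t, unfolded XY(1)] m4[of "-t", unfolded XY(2)] unfolding X_def[symmetric] by simp
  qed
  \<comment> \<open>The values that Isserlis' formula predicts for \<open>E 2 6\<close>,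
    \<open>E 4 4\<close> and \<open>E 6 2\<close>. They solve the same three equations, and only the
    middle one is wanted.\<close>
  define a b c where "a = 15 * A * B ^ 3 + 90 * B ^ 2 * r ^ 2"
    and "b = 9 * A ^ 2 * B ^ 2 + 72 * A * B * r ^ 2 + 24 * r ^ 4" and "c = 15 * A ^ 3 * B + 90 * A ^ 2 * r ^ 2"
  have id: "105 * (u * A + B) ^ 4 + 2520 * (u * A + B) ^ 2 * (u * r ^ 2) + 1680 * (u ^ 2 * r ^ 4)
     = 105 * B ^ 4 + 28 * u * a + 70 * u ^ 2 * b + 28 * u ^ 3 * c + u ^ 4 * (105 * A ^ 4)" for u
    by (simp add: a_def b_def c_def power_numeral_reduce algebra_simps)
  have 41: "28 * E 2 6 + 70 * E 4 4 + 28 * E 6 2 = 28 * a + 70 * b + 28 * c"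
    using e4[of 1] id[of 1] unfolding p' by simp
  have 42: "112 * E 2 6 + 1120 * E 4 4 + 1792 * E 6 2 = 112 * a + 1120 * b + 1792 * c"
    using e4[of 2] id[of 4] unfolding p' by simp
  have 43: "252 * E 2 6 + 5670 * E 4 4 + 20412 * E 6 2 = 252 * a + 5670 * b + 20412 * c"
    using e4[of 3] id[of 9] unfolding p' by simp
  have "E 4 4 = b" using 41 42 43 by linarith
  then show "E 4 4 = 9 * A ^ 2 * B ^ 2 + 72 * A * B * r ^ 2 + 24 * r ^ 4" by (simp add: b_def)
qed

text \<open>The reproducing kernel of the fourth Wiener chaos. It expresses Hermite orthogonality
  for all h and k at once, without an orthonormal basis.\<close>

lemma herm4_kernel:
  "(\<integral>g. herm 4 (dot d h g) (nsq d h) * herm 4 (dot d k g) (nsq d k) \<partial>gam d) = 24 * dot d h k ^ 4"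
proof -
  interpret prob_space "gam d" by (rule prob_gam)
  define m where "m a b = (\<lambda>g. dot d h g ^ a * dot d k g ^ b)" for a b
  let ?A = "nsq d h" and ?B = "nsq d k"
  have [simp]: "integrable (gam d) (m a b)" for a b
    unfolding m_def by (rule gam_dot_powers_integrable)
  note E = gam_mixed_moments[where d=d and h=h and k=k, folded m_def]
  have "(\<integral>g. herm 4 (dot d h g) ?A * herm 4 (dot d k g) ?B \<partial>gam d)
    = (\<integral>g. m 4 4 g - (6 * ?B) * m 4 2 g + (3 * ?B ^ 2) * m 4 0 g - (6 * ?A) * m 2 4 g + (36 * ?A * ?B) * m 2 2 g
        - (18 * ?A * ?B ^ 2) * m 2 0 g + (3 * ?A ^ 2) * m 0 4 g - (18 * ?A ^ 2 * ?B) * m 0 2 g + 9 * ?A ^ 2 * ?B ^ 2 \<partial>gam d)"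
    by (intro Bochner_Integration.integral_cong refl) (simp add: m_def herm_numeral algebra_simps)
  also have "\<dots> = 24 * dot d h k ^ 4"
    by (simp add: E prob_space[simplified]) (simp add: power_numeral_reduce algebra_simps)
  finally show ?thesis .
qed

definition pair_delta :: "nat list \<Rightarrow> real" where
  "pair_delta js = (if js ! 0 = js ! 1 then 1 else 0)"

text \<open>A coefficient tensor of the fourth Hermite polynomial that is deliberately not
  symmetrised: the six single traces are all placed on the first two indices and the three double
  traces on one pairing. Contraction with a symmetric tensor does not see the difference.\<close>

definition herm4_coeff :: "nat list \<Rightarrow> (nat \<Rightarrow> real) \<Rightarrow> real" where
  "herm4_coeff is g = (\<Prod>i\<leftarrow>is. g i) - 6 * pair_delta (take 2 is) * (\<Prod>i\<leftarrow>drop 2 is. g i)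
     + 3 * pair_delta (take 2 is) * pair_delta (drop 2 is)"

lemma monomial_split: "(\<Prod>i\<leftarrow>is. h i) = (\<Prod>i\<leftarrow>take k is. h i) * (\<Prod>i\<leftarrow>drop k is. h i :: real)"
  by (metis append_take_drop_id map_append prod_list.append)

lemma nsq_eq_pair_delta: "nsq d h = (\<Sum>is\<in>multi_idx d 2. pair_delta is * (\<Prod>i\<leftarrow>is. h i))"
  by (simp add: numeral_2_eq_2 sum_multi_idx_Suc pair_delta_def dot_def if_distrib[of "\<lambda>x. x * _"] sum.delta' cong: if_cong)

lemma herm4_expand:
  "herm 4 (dot d h g) (nsq d h) = (\<Sum>is\<in>multi_idx d 4. (\<Prod>i\<leftarrow>is. h i) * herm4_coeff is g)"
proof -
  have split: "(\<Sum>is\<in>multi_idx d 2. \<Sum>js\<in>multi_idx d 2. a is * (\<Prod>i\<leftarrow>is. h i) * (b js * (\<Prod>i\<leftarrow>js. h i)))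
     = (\<Sum>is\<in>multi_idx d 4. (\<Prod>i\<leftarrow>is. h i) * (a (take 2 is) * b (drop 2 is)))" for a b :: "nat list \<Rightarrow> real"
  proof -
    have "(\<Sum>is\<in>multi_idx d 2. \<Sum>js\<in>multi_idx d 2. a is * (\<Prod>i\<leftarrow>is. h i) * (b js * (\<Prod>i\<leftarrow>js. h i)))
      = (\<Sum>is\<in>multi_idx d 4. a (take 2 is) * (\<Prod>i\<leftarrow>take 2 is. h i) * (b (drop 2 is) * (\<Prod>i\<leftarrow>drop 2 is. h i)))"
      using sum_multi_idx_add[where F="\<lambda>is js. a is * (\<Prod>i\<leftarrow>is. h i) * (b js * (\<Prod>i\<leftarrow>js. h i))" and p=2 and q=2 and d=d]
      by simp
    also have "\<dots> = (\<Sum>is\<in>multi_idx d 4. (\<Prod>i\<leftarrow>is. h i) * (a (take 2 is) * b (drop 2 is)))"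
    proof (intro sum.cong refl)
      fix "is" :: "nat list"
      show "a (take 2 is) * (\<Prod>i\<leftarrow>take 2 is. h i) * (b (drop 2 is) * (\<Prod>i\<leftarrow>drop 2 is. h i))
        = (\<Prod>i\<leftarrow>is. h i) * (a (take 2 is) * b (drop 2 is))"
        by (simp add: monomial_split[of h "is" 2] mult_ac)
    qed
    finally show ?thesis .
  qed
  have 1: "nsq d h * dot d h g ^ 2 = (\<Sum>is\<in>multi_idx d 4. (\<Prod>i\<leftarrow>is. h i) * (pair_delta (take 2 is) * (\<Prod>i\<leftarrow>drop 2 is. g i)))"
    using split[of pair_delta "\<lambda>js. \<Prod>i\<leftarrow>js. g i"] unfolding nsq_eq_pair_delta dot_power sum_product
    by (simp only: mult.commute[of "\<Prod>i\<leftarrow>_. h i" "\<Prod>i\<leftarrow>_. g i"])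
  have 2: "(nsq d h)\<^sup>2 = (\<Sum>is\<in>multi_idx d 4. (\<Prod>i\<leftarrow>is. h i) * (pair_delta (take 2 is) * pair_delta (drop 2 is)))"
    using split[of pair_delta pair_delta] unfolding power2_eq_square nsq_eq_pair_delta sum_product .
  have "herm 4 (dot d h g) (nsq d h) = dot d h g ^ 4 - 6 * (nsq d h * dot d h g ^ 2) + 3 * (nsq d h)\<^sup>2"
    by (simp add: herm_numeral)
  also have "\<dots> = (\<Sum>is\<in>multi_idx d 4. (\<Prod>i\<leftarrow>is. h i) * herm4_coeff is g)"
    unfolding 1 2 dot_power[of d h g 4] herm4_coeff_def
    by (simp add: sum_distrib_left sum.distrib sum_subtractf algebra_simps)
  finally show ?thesis .
qed

lemma herm4_coeff_integrable:
  assumes "is \<in> multi_idx d 4" "js \<in> multi_idx d 4"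
  shows "integrable (gam d) (herm4_coeff is)" "integrable (gam d) (\<lambda>g. herm4_coeff is g * herm4_coeff js g)"
proof -
  interpret prob_space "gam d" by (rule prob_gam)
  have d2: "drop 2 is \<in> multi_idx d 2" "drop 2 js \<in> multi_idx d 2"
    using assms by (auto simp: multi_idx_def dest: in_set_dropD)
  have m: "integrable (gam d) (\<lambda>g. (\<Prod>i\<leftarrow>xs. g i) * (\<Prod>i\<leftarrow>ys. g i))" if "xs \<in> multi_idx d k" "ys \<in> multi_idx d l" for xs ys k l
    using gam_monomial_integrable[of "xs @ ys" d "k + l"] that by (simp add: multi_idx_def)
  show "integrable (gam d) (herm4_coeff is)"
    unfolding herm4_coeff_def[abs_def] using gam_monomial_integrable[OF assms(1)] gam_monomial_integrable[OF d2(1)]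
    by simp
  let ?p = "\<lambda>xs g. \<Prod>i\<leftarrow>xs. g i :: real"
  define a b a' b' where "a = 6 * pair_delta (take 2 is)" and "b = 3 * pair_delta (take 2 is) * pair_delta (drop 2 is)"
    and "a' = 6 * pair_delta (take 2 js)" and "b' = 3 * pair_delta (take 2 js) * pair_delta (drop 2 js)"
  have "herm4_coeff is g * herm4_coeff js g = ?p is g * ?p js g - a' * (?p is g * ?p (drop 2 js) g) + b' * ?p is g
     - a * (?p (drop 2 is) g * ?p js g) + (a * a') * (?p (drop 2 is) g * ?p (drop 2 js) g) - (a * b') * ?p (drop 2 is) g
     + b * ?p js g - (b * a') * ?p (drop 2 js) g + b * b'" for g
    unfolding herm4_coeff_def a_def[symmetric] b_def[symmetric] a'_def[symmetric] b'_def[symmetric]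
    by (simp add: algebra_simps)
  then show "integrable (gam d) (\<lambda>g. herm4_coeff is g * herm4_coeff js g)"
    using m[OF assms] m[OF assms(1) d2(2)] m[OF d2(1) assms(2)] m[OF d2] gam_monomial_integrable[OF assms(1)]
      gam_monomial_integrable[OF assms(2)] gam_monomial_integrable[OF d2(1)] gam_monomial_integrable[OF d2(2)]
    by simp
qed

definition moment_gap :: "(nat \<Rightarrow> real) measure \<Rightarrow> (nat \<Rightarrow> real) measure \<Rightarrow> nat list \<Rightarrow> real" where
  "moment_gap \<mu> \<nu> is = (\<integral>x. (\<Prod>i\<leftarrow>is. x i) \<partial>\<mu>) - (\<integral>x. (\<Prod>i\<leftarrow>is. x i) \<partial>\<nu>)"

lemma integral_hom_poly:
  assumes "sixth_moments d \<mu>" "k \<le> 6"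
  shows "(\<integral>h. (\<Sum>is\<in>multi_idx d k. (\<Prod>i\<leftarrow>is. h i) * c is) \<partial>\<mu>) = (\<Sum>is\<in>multi_idx d k. (\<integral>x. (\<Prod>i\<leftarrow>is. x i) \<partial>\<mu>) * c is)"
  using monomial_integrable[OF assms(1) _ assms(2)]
  by (subst Bochner_Integration.integral_sum) auto

text \<open>Moment tensors are symmetric, so a contraction with their difference depends only on the
  polynomial that a tensor represents. Integrating that polynomial under both laws proves it without
  any symmetrisation.\<close>

lemma moment_gap_linear:
  assumes \<mu>: "sixth_moments d \<mu>" and \<nu>: "sixth_moments d \<nu>" and k: "k \<le> 6"
    and eq: "\<And>h. (\<Sum>is\<in>multi_idx d k. (\<Prod>i\<leftarrow>is. h i) * a is) = (\<Sum>is\<in>multi_idx d k. (\<Prod>i\<leftarrow>is. h i) * b is)"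
  shows "(\<Sum>is\<in>multi_idx d k. moment_gap \<mu> \<nu> is * a is) = (\<Sum>is\<in>multi_idx d k. moment_gap \<mu> \<nu> is * b is)"
proof -
  have "(\<Sum>is\<in>multi_idx d k. moment_gap \<mu> \<nu> is * c is)
    = (\<integral>h. (\<Sum>is\<in>multi_idx d k. (\<Prod>i\<leftarrow>is. h i) * c is) \<partial>\<mu>) - (\<integral>h. (\<Sum>is\<in>multi_idx d k. (\<Prod>i\<leftarrow>is. h i) * c is) \<partial>\<nu>)" for c
    unfolding integral_hom_poly[OF \<mu> k] integral_hom_poly[OF \<nu> k]
    by (simp add: moment_gap_def left_diff_distrib sum_subtractf)
  then show ?thesis by (simp add: eq)
qed

text \<open>The kernel identity is polynomial in h and in k. It is contracted with the moment gap
  first in one variable and then in the other, which leaves 4! times the squared norm of the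
  gap.\<close>

lemma moment_gap_kernel:
  assumes \<mu>: "sixth_moments d \<mu>" and \<nu>: "sixth_moments d \<nu>"
  shows "(\<integral>g. (\<Sum>is\<in>multi_idx d 4. moment_gap \<mu> \<nu> is * herm4_coeff is g)\<^sup>2 \<partial>gam d) = 24 * (\<Sum>is\<in>multi_idx d 4. (moment_gap \<mu> \<nu> is)\<^sup>2)"
proof -
  let ?I = "multi_idx d 4" and ?D = "moment_gap \<mu> \<nu>"
  define K where "K is js = (\<integral>g. herm4_coeff is g * herm4_coeff js g \<partial>gam d)" for "is" js
  have int: "(\<integral>g. (\<Sum>is\<in>?I. a is * herm4_coeff is g) * (\<Sum>js\<in>?I. b js * herm4_coeff js g) \<partial>gam d) = (\<Sum>is\<in>?I. a is * (\<Sum>js\<in>?I. b js * K is js))" for a b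
  proof -
    have "(\<integral>g. (\<Sum>is\<in>?I. a is * herm4_coeff is g) * (\<Sum>js\<in>?I. b js * herm4_coeff js g) \<partial>gam d)
       = (\<integral>g. (\<Sum>is\<in>?I. \<Sum>js\<in>?I. (a is * b js) * (herm4_coeff is g * herm4_coeff js g)) \<partial>gam d)"
      by (simp add: sum_product mult_ac)
    also have "\<dots> = (\<Sum>is\<in>?I. \<Sum>js\<in>?I. (a is * b js) * K is js)"
      unfolding K_def using herm4_coeff_integrable(2)
      by (subst Bochner_Integration.integral_sum, force intro!: Bochner_Integration.integrable_sum)
         (intro sum.cong refl, subst Bochner_Integration.integral_sum, auto)
    finally show ?thesis by (simp add: sum_distrib_left mult_ac)
  qed
  have "(\<Sum>is\<in>?I. (\<Prod>i\<leftarrow>is. h i) * (\<Sum>js\<in>?I. (\<Prod>j\<leftarrow>js. k j) * K is js)) = (\<Sum>is\<in>?I. (\<Prod>i\<leftarrow>is. h i) * (24 * (\<Prod>i\<leftarrow>is. k i)))" for h k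
    using herm4_kernel[of d h k] unfolding herm4_expand int dot_power by (simp add: sum_distrib_left mult_ac)
  from moment_gap_linear[OF \<mu> \<nu> _ this]
  have "(\<Sum>is\<in>?I. ?D is * (\<Sum>js\<in>?I. (\<Prod>j\<leftarrow>js. k j) * K is js)) = (\<Sum>is\<in>?I. ?D is * (24 * (\<Prod>i\<leftarrow>is. k i)))" for k by simp
  then have "(\<Sum>js\<in>?I. (\<Prod>j\<leftarrow>js. k j) * (\<Sum>is\<in>?I. ?D is * K is js)) = (\<Sum>is\<in>?I. (\<Prod>i\<leftarrow>is. k i) * (24 * ?D is))" for k
    by (subst (asm) sum_distrib_left, subst (asm) sum.swap) (simp add: sum_distrib_left mult_ac)
  from moment_gap_linear[OF \<mu> \<nu> _ this]
  have "(\<Sum>js\<in>?I. ?D js * (\<Sum>is\<in>?I. ?D is * K is js)) = (\<Sum>is\<in>?I. ?D is * (24 * ?D is))" by simp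
  moreover have "K is js = K js is" for "is" js by (simp add: K_def mult.commute)
  ultimately show ?thesis
    unfolding power2_eq_square int by (simp add: sum_distrib_left mult_ac)
qed

text \<open>The difference is the Gaussian expectation of e times an element F of the fourth chaos.
  As e is bounded by M, Cauchy-Schwarz leaves the L2 norm of F, which is sqrt (4!) times the
  Frobenius norm; after the Taylor factor 1 / 4! this becomes 1 / sqrt (4!).\<close>

lemma hermite_coeff_4_gap:
  assumes e: "test_fun d M e" and s: "0 < s" and \<mu>: "sixth_moments d \<mu>" and \<nu>: "sixth_moments d \<nu>"
  shows "\<bar>(\<integral>h. hermite_coeff d e s x 4 h \<partial>\<mu>) - (\<integral>h. hermite_coeff d e s x 4 h \<partial>\<nu>)\<bar>
    \<le> M * sqrt 24 / s ^ 4 * sqrt (\<Sum>is\<in>multi_idx d 4. (moment_gap \<mu> \<nu> is)\<^sup>2)"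
proof -
  let ?I = "multi_idx d 4" and ?D = "moment_gap \<mu> \<nu>"
  have M: "0 \<le> M" using test_fun_bound_nonneg[OF e] .
  define c where "c is = (\<integral>g. e (x + scale s g) * herm4_coeff is g \<partial>gam d)" for "is"
  have q: "hermite_coeff d e s x 4 h = (\<Sum>is\<in>?I. (\<Prod>i\<leftarrow>is. h i) * (c is / s ^ 4))" for h
  proof -
    have "herm 4 (dot d h g / s) (nsq d h / s\<^sup>2) = herm 4 (dot d h g) (nsq d h) / s ^ 4" for g
      by (simp add: herm_numeral power_divide diff_divide_distrib add_divide_distrib flip: power_mult power_add)
    then have "hermite_coeff d e s x 4 h = (\<integral>g. (\<Sum>is\<in>?I. ((\<Prod>i\<leftarrow>is. h i) / s ^ 4) * (e (x + scale s g) * herm4_coeff is g)) \<partial>gam d)"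
      unfolding hermite_coeff_def herm4_expand
      by (intro Bochner_Integration.integral_cong refl) (simp add: sum_distrib_left sum_divide_distrib mult_ac)
    also have "\<dots> = (\<Sum>is\<in>?I. ((\<Prod>i\<leftarrow>is. h i) / s ^ 4) * c is)"
      unfolding c_def
      by (subst Bochner_Integration.integral_sum)
         (auto intro!: integrable_mult_right test_fun_mult_integrable[OF e] herm4_coeff_integrable)
    finally show ?thesis by simp
  qed
  have "(\<integral>h. hermite_coeff d e s x 4 h \<partial>\<mu>) - (\<integral>h. hermite_coeff d e s x 4 h \<partial>\<nu>) = (\<Sum>is\<in>?I. ?D is * (c is / s ^ 4))"
    unfolding q integral_hom_poly[OF \<mu>, of 4, simplified] integral_hom_poly[OF \<nu>, of 4, simplified]
    by (simp add: moment_gap_def left_diff_distrib sum_subtractf diff_divide_distrib)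
  also have "\<dots> = (\<integral>g. (\<Sum>is\<in>?I. ?D is * (e (x + scale s g) * herm4_coeff is g)) \<partial>gam d) / s ^ 4"
    unfolding c_def
    by (subst Bochner_Integration.integral_sum)
       (auto intro!: integrable_mult_right test_fun_mult_integrable[OF e] herm4_coeff_integrable simp: sum_divide_distrib)
  also have "\<dots> = (\<integral>g. e (x + scale s g) * (\<Sum>is\<in>?I. ?D is * herm4_coeff is g) \<partial>gam d) / s ^ 4"
    by (simp add: sum_distrib_left mult_ac)
  finally have eq: "(\<integral>h. hermite_coeff d e s x 4 h \<partial>\<mu>) - (\<integral>h. hermite_coeff d e s x 4 h \<partial>\<nu>) = \<dots>" .
  define F where "F g = (\<Sum>is\<in>?I. ?D is * herm4_coeff is g)" for g
  have iF: "integrable (gam d) F"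
    unfolding F_def by (intro Bochner_Integration.integrable_sum integrable_mult_right herm4_coeff_integrable)
  have iF2: "integrable (gam d) (\<lambda>g. (F g)\<^sup>2)"
  proof -
    have "(F g)\<^sup>2 = (\<Sum>is\<in>?I. \<Sum>js\<in>?I. (?D is * ?D js) * (herm4_coeff is g * herm4_coeff js g))" for g
      by (simp add: F_def power2_eq_square sum_product mult_ac)
    then show ?thesis
      using herm4_coeff_integrable(2)
      by (auto intro!: Bochner_Integration.integrable_sum)
  qed
  have "\<bar>\<integral>g. e (x + scale s g) * F g \<partial>gam d\<bar> \<le> (\<integral>g. M * \<bar>F g\<bar> \<partial>gam d)"
    by (intro order_trans[OF integral_abs_bound] integral_mono integrable_abs integrable_mult_right
          test_fun_mult_integrable[OF e iF] iF)
       (auto simp: abs_mult intro!: mult_right_mono test_funD[OF e])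
  also have "\<dots> \<le> M * sqrt (\<integral>g. (F g)\<^sup>2 \<partial>gam d)"
    using prob_abs_le_sqrt(2)[OF prob_gam iF2] iF M by (auto intro!: mult_left_mono)
  also have "(\<integral>g. (F g)\<^sup>2 \<partial>gam d) = 24 * (\<Sum>is\<in>?I. (?D is)\<^sup>2)"
    unfolding F_def by (rule moment_gap_kernel[OF \<mu> \<nu>])
  finally have "\<bar>\<integral>g. e (x + scale s g) * F g \<partial>gam d\<bar> \<le> M * (sqrt 24 * sqrt (\<Sum>is\<in>?I. (?D is)\<^sup>2))"
    by (simp only: real_sqrt_mult)
  then have "\<bar>\<integral>g. e (x + scale s g) * F g \<partial>gam d\<bar> / s ^ 4 \<le> M * (sqrt 24 * sqrt (\<Sum>is\<in>?I. (?D is)\<^sup>2)) / s ^ 4"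
    using s by (intro divide_right_mono) auto
  moreover have "\<bar>s ^ 4\<bar> = s ^ 4" by simp
  ultimately show ?thesis
    unfolding eq F_def[symmetric] abs_divide by (simp only: mult.assoc times_divide_eq_left)
qed

text \<open>With an independent copy \<open>x'\<close> of \<open>x\<close>, the squared norm of the moment tensor is \<open>E (x \<bullet> x')\<^sup>4\<close>.\<close>

lemma moment_tensor_le:
  assumes \<mu>: "sixth_moments d \<mu>"
  shows "sqrt (\<Sum>is\<in>multi_idx d 4. (\<integral>x. (\<Prod>i\<leftarrow>is. x i) \<partial>\<mu>)\<^sup>2) \<le> (\<integral>x. (nsq d x)\<^sup>2 \<partial>\<mu>)"
proof -
  let ?I = "multi_idx d 4" and ?m = "\<lambda>is. \<integral>x. (\<Prod>i\<leftarrow>is. x i) \<partial>\<mu>"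
  define N where "N = (\<integral>x. (nsq d x)\<^sup>2 \<partial>\<mu>)"
  have iN: "integrable \<mu> (\<lambda>x. (nsq d x)\<^sup>2)"
    using hom_poly_integrable[OF \<mu> hom_poly_power[OF hom_poly_nsq, of d 2]] by simp
  have N0: "0 \<le> N" unfolding N_def by simp
  have inner: "(\<Sum>is\<in>?I. ?m is * (\<Prod>i\<leftarrow>is. y i)) \<le> N * (nsq d y)\<^sup>2" for y
  proof -
    have "(\<Sum>is\<in>?I. ?m is * (\<Prod>i\<leftarrow>is. y i)) = (\<integral>x. dot d x y ^ 4 \<partial>\<mu>)"
      unfolding dot_power by (rule integral_hom_poly[OF \<mu>, symmetric]) simp
    also have "\<dots> \<le> (\<integral>x. (nsq d x)\<^sup>2 * (nsq d y)\<^sup>2 \<partial>\<mu>)"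
    proof (rule integral_mono)
      show "integrable \<mu> (\<lambda>x. dot d x y ^ 4)"
        using hom_poly_integrable[OF \<mu> hom_poly_power[OF hom_poly_dot[of d y], of 4]] by (simp add: dot_commute[of d _ y])
      show "integrable \<mu> (\<lambda>x. (nsq d x)\<^sup>2 * (nsq d y)\<^sup>2)" using iN by simp
      fix x
      have "\<bar>dot d x y\<bar> ^ 4 \<le> (enorm d x * enorm d y) ^ 4"
        by (intro power_mono dot_eq_enorm_bound) auto
      also have "\<dots> = (nsq d x)\<^sup>2 * (nsq d y)\<^sup>2"
        by (simp add: power_mult_distrib enorm_sq[symmetric] flip: power_mult)
      finally show "dot d x y ^ 4 \<le> (nsq d x)\<^sup>2 * (nsq d y)\<^sup>2" by (simp add: power_even_abs)
    qed
    finally show ?thesis by (simp add: N_def)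
  qed
  have "(\<Sum>is\<in>?I. (?m is)\<^sup>2) = (\<integral>y. (\<Sum>is\<in>?I. (\<Prod>i\<leftarrow>is. y i) * ?m is) \<partial>\<mu>)"
    by (subst integral_hom_poly[OF \<mu>]) (simp_all add: power2_eq_square)
  also have "\<dots> \<le> (\<integral>y. N * (nsq d y)\<^sup>2 \<partial>\<mu>)"
    using inner iN monomial_integrable[OF \<mu>, of _ 4]
    by (intro integral_mono) (auto simp: mult.commute intro!: Bochner_Integration.integrable_sum)
  also have "\<dots> = N ^ 2" by (simp add: N_def power2_eq_square)
  finally show ?thesis unfolding N_def[symmetric] using N0 by (intro real_le_lsqrt) (auto intro: sum_nonneg)
qed

text \<open>Crude control of the Frobenius norm by moments, for the places where the gap carries an
  additional factor 1 / n.\<close>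

lemma moment_gap_norm_le:
  assumes "sixth_moments d \<mu>" "sixth_moments d \<nu>"
  shows "sqrt (\<Sum>is\<in>multi_idx d 4. (moment_gap \<mu> \<nu> is)\<^sup>2) \<le> (\<integral>x. (nsq d x)\<^sup>2 \<partial>\<mu>) + (\<integral>x. (nsq d x)\<^sup>2 \<partial>\<nu>)"
proof -
  let ?m = "\<lambda>\<mu> is. \<integral>x. (\<Prod>i\<leftarrow>is. x i) \<partial>\<mu>"
  have "L2_set (moment_gap \<mu> \<nu>) (multi_idx d 4) = L2_set (\<lambda>is. ?m \<mu> is + - ?m \<nu> is) (multi_idx d 4)"
    by (simp add: moment_gap_def[abs_def])
  also have "\<dots> \<le> L2_set (?m \<mu>) (multi_idx d 4) + L2_set (\<lambda>is. - ?m \<nu> is) (multi_idx d 4)"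
    by (rule L2_set_triangle_ineq)
  finally show ?thesis
    using moment_tensor_le[OF assms(1)] moment_tensor_le[OF assms(2)] by (simp add: L2_set_def)
qed

section \<open>Characteristic functions and Gaussian vectors\<close>

lemma gam_cos_sin:
  "(\<integral>g. cos (dot d u g) \<partial>gam d) = exp (- nsq d u / 2)" "(\<integral>g. sin (dot d u g) \<partial>gam d) = 0"
proof -
  interpret prob_space "gam d" by (rule prob_gam)
  have i: "integrable (gam d) (\<lambda>g. iexp (dot d u g))"
    by (rule integrable_iexp) auto
  have "(\<integral>g. Re (iexp (dot d u g)) \<partial>gam d) = exp (- nsq d u / 2)"
    using integral_Re[OF i] gam_char[of d u] by simp
  then show "(\<integral>g. cos (dot d u g) \<partial>gam d) = exp (- nsq d u / 2)" by (simp add: Re_exp)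
  have "(\<integral>g. Im (iexp (dot d u g)) \<partial>gam d) = 0"
    using integral_Im[OF i] gam_char[of d u] by simp
  then show "(\<integral>g. sin (dot d u g) \<partial>gam d) = 0" by (simp add: Im_exp)
qed

text \<open>Equality of the characteristic functions in the first d coordinates, with real and
  imaginary part separated so that all integrals stay real.\<close>

definition same_cf :: "nat \<Rightarrow> (nat \<Rightarrow> real) measure \<Rightarrow> (nat \<Rightarrow> real) measure \<Rightarrow> bool" where
  "same_cf d \<mu> \<nu> \<longleftrightarrow> (\<forall>u. (\<integral>x. cos (dot d u x) \<partial>\<mu>) = (\<integral>x. cos (dot d u x) \<partial>\<nu>) \<and>
     (\<integral>x. sin (dot d u x) \<partial>\<mu>) = (\<integral>x. sin (dot d u x) \<partial>\<nu>))"

lemma pair_prob_space_gam: "law \<mu> \<Longrightarrow> pair_prob_space \<mu> (gam d)"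
  by (intro pair_prob_space.intro pair_sigma_finite.intro prob_space_imp_sigma_finite law_prob law_gam)

text \<open>A Gaussian density is the average of \<open>cos\<close> over a Gaussian vector, so integrating it needs only the characteristic function.\<close>

lemma integral_gauss_density:
  assumes \<mu>: "law \<mu>"
  shows "(\<integral>y. exp (- nsq d (a + scale s y) / 2) \<partial>\<mu>) =
    (\<integral>g. cos (dot d a g) * (\<integral>y. cos (dot d (scale s g) y) \<partial>\<mu>) - sin (dot d a g) * (\<integral>y. sin (dot d (scale s g) y) \<partial>\<mu>) \<partial>gam d)"
proof -
  interpret A: prob_space \<mu> by (rule law_prob[OF \<mu>])
  interpret pair_prob_space \<mu> "gam d" by (rule pair_prob_space_gam[OF \<mu>])
  note [measurable_cong] = law_sets[OF \<mu>]
  have "integrable (\<mu> \<Otimes>\<^sub>M gam d) (\<lambda>p. cos (dot d (a + scale s (fst p)) (snd p)))"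
    by (rule P.integrable_const_bound[where B=1]) auto
  then have i: "integrable (\<mu> \<Otimes>\<^sub>M gam d) (\<lambda>(y, g). cos (dot d (a + scale s y) g))" by (simp add: split_beta')
  have "(\<integral>y. exp (- nsq d (a + scale s y) / 2) \<partial>\<mu>) = (\<integral>y. \<integral>g. cos (dot d (a + scale s y) g) \<partial>gam d \<partial>\<mu>)"
    by (simp only: gam_cos_sin)
  also have "\<dots> = (\<integral>g. \<integral>y. cos (dot d (a + scale s y) g) \<partial>\<mu> \<partial>gam d)"
    using Fubini_integral[OF i] by simp
  also have "\<dots> = (\<integral>g. cos (dot d a g) * (\<integral>y. cos (dot d (scale s g) y) \<partial>\<mu>) - sin (dot d a g) * (\<integral>y. sin (dot d (scale s g) y) \<partial>\<mu>) \<partial>gam d)"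
  proof (intro Bochner_Integration.integral_cong refl)
    fix g
    have i: "integrable \<mu> (\<lambda>y. cos (dot d (scale s g) y))" "integrable \<mu> (\<lambda>y. sin (dot d (scale s g) y))"
      by (rule A.integrable_const_bound[where B=1]; auto)+
    have "cos (dot d (a + scale s y) g) = cos (dot d a g) * cos (dot d (scale s g) y) - sin (dot d a g) * sin (dot d (scale s g) y)" for y
      by (simp only: dot_add dot_scale cos_add dot_commute[of d y g])
    then have "(\<integral>y. cos (dot d (a + scale s y) g) \<partial>\<mu>) = (\<integral>y. cos (dot d a g) * cos (dot d (scale s g) y) - sin (dot d a g) * sin (dot d (scale s g) y) \<partial>\<mu>)"
      by (simp only:)
    also have "\<dots> = cos (dot d a g) * (\<integral>y. cos (dot d (scale s g) y) \<partial>\<mu>) - sin (dot d a g) * (\<integral>y. sin (dot d (scale s g) y) \<partial>\<mu>)"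
      using i by (subst Bochner_Integration.integral_diff) auto
    finally show "(\<integral>y. cos (dot d (a + scale s y) g) \<partial>\<mu>) = \<dots>" .
  qed
  finally show ?thesis .
qed

lemma same_cf_gauss_density:
  assumes "law \<mu>" "law \<nu>" "same_cf d \<mu> \<nu>"
  shows "(\<integral>y. exp (- nsq d (a + scale s y) / 2) \<partial>\<mu>) = (\<integral>y. exp (- nsq d (a + scale s y) / 2) \<partial>\<nu>)"
  using assms by (simp only: integral_gauss_density same_cf_def)

text \<open>By Cameron-Martin the smoothed f at y is a Gaussian average with weight
  \<open>W y g\<close>. Completing the square gives exp (|g|^2 / 2) times exp (- |g - y / s|^2 / 2),
  and the y-integral of the second factor is determined by the characteristic function. Nonnegative
  integrals are used because the first factor is unbounded.\<close>

lemma smoothed_integral: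
  assumes \<mu>: "law \<mu>" and f: "test_fun d M f" and f0: "\<And>x. 0 \<le> f x" and s: "0 < s"
  shows "ennreal (\<integral>y. avg (gauss d s) f y \<partial>\<mu>) =
    (\<integral>\<^sup>+g. ennreal (f (scale s g) * exp (nsq d g / 2) * (\<integral>y. exp (- nsq d (g + scale (-1 / s) y) / 2) \<partial>\<mu>)) \<partial>gam d)"
proof -
  interpret A: prob_space \<mu> by (rule law_prob[OF \<mu>])
  interpret pair_prob_space \<mu> "gam d" by (rule pair_prob_space_gam[OF \<mu>])
  note [measurable_cong] = law_sets[OF \<mu>]
  note [measurable] = test_funD(1)[OF f]
  define W where "W y g = exp (dot d (scale (1 / s) y) g - nsq d (scale (1 / s) y) / 2)" for y g
  have W: "W y g = exp (nsq d g / 2) * exp (- nsq d (g + scale (-1 / s) y) / 2)" for y g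
    by (simp only: W_def exp_add[symmetric] dot_add dot_scale dot_commute[of d g y])
       (use s in \<open>simp add: field_simps\<close>)
  have mW [measurable]: "(\<lambda>p. W (fst p) (snd p)) \<in> borel_measurable (\<mu> \<Otimes>\<^sub>M gam d)"
    unfolding W_def by measurable
  have [measurable]: "W y \<in> borel_measurable borel" for y
    unfolding W_def by measurable
  have [simp]: "0 \<le> W y g" for y g by (simp add: W_def)
  have i1: "integrable \<mu> (avg (gauss d s) f)"
    by (rule test_fun_integrable[OF test_fun_avg[OF f law_gauss] law_prob[OF \<mu>]]) simp
  have n1: "0 \<le> avg (gauss d s) f y" for y unfolding avg_def by (simp add: f0)
  have cm: "ennreal (avg (gauss d s) f y) = (\<integral>\<^sup>+g. ennreal (f (scale s g) * W y g) \<partial>gam d)" for y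
  proof -
    have "f (y + scale s g) = f (scale s (g + trunc d (scale (1 / s) y)))" for g
    proof -
      have "trunc d (scale s (g + trunc d (scale (1 / s) y))) = trunc d (y + scale s g)"
        using s by (simp only: trunc_add scale_add trunc_scale scale_scale trunc_trunc) (simp add: add.commute)
      then show ?thesis using test_funD(2)[OF f] by metis
    qed
    then have "ennreal (avg (gauss d s) f y) = ennreal (\<integral>g. f (scale s (g + trunc d (scale (1 / s) y))) \<partial>gam d)"
      unfolding avg_gauss[OF f] by (simp only:)
    also have "\<dots> = (\<integral>\<^sup>+g. ennreal (f (scale s (g + trunc d (scale (1 / s) y)))) \<partial>gam d)"
      by (rule nn_integral_eq_integral[symmetric], rule test_fun_integrable[OF f prob_gam])
         (auto simp: f0)
    also have "\<dots> = (\<integral>\<^sup>+g. ennreal (f (scale s g) * W y g) \<partial>gam d)"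
      using gam_cameron_martin_integral(2)[of "\<lambda>g. f (scale s g)" d "scale (1 / s) y"]
      by (simp add: W_def ennreal_mult f0 mult.commute)
    finally show ?thesis .
  qed
  have "ennreal (\<integral>y. avg (gauss d s) f y \<partial>\<mu>) = (\<integral>\<^sup>+y. ennreal (avg (gauss d s) f y) \<partial>\<mu>)"
    by (rule nn_integral_eq_integral[symmetric, OF i1]) (simp add: n1)
  also have "\<dots> = (\<integral>\<^sup>+y. \<integral>\<^sup>+g. ennreal (f (scale s g) * W y g) \<partial>gam d \<partial>\<mu>)"
    by (simp only: cm)
  also have "\<dots> = (\<integral>\<^sup>+g. \<integral>\<^sup>+y. ennreal (f (scale s g) * W y g) \<partial>\<mu> \<partial>gam d)"
    by (rule Fubini'[symmetric]) measurable
  also have "\<dots> = (\<integral>\<^sup>+g. ennreal (f (scale s g) * exp (nsq d g / 2) * (\<integral>y. exp (- nsq d (g + scale (-1 / s) y) / 2) \<partial>\<mu>)) \<partial>gam d)"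
  proof (intro nn_integral_cong)
    fix g
    have "integrable \<mu> (\<lambda>y. exp (- nsq d (g + scale (-1 / s) y) / 2))"
      by (rule A.integrable_const_bound[where B=1]) auto
    then have i: "integrable \<mu> (\<lambda>y. f (scale s g) * W y g)" unfolding W by simp
    have "(\<integral>\<^sup>+y. ennreal (f (scale s g) * W y g) \<partial>\<mu>) = ennreal (\<integral>y. f (scale s g) * W y g \<partial>\<mu>)"
      by (rule nn_integral_eq_integral[OF i]) (simp add: f0)
    also have "(\<integral>y. f (scale s g) * W y g \<partial>\<mu>) = f (scale s g) * exp (nsq d g / 2) * (\<integral>y. exp (- nsq d (g + scale (-1 / s) y) / 2) \<partial>\<mu>)"
      unfolding W by (simp add: mult.assoc)
    finally show "(\<integral>\<^sup>+y. ennreal (f (scale s g) * W y g) \<partial>\<mu>) = ennreal \<dots>" .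
  qed
  finally show ?thesis .
qed

lemma same_cf_smoothed:
  assumes \<mu>: "law \<mu>" and \<nu>: "law \<nu>" and cf: "same_cf d \<mu> \<nu>"
    and f: "test_fun d M f" and f0: "\<And>x. 0 \<le> f x" and s: "0 < s"
  shows "(\<integral>y. avg (gauss d s) f y \<partial>\<mu>) = (\<integral>y. avg (gauss d s) f y \<partial>\<nu>)"
proof -
  have "ennreal (\<integral>y. avg (gauss d s) f y \<partial>\<mu>) = ennreal (\<integral>y. avg (gauss d s) f y \<partial>\<nu>)"
    unfolding smoothed_integral[OF \<mu> f f0 s] smoothed_integral[OF \<nu> f f0 s] same_cf_gauss_density[OF \<mu> \<nu> cf] ..
  moreover have "0 \<le> (\<integral>y. avg (gauss d s) f y \<partial>\<mu>)" "0 \<le> (\<integral>y. avg (gauss d s) f y \<partial>\<nu>)"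
    unfolding avg_def by (simp_all add: f0)
  ultimately show ?thesis by (simp add: ennreal_inj)
qed

text \<open>The smoothing is removed along the scales 1 / (n + 1) by dominated convergence.\<close>

lemma same_cf_continuous:
  assumes \<mu>: "law \<mu>" and \<nu>: "law \<nu>" and cf: "same_cf d \<mu> \<nu>"
    and f: "continuous_on UNIV f" and f0: "\<And>x. 0 \<le> f x" and f1: "\<And>x. f x \<le> (1::real)"
  shows "(\<integral>y. f (trunc d y) \<partial>\<mu>) = (\<integral>y. f (trunc d y) \<partial>\<nu>)"
proof -
  define F where "F x = f (trunc d x)" for x
  have [measurable]: "f \<in> borel_measurable borel" using f by (rule borel_measurable_continuous_onI)
  have F: "test_fun d 1 F" unfolding test_fun_def F_def using f0 f1 by (auto simp: abs_of_nonneg)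
  note [measurable] = test_funD(1)[OF F]
  define s where "s n = 1 / (real n + 1)" for n
  have s0: "0 < s n" for n by (simp add: s_def)
  have lim: "(\<lambda>n. F (y + scale (s n) g)) \<longlonglongrightarrow> F y" for y g
  proof -
    have "(\<lambda>r. trunc d (y + scale r g)) = (\<lambda>r i. if i < d then y i + r * g i else 0)"
      by (intro ext) (simp add: trunc_def)
    moreover have "continuous_on UNIV (\<lambda>r i. if i < d then y i + r * g i else 0)"
    proof (rule continuous_on_coordinatewise_then_product)
      fix i show "continuous_on UNIV (\<lambda>r. if i < d then y i + r * g i else 0)"
        by (cases "i < d") (auto intro!: continuous_intros)
    qed
    ultimately have "continuous_on UNIV (\<lambda>r. trunc d (y + scale r g))" by (simp only:)
    then have "continuous_on UNIV (\<lambda>r. f (trunc d (y + scale r g)))"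
      by (rule continuous_on_compose2[OF f]) auto
    then have "isCont (\<lambda>r. F (y + scale r g)) 0" by (simp add: F_def continuous_on_eq_continuous_at)
    moreover have "s \<longlonglongrightarrow> 0" unfolding s_def by real_asymp
    ultimately have "(\<lambda>n. F (y + scale (s n) g)) \<longlonglongrightarrow> F (y + scale 0 g)"
      by (rule isCont_tendsto_compose)
    moreover have "y + scale 0 g = y" by (rule ext) simp
    ultimately show ?thesis by simp
  qed
  have conv: "(\<lambda>n. \<integral>y. avg (gauss d (s n)) F y \<partial>\<rho>) \<longlonglongrightarrow> (\<integral>y. F y \<partial>\<rho>)" if \<rho>: "law \<rho>" for \<rho>
  proof -
    interpret R: prob_space \<rho> by (rule law_prob[OF \<rho>])
    interpret G: prob_space "gam d" by (rule prob_gam)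
    note [measurable_cong] = law_sets[OF \<rho>]
    have 1: "(\<lambda>n. avg (gauss d (s n)) F y) \<longlonglongrightarrow> F y" for y
    proof -
      have "(\<lambda>n. \<integral>g. F (y + scale (s n) g) \<partial>gam d) \<longlonglongrightarrow> (\<integral>g. F y \<partial>gam d)"
        by (rule integral_dominated_convergence[where w="\<lambda>_. 1"])
           (auto simp: lim intro!: AE_I2 test_funD(3)[OF F])
      then show ?thesis unfolding avg_gauss[OF F] by (simp add: G.prob_space[simplified])
    qed
    show ?thesis
    proof (rule integral_dominated_convergence[where w="\<lambda>_. 1"])
      show "AE y in \<rho>. (\<lambda>n. avg (gauss d (s n)) F y) \<longlonglongrightarrow> F y" using 1 by simp
      show "AE y in \<rho>. norm (avg (gauss d (s n)) F y) \<le> 1" for n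
        using test_funD(3)[OF test_fun_avg[OF F law_gauss]] by simp
      show "avg (gauss d (s n)) F \<in> borel_measurable \<rho>" for n
        by (rule law_measurable[OF \<rho> test_funD(1)[OF test_fun_avg[OF F law_gauss]]])
    qed auto
  qed
  have "(\<lambda>n. \<integral>y. avg (gauss d (s n)) F y \<partial>\<mu>) = (\<lambda>n. \<integral>y. avg (gauss d (s n)) F y \<partial>\<nu>)"
    using same_cf_smoothed[OF \<mu> \<nu> cf F _ s0] f0 by (auto simp: F_def)
  then show ?thesis
    using LIMSEQ_unique[OF conv[OF \<mu>]] conv[OF \<nu>] by (simp add: F_def)
qed

text \<open>Closed sets are an intersection-stable generator, and their indicators are limits of
  continuous functions of the distance to the set.\<close>

lemma same_cf_distr_eq:
  assumes \<mu>: "law \<mu>" and \<nu>: "law \<nu>" and cf: "same_cf d \<mu> \<nu>"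
  shows "distr \<mu> borel (trunc d) = distr \<nu> borel (trunc d)"
proof (rule measure_eqI_generator_eq[where E="Collect closed" and \<Omega>=UNIV and A="\<lambda>_. UNIV"])
  show "Int_stable (Collect (closed :: (nat \<Rightarrow> real) set \<Rightarrow> bool))"
    by (auto simp: Int_stable_def)
  have [measurable]: "trunc d \<in> borel_measurable \<rho>" if "law \<rho>" for \<rho>
    using law_measurable[OF that, of "trunc d"] measurable_trunc[of "\<lambda>x. x" borel] by simp
  have pm: "prob_space (distr \<rho> borel (trunc d))" if "law \<rho>" for \<rho>
    using that by (intro prob_space.prob_space_distr law_prob) auto
  show "emeasure (distr \<mu> borel (trunc d)) UNIV \<noteq> \<infinity>"
    using prob_space.emeasure_space_1[OF pm[OF \<mu>]] by simp
  fix C :: "(nat \<Rightarrow> real) set" assume "C \<in> Collect closed"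
  then have C: "closed C" by simp
  show "emeasure (distr \<mu> borel (trunc d)) C = emeasure (distr \<nu> borel (trunc d)) C"
  proof (cases "C = {}")
    case False
    define f where "f n x = max 0 (1 - real n * infdist x C)" for n x
    have cont: "continuous_on UNIV (f n)" for n
      unfolding f_def by (intro continuous_intros)
    have [measurable]: "f n \<in> borel_measurable borel" for n
      using cont by (rule borel_measurable_continuous_onI)
    have b: "0 \<le> f n x" "f n x \<le> 1" for n x
      by (auto simp: f_def infdist_nonneg)
    have [measurable]: "C \<in> sets borel" using C by simp
    have lim: "(\<lambda>n. f n x) \<longlonglongrightarrow> indicator C x" for x
    proof (cases "x \<in> C")
      case False
      then have p: "0 < infdist x C"
        using C \<open>C \<noteq> {}\<close> in_closed_iff_infdist_zero infdist_nonneg by (metis less_eq_real_def)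
      have "\<forall>\<^sub>F n in sequentially. f n x = 0"
        using eventually_ge_at_top[of "nat \<lceil>1 / infdist x C\<rceil>"]
      proof eventually_elim
        case (elim n)
        then have "1 / infdist x C \<le> real n" by linarith
        then have "1 \<le> real n * infdist x C" using p by (simp add: field_simps)
        then show ?case by (simp add: f_def)
      qed
      then show ?thesis using False by (auto intro!: tendsto_eventually)
    qed (simp add: f_def)
    have conv: "(\<lambda>n. \<integral>y. f n (trunc d y) \<partial>\<rho>) \<longlonglongrightarrow> measure (distr \<rho> borel (trunc d)) C" if \<rho>: "law \<rho>" for \<rho>
    proof -
      interpret R: prob_space \<rho> by (rule law_prob[OF \<rho>])
      note [measurable] = \<open>law \<rho>\<close>
      have m[measurable]: "trunc d \<in> borel_measurable \<rho>"
        using law_measurable[OF \<rho>, of "trunc d"] measurable_trunc[of "\<lambda>x. x" borel] by simp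
      interpret D: prob_space "distr \<rho> borel (trunc d)" by (rule pm[OF \<rho>])
      have "(\<lambda>n. \<integral>x. f n x \<partial>distr \<rho> borel (trunc d)) \<longlonglongrightarrow> (\<integral>x. indicator C x \<partial>distr \<rho> borel (trunc d))"
        by (rule integral_dominated_convergence[where w="\<lambda>_. 1"]) (auto simp: lim b)
      moreover have "(\<integral>x. f n x \<partial>distr \<rho> borel (trunc d)) = (\<integral>y. f n (trunc d y) \<partial>\<rho>)" for n
        by (rule integral_distr) auto
      ultimately show ?thesis by simp
    qed
    have "measure (distr \<mu> borel (trunc d)) C = measure (distr \<nu> borel (trunc d)) C"
      using LIMSEQ_unique[OF conv[OF \<mu>]] conv[OF \<nu>] same_cf_continuous[OF \<mu> \<nu> cf cont b] by simp
    then show ?thesis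
      using pm[OF \<mu>] pm[OF \<nu>] by (simp add: finite_measure.emeasure_eq_measure prob_space.finite_measure)
  qed simp
qed (auto simp: borel_eq_closed)

lemma same_cf_avg:
  assumes \<mu>: "law \<mu>" and \<nu>: "law \<nu>" and cf: "same_cf d \<mu> \<nu>" and f: "test_fun d M f"
  shows "avg \<mu> f = avg \<nu> f"
proof
  fix x
  note [measurable] = test_funD(1)[OF f]
  have *: "avg \<rho> f x = (\<integral>y. f (x + y) \<partial>distr \<rho> borel (trunc d))" if \<rho>: "law \<rho>" for \<rho>
  proof -
    have [measurable]: "trunc d \<in> borel_measurable \<rho>"
      using law_measurable[OF \<rho>, of "trunc d"] measurable_trunc[of "\<lambda>x. x" borel] by simp
    have "f (x + trunc d y) = f (x + y)" for y
      using test_funD(2)[OF f, of "x + trunc d y"] test_funD(2)[OF f, of "x + y"] by (simp add: trunc_add)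
    then show ?thesis unfolding avg_def by (subst integral_distr) (auto simp del: plus_fun_apply)
  qed
  show "avg \<mu> f x = avg \<nu> f x"
    by (simp only: *[OF \<mu>] *[OF \<nu>] same_cf_distr_eq[OF \<mu> \<nu> cf])
qed

text \<open>The characteristic function of a normal law with mean m. The covariance enters as its
  quadratic form q, so that convolution adds forms and degenerate covariances are included.\<close>

definition cf_eq :: "nat \<Rightarrow> (nat \<Rightarrow> real) measure \<Rightarrow> (nat \<Rightarrow> real) \<Rightarrow> ((nat \<Rightarrow> real) \<Rightarrow> real) \<Rightarrow> bool" where
  "cf_eq d \<mu> m q \<longleftrightarrow> (\<forall>u. (\<integral>x. cos (dot d u x) \<partial>\<mu>) = cos (dot d u m) * exp (- q u / 2) \<and>
      (\<integral>x. sin (dot d u x) \<partial>\<mu>) = sin (dot d u m) * exp (- q u / 2))"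

lemma cf_eq_same: "cf_eq d \<mu> m q \<Longrightarrow> cf_eq d \<nu> m q \<Longrightarrow> same_cf d \<mu> \<nu>"
  by (simp add: cf_eq_def same_cf_def)

lemma cf_eq_conv:
  assumes \<mu>: "law \<mu>" and \<nu>: "law \<nu>" and "cf_eq d \<mu> m q" "cf_eq d \<nu> m' q'"
  shows "cf_eq d (conv \<mu> \<nu>) (m + m') (\<lambda>u. q u + q' u)"
proof -
  interpret A: prob_space \<mu> by (rule law_prob[OF \<mu>])
  interpret B: prob_space \<nu> by (rule law_prob[OF \<nu>])
  note [measurable_cong] = law_sets[OF \<mu>] law_sets[OF \<nu>]
  have i [simp]: "integrable \<mu> (\<lambda>y. cos (dot d u y))" "integrable \<mu> (\<lambda>y. sin (dot d u y))"
     "integrable \<nu> (\<lambda>y. cos (dot d u y))" "integrable \<nu> (\<lambda>y. sin (dot d u y))" for u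
    by (rule A.integrable_const_bound[where B=1] B.integrable_const_bound[where B=1]; auto)+
  have e: "exp (- (q u + q' u) / 2) = exp (- q u / 2) * exp (- q' u / 2)" for u
    by (simp add: exp_add[symmetric] field_simps)
  have m: "(\<lambda>x. cos (dot d u x)) \<in> borel_measurable borel" "(\<lambda>x. sin (dot d u x)) \<in> borel_measurable borel" for u
    by measurable
  have "(\<integral>x. cos (dot d u x) \<partial>conv \<mu> \<nu>) = (\<integral>x. \<integral>y. cos (dot d u x) * cos (dot d u y) - sin (dot d u x) * sin (dot d u y) \<partial>\<nu> \<partial>\<mu>)" for u
    using integral_conv[OF \<mu> \<nu> m(1) abs_cos_le_one] by (simp only: dot_add cos_add)
  moreover have "(\<integral>x. sin (dot d u x) \<partial>conv \<mu> \<nu>) = (\<integral>x. \<integral>y. sin (dot d u x) * cos (dot d u y) + cos (dot d u x) * sin (dot d u y) \<partial>\<nu> \<partial>\<mu>)" for u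
    using integral_conv[OF \<mu> \<nu> m(2) abs_sin_le_one] by (simp only: dot_add sin_add)
  ultimately show ?thesis
    unfolding cf_eq_def e dot_add cos_add sin_add
    using assms(3,4) by (simp add: cf_eq_def algebra_simps)
qed

lemma cf_eq_gauss: "cf_eq d (gauss d s) 0 (\<lambda>u. s\<^sup>2 * nsq d u)"
proof -
  have "(\<integral>x. cos (dot d u x) \<partial>gauss d s) = (\<integral>g. cos (dot d (scale s u) g) \<partial>gam d)"
     "(\<integral>x. sin (dot d u x) \<partial>gauss d s) = (\<integral>g. sin (dot d (scale s u) g) \<partial>gam d)" for u
    unfolding gauss_def by (subst integral_distr; simp add: dot_scale)+
  moreover have "dot d u 0 = 0" for u by (simp add: dot_def)
  ultimately show ?thesis
    unfolding cf_eq_def gam_cos_sin by (simp add: dot_scale power2_eq_square mult.assoc)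
qed

lemma avg_gauss_gauss:
  assumes f: "test_fun d M f" and "0 \<le> a" "0 \<le> b"
  shows "avg (gauss d a) (avg (gauss d b) f) = avg (gauss d (sqrt (a\<^sup>2 + b\<^sup>2))) f"
proof -
  have "cf_eq d (conv (gauss d a) (gauss d b)) (0 + 0) (\<lambda>u. a\<^sup>2 * nsq d u + b\<^sup>2 * nsq d u)"
    by (intro cf_eq_conv law_gauss cf_eq_gauss)
  moreover have "cf_eq d (gauss d (sqrt (a\<^sup>2 + b\<^sup>2))) 0 (\<lambda>u. a\<^sup>2 * nsq d u + b\<^sup>2 * nsq d u)"
    using cf_eq_gauss[of d "sqrt (a\<^sup>2 + b\<^sup>2)"] by (simp add: distrib_right)
  ultimately have "same_cf d (conv (gauss d a) (gauss d b)) (gauss d (sqrt (a\<^sup>2 + b\<^sup>2)))"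
    by (auto intro: cf_eq_same)
  from same_cf_avg[OF _ _ this f] show ?thesis
    by (simp add: avg_conv[OF law_gauss law_gauss f] law_conv law_gauss)
qed

lemma avg_gauss_0: "test_fun d M f \<Longrightarrow> avg (gauss d 0) f = f"
proof
  fix x assume f: "test_fun d M f"
  interpret prob_space "gam d" by (rule prob_gam)
  have "scale 0 g = 0" for g by (rule ext) simp
  then show "avg (gauss d 0) f x = f x" by (simp add: avg_gauss[OF f] prob_space[simplified])
qed

section \<open>Positive semidefinite forms and smallest eigenvalues\<close>

definition quad :: "nat \<Rightarrow> (nat \<Rightarrow> nat \<Rightarrow> real) \<Rightarrow> (nat \<Rightarrow> real) \<Rightarrow> real" where
  "quad d a u = (\<Sum>i<d. \<Sum>j<d. u i * a i j * u j)"

text \<open>Cholesky decomposition, by Schur complements.\<close>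

lemma psd_decomposition:
  assumes "\<And>i j. a i j = a j i" "\<And>u. 0 \<le> quad d a u"
  shows "\<exists>b. \<forall>i<d. \<forall>j<d. a i j = (\<Sum>k<d. b i k * b j k :: real)"
  using assms
proof (induction d arbitrary: a)
  case (Suc d)
  note sym = Suc.prems(1)
  define p where "p = a d d"
  have q: "quad (Suc d) a u = quad d a u + 2 * u d * (\<Sum>i<d. u i * a i d) + p * (u d)\<^sup>2" for u
  proof -
    have "(\<Sum>j<d. u d * a d j * u j) = u d * (\<Sum>i<d. u i * a i d)"
      unfolding sum_distrib_left by (intro sum.cong) (auto simp: sym[of d] mult_ac)
    moreover have "(\<Sum>i<d. u i * a i d * u d) = u d * (\<Sum>i<d. u i * a i d)"
      unfolding sum_distrib_left by (intro sum.cong) (auto simp: mult_ac)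
    ultimately show ?thesis
      by (simp add: quad_def sum.distrib p_def power2_eq_square)
  qed
  have restrict: "quad d a (u(d := t)) = quad d a u" "(\<Sum>i<d. (u(d := t)) i * a i d) = (\<Sum>i<d. u i * a i d)" for u t
    by (auto simp: quad_def intro!: sum.cong)
  have pos: "0 \<le> quad d a u + 2 * t * (\<Sum>i<d. u i * a i d) + p * t\<^sup>2" for u t
    using Suc.prems(2)[of "u(d := t)"] unfolding q restrict by simp
  have p0: "0 \<le> p" using pos[of "\<lambda>_. 0" 1] by (simp add: quad_def)
  show ?case
  proof (cases "p = 0")
    case True
    \<comment> \<open>With a vanishing diagonal entry the form is affine in the last variable, and
      an affine function bounded below is constant.\<close>
    have z: "a i d = 0" if "i < d" for i
    proof (rule ccontr)
      assume nz: "a i d \<noteq> 0"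
      define e where "e = (\<lambda>k. if k = i then 1 else 0 :: real)"
      have s: "(\<Sum>k<d. e k * a k d) = a i d" using that by (simp add: e_def if_distrib[of "\<lambda>x. x * _"] cong: if_cong)
      define Q where "Q = quad d a e"
      have "0 \<le> Q + 2 * t * a i d" for t using pos[of e t] True s by (simp add: Q_def)
      \<comment> \<open>This t would give the form the value -1.\<close>
      from this[of "(- Q - 1) / (2 * a i d)"] show False using nz by (simp add: field_simps)
    qed
    have "0 \<le> quad d a u" for u using pos[of u 0] by simp
    then obtain b where b: "\<And>i j. i < d \<Longrightarrow> j < d \<Longrightarrow> a i j = (\<Sum>k<d. b i k * b j k)"
      using Suc.IH[of a] sym by blast
    define b' where "b' i k = (if i < d \<and> k < d then b i k else 0)" for i k
    have "a i j = (\<Sum>k<Suc d. b' i k * b' j k)" if "i < Suc d" "j < Suc d" for i j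
      using that b[of i j] z[of i] z[of j] sym[of d j] True
      by (cases "i < d"; cases "j < d") (auto simp: b'_def p_def less_Suc_eq)
    then show ?thesis by blast
  next
    case False
    then have p: "0 < p" using p0 by simp
    define a' where "a' i j = a i j - a i d * a j d / p" for i j
    have "0 \<le> quad d a' u" for u
    proof -
      define L where "L = (\<Sum>i<d. u i * a i d)"
      have "quad d a' u = quad d a u - L * L / p"
        unfolding quad_def a'_def L_def sum_product sum_divide_distrib sum_subtractf[symmetric]
        by (intro sum.cong) (auto simp: algebra_simps)
      \<comment> \<open>The value - L / p minimises the form in its last variable, and the minimum
        is the Schur complement.\<close>
      moreover have "0 \<le> quad d a u + 2 * (- L / p) * L + p * (- L / p)\<^sup>2"
        using pos[of u "- L / p"] by (simp add: L_def)
      ultimately have "0 \<le> p * quad d a' u" using p by (simp add: power2_eq_square field_simps)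
      then show ?thesis using p by (simp add: zero_le_mult_iff)
    qed
    moreover have "a' i j = a' j i" for i j using sym[of i j] by (simp add: a'_def mult.commute)
    ultimately obtain b where b: "\<And>i j. i < d \<Longrightarrow> j < d \<Longrightarrow> a' i j = (\<Sum>k<d. b i k * b j k)"
      using Suc.IH[of a'] by blast
    define b' where "b' i k = (if k < d then (if i < d then b i k else 0) else a i d / sqrt p)" for i k
    have sp: "sqrt p * sqrt p = p" using p by simp
    have "a i j = (\<Sum>k<Suc d. b' i k * b' j k)" if ij: "i < Suc d" "j < Suc d" for i j
    proof -
      have "b' i d * b' j d = a i d * a j d / p" using p sp by (simp add: b'_def)
      moreover have "(\<Sum>k<d. b' i k * b' j k) = a i j - a i d * a j d / p"
      proof (cases "i < d \<and> j < d")
        case True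
        then show ?thesis using b[of i j] by (simp add: b'_def a'_def)
      next
        case False
        then have "i = d \<or> j = d" using ij by auto
        then have "a i j - a i d * a j d / p = 0" using p sym[of d j] by (auto simp: p_def)
        then show ?thesis using False by (auto simp: b'_def intro!: sum.neutral)
      qed
      ultimately show ?thesis by simp
    qed
    then show ?thesis by blast
  qed
qed simp

definition mat_form :: "real mat \<Rightarrow> nat \<Rightarrow> nat \<Rightarrow> real" where
  "mat_form A i j = A $$ (i, j)"

lemma quad_form_vec:
  assumes "A \<in> carrier_mat d d"
  shows "vec d u \<bullet> (A *\<^sub>v vec d u) = quad d (mat_form A) u"
proof -
  have "vec d u \<bullet> (A *\<^sub>v vec d u) = (\<Sum>i<d. u i * (\<Sum>j<d. A $$ (i, j) * u j))"
    using assms by (auto simp: scalar_prod_def lessThan_atLeast0 intro!: sum.cong)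
  then show ?thesis by (simp add: quad_def mat_form_def sum_distrib_left mult.assoc)
qed

lemma pos_def_mat_sym:
  assumes "pos_def_mat d A" "i < d" "j < d"
  shows "A $$ (i, j) = A $$ (j, i)"
proof -
  have "A \<in> carrier_mat d d" "transpose_mat A = A" using assms by (auto simp: pos_def_mat_def)
  then show ?thesis using assms(2,3) by (metis carrier_matD index_transpose_mat(1))
qed

lemma quad_perturb:
  assumes sym: "\<And>i j. i < d \<Longrightarrow> j < d \<Longrightarrow> a i j = a j i"
  shows "quad d a (v + scale t w) = quad d a v + 2 * t * (\<Sum>i<d. w i * (\<Sum>j<d. a i j * v j)) + t\<^sup>2 * quad d a w"
proof -
  have sw: "(\<Sum>i<d. \<Sum>j<d. v i * a i j * w j) = (\<Sum>i<d. \<Sum>j<d. w i * a i j * v j)"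
    by (subst sum.swap) (auto simp: sym mult_ac intro!: sum.cong)
  have "quad d a (v + scale t w) = (\<Sum>i<d. \<Sum>j<d. v i * a i j * v j + t * (v i * a i j * w j) + t * (w i * a i j * v j) + t\<^sup>2 * (w i * a i j * w j))"
    unfolding quad_def by (intro sum.cong refl) (simp add: algebra_simps power2_eq_square)
  also have "\<dots> = quad d a v + t * (\<Sum>i<d. \<Sum>j<d. v i * a i j * w j) + t * (\<Sum>i<d. \<Sum>j<d. w i * a i j * v j) + t\<^sup>2 * quad d a w"
    by (simp add: quad_def sum.distrib sum_distrib_left)
  finally show ?thesis unfolding sw by (simp add: sum_distrib_left mult.assoc)
qed

lemma nsq_perturb: "nsq d (v + scale t w) = nsq d v + 2 * t * dot d w v + t\<^sup>2 * nsq d w"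
  by (simp only: dot_add dot_scale dot_commute[of d v w]) (simp add: power2_eq_square algebra_simps)

text \<open>Coordinates beyond d are pinned to 0, so that the sphere is a closed part of a product
  of compact sets and Tychonoff's theorem applies.\<close>

lemma compact_unit_sphere: "compact {x. (\<forall>k\<ge>d. x k = 0) \<and> nsq d x = 1}"
proof -
  define S where "S k = (if k < d then {-1..1} else {0 :: real})" for k
  have "compactin (product_topology (\<lambda>_. euclidean) UNIV) (PiE UNIV S)"
    unfolding compactin_PiE by (auto simp: S_def)
  then have c: "compact (PiE UNIV S)"
    unfolding euclidean_product_topology compactin_euclidean_iff .
  have "closed {x. nsq d x = 1}"
    unfolding dot_def by (intro closed_Collect_eq continuous_intros continuous_on_product_coordinates)
  then have "compact (PiE UNIV S \<inter> {x. nsq d x = 1})" using c by (rule compact_Int_closed[rotated])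
  also have "PiE UNIV S \<inter> {x. nsq d x = 1} = {x. (\<forall>k\<ge>d. x k = 0) \<and> nsq d x = 1}"
  proof (intro subset_antisym subsetI)
    fix x assume x: "x \<in> {x. (\<forall>k\<ge>d. x k = 0) \<and> nsq d x = 1}"
    have "x k \<in> S k" for k
    proof (cases "k < d")
      case True
      then have "x k * x k \<le> nsq d x" unfolding dot_def by (intro member_le_sum) auto
      then have "(x k)\<^sup>2 \<le> 1" using x by (simp add: power2_eq_square)
      then have "\<bar>x k\<bar> \<le> 1" by (simp add: abs_square_le_1)
      then show ?thesis using True by (auto simp: S_def)
    qed (use x in \<open>auto simp: S_def\<close>)
    then show "x \<in> PiE UNIV S \<inter> {x. nsq d x = 1}" using x by auto
  next
    fix x assume x: "x \<in> PiE UNIV S \<inter> {x. nsq d x = 1}"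
    then have "x k \<in> S k" for k by auto
    then have "x k = 0" if "d \<le> k" for k using that by (metis S_def linorder_not_le singletonD)
    then show "x \<in> {x. (\<forall>k\<ge>d. x k = 0) \<and> nsq d x = 1}" using x by simp
  qed
  finally show ?thesis .
qed

text \<open>A minimiser of the Rayleigh quotient is an eigenvector.\<close>

lemma smallest_eigenvalue_le_quad:
  assumes A: "pos_def_mat d A" and l: "smallest_eigenvalue A l" and d: "1 \<le> d"
  shows "l * nsq d u \<le> quad d (mat_form A) u"
proof -
  let ?q = "quad d (mat_form A)"
  let ?S = "{x. (\<forall>k\<ge>d. x k = 0) \<and> nsq d x = 1}"
  have Ac: "A \<in> carrier_mat d d" using A by (simp add: pos_def_mat_def)
  have sym: "mat_form A i j = mat_form A j i" if "i < d" "j < d" for i j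
    using pos_def_mat_sym[OF A that] by (simp add: mat_form_def)
  have ne: "?S \<noteq> {}"
  proof -
    define e where "e = (\<lambda>k::nat. if k = 0 then 1 else 0 :: real)"
    have "nsq d e = (\<Sum>k<d. if k = 0 then 1 else 0)"
      unfolding dot_def e_def by (intro sum.cong) auto
    then have "e \<in> ?S" using d by (auto simp: e_def)
    then show ?thesis by blast
  qed
  have cq: "continuous_on ?S ?q"
    unfolding quad_def by (intro continuous_intros continuous_on_subset[OF continuous_on_product_coordinates]) simp_all
  from continuous_attains_inf[OF compact_unit_sphere ne cq]
  obtain v where v: "v \<in> ?S" and min: "\<forall>y\<in>?S. ?q v \<le> ?q y" by (rule bexE)
  define m where "m = ?q v"
  have q_scale: "?q (scale c x) = c\<^sup>2 * ?q x" for c x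
    unfolding quad_def sum_distrib_left scale_apply by (intro sum.cong refl) (simp add: power2_eq_square)
  have q_trunc: "?q (trunc d x) = ?q x" for x
    by (auto simp: quad_def trunc_def intro!: sum.cong)
  have bound: "m * nsq d x \<le> ?q x" for x
  proof (cases "nsq d x = 0")
    case True
    have "x k = 0" if "k < d" for k
    proof -
      have "x k * x k \<le> nsq d x" unfolding dot_def using that by (intro member_le_sum) auto
      then have "x k * x k = 0" using True zero_le_square[of "x k"] by linarith
      then show ?thesis by simp
    qed
    then show ?thesis using True by (simp add: quad_def)
  next
    case False
    then have p: "0 < nsq d x" using nsq_nonneg[of d x] by linarith
    define c where "c = 1 / sqrt (nsq d x)"
    have c2: "c\<^sup>2 * nsq d x = 1" using p by (simp add: c_def power_divide)
    have "nsq d (scale c (trunc d x)) = c\<^sup>2 * nsq d x"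
      by (simp add: dot_scale power2_eq_square mult.assoc)
    moreover have "scale c (trunc d x) k = 0" if "d \<le> k" for k
      using that by (simp add: trunc_def)
    ultimately have "scale c (trunc d x) \<in> ?S" using c2 by simp
    with min have "m \<le> ?q (scale c (trunc d x))" unfolding m_def by (rule bspec)
    then have "m \<le> c\<^sup>2 * ?q x" by (simp only: q_scale q_trunc)
    then have "m * nsq d x \<le> c\<^sup>2 * ?q x * nsq d x" using p by (intro mult_right_mono) auto
    also have "\<dots> = ?q x" using c2 by (simp add: mult_ac)
    finally show ?thesis .
  qed
  have nv: "nsq d v = 1" using v by simp
  \<comment> \<open>Vanishing first variation at the minimiser v, in an arbitrary direction
    w.\<close>
  have lin: "(\<Sum>i<d. w i * (\<Sum>j<d. mat_form A i j * v j)) = m * dot d w v" for w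
  proof -
    define b where "b = (\<Sum>i<d. w i * (\<Sum>j<d. mat_form A i j * v j)) - m * dot d w v"
    define c where "c = ?q w - m * nsq d w"
    have c0: "0 \<le> c" using bound[of w] by (simp add: c_def)
    have qp: "?q (v + scale t w) = m + 2 * t * (\<Sum>i<d. w i * (\<Sum>j<d. mat_form A i j * v j)) + t\<^sup>2 * ?q w" for t
      unfolding m_def by (rule quad_perturb) (rule sym)
    have "0 \<le> 2 * t * b + t\<^sup>2 * c" for t
      using bound[of "v + scale t w"] unfolding qp nsq_perturb nv
      by (simp add: b_def c_def algebra_simps)
    \<comment> \<open>At this t the quadratic equals - t^2 (c + 2), also when c = 0, so its
      nonnegativity forces t = 0 and b = 0.\<close>
    moreover define t where "t = - b / (c + 1)"
    moreover have b: "b = - t * (c + 1)" using c0 by (simp add: t_def)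
    ultimately have "0 \<le> 2 * t * (- t * (c + 1)) + t\<^sup>2 * c" by metis
    then have "t\<^sup>2 * (c + 2) \<le> 0" by (simp add: power2_eq_square algebra_simps)
    then have "t = 0" using c0 by (simp add: mult_le_0_iff)
    then have "b = 0" using b by simp
    then show ?thesis by (simp add: b_def)
  qed
  have "eigenvalue A m"
    unfolding eigenvalue_def eigenvector_def
  proof (intro exI conjI)
    show "vec d v \<in> carrier_vec (dim_row A)" using Ac by simp
    show "vec d v \<noteq> 0\<^sub>v (dim_row A)"
    proof
      assume "vec d v = 0\<^sub>v (dim_row A)"
      then have "v k = 0" if "k < d" for k using that Ac by (metis carrier_matD(1) index_vec index_zero_vec(1))
      then show False using nv by (simp add: dot_def)
    qed
    show "A *\<^sub>v vec d v = m \<cdot>\<^sub>v vec d v"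
    proof (rule eq_vecI)
      fix i assume "i < dim_vec (m \<cdot>\<^sub>v vec d v)"
      then have i: "i < d" by simp
      have "(\<Sum>j<d. mat_form A i j * v j) = m * v i"
        using lin[of "\<lambda>k. if k = i then 1 else 0"] i
        by (simp add: dot_def if_distrib[of "\<lambda>x. x * _"] cong: if_cong)
      then show "(A *\<^sub>v vec d v) $ i = (m \<cdot>\<^sub>v vec d v) $ i"
        using i Ac by (simp add: scalar_prod_def mat_form_def lessThan_atLeast0)
    qed (use Ac in auto)
  qed
  then have "l \<le> m" using l by (simp add: smallest_eigenvalue_def)
  then have "l * nsq d u \<le> m * nsq d u" by (intro mult_right_mono) auto
  then show ?thesis using bound[of u] by linarith
qed

section \<open>Gaussian random vectors and their splitting\<close>

definition vec_law :: "'a measure \<Rightarrow> nat \<Rightarrow> ('a \<Rightarrow> nat \<Rightarrow> real) \<Rightarrow> (nat \<Rightarrow> real) measure" where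
  "vec_law M d Y = distr M borel (\<lambda>\<omega>. trunc d (Y \<omega>))"

lemma random_vector_measurable:
  assumes "random_vector M d Y"
  shows "(\<lambda>\<omega>. trunc d (Y \<omega>)) \<in> borel_measurable M"
  using assms measurable_compose[OF _ measurable_trunc_Rd] by (auto simp: random_vector_def)

lemma law_vec_law: "random_vector M d Y \<Longrightarrow> law (vec_law M d Y)"
  unfolding vec_law_def using random_vector_measurable by (intro law_distr) (auto simp: random_vector_def)

lemma integral_vec_law:
  fixes f :: "_ \<Rightarrow> real"
  assumes "random_vector M d Y" "f \<in> borel_measurable borel"
  shows "(\<integral>x. f x \<partial>vec_law M d Y) = (\<integral>\<omega>. f (trunc d (Y \<omega>)) \<partial>M)"
    and "integrable (vec_law M d Y) f \<longleftrightarrow> integrable M (\<lambda>\<omega>. f (trunc d (Y \<omega>)))"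
  unfolding vec_law_def
  by (rule integral_distr[OF random_vector_measurable[OF assms(1)] assms(2)],
      rule integrable_distr_eq[OF random_vector_measurable[OF assms(1)] assms(2)])

lemma std_cos_sin:
  "(\<integral>x. cos (t * x) \<partial>std_normal_distribution) = exp (- t\<^sup>2 / 2)" "(\<integral>x. sin (t * x) \<partial>std_normal_distribution) = 0"
proof -
  interpret prob_space std_normal_distribution by (rule prob_std)
  have i: "integrable std_normal_distribution (\<lambda>x. iexp (t * x))"
    by (rule integrable_iexp) auto
  have c: "(\<integral>x. iexp (t * x) \<partial>std_normal_distribution) = complex_of_real (exp (- t\<^sup>2 / 2))"
    using fun_cong[OF char_std_normal_distribution, of t] by (simp add: char_def)
  have "(\<integral>x. Re (iexp (t * x)) \<partial>std_normal_distribution) = exp (- t\<^sup>2 / 2)"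
    using integral_Re[OF i] unfolding c by simp
  then show "(\<integral>x. cos (t * x) \<partial>std_normal_distribution) = exp (- t\<^sup>2 / 2)" by (simp add: Re_exp)
  have "(\<integral>x. Im (iexp (t * x)) \<partial>std_normal_distribution) = 0"
    using integral_Im[OF i] unfolding c by simp
  then show "(\<integral>x. sin (t * x) \<partial>std_normal_distribution) = 0" by (simp add: Im_exp)
qed

lemma std_affine_normal:
  assumes "0 < \<sigma>"
  shows "distr std_normal_distribution borel (\<lambda>x. \<beta> + \<sigma> * x) = density lborel (normal_density \<beta> \<sigma>)"
proof -
  interpret prob_space std_normal_distribution by (rule prob_std)
  have "distributed std_normal_distribution lborel (\<lambda>x. x) std_normal_density"
    by (auto simp: distributed_def intro!: distr_id2)
  from normal_density_affine[OF this, of \<sigma> \<beta>] assms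
  show ?thesis by (auto simp: distributed_def cong: distr_cong)
qed

lemma distributed_normal_integral:
  fixes F :: "real \<Rightarrow> real"
  assumes X: "distributed M lborel X (normal_density \<beta> \<sigma>)" and s: "0 < \<sigma>" and [measurable]: "F \<in> borel_measurable borel"
  shows "(\<integral>\<omega>. F (X \<omega>) \<partial>M) = (\<integral>x. F (\<beta> + \<sigma> * x) \<partial>std_normal_distribution)"
    and "integrable M (\<lambda>\<omega>. F (X \<omega>)) \<longleftrightarrow> integrable std_normal_distribution (\<lambda>x. F (\<beta> + \<sigma> * x))"
proof -
  have m[measurable]: "X \<in> borel_measurable M" using X by (simp add: distributed_def)
  have eq: "distr M borel X = distr std_normal_distribution borel (\<lambda>x. \<beta> + \<sigma> * x)"
    using X s by (simp add: distributed_def std_affine_normal cong: distr_cong)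
  have "(\<integral>\<omega>. F (X \<omega>) \<partial>M) = (\<integral>x. F x \<partial>distr M borel X)" by (subst integral_distr) auto
  also have "\<dots> = (\<integral>x. F (\<beta> + \<sigma> * x) \<partial>std_normal_distribution)" unfolding eq by (subst integral_distr) auto
  finally show "(\<integral>\<omega>. F (X \<omega>) \<partial>M) = (\<integral>x. F (\<beta> + \<sigma> * x) \<partial>std_normal_distribution)" .
  have "integrable M (\<lambda>\<omega>. F (X \<omega>)) \<longleftrightarrow> integrable (distr M borel X) F" by (subst integrable_distr_eq) auto
  also have "\<dots> \<longleftrightarrow> integrable std_normal_distribution (\<lambda>x. F (\<beta> + \<sigma> * x))" unfolding eq by (subst integrable_distr_eq) auto
  finally show "integrable M (\<lambda>\<omega>. F (X \<omega>)) \<longleftrightarrow> integrable std_normal_distribution (\<lambda>x. F (\<beta> + \<sigma> * x))" .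
qed

lemma pos_def_quad_pos:
  assumes "pos_def_mat d A" "k < d" "u k \<noteq> 0"
  shows "0 < quad d (mat_form A) u"
proof -
  have A: "A \<in> carrier_mat d d" using assms by (simp add: pos_def_mat_def)
  have "vec d u \<noteq> 0\<^sub>v d" using assms(2,3) by (metis index_vec index_zero_vec(1))
  then have "vec d u \<bullet> (A *\<^sub>v vec d u) > 0" using assms(1) by (simp add: pos_def_mat_def)
  then show ?thesis by (simp add: quad_form_vec[OF A])
qed

lemma gaussian_vector_distributed:
  assumes Z: "gaussian_vector M d m A Z" and A: "pos_def_mat d A" and k: "k < d" "u k \<noteq> 0"
  shows "distributed M lborel (\<lambda>\<omega>. dot d u (Z \<omega>)) (normal_density (dot d u m) (sqrt (quad d (mat_form A) u)))"
proof -
  have Ac: "A \<in> carrier_mat d d" using A by (simp add: pos_def_mat_def)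
  have nz: "vec d u \<noteq> 0\<^sub>v d" using k by (metis index_vec index_zero_vec(1))
  have "(\<Sum>k<d. vec d u $ k * x k) = dot d u x" for x
    by (simp add: dot_def)
  then show ?thesis
    using Z nz unfolding gaussian_vector_def by (auto simp: quad_form_vec[OF Ac, symmetric] dest!: bspec[of _ _ "vec d u"])
qed

lemma gaussian_vector_cf_eq:
  assumes Z: "gaussian_vector M d m A Z" and A: "pos_def_mat d A"
  shows "cf_eq d (vec_law M d Z) m (quad d (mat_form A))"
  unfolding cf_eq_def
proof
  fix u
  have rv: "random_vector M d Z" using Z by (simp add: gaussian_vector_def)
  interpret M: prob_space M using rv by (simp add: random_vector_def)
  interpret S: prob_space std_normal_distribution by (rule prob_std)
  have "(\<lambda>x. cos (dot d u x)) \<in> borel_measurable borel" "(\<lambda>x. sin (dot d u x)) \<in> borel_measurable borel" by measurable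
  note i = integral_vec_law(1)[OF rv this(1)] integral_vec_law(1)[OF rv this(2)]
  show "(\<integral>x. cos (dot d u x) \<partial>vec_law M d Z) = cos (dot d u m) * exp (- quad d (mat_form A) u / 2) \<and>
      (\<integral>x. sin (dot d u x) \<partial>vec_law M d Z) = sin (dot d u m) * exp (- quad d (mat_form A) u / 2)"
  proof (cases "\<exists>k<d. u k \<noteq> 0")
    \<comment> \<open>The zero functional is not covered by \<open>gaussian_vector\<close>; here
      both characteristic functions are 1.\<close>
    case False
    then have "dot d u x = 0" for x by (auto simp: dot_def)
    moreover have "quad d (mat_form A) u = 0" using False by (auto simp: quad_def)
    ultimately show ?thesis unfolding i by (simp add: M.prob_space)
  next
    case True
    then obtain k where k: "k < d" "u k \<noteq> 0" by blast
    define s where "s = sqrt (quad d (mat_form A) u)"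
    have s: "0 < s" "s\<^sup>2 = quad d (mat_form A) u" using pos_def_quad_pos[where u=u and k=k, OF A k] by (simp_all add: s_def)
    note D = gaussian_vector_distributed[where u=u and k=k, OF Z A k, folded s_def]
    have ii [simp]: "integrable std_normal_distribution (\<lambda>x. cos (s * x))" "integrable std_normal_distribution (\<lambda>x. sin (s * x))"
      by (rule S.integrable_const_bound[where B=1]; auto)+
    have mc: "cos \<in> borel_measurable (borel :: real measure)" "sin \<in> borel_measurable (borel :: real measure)"
      by measurable
    show ?thesis
      unfolding i dot_trunc distributed_normal_integral(1)[OF D s(1) mc(1)] distributed_normal_integral(1)[OF D s(1) mc(2)]
      by (simp add: cos_add sin_add std_cos_sin s(2))
  qed
qed

definition image_law :: "nat \<Rightarrow> (nat \<Rightarrow> real) \<Rightarrow> (nat \<Rightarrow> nat \<Rightarrow> real) \<Rightarrow> (nat \<Rightarrow> real) measure" where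
  "image_law d m b = distr (gam d) borel (\<lambda>g i. m i + (\<Sum>k<d. b i k * g k))"

lemma measurable_image:
  fixes m :: "nat \<Rightarrow> real"
  shows "(\<lambda>g i. m i + (\<Sum>k<d. b i k * g k)) \<in> borel_measurable (gam d)"
  by (rule measurable_coordinatewise_then_product) simp

lemma law_image_law: "law (image_law d m b)"
  unfolding image_law_def by (rule law_distr[OF prob_gam measurable_image])

lemma cf_eq_image_law:
  "cf_eq d (image_law d m b) m (\<lambda>u. \<Sum>k<d. (\<Sum>i<d. b i k * u i)\<^sup>2)"
  unfolding cf_eq_def
proof
  fix u
  interpret G: prob_space "gam d" by (rule prob_gam)
  define w where "w k = (\<Sum>i<d. b i k * u i)" for k
  have dw: "dot d u (\<lambda>i. m i + (\<Sum>k<d. b i k * g k)) = dot d u m + dot d w g" for g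
  proof -
    have "(\<Sum>i<d. u i * (\<Sum>k<d. b i k * g k)) = (\<Sum>k<d. w k * g k)"
      unfolding w_def sum_distrib_left sum_distrib_right by (subst sum.swap) (simp add: mult_ac)
    then show ?thesis by (simp add: dot_def distrib_left sum.distrib)
  qed
  have n: "nsq d w = (\<Sum>k<d. (\<Sum>i<d. b i k * u i)\<^sup>2)" by (simp add: dot_def w_def power2_eq_square)
  have i [simp]: "integrable (gam d) (\<lambda>g. cos (dot d w g))" "integrable (gam d) (\<lambda>g. sin (dot d w g))"
    by (rule G.integrable_const_bound[where B=1]; auto)+
  have "(\<lambda>x. cos (dot d u x)) \<in> borel_measurable borel" "(\<lambda>x. sin (dot d u x)) \<in> borel_measurable borel" by measurable
  then have "(\<integral>x. cos (dot d u x) \<partial>image_law d m b) = (\<integral>g. cos (dot d u m + dot d w g) \<partial>gam d)"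
    "(\<integral>x. sin (dot d u x) \<partial>image_law d m b) = (\<integral>g. sin (dot d u m + dot d w g) \<partial>gam d)"
    unfolding image_law_def by (simp_all only: integral_distr[OF measurable_image] dw)
  then show "(\<integral>x. cos (dot d u x) \<partial>image_law d m b) = cos (dot d u m) * exp (- (\<Sum>k<d. (\<Sum>i<d. b i k * u i)\<^sup>2) / 2) \<and>
      (\<integral>x. sin (dot d u x) \<partial>image_law d m b) = sin (dot d u m) * exp (- (\<Sum>k<d. (\<Sum>i<d. b i k * u i)\<^sup>2) / 2)"
    by (simp add: cos_add sin_add gam_cos_sin flip: n)
qed

text \<open>The covariance exceeds s^2 I, so the law is the convolution of s g with a possibly
  degenerate normal law of covariance A - s^2 I, which the Cholesky factor realises as an affine
  image of a standard Gaussian.\<close>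

lemma gaussian_vector_split:
  assumes Z: "gaussian_vector M d m A Z" and A: "pos_def_mat d A"
    and s: "\<And>u. s\<^sup>2 * nsq d u \<le> quad d (mat_form A) u"
  obtains \<zeta> where "law \<zeta>" "\<And>K f. test_fun d K f \<Longrightarrow> avg (vec_law M d Z) f = avg (gauss d s) (avg \<zeta> f)"
proof -
  \<comment> \<open>The matrix A - s^2 I, set to 0 outside the d by d block because the
    decomposition asks for symmetry at all indices.\<close>
  define a where "a i j = (if i < d \<and> j < d then mat_form A i j - (if i = j then s\<^sup>2 else 0) else 0)" for i j
  have qa: "quad d a u = quad d (mat_form A) u - s\<^sup>2 * nsq d u" for u
  proof -
    have "quad d a u = (\<Sum>i<d. \<Sum>j<d. u i * mat_form A i j * u j - (if i = j then s\<^sup>2 * (u i * u j) else 0))"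
      unfolding quad_def by (intro sum.cong refl) (auto simp: a_def algebra_simps)
    then show ?thesis by (simp add: quad_def sum_subtractf dot_def sum_distrib_left)
  qed
  have "a i j = a j i" for i j
    using pos_def_mat_sym[OF A, of i j] by (auto simp: a_def mat_form_def)
  moreover have "0 \<le> quad d a u" for u using s[of u] by (simp add: qa)
  ultimately obtain b where b: "\<forall>i<d. \<forall>j<d. a i j = (\<Sum>k<d. b i k * b j k)"
    using psd_decomposition[of a d] by blast
  have "(\<Sum>k<d. (\<Sum>i<d. b i k * u i)\<^sup>2) = quad d a u" for u
  proof -
    have "(\<Sum>k<d. (\<Sum>i<d. b i k * u i)\<^sup>2) = (\<Sum>k<d. \<Sum>i<d. \<Sum>j<d. u i * (b i k * b j k) * u j)"
      by (simp add: power2_eq_square sum_product mult_ac)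
    also have "\<dots> = (\<Sum>i<d. \<Sum>k<d. \<Sum>j<d. u i * (b i k * b j k) * u j)" by (rule sum.swap)
    also have "\<dots> = (\<Sum>i<d. \<Sum>j<d. \<Sum>k<d. u i * (b i k * b j k) * u j)"
      by (intro sum.cong refl sum.swap)
    also have "\<dots> = quad d a u"
      unfolding quad_def using b by (intro sum.cong refl) (simp add: sum_distrib_left sum_distrib_right)
    finally show ?thesis .
  qed
  then have "cf_eq d (image_law d m b) m (quad d a)"
    using cf_eq_image_law[of d m b] by simp
  then have "cf_eq d (conv (gauss d s) (image_law d m b)) (0 + m) (\<lambda>u. s\<^sup>2 * nsq d u + quad d a u)"
    by (intro cf_eq_conv law_gauss law_image_law cf_eq_gauss)
  then have "cf_eq d (conv (gauss d s) (image_law d m b)) m (quad d (mat_form A))"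
    by (simp add: qa)
  then have "same_cf d (vec_law M d Z) (conv (gauss d s) (image_law d m b))"
    by (rule cf_eq_same[OF gaussian_vector_cf_eq[OF Z A]])
  moreover have "law (vec_law M d Z)" using Z by (intro law_vec_law) (simp add: gaussian_vector_def)
  ultimately have "avg (vec_law M d Z) f = avg (gauss d s) (avg (image_law d m b) f)" if "test_fun d K f" for K f
    using same_cf_avg[of "vec_law M d Z" "conv (gauss d s) (image_law d m b)" d K f] that
    by (simp add: avg_conv[OF law_gauss law_image_law that] law_conv law_gauss law_image_law)
  then show ?thesis using that[OF law_image_law] by blast
qed

text \<open>The constant C speaks of \<open>gaussian_vector\<close> and a smallest eigenvalue. Here
  s g is exhibited as such a vector with covariance s^2 I, and the shift x is moved into the centre
  of the ball.\<close>

lemma gauss_ball_anticoncentration: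
  assumes C: "gaussian_ball_const C" and d: "1 \<le> d" and s: "0 < s" and \<epsilon>: "0 < \<epsilon>" and r: "0 \<le> r"
  shows "avg (gauss d s) (indicator (eball d x0 (r + \<epsilon>) - eball d x0 r)) x \<le> \<epsilon> * C / s"
proof -
  let ?B = "eball d x0 (r + \<epsilon>) - eball d x0 r"
  define Z where "Z g = restrict (scale s g) {..<d}" for g
  define A where "A = s\<^sup>2 \<cdot>\<^sub>m 1\<^sub>m d"
  have Ac: "A \<in> carrier_mat d d" by (simp add: A_def)
  have Av: "A *\<^sub>v v = s\<^sup>2 \<cdot>\<^sub>v v" if v: "v \<in> carrier_vec d" for v
  proof (rule eq_vecI)
    fix i assume "i < dim_vec (s\<^sup>2 \<cdot>\<^sub>v v)"
    then have i: "i < d" using v by simp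
    have delta: "s\<^sup>2 * (if j = i then 1 else 0) * v $ j = (if j = i then s\<^sup>2 * v $ j else 0)" for j
      by simp
    show "(A *\<^sub>v v) $ i = (s\<^sup>2 \<cdot>\<^sub>v v) $ i" using i v by (simp add: A_def scalar_prod_def delta)
  qed (use v in \<open>auto simp: A_def\<close>)
  have qA: "u \<bullet> (A *\<^sub>v u) = s\<^sup>2 * nsq d (\<lambda>k. u $ k)" if "u \<in> carrier_vec d" for u
  proof -
    show ?thesis using that by (simp add: Av scalar_prod_def dot_def lessThan_atLeast0 sum_distrib_left mult_ac)
  qed
  have pos: "0 < nsq d (\<lambda>k. u $ k)" if u: "u \<in> carrier_vec d" "u \<noteq> 0\<^sub>v d" for u :: "real vec"
  proof -
    obtain k where k: "k < d" "u $ k \<noteq> 0" using u by (metis carrier_vecD eq_vecI index_zero_vec)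
    then have "0 < u $ k * u $ k" by (auto simp: zero_less_mult_iff linorder_neq_iff)
    also have "\<dots> \<le> nsq d (\<lambda>k. u $ k)" unfolding dot_def using k by (intro member_le_sum) auto
    finally show ?thesis .
  qed
  have pd: "pos_def_mat d A"
  proof -
    have "transpose_mat A = A" by (rule eq_matI) (auto simp: A_def)
    then show ?thesis unfolding pos_def_mat_def using s pos Ac by (auto simp: qA)
  qed
  have ev: "smallest_eigenvalue A (s\<^sup>2)"
    unfolding smallest_eigenvalue_def
  proof (intro conjI allI impI)
    have "unit_vec d 0 \<noteq> (0\<^sub>v d :: real vec)"
    proof
      assume "unit_vec d 0 = (0\<^sub>v d :: real vec)"
      then have "unit_vec d 0 $ 0 = (0\<^sub>v d :: real vec) $ 0" by simp
      then show False using d by simp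
    qed
    then show "eigenvalue A (s\<^sup>2)"
      unfolding eigenvalue_def eigenvector_def using Av[of "unit_vec d 0"] Ac by (intro exI[of _ "unit_vec d 0"]) auto
    fix l' assume "eigenvalue A l'"
    then obtain v where v: "v \<in> carrier_vec d" "v \<noteq> 0\<^sub>v d" "A *\<^sub>v v = l' \<cdot>\<^sub>v v"
      unfolding eigenvalue_def eigenvector_def using Ac by auto
    then obtain k where k: "k < d" "v $ k \<noteq> 0" by (metis carrier_vecD eq_vecI index_zero_vec)
    have "s\<^sup>2 * v $ k = l' * v $ k" using v Av[OF v(1)] k by (metis carrier_vecD index_smult_vec(1))
    then show "s\<^sup>2 \<le> l'" using k by simp
  qed
  have mZ: "Z \<in> measurable (gam d) (Rd d)"
    unfolding Z_def by (intro measurable_restrict) simp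
  have gv: "gaussian_vector (gam d) d 0 A Z"
    unfolding gaussian_vector_def random_vector_def
  proof (intro conjI ballI impI mZ prob_gam)
    fix u :: "real vec" assume u: "u \<in> carrier_vec d" "u \<noteq> 0\<^sub>v d"
    define h where "h = (\<lambda>k. u $ k)"
    have e: "0 < s * enorm d h" using s pos[OF u] by (simp add: enorm_eq h_def)
    have "distr (gam d) borel (\<lambda>g. dot d (scale s h) g) = distr std_normal_distribution borel (\<lambda>x. enorm d (scale s h) * x)"
      by (rule gam_dot_distr)
    also have "enorm d (scale s h) = s * enorm d h" using s by (simp add: enorm_eq dot_scale real_sqrt_mult)
    also have "distr std_normal_distribution borel (\<lambda>x. s * enorm d h * x) = density lborel (normal_density 0 (s * enorm d h))"
      using std_affine_normal[OF e, of 0] by simp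
    finally have D: "distr (gam d) borel (\<lambda>g. dot d (scale s h) g) = density lborel (normal_density 0 (s * enorm d h))" .
    have 1: "(\<Sum>k<d. u $ k * Z g k) = dot d (scale s h) g" for g
      unfolding dot_def by (intro sum.cong) (auto simp: Z_def h_def)
    have 2: "sqrt (u \<bullet> (A *\<^sub>v u)) = s * enorm d h"
      using s by (simp add: qA[OF u(1)] real_sqrt_mult enorm_eq h_def)
    show "distributed (gam d) lborel (\<lambda>g. \<Sum>k<d. u $ k * Z g k) (normal_density (\<Sum>k<d. u $ k * 0 k) (sqrt (u \<bullet> (A *\<^sub>v u))))"
      unfolding 1 2 distributed_def using D by (auto cong: distr_cong)
  qed
  have ball: "x + scale s g \<in> eball d x0 \<rho> \<longleftrightarrow> Z g \<in> eball d (\<lambda>k. x0 k - x k) \<rho>" for g \<rho>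
  proof -
    have "L2_set (\<lambda>k. (x + scale s g) k - x0 k) {..<d} = L2_set (\<lambda>k. Z g k - (x0 k - x k)) {..<d}"
      by (intro L2_set_cong) (auto simp: Z_def)
    then show ?thesis by (simp add: eball_def)
  qed
  have meas: "eball d y \<rho> \<in> sets borel" for y \<rho>
  proof -
    have [measurable]: "(\<lambda>x::nat \<Rightarrow> real. x k) \<in> borel_measurable borel" for k by measurable
    show ?thesis unfolding eball_def L2_set_def by measurable
  qed
  have tf: "test_fun d 1 (indicator ?B)"
  proof -
    have "trunc d y \<in> eball d x0 \<rho> \<longleftrightarrow> y \<in> eball d x0 \<rho>" for y \<rho>
    proof -
      have "L2_set (\<lambda>k. trunc d y k - x0 k) {..<d} = L2_set (\<lambda>k. y k - x0 k) {..<d}"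
        by (intro L2_set_cong) (auto simp: trunc_def)
      then show ?thesis by (simp add: eball_def)
    qed
    then show ?thesis unfolding test_fun_def using meas by (auto simp: indicator_def)
  qed
  have "avg (gauss d s) (indicator ?B) x = (\<integral>g. indicator {g. Z g \<in> eball d (\<lambda>k. x0 k - x k) (r + \<epsilon>) - eball d (\<lambda>k. x0 k - x k) r} g \<partial>gam d)"
    unfolding avg_gauss[OF tf] by (intro Bochner_Integration.integral_cong refl) (simp add: indicator_def ball)
  also have "\<dots> = measure (gam d) {g \<in> space (gam d). Z g \<in> eball d (\<lambda>k. x0 k - x k) (r + \<epsilon>) - eball d (\<lambda>k. x0 k - x k) r}"
    by simp
  also have "\<dots> \<le> \<epsilon> * C / s"
    using C d s \<epsilon> r pd gv ev unfolding gaussian_ball_const_def by blast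
  finally show ?thesis .
qed

section \<open>The smoothed indicator of a ball\<close>

text \<open>The sixth power is five times continuously differentiable, so its primitive has the six
  continuous derivatives that the Taylor expansion needs.\<close>

definition bump :: "real \<Rightarrow> real" where
  "bump x = max 0 (x * (1 - x))"

text \<open>Only the point 0 is delicate: there the difference quotient is again a power of the
  positive part.\<close>

lemma pos_part_power_deriv:
  assumes "2 \<le> n"
  shows "((\<lambda>z::real. max 0 z ^ n) has_real_derivative real n * max 0 z ^ (n - 1)) (at z)"
proof -
  have z0: "(0::real) ^ (n - 1) = 0" using assms by (intro zero_power) simp
  consider "0 < z" | "z < 0" | "z = 0" by linarith
  then show ?thesis
  proof cases
    case 1
    have "((\<lambda>z::real. z ^ n) has_real_derivative real n * z ^ (n - 1)) (at z)"
      by (auto intro!: derivative_eq_intros)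
    then have "((\<lambda>z::real. max 0 z ^ n) has_real_derivative real n * z ^ (n - 1)) (at z)"
      by (rule has_field_derivative_transform_within_open[of _ _ _ "{0<..}"]) (use 1 in auto)
    then show ?thesis using 1 by simp
  next
    case 2
    have "((\<lambda>z::real. 0) has_real_derivative 0) (at z)" by simp
    then have "((\<lambda>z::real. max 0 z ^ n) has_real_derivative 0) (at z)"
      by (rule has_field_derivative_transform_within_open[of _ _ _ "{..<0}"]) (use 2 assms in auto)
    moreover have "max 0 z = 0" using 2 by simp
    ultimately show ?thesis by (simp only: z0 mult_zero_right)
  next
    case 3
    have "isCont (\<lambda>h::real. max 0 h ^ (n - 1)) 0" by (intro continuous_intros)
    from this[unfolded isCont_def max.idem z0] have c: "((\<lambda>h::real. max 0 h ^ (n - 1)) \<longlongrightarrow> 0) (at 0)" .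
    have "(max 0 (0 + h) ^ n - max 0 0 ^ n) / h = max 0 h ^ (n - 1)" if "h \<noteq> 0" for h :: real
    proof (cases "0 < h")
      case True
      have "h ^ n = h * h ^ (n - 1)" using assms by (cases n) auto
      then show ?thesis using True assms by (simp add: power_0_left)
    qed (use that assms in \<open>auto simp: power_0_left\<close>)
    then have "((\<lambda>h::real. (max 0 (0 + h) ^ n - max 0 0 ^ n) / h) \<longlongrightarrow> 0) (at 0)"
      using c by (subst LIM_cong[of 0 0 _ "\<lambda>h. max 0 h ^ (n - 1)" 0 0]) auto
    then have "((\<lambda>z::real. max 0 z ^ n) has_real_derivative 0) (at 0)" by (simp add: DERIV_def)
    moreover have "max 0 z = 0" using 3 by simp
    ultimately show ?thesis unfolding 3 by (simp only: z0 mult_zero_right max.idem)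
  qed
qed

lemma bump_power_deriv:
  assumes "2 \<le> n"
  shows "((\<lambda>x. bump x ^ n) has_real_derivative real n * bump x ^ (n - 1) * (1 - 2 * x)) (at x within S)"
proof -
  have "((\<lambda>x::real. x * (1 - x)) has_real_derivative (1 - 2 * x)) (at x within S)"
    by (auto intro!: derivative_eq_intros simp: algebra_simps)
  from DERIV_chain2[OF pos_part_power_deriv[OF assms] this] show ?thesis by (simp add: bump_def)
qed

lemma bump_le: "0 \<le> bump x" "bump x \<le> 1 / 4"
proof -
  have "0 \<le> (x - 1 / 2)\<^sup>2" by simp
  then show "bump x \<le> 1 / 4" by (auto simp: bump_def power2_eq_square algebra_simps max_def)
qed (simp add: bump_def)

lemma bump_eq_0: "x \<le> 0 \<or> 1 \<le> x \<Longrightarrow> bump x = 0"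
proof -
  assume "x \<le> 0 \<or> 1 \<le> x"
  then have "x * (1 - x) \<le> 0"
    using mult_nonpos_nonneg[of x "1 - x"] mult_nonneg_nonpos[of x "1 - x"] by linarith
  then show ?thesis by (simp add: bump_def)
qed

lemma bump_bound: "1 \<le> n \<Longrightarrow> \<bar>bump x ^ n * (1 - 2 * x) ^ m\<bar> \<le> (1 / 4) ^ n"
proof (cases "x \<le> 0 \<or> 1 \<le> x")
  case False
  have "\<bar>1 - 2 * x\<bar> ^ m \<le> 1" using False by (intro power_le_one) auto
  moreover have "bump x ^ n \<le> (1 / 4) ^ n" using bump_le by (intro power_mono)
  ultimately have "bump x ^ n * \<bar>1 - 2 * x\<bar> ^ m \<le> (1 / 4) ^ n * 1"
    using bump_le(1)[of x] by (intro mult_mono) auto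
  then show ?thesis using bump_le(1)[of x] by (simp add: abs_mult power_abs)
qed (auto simp: bump_eq_0 power_0_left)

lemma bump_primitive_exists: "\<exists>F. \<forall>x. (F has_real_derivative bump x ^ 6) (at x)"
proof -
  have "isCont (\<lambda>x. bump x ^ 6) x" for x
    using bump_power_deriv[of 6 x UNIV] DERIV_isCont by auto
  then have "\<exists>F. \<forall>x. - \<infinity> < ereal x \<longrightarrow> ereal x < \<infinity> \<longrightarrow> (F has_vector_derivative bump x ^ 6) (at x)"
    by (intro einterval_antiderivative) auto
  then show ?thesis by (auto simp: has_real_derivative_iff_has_vector_derivative)
qed

definition bump_primitive :: "real \<Rightarrow> real" where
  "bump_primitive = (SOME F. \<forall>x. (F has_real_derivative bump x ^ 6) (at x))"

lemma bump_primitive_deriv: "(bump_primitive has_real_derivative bump x ^ 6) (at x)"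
  using someI_ex[OF bump_primitive_exists] unfolding bump_primitive_def by blast

text \<open>\<open>12012 = 13! / (6!)\<^sup>2\<close> normalises the Beta density \<open>(x (1 - x))\<^sup>6\<close>.\<close>

definition cutoff_deriv :: "nat \<Rightarrow> real \<Rightarrow> real" where
  "cutoff_deriv k x = (let u = bump x; v = 1 - 2 * x in
     if k = 0 then 1 - 12012 * (bump_primitive x - bump_primitive 0)
     else if k = 1 then - 12012 * u ^ 6
     else if k = 2 then - 12012 * (6 * u ^ 5 * v)
     else if k = 3 then - 12012 * (30 * u ^ 4 * v ^ 2 - 12 * u ^ 5)
     else if k = 4 then - 12012 * (120 * u ^ 3 * v ^ 3 - 180 * u ^ 4 * v)
     else if k = 5 then - 12012 * (360 * u ^ 2 * v ^ 4 - 1440 * u ^ 3 * v ^ 2 + 360 * u ^ 4)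
     else - 12012 * (720 * u * v ^ 5 - 7200 * u ^ 2 * v ^ 3 + 7200 * u ^ 3 * v))"

lemma less_6_cases: "k < 6 \<Longrightarrow> (k = 0 \<or> k = 1 \<or> k = 2 \<or> k = 3 \<or> k = 4 \<or> k = (5::nat))"
  by auto

lemma cutoff_deriv_deriv:
  assumes "k < 6"
  shows "(cutoff_deriv k has_real_derivative cutoff_deriv (Suc k) x) (at x)"
proof -
  \<comment> \<open>Powers are treated as units of differentiation, since \<open>bump\<close> itself
    is not differentiable at 0 and 1.\<close>
  define U where "U n = (\<lambda>x. bump x ^ n)" for n
  have U': "(U n has_real_derivative real n * U (n - 1) x * (1 - 2 * x)) (at x)" if "2 \<le> n" for n
    unfolding U_def using bump_power_deriv[OF that] .
  note b = U'[of 2, simplified] U'[of 3, simplified] U'[of 4, simplified] U'[of 5, simplified] U'[of 6, simplified]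
  have U1: "bump x = U 1 x" "bump x = U (Suc 0) x" for x by (simp_all add: U_def)
  have eqs: "cutoff_deriv 1 = (\<lambda>x. - 12012 * U 6 x)"
    "cutoff_deriv 2 = (\<lambda>x. - 12012 * (6 * U 5 x * (1 - 2 * x)))"
    "cutoff_deriv 3 = (\<lambda>x. - 12012 * (30 * U 4 x * (1 - 2 * x) ^ 2 - 12 * U 5 x))"
    "cutoff_deriv 4 = (\<lambda>x. - 12012 * (120 * U 3 x * (1 - 2 * x) ^ 3 - 180 * U 4 x * (1 - 2 * x)))"
    "cutoff_deriv 5 = (\<lambda>x. - 12012 * (360 * U 2 x * (1 - 2 * x) ^ 4 - 1440 * U 3 x * (1 - 2 * x) ^ 2 + 360 * U 4 x))"
    "cutoff_deriv 6 = (\<lambda>x. - 12012 * (720 * U 1 x * (1 - 2 * x) ^ 5 - 7200 * U 2 x * (1 - 2 * x) ^ 3 + 7200 * U 3 x * (1 - 2 * x)))"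
    by (simp_all add: cutoff_deriv_def[abs_def] Let_def U_def)
  have Suc: "Suc 0 = 1" "Suc 1 = 2" "Suc 2 = 3" "Suc 3 = 4" "Suc 4 = 5" "Suc 5 = 6" by simp_all
  show ?thesis
    using less_6_cases[OF assms]
  proof (elim disjE)
    assume [simp]: "k = 0"
    show ?thesis
      unfolding cutoff_deriv_def[abs_def] Let_def by (auto intro!: derivative_eq_intros bump_primitive_deriv)
  next
    assume k: "k = 1"
    show ?thesis unfolding k Suc eqs
      by (rule derivative_eq_intros b refl)+ simp
  next
    assume k: "k = 2"
    show ?thesis unfolding k Suc eqs
      by (rule derivative_eq_intros b refl)+ (simp add: power_numeral_reduce algebra_simps)
  next
    assume k: "k = 3"
    show ?thesis unfolding k Suc eqs
      by (rule derivative_eq_intros b refl)+ (simp add: power_numeral_reduce algebra_simps)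
  next
    assume k: "k = 4"
    show ?thesis unfolding k Suc eqs
      by (rule derivative_eq_intros b refl)+ (simp add: power_numeral_reduce algebra_simps)
  next
    assume k: "k = 5"
    show ?thesis unfolding k Suc eqs
      by (rule derivative_eq_intros b refl)+ (simp add: power_numeral_reduce algebra_simps)
  qed
qed

lemma cutoff_deriv_outside: "1 \<le> k \<Longrightarrow> x \<le> 0 \<or> 1 \<le> x \<Longrightarrow> cutoff_deriv k x = 0"
  by (simp add: cutoff_deriv_def bump_eq_0 Let_def)

text \<open>The largest bound is that of order 6, namely 12012 * (720 / 4 + 7200 / 16 + 7200 / 64),
  which is just below 9000000.\<close>

lemma cutoff_deriv_bound:
  assumes "1 \<le> k"
  shows "\<bar>cutoff_deriv k x\<bar> \<le> 9000000"
proof -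
  have B60: "\<bar>bump x ^ 6\<bar> \<le> 1 / 4096"
    using bump_bound[of 6 x 0] by (simp add: power_divide)
  have B51: "\<bar>bump x ^ 5 * (1 - 2 * x)\<bar> \<le> 1 / 1024"
    using bump_bound[of 5 x 1] by (simp add: power_divide)
  have B50: "\<bar>bump x ^ 5\<bar> \<le> 1 / 1024"
    using bump_bound[of 5 x 0] by (simp add: power_divide)
  have B42: "\<bar>bump x ^ 4 * (1 - 2 * x) ^ 2\<bar> \<le> 1 / 256"
    using bump_bound[of 4 x 2] by (simp add: power_divide)
  have B41: "\<bar>bump x ^ 4 * (1 - 2 * x)\<bar> \<le> 1 / 256"
    using bump_bound[of 4 x 1] by (simp add: power_divide)
  have B40: "\<bar>bump x ^ 4\<bar> \<le> 1 / 256"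
    using bump_bound[of 4 x 0] by (simp add: power_divide)
  have B33: "\<bar>bump x ^ 3 * (1 - 2 * x) ^ 3\<bar> \<le> 1 / 64"
    using bump_bound[of 3 x 3] by (simp add: power_divide)
  have B32: "\<bar>bump x ^ 3 * (1 - 2 * x) ^ 2\<bar> \<le> 1 / 64"
    using bump_bound[of 3 x 2] by (simp add: power_divide)
  have B31: "\<bar>bump x ^ 3 * (1 - 2 * x)\<bar> \<le> 1 / 64"
    using bump_bound[of 3 x 1] by (simp add: power_divide)
  have B24: "\<bar>bump x ^ 2 * (1 - 2 * x) ^ 4\<bar> \<le> 1 / 16"
    using bump_bound[of 2 x 4] by (simp add: power_divide)
  have B23: "\<bar>bump x ^ 2 * (1 - 2 * x) ^ 3\<bar> \<le> 1 / 16"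
    using bump_bound[of 2 x 3] by (simp add: power_divide)
  have B15: "\<bar>bump x * (1 - 2 * x) ^ 5\<bar> \<le> 1 / 4"
    using bump_bound[of 1 x 5] by (simp add: power_divide)
  have aux3: "\<bar>t\<bar> \<le> 9000000" if "t = - 12012 * (30 * a - 12 * b)" "\<bar>a\<bar> \<le> 1 / 256" "\<bar>b\<bar> \<le> 1 / 1024" for t a b :: real
    using that by (auto simp: abs_le_iff)
  have aux4: "\<bar>t\<bar> \<le> 9000000" if "t = - 12012 * (120 * a - 180 * b)" "\<bar>a\<bar> \<le> 1 / 64" "\<bar>b\<bar> \<le> 1 / 256" for t a b :: real
    using that by (auto simp: abs_le_iff)
  have aux5: "\<bar>t\<bar> \<le> 9000000" if "t = - 12012 * (360 * a - 1440 * b + 360 * c)" "\<bar>a\<bar> \<le> 1 / 16" "\<bar>b\<bar> \<le> 1 / 64" "\<bar>c\<bar> \<le> 1 / 256" for t a b c :: real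
    using that by (auto simp: abs_le_iff)
  have aux6: "\<bar>t\<bar> \<le> 9000000" if "t = - 12012 * (720 * a - 7200 * b + 7200 * c)" "\<bar>a\<bar> \<le> 1 / 4" "\<bar>b\<bar> \<le> 1 / 16" "\<bar>c\<bar> \<le> 1 / 64" for t a b c :: real
    using that by (auto simp: abs_le_iff)
  have "k = 1 \<or> k = 2 \<or> k = 3 \<or> k = 4 \<or> k = 5 \<or> 6 \<le> k" using assms by auto
  then show ?thesis
  proof (elim disjE)
    assume k: "k = 1"
    have "cutoff_deriv k x = - 12012 * (bump x ^ 6)" by (simp add: k cutoff_deriv_def Let_def)
    then show ?thesis using B60 by linarith
  next
    assume k: "k = 2"
    have "cutoff_deriv k x = - 12012 * (6 * (bump x ^ 5 * (1 - 2 * x)))" by (simp add: k cutoff_deriv_def Let_def)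
    then show ?thesis using B51 by linarith
  next
    assume k: "k = 3"
    have "cutoff_deriv k x = - 12012 * (30 * (bump x ^ 4 * (1 - 2 * x) ^ 2) - 12 * bump x ^ 5)"
      by (simp add: k cutoff_deriv_def Let_def)
    then show ?thesis by (rule aux3[OF _ B42 B50])
  next
    assume k: "k = 4"
    have "cutoff_deriv k x = - 12012 * (120 * (bump x ^ 3 * (1 - 2 * x) ^ 3) - 180 * (bump x ^ 4 * (1 - 2 * x)))"
      by (simp add: k cutoff_deriv_def Let_def)
    then show ?thesis by (rule aux4[OF _ B33 B41])
  next
    assume k: "k = 5"
    have "cutoff_deriv k x = - 12012 * (360 * (bump x ^ 2 * (1 - 2 * x) ^ 4) - 1440 * (bump x ^ 3 * (1 - 2 * x) ^ 2) + 360 * bump x ^ 4)"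
      by (simp add: k cutoff_deriv_def Let_def)
    then show ?thesis by (rule aux5[OF _ B24 B32 B40])
  next
    assume k: "6 \<le> k"
    have "cutoff_deriv k x = - 12012 * (720 * (bump x * (1 - 2 * x) ^ 5) - 7200 * (bump x ^ 2 * (1 - 2 * x) ^ 3) + 7200 * (bump x ^ 3 * (1 - 2 * x)))"
      using k by (simp add: cutoff_deriv_def Let_def)
    then show ?thesis by (rule aux6[OF _ B15 B23 B31])
  qed
qed

lemma cutoff_0:
  shows "x \<le> 0 \<Longrightarrow> cutoff_deriv 0 x = 1" and "1 \<le> x \<Longrightarrow> cutoff_deriv 0 x = 0"
    and "0 \<le> cutoff_deriv 0 x" and "cutoff_deriv 0 x \<le> 1"
proof -
  let ?F = bump_primitive
  have mono: "?F a \<le> ?F b" if "a \<le> b" for a b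
    by (rule DERIV_nonneg_imp_nondecreasing[OF that]) (meson bump_primitive_deriv bump_le(1) zero_le_power)
  have const: "?F a = ?F b" if "a \<le> b" "b \<le> 0 \<or> 1 \<le> a" for a b
  proof (cases "a = b")
    case False
    then have ab: "a < b" using that by simp
    have z: "(?F has_real_derivative 0) (at x)" if "a \<le> x" "x \<le> b" for x
      using bump_primitive_deriv[of x] bump_eq_0[of x] that \<open>b \<le> 0 \<or> 1 \<le> a\<close> by (auto simp: field_simps)
    show ?thesis
      by (rule DERIV_isconst_end[OF ab, symmetric])
         (auto intro!: continuous_at_imp_continuous_on DERIV_isCont[OF bump_primitive_deriv] z)
  qed simp
  \<comment> \<open>An explicit primitive of the polynomial with which \<open>bump ^ 6\<close>
    agrees on [0, 1]; it evaluates the total mass.\<close>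
  define P where "P x = x ^ 7 / 7 - 6 * x ^ 8 / 8 + 15 * x ^ 9 / 9 - 20 * x ^ 10 / 10 + 15 * x ^ 11 / 11 - 6 * x ^ 12 / 12 + x ^ 13 / 13" for x :: real
  have P': "(P has_real_derivative (x * (1 - x)) ^ 6) (at x)" for x
    unfolding P_def by (auto intro!: derivative_eq_intros simp: power_numeral_reduce algebra_simps)
  have "?F 1 - P 1 = ?F 0 - P 0"
  proof (rule DERIV_isconst_end[where f="\<lambda>x. ?F x - P x"])
    show "continuous_on {0..1} (\<lambda>x. ?F x - P x)"
      by (intro continuous_on_diff continuous_at_imp_continuous_on ballI DERIV_isCont[OF bump_primitive_deriv] DERIV_isCont[OF P'])
    fix x :: real assume "0 < x" "x < 1"
    then have "bump x = x * (1 - x)" by (simp add: bump_def)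
    then show "((\<lambda>x. ?F x - P x) has_real_derivative 0) (at x)"
      using DERIV_diff[OF bump_primitive_deriv P', of x] by simp
  qed simp
  then have total: "?F 1 - ?F 0 = 1 / 12012" by (simp add: P_def)
  show 1: "x \<le> 0 \<Longrightarrow> cutoff_deriv 0 x = 1" using const[of x 0] by (simp add: cutoff_deriv_def)
  show 0: "1 \<le> x \<Longrightarrow> cutoff_deriv 0 x = 0" using const[of 1 x] total by (simp add: cutoff_deriv_def)
  show "cutoff_deriv 0 x \<le> 1"
  proof (cases "x \<le> 0")
    case False
    then have "?F 0 \<le> ?F x" using mono[of 0 x] by simp
    then show ?thesis by (simp add: cutoff_deriv_def)
  qed (simp add: 1)
  show "0 \<le> cutoff_deriv 0 x"
  proof (cases "1 \<le> x")
    case False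
    then have "?F x \<le> ?F 1" using mono[of x 1] by simp
    then show ?thesis using total by (simp add: cutoff_deriv_def)
  qed (simp add: 0)
qed

text \<open>
  Faa di Bruno for an outer function with derivatives \<open>w 0, w 1, \<dots>\<close> and an inner quadratic
  with first derivative \<open>p\<close> and constant second derivative \<open>s\<close>.
\<close>

definition quad_chain :: "(nat \<Rightarrow> real) \<Rightarrow> real \<Rightarrow> real \<Rightarrow> nat \<Rightarrow> real" where
  "quad_chain w p s k =
    (if k = 0 then w 0
     else if k = 1 then w 1 * p
     else if k = 2 then w 2 * p ^ 2 + w 1 * s
     else if k = 3 then w 3 * p ^ 3 + 3 * w 2 * p * s
     else if k = 4 then w 4 * p ^ 4 + 6 * w 3 * p ^ 2 * s + 3 * w 2 * s ^ 2
     else if k = 5 then w 5 * p ^ 5 + 10 * w 4 * p ^ 3 * s + 15 * w 3 * p * s ^ 2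
     else w 6 * p ^ 6 + 15 * w 5 * p ^ 4 * s + 45 * w 4 * p ^ 2 * s ^ 2 + 15 * w 3 * s ^ 3)"

text \<open>The partial derivative of \<open>quad_chain\<close> with respect to p. Differentiating
  the outer function instead shifts the sequence w.\<close>

definition quad_chain_p :: "(nat \<Rightarrow> real) \<Rightarrow> real \<Rightarrow> real \<Rightarrow> nat \<Rightarrow> real" where
  "quad_chain_p w p s k =
    (if k = 0 then 0
     else if k = 1 then w 1
     else if k = 2 then 2 * w 2 * p
     else if k = 3 then 3 * w 3 * p ^ 2 + 3 * w 2 * s
     else if k = 4 then 4 * w 4 * p ^ 3 + 12 * w 3 * p * s
     else 5 * w 5 * p ^ 4 + 30 * w 4 * p ^ 2 * s + 15 * w 3 * s ^ 2)"

lemma quad_chain_Suc: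
  assumes "k < 6"
  shows "quad_chain (\<lambda>i. w (Suc i)) p s k * p + quad_chain_p w p s k * s = quad_chain w p s (Suc k)"
  using less_6_cases[OF assms]
  by (elim disjE) (simp_all add: quad_chain_def quad_chain_p_def eval_nat_numeral algebra_simps)

text \<open>The derivatives q' and p' are left free, so that the formula serves both along a line,
  where q' = p and p' = s, and for partial derivatives in one coordinate.\<close>

lemma quad_chain_deriv:
  assumes k: "k < 6" and w: "\<And>i. i \<le> k \<Longrightarrow> (w i has_real_derivative w (Suc i) (q t)) (at (q t))"
    and q: "(q has_real_derivative q') (at t within S)" and p: "(p has_real_derivative p') (at t within S)"
  shows "((\<lambda>t. quad_chain (\<lambda>i. w i (q t)) (p t) s k) has_real_derivative
    quad_chain (\<lambda>i. w (Suc i) (q t)) (p t) s k * q' + quad_chain_p (\<lambda>i. w i (q t)) (p t) s k * p') (at t within S)"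
proof -
  have c: "((\<lambda>t. w i (q t)) has_real_derivative w (Suc i) (q t) * q') (at t within S)" if "i \<le> k" for i
    by (rule DERIV_chain2[OF w[OF that] q])
  show ?thesis
    using less_6_cases[OF k]
  proof (elim disjE)
    assume [simp]: "k = 0"
    show ?thesis unfolding quad_chain_def quad_chain_p_def using c[of 0] by simp
  next
    assume [simp]: "k = 1"
    show ?thesis unfolding quad_chain_def quad_chain_p_def using c[of 1] p
      by (auto intro!: derivative_eq_intros simp: algebra_simps)
  next
    assume [simp]: "k = 2"
    show ?thesis unfolding quad_chain_def quad_chain_p_def using c[of 1] c[of 2] p
      by (auto intro!: derivative_eq_intros simp: algebra_simps eval_nat_numeral)
  next
    assume [simp]: "k = 3"
    show ?thesis unfolding quad_chain_def quad_chain_p_def using c[of 2] c[of 3] p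
      by (auto intro!: derivative_eq_intros simp: algebra_simps eval_nat_numeral)
  next
    assume [simp]: "k = 4"
    show ?thesis unfolding quad_chain_def quad_chain_p_def using c[of 2] c[of 3] c[of 4] p
      by (auto intro!: derivative_eq_intros simp: algebra_simps eval_nat_numeral)
  next
    assume [simp]: "k = 5"
    show ?thesis unfolding quad_chain_def quad_chain_p_def using c[of 3] c[of 4] c[of 5] p
      by (auto intro!: derivative_eq_intros simp: algebra_simps eval_nat_numeral)
  qed
qed

text \<open>The worst order is 6, where the coefficients add up to 2^6 + 15 * 2^5 + 45 * 2^4 + 15 *
  2^3 = 1384.\<close>

lemma quad_chain_bound:
  assumes w: "\<And>i. 1 \<le> i \<Longrightarrow> \<bar>w i\<bar> \<le> B" and k: "1 \<le> k" "k \<le> 6" and p: "\<bar>p\<bar> \<le> 2 * H" and s: "\<bar>s\<bar> \<le> 2 * H ^ 2" and H: "0 \<le> H"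
  shows "\<bar>quad_chain w p s k\<bar> \<le> 1384 * B * H ^ k"
proof -
  have B: "0 \<le> B" using w[of 1] by linarith
  have m: "\<bar>w i * (p ^ a * s ^ b)\<bar> \<le> B * (2 ^ (a + b) * H ^ (a + 2 * b))" if "1 \<le> i" for i a b
  proof -
    have "\<bar>p\<bar> ^ a * \<bar>s\<bar> ^ b \<le> (2 * H) ^ a * (2 * H ^ 2) ^ b"
      using p s H by (intro mult_mono power_mono) auto
    also have "\<dots> = 2 ^ (a + b) * H ^ (a + 2 * b)"
      by (simp add: power_mult_distrib power_add power_mult)
    finally have "\<bar>p\<bar> ^ a * \<bar>s\<bar> ^ b \<le> 2 ^ (a + b) * H ^ (a + 2 * b)" .
    from mult_mono[OF w[OF that] this B] show ?thesis by (simp add: abs_mult power_abs)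
  qed
  have nn: "0 \<le> B * H ^ k" using B H by simp
  have "k = 1 \<or> k = 2 \<or> k = 3 \<or> k = 4 \<or> k = 5 \<or> k = 6" using k by auto
  then show ?thesis
  proof (elim disjE)
    assume [simp]: "k = 1"
    show ?thesis using m[of 1 1 0] nn by (simp add: quad_chain_def)
  next
    assume [simp]: "k = 2"
    show ?thesis using m[of 2 2 0] m[of 1 0 1] nn by (simp add: quad_chain_def power2_eq_square)
  next
    assume [simp]: "k = 3"
    show ?thesis using m[of 3 3 0] m[of 2 1 1] nn by (simp add: quad_chain_def mult.assoc power3_eq_cube)
  next
    assume [simp]: "k = 4"
    show ?thesis using m[of 4 4 0] m[of 3 2 1] m[of 2 0 2] nn by (simp add: quad_chain_def mult.assoc)
  next
    assume [simp]: "k = 5"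
    show ?thesis using m[of 5 5 0] m[of 4 3 1] m[of 3 1 2] nn power_Suc[of H 4] by (simp add: quad_chain_def mult.assoc)
  next
    assume [simp]: "k = 6"
    show ?thesis using m[of 6 6 0] m[of 5 4 1] m[of 4 2 2] m[of 3 0 3] nn by (simp add: quad_chain_def mult.assoc)
  qed
qed

text \<open>Affine in the squared distance, 0 on the sphere of radius r and 1 on that of radius r +
  \<epsilon>. Along any line it is a quadratic polynomial, to which \<open>quad_chain\<close>
  applies.\<close>

definition ball_level :: "nat \<Rightarrow> (nat \<Rightarrow> real) \<Rightarrow> real \<Rightarrow> real \<Rightarrow> (nat \<Rightarrow> real) \<Rightarrow> real" where
  "ball_level d x0 r \<epsilon> x = (nsq d (x - x0) - r\<^sup>2) / (\<epsilon>\<^sup>2 + 2 * r * \<epsilon>)"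

definition soft_ball :: "nat \<Rightarrow> (nat \<Rightarrow> real) \<Rightarrow> real \<Rightarrow> real \<Rightarrow> (nat \<Rightarrow> real) \<Rightarrow> real" where
  "soft_ball d x0 r \<epsilon> x = cutoff_deriv 0 (ball_level d x0 r \<epsilon> x)"

abbreviation annulus :: "nat \<Rightarrow> (nat \<Rightarrow> real) \<Rightarrow> real \<Rightarrow> real \<Rightarrow> (nat \<Rightarrow> real) set" where
  "annulus d x0 r \<epsilon> \<equiv> eball d x0 (r + \<epsilon>) - eball d x0 r"

lemma eball_iff: "0 \<le> r \<Longrightarrow> x \<in> eball d x0 r \<longleftrightarrow> nsq d (x - x0) \<le> r\<^sup>2"
proof -
  assume r: "0 \<le> r"
  have "L2_set (\<lambda>k. x k - x0 k) {..<d} = sqrt (nsq d (x - x0))"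
    by (simp add: L2_set_def dot_def power2_eq_square)
  then have "x \<in> eball d x0 r \<longleftrightarrow> sqrt (nsq d (x - x0)) \<le> r" by (simp add: eball_def)
  also have "\<dots> \<longleftrightarrow> nsq d (x - x0) \<le> r\<^sup>2" using r by (simp add: real_sqrt_le_iff')
  finally show ?thesis .
qed

lemma eball_trunc: "trunc d y \<in> eball d x0 r \<longleftrightarrow> y \<in> eball d x0 r"
proof -
  have "L2_set (\<lambda>k. trunc d y k - x0 k) {..<d} = L2_set (\<lambda>k. y k - x0 k) {..<d}"
    by (intro L2_set_cong) (auto simp: trunc_def)
  then show ?thesis by (simp add: eball_def)
qed

lemma measurable_fun_minus [measurable (raw)]:
  fixes f g :: "'a \<Rightarrow> nat \<Rightarrow> real"
  assumes [measurable]: "f \<in> borel_measurable M" "g \<in> borel_measurable M"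
  shows "(\<lambda>x. f x - g x) \<in> borel_measurable M"
proof (rule measurable_coordinatewise_then_product)
  fix i
  have "(\<lambda>x. f x i) \<in> borel_measurable M" "(\<lambda>x. g x i) \<in> borel_measurable M"
    by (auto intro: measurable_coord assms)
  then show "(\<lambda>x. (f x - g x) i) \<in> borel_measurable M" by simp
qed

lemma eball_sets [measurable]: "eball d y r \<in> sets borel"
proof -
  have [measurable]: "(\<lambda>x::nat \<Rightarrow> real. x k) \<in> borel_measurable borel" for k by measurable
  show ?thesis unfolding eball_def L2_set_def by measurable
qed

lemma test_fun_eball: "test_fun d 1 (indicator (eball d x0 r))"
  by (auto simp: test_fun_def indicator_def eball_trunc)

lemma test_fun_annulus: "test_fun d 1 (indicator (annulus d x0 r \<epsilon>))"
  by (auto simp: test_fun_def indicator_def eball_trunc)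

lemma ball_level_bounds:
  assumes r: "0 \<le> r" and \<epsilon>: "0 < \<epsilon>"
  shows "ball_level d x0 r \<epsilon> x \<le> 0 \<longleftrightarrow> x \<in> eball d x0 r"
    and "1 < ball_level d x0 r \<epsilon> x \<longleftrightarrow> x \<notin> eball d x0 (r + \<epsilon>)"
proof -
  have D: "0 < \<epsilon>\<^sup>2 + 2 * r * \<epsilon>" using assms by (intro add_pos_nonneg) auto
  show "ball_level d x0 r \<epsilon> x \<le> 0 \<longleftrightarrow> x \<in> eball d x0 r"
    using D r by (simp add: ball_level_def eball_iff divide_le_0_iff)
  show "1 < ball_level d x0 r \<epsilon> x \<longleftrightarrow> x \<notin> eball d x0 (r + \<epsilon>)"
    using D r \<epsilon> by (simp add: ball_level_def eball_iff less_divide_eq power2_eq_square algebra_simps not_le)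
qed

lemma soft_ball_bounds:
  assumes "0 \<le> r" "0 < \<epsilon>"
  shows "indicator (eball d x0 r) x \<le> soft_ball d x0 r \<epsilon> x" "soft_ball d x0 r \<epsilon> x \<le> indicator (eball d x0 (r + \<epsilon>)) x"
  using ball_level_bounds[OF assms, of d x0 x] cutoff_0[of "ball_level d x0 r \<epsilon> x"]
  by (auto simp: soft_ball_def indicator_def)

lemma measurable_cutoff_deriv [measurable]: "cutoff_deriv k \<in> borel_measurable borel"
proof -
  have "isCont bump_primitive x" for x using DERIV_isCont[OF bump_primitive_deriv] .
  then have [measurable]: "bump_primitive \<in> borel_measurable borel"
    by (intro borel_measurable_continuous_onI continuous_at_imp_continuous_on) auto
  have [measurable]: "bump \<in> borel_measurable borel" unfolding bump_def[abs_def] by measurable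
  show ?thesis unfolding cutoff_deriv_def[abs_def] Let_def by (cases "k = 0") simp_all
qed

lemma measurable_ball_level [measurable (raw)]:
  assumes [measurable]: "f \<in> borel_measurable M"
  shows "(\<lambda>x. ball_level d x0 r \<epsilon> (f x)) \<in> borel_measurable M"
  unfolding ball_level_def by measurable

lemma trunc_minus: "trunc d (x - y) = trunc d x - trunc d y"
  by (auto simp: trunc_def)

lemma test_fun_soft_ball: "test_fun d 1 (soft_ball d x0 r \<epsilon>)"
proof -
  have "nsq d (trunc d x - x0) = nsq d (x - x0)" for x
  proof -
    have "nsq d (trunc d x - x0) = nsq d (trunc d (trunc d x - x0))" by simp
    also have "trunc d (trunc d x - x0) = trunc d (x - x0)" by (simp only: trunc_minus trunc_trunc)
    finally show ?thesis by (simp only: dot_trunc)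
  qed
  then show ?thesis
    unfolding test_fun_def soft_ball_def[abs_def]
    using cutoff_0(3,4) by (auto simp: ball_level_def[abs_def] abs_of_nonneg)
qed

definition soft_deriv :: "nat \<Rightarrow> (nat \<Rightarrow> real) \<Rightarrow> real \<Rightarrow> real \<Rightarrow> (nat \<Rightarrow> real) \<Rightarrow> (nat \<Rightarrow> real) \<Rightarrow> nat \<Rightarrow> real" where
  "soft_deriv d x0 r \<epsilon> y h k = quad_chain (\<lambda>i. cutoff_deriv i (ball_level d x0 r \<epsilon> y))
     (2 * dot d h (y - x0) / (\<epsilon>\<^sup>2 + 2 * r * \<epsilon>)) (2 * nsq d h / (\<epsilon>\<^sup>2 + 2 * r * \<epsilon>)) k"

lemma soft_deriv_0: "soft_deriv d x0 r \<epsilon> y h 0 = soft_ball d x0 r \<epsilon> y"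
  by (simp add: soft_deriv_def quad_chain_def soft_ball_def)

lemma nsq_line: "nsq d (y + scale t h - x0) = nsq d (y - x0) + 2 * t * dot d h (y - x0) + t\<^sup>2 * nsq d h"
proof -
  have "y + scale t h - x0 = (y - x0) + scale t h" by auto
  then show ?thesis
    by (simp only: dot_add dot_scale dot_commute[of d "y - x0" h]) (simp add: power2_eq_square algebra_simps)
qed

lemma dot_line: "dot d h (y + scale t h - x0) = dot d h (y - x0) + t * nsq d h"
proof -
  have "y + scale t h - x0 = (y - x0) + scale t h" by auto
  then show ?thesis by (simp only: dot_add dot_scale)
qed

lemma soft_deriv_line:
  assumes m: "m < 6"
  shows "((\<lambda>t. soft_deriv d x0 r \<epsilon> (y + scale t h) h m) has_real_derivative
     soft_deriv d x0 r \<epsilon> (y + scale t h) h (Suc m)) (at t within S)"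
proof -
  define D where "D = \<epsilon>\<^sup>2 + 2 * r * \<epsilon>"
  define q where "q t = ball_level d x0 r \<epsilon> (y + scale t h)" for t
  define p where "p t = 2 * dot d h (y + scale t h - x0) / D" for t
  define s where "s = 2 * nsq d h / D"
  have "((\<lambda>t. nsq d (y - x0) + 2 * t * dot d h (y - x0) + t\<^sup>2 * nsq d h - r\<^sup>2) has_real_derivative
      2 * (dot d h (y - x0) + t * nsq d h)) (at t within S)"
    by (auto intro!: derivative_eq_intros simp: algebra_simps)
  from DERIV_cdivide[OF this, of D] have q': "(q has_real_derivative p t) (at t within S)"
    unfolding q_def p_def ball_level_def nsq_line dot_line D_def[symmetric] .
  have "((\<lambda>t. 2 * (dot d h (y - x0) + t * nsq d h)) has_real_derivative 2 * nsq d h) (at t within S)"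
    by (auto intro!: derivative_eq_intros)
  from DERIV_cdivide[OF this, of D] have p': "(p has_real_derivative s) (at t within S)"
    unfolding p_def s_def dot_line .
  have "((\<lambda>t. quad_chain (\<lambda>i. cutoff_deriv i (q t)) (p t) s m) has_real_derivative
    quad_chain (\<lambda>i. cutoff_deriv (Suc i) (q t)) (p t) s m * p t + quad_chain_p (\<lambda>i. cutoff_deriv i (q t)) (p t) s m * s) (at t within S)"
    using m by (intro quad_chain_deriv q' p' cutoff_deriv_deriv) auto
  then show ?thesis
    unfolding quad_chain_Suc[OF m, of "\<lambda>i. cutoff_deriv i (q t)"]
    by (simp add: soft_deriv_def q_def p_def s_def D_def)
qed

lemma quad_chain_zero: "1 \<le> k \<Longrightarrow> (\<And>i. 1 \<le> i \<Longrightarrow> w i = 0) \<Longrightarrow> quad_chain w p s k = 0"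
  by (simp add: quad_chain_def)

text \<open>The bounds do not depend on r: the slope is at most 2 (r + \<epsilon>) |h| / D, and D =
  \<epsilon> (2 r + \<epsilon>) dominates both \<epsilon> (r + \<epsilon>) and \<epsilon>^2.\<close>

lemma annulus_chain_bounds:
  assumes r: "0 \<le> r" and \<epsilon>: "0 < \<epsilon>" and y: "y \<in> eball d x0 (r + \<epsilon>)"
  shows "\<bar>2 * dot d h (y - x0) / (\<epsilon>\<^sup>2 + 2 * r * \<epsilon>)\<bar> \<le> 2 * (enorm d h / \<epsilon>)"
    and "\<bar>2 * nsq d h / (\<epsilon>\<^sup>2 + 2 * r * \<epsilon>)\<bar> \<le> 2 * (enorm d h / \<epsilon>) ^ 2"
proof -
  define D where "D = \<epsilon>\<^sup>2 + 2 * r * \<epsilon>"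
  have D: "\<epsilon> * (r + \<epsilon>) \<le> D" "\<epsilon>\<^sup>2 \<le> D" using r \<epsilon> by (simp_all add: D_def power2_eq_square algebra_simps)
  have D0: "0 < D" using D(2) \<epsilon> by (metis order_less_le_trans zero_less_power)
  have "enorm d (y - x0) \<le> r + \<epsilon>"
    using y r \<epsilon> by (simp add: eball_iff enorm_eq real_le_lsqrt)
  then have "\<bar>dot d h (y - x0)\<bar> \<le> enorm d h * (r + \<epsilon>)"
    by (intro order_trans[OF dot_eq_enorm_bound] mult_left_mono) auto
  then have "\<bar>dot d h (y - x0)\<bar> / D \<le> enorm d h * (r + \<epsilon>) / (\<epsilon> * (r + \<epsilon>))"
    using D r \<epsilon> by (intro frac_le) auto
  also have "\<dots> = enorm d h / \<epsilon>" using r \<epsilon> by (simp add: add_nonneg_eq_0_iff)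
  finally show "\<bar>2 * dot d h (y - x0) / (\<epsilon>\<^sup>2 + 2 * r * \<epsilon>)\<bar> \<le> 2 * (enorm d h / \<epsilon>)"
    using D0 by (simp add: D_def[symmetric] abs_mult)
  have "nsq d h / D \<le> nsq d h / \<epsilon>\<^sup>2" using D \<epsilon> by (intro frac_le) auto
  then show "\<bar>2 * nsq d h / (\<epsilon>\<^sup>2 + 2 * r * \<epsilon>)\<bar> \<le> 2 * (enorm d h / \<epsilon>) ^ 2"
    using D0 by (simp add: D_def[symmetric] power_divide enorm_sq abs_mult)
qed

text \<open>The constant is 1384 * 9000000. The indicator of the annulus is essential, because its
  small probability is what makes smoothed exchanges cheap.\<close>

lemma soft_deriv_bound:
  assumes r: "0 \<le> r" and \<epsilon>: "0 < \<epsilon>" and k: "1 \<le> k" "k \<le> 6"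
  shows "\<bar>soft_deriv d x0 r \<epsilon> y h k\<bar> \<le> 12456000000 * (enorm d h / \<epsilon>) ^ k * indicator (annulus d x0 r \<epsilon>) y"
proof (cases "y \<in> annulus d x0 r \<epsilon>")
  case False
  then have "ball_level d x0 r \<epsilon> y \<le> 0 \<or> 1 < ball_level d x0 r \<epsilon> y"
    using ball_level_bounds[OF r \<epsilon>, of d x0 y] by auto
  then have "cutoff_deriv i (ball_level d x0 r \<epsilon> y) = 0" if "1 \<le> i" for i
    using cutoff_deriv_outside[OF that] by auto
  then show ?thesis using False k by (simp add: soft_deriv_def quad_chain_zero)
next
  case True
  have "\<bar>soft_deriv d x0 r \<epsilon> y h k\<bar> \<le> 1384 * 9000000 * (enorm d h / \<epsilon>) ^ k"
    unfolding soft_deriv_def using True annulus_chain_bounds[OF r \<epsilon>, of y d x0 h] \<epsilon> k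
    by (intro quad_chain_bound cutoff_deriv_bound) auto
  then show ?thesis using True by simp
qed

lemma soft_deriv_hom_poly:
  assumes "i < 6"
  shows "hom_poly d i (\<lambda>h. soft_deriv d x0 r \<epsilon> y h i)"
proof -
  define D where "D = \<epsilon>\<^sup>2 + 2 * r * \<epsilon>"
  define w where "w i = cutoff_deriv i (ball_level d x0 r \<epsilon> y)" for i
  have p: "hom_poly d 1 (\<lambda>h. 2 * dot d h (y - x0) / D)"
    using hom_poly_cmult[OF hom_poly_dot, of d "2 / D" "y - x0"] by (simp add: dot_commute)
  have s: "hom_poly d 2 (\<lambda>h. 2 * nsq d h / D)"
    using hom_poly_cmult[OF hom_poly_nsq, of d "2 / D"] by simp
  have ps: "hom_poly d k (\<lambda>h. c * ((2 * dot d h (y - x0) / D) ^ a * (2 * nsq d h / D) ^ b))" if "k = a + 2 * b" for a b c k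
    unfolding that using hom_poly_cmult[OF hom_poly_mult[OF hom_poly_power[OF p, of a] hom_poly_power[OF s, of b]], of c]
    by (simp add: mult.commute)
  let ?F = "\<lambda>h. soft_deriv d x0 r \<epsilon> y h i" and ?P = "\<lambda>h. 2 * dot d h (y - x0) / D" and ?S = "\<lambda>h. 2 * nsq d h / D"
  have F: "soft_deriv d x0 r \<epsilon> y h i = quad_chain w (?P h) (?S h) i" for h
    by (simp add: soft_deriv_def w_def[abs_def] D_def)
  show ?thesis
    using less_6_cases[OF assms]
  proof (elim disjE)
    assume k: "i = 0"
    show ?thesis unfolding F unfolding k quad_chain_def using hom_poly_const[of d "w 0"] by simp
  next
    assume k: "i = 1"
    have "?F h = w 1 * (?P h ^ 1 * ?S h ^ 0)" for h unfolding F by (simp add: k quad_chain_def)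
    then show ?thesis using ps[of 1 1 0 "w 1"] unfolding k by simp
  next
    assume k: "i = 2"
    have "?F h = w 2 * (?P h ^ 2 * ?S h ^ 0) + w 1 * (?P h ^ 0 * ?S h ^ 1)" for h unfolding F by (simp add: k quad_chain_def)
    moreover have "hom_poly d 2 (\<lambda>h. w 2 * (?P h ^ 2 * ?S h ^ 0) + w 1 * (?P h ^ 0 * ?S h ^ 1))"
      by (intro hom_poly_add ps) simp_all
    ultimately show ?thesis unfolding k by simp
  next
    assume k: "i = 3"
    have "?F h = w 3 * (?P h ^ 3 * ?S h ^ 0) + (3 * w 2) * (?P h ^ 1 * ?S h ^ 1)" for h unfolding F by (simp add: k quad_chain_def)
    moreover have "hom_poly d 3 (\<lambda>h. w 3 * (?P h ^ 3 * ?S h ^ 0) + (3 * w 2) * (?P h ^ 1 * ?S h ^ 1))"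
      by (intro hom_poly_add ps) simp_all
    ultimately show ?thesis unfolding k by simp
  next
    assume k: "i = 4"
    have "?F h = w 4 * (?P h ^ 4 * ?S h ^ 0) + (6 * w 3) * (?P h ^ 2 * ?S h ^ 1) + (3 * w 2) * (?P h ^ 0 * ?S h ^ 2)" for h
      unfolding F by (simp add: k quad_chain_def)
    moreover have "hom_poly d 4 (\<lambda>h. w 4 * (?P h ^ 4 * ?S h ^ 0) + (6 * w 3) * (?P h ^ 2 * ?S h ^ 1) + (3 * w 2) * (?P h ^ 0 * ?S h ^ 2))"
      by (intro hom_poly_add ps) simp_all
    ultimately show ?thesis unfolding k by simp
  next
    assume k: "i = 5"
    have "?F h = w 5 * (?P h ^ 5 * ?S h ^ 0) + (10 * w 4) * (?P h ^ 3 * ?S h ^ 1) + (15 * w 3) * (?P h ^ 1 * ?S h ^ 2)" for h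
      unfolding F by (simp add: k quad_chain_def)
    moreover have "hom_poly d 5 (\<lambda>h. w 5 * (?P h ^ 5 * ?S h ^ 0) + (10 * w 4) * (?P h ^ 3 * ?S h ^ 1) + (15 * w 3) * (?P h ^ 1 * ?S h ^ 2))"
      by (intro hom_poly_add ps) simp_all
    ultimately show ?thesis unfolding k by simp
  qed
qed

lemma measurable_soft_deriv [measurable (raw)]:
  assumes [measurable]: "f \<in> borel_measurable M" "g \<in> borel_measurable M"
  shows "(\<lambda>z. soft_deriv d x0 r \<epsilon> (f z) (g z) k) \<in> borel_measurable M"
  unfolding soft_deriv_def quad_chain_def by (cases "k \<in> {0,1,2,3,4,5}") simp_all

lemma power_le_1_plus: "0 \<le> t \<Longrightarrow> k \<le> 6 \<Longrightarrow> t ^ k \<le> 1 + t ^ (6::nat)" for t :: real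
proof (cases "t \<le> 1")
  case True
  assume "0 \<le> t"
  then have "t ^ k \<le> 1" using True by (intro power_le_one) auto
  then show ?thesis using \<open>0 \<le> t\<close> by (simp add: add_increasing2)
next
  case False
  assume "0 \<le> t" "k \<le> 6"
  then have "t ^ k \<le> t ^ 6" using False by (intro power_increasing) auto
  then show ?thesis by simp
qed

lemma enorm_6: "enorm d h ^ 6 = nsq d h ^ 3"
  using power_mult[of "enorm d h" 2 3] by (simp add: enorm_sq)

text \<open>The expansion in t is averaged over both the increment h and the rest z of the sum. In
  the remainder z is integrated first: the annulus has probability at most Q around every centre,
  whatever the shift t h, and h then contributes only its sixth moment.\<close>

lemma soft_taylor:
  assumes \<mu>: "sixth_moments d \<mu>" and \<pi>: "law \<pi>" and r: "0 \<le> r" and \<epsilon>: "0 < \<epsilon>"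
    and Q: "\<And>y. avg \<pi> (indicator (annulus d x0 r \<epsilon>)) y \<le> Q" and Q0: "0 \<le> Q"
  shows "\<bar>avg \<pi> (avg \<mu> (soft_ball d x0 r \<epsilon>)) x - (\<Sum>i<6. (\<integral>z. \<integral>h. soft_deriv d x0 r \<epsilon> (x + z) h i \<partial>\<mu> \<partial>\<pi>) / fact i)\<bar>
    \<le> 12456000000 / \<epsilon> ^ 6 * Q * (\<integral>h. nsq d h ^ 3 \<partial>\<mu>) / 720"
proof -
  have \<mu>l: "law \<mu>" by (rule sixth_moments_law[OF \<mu>])
  interpret A: prob_space \<pi> by (rule law_prob[OF \<pi>])
  interpret B: prob_space \<mu> by (rule law_prob[OF \<mu>l])
  interpret pair_prob_space \<pi> \<mu> ..
  note [measurable_cong] = law_sets[OF \<pi>] law_sets[OF \<mu>l]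
  define D where "D m t z = soft_deriv d x0 r \<epsilon> (x + fst z + scale t (snd z)) (snd z) m" for m t and z :: "(nat \<Rightarrow> real) \<times> (nat \<Rightarrow> real)"
  define C :: real where "C = 12456000000 / \<epsilon> ^ 6"
  define \<beta> where "\<beta> = (\<integral>h. nsq d h ^ 3 \<partial>\<mu>)"
  have C0: "0 \<le> C" using \<epsilon> by (simp add: C_def)
  have \<beta>0: "0 \<le> \<beta>" by (simp add: \<beta>_def)
  have i3: "integrable \<mu> (\<lambda>h. nsq d h ^ 3)" by (rule nsq_cube_integrable[OF \<mu>])
  have mD [measurable]: "(\<lambda>z. D m t z) \<in> borel_measurable (\<pi> \<Otimes>\<^sub>M \<mu>)" for m t
    unfolding D_def by measurable
  have int: "integrable (\<pi> \<Otimes>\<^sub>M \<mu>) (D i t)" if "i \<le> 6" for i t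
  proof (cases "i = 0")
    case True
    then show ?thesis
      using test_funD(3)[OF test_fun_soft_ball]
      by (intro P.integrable_const_bound[where B=1]) (auto simp: D_def soft_deriv_0)
  next
    case False
    have "integrable (\<pi> \<Otimes>\<^sub>M \<mu>) (\<lambda>z. 12456000000 * (1 + nsq d (snd z) ^ 3 / \<epsilon> ^ 6))"
    proof -
      have "integrable (\<pi> \<Otimes>\<^sub>M \<mu>) (\<lambda>z. nsq d (snd z) ^ 3)"
        by (rule Fubini_integrable) (auto simp: i3)
      then show ?thesis by simp
    qed
    then show ?thesis
    proof (rule Bochner_Integration.integrable_bound)
      have "\<bar>D i t z\<bar> \<le> 12456000000 * (1 + nsq d (snd z) ^ 3 / \<epsilon> ^ 6)" for z
      proof -
        have "\<bar>D i t z\<bar> \<le> 12456000000 * (enorm d (snd z) / \<epsilon>) ^ i * indicator (annulus d x0 r \<epsilon>) (x + fst z + scale t (snd z))"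
          unfolding D_def using False that by (intro soft_deriv_bound[OF r \<epsilon>]) auto
        also have "\<dots> \<le> 12456000000 * (enorm d (snd z) / \<epsilon>) ^ i * 1"
          using \<epsilon> by (intro mult_left_mono) (auto simp: indicator_def)
        also have "\<dots> \<le> 12456000000 * (1 + (enorm d (snd z) / \<epsilon>) ^ 6)"
          using \<epsilon> that power_le_1_plus[of "enorm d (snd z) / \<epsilon>" i] by simp
        finally show ?thesis by (simp add: power_divide enorm_6)
      qed
      then show "AE z in \<pi> \<Otimes>\<^sub>M \<mu>. norm (D i t z) \<le> norm (12456000000 * (1 + nsq d (snd z) ^ 3 / \<epsilon> ^ 6))"
        by (auto intro!: AE_I2 order_trans[OF _ abs_ge_self])
    qed measurable
  qed
  have "\<bar>(\<integral>z. D 0 1 z \<partial>(\<pi> \<Otimes>\<^sub>M \<mu>)) - (\<Sum>i<6. (\<integral>z. D i 0 z \<partial>(\<pi> \<Otimes>\<^sub>M \<mu>)) / fact i)\<bar> \<le> (C * Q * \<beta>) / 720"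
  proof (rule taylor_average[OF P.prob_space_axioms])
    fix z :: "(nat \<Rightarrow> real) \<times> (nat \<Rightarrow> real)" and m t
    assume "m < (6::nat)"
    then show "((\<lambda>t. D m t z) has_real_derivative D (Suc m) t z) (at t within {0..1})"
      unfolding D_def by (rule soft_deriv_line)
  next
    fix z :: "(nat \<Rightarrow> real) \<times> (nat \<Rightarrow> real)"
    define w where "w = (\<lambda>i t. cutoff_deriv i (ball_level d x0 r \<epsilon> (x + fst z + scale t (snd z))))"
    have cl: "continuous_on {0..1} (\<lambda>t. ball_level d x0 r \<epsilon> (x + fst z + scale t (snd z)))"
      unfolding ball_level_def nsq_line divide_inverse by (intro continuous_intros)
    have cw: "continuous_on {0..1} (w i)" if "i < 6" for i
      unfolding w_def
      by (rule continuous_on_compose2[OF _ cl, of UNIV])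
         (auto intro!: continuous_at_imp_continuous_on DERIV_isCont[OF cutoff_deriv_deriv[OF that]])
    have c6: "isCont (cutoff_deriv 6) y" for y
    proof -
      have "isCont bump y" unfolding bump_def[abs_def] by (intro continuous_intros)
      then show ?thesis unfolding cutoff_deriv_def[abs_def] Let_def by (auto intro!: continuous_intros)
    qed
    have cw6: "continuous_on {0..1} (w 6)"
      unfolding w_def
      by (rule continuous_on_compose2[OF _ cl, of UNIV])
         (auto intro!: continuous_at_imp_continuous_on c6)
    show "continuous_on {0..1} (\<lambda>t. D 6 t z)"
      unfolding D_def soft_deriv_def quad_chain_def dot_line divide_inverse
      using cw[of 3] cw[of 4] cw[of 5] cw6 unfolding w_def
      by (simp, intro continuous_intros)
  next
    show "(\<lambda>p. D 6 (fst p) (snd p)) \<in> borel_measurable (borel \<Otimes>\<^sub>M (\<pi> \<Otimes>\<^sub>M \<mu>))"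
      unfolding D_def by measurable
  next
    fix t :: real
    have ann: "(\<integral>\<^sup>+z. ennreal (indicator (annulus d x0 r \<epsilon>) (x + z + scale t h)) \<partial>\<pi>) \<le> ennreal Q" for h
    proof -
      have "(\<integral>\<^sup>+z. ennreal (indicator (annulus d x0 r \<epsilon>) (x + z + scale t h)) \<partial>\<pi>) = ennreal (avg \<pi> (indicator (annulus d x0 r \<epsilon>)) (x + scale t h))"
        unfolding avg_def add.assoc add.commute[of _ "scale t h"] unfolding add.assoc[symmetric]
        by (rule nn_integral_eq_integral[OF test_fun_law_integrable[OF test_fun_annulus \<pi>]]) simp
      also have "\<dots> \<le> ennreal Q" by (intro ennreal_leI Q)
      finally show ?thesis .
    qed
    have "(\<integral>\<^sup>+z. ennreal \<bar>D 6 t z\<bar> \<partial>(\<pi> \<Otimes>\<^sub>M \<mu>))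
       \<le> (\<integral>\<^sup>+z. ennreal (C * nsq d (snd z) ^ 3 * indicator (annulus d x0 r \<epsilon>) (x + fst z + scale t (snd z))) \<partial>(\<pi> \<Otimes>\<^sub>M \<mu>))"
    proof (intro nn_integral_mono ennreal_leI)
      fix z :: "(nat \<Rightarrow> real) \<times> (nat \<Rightarrow> real)"
      show "\<bar>D 6 t z\<bar> \<le> C * nsq d (snd z) ^ 3 * indicator (annulus d x0 r \<epsilon>) (x + fst z + scale t (snd z))"
        using soft_deriv_bound[OF r \<epsilon>, of 6 d x0 "x + fst z + scale t (snd z)" "snd z"]
        unfolding D_def C_def power_divide enorm_6 by (simp del: plus_fun_apply)
    qed
    also have "\<dots> = (\<integral>\<^sup>+h. \<integral>\<^sup>+z. ennreal (C * nsq d h ^ 3 * indicator (annulus d x0 r \<epsilon>) (x + z + scale t h)) \<partial>\<pi> \<partial>\<mu>)"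
      by (subst nn_integral_snd[symmetric]) simp_all
    also have "\<dots> \<le> (\<integral>\<^sup>+h. ennreal (C * nsq d h ^ 3) * ennreal Q \<partial>\<mu>)"
    proof (intro nn_integral_mono)
      fix h
      have "(\<integral>\<^sup>+z. ennreal (C * nsq d h ^ 3 * indicator (annulus d x0 r \<epsilon>) (x + z + scale t h)) \<partial>\<pi>)
         = (\<integral>\<^sup>+z. ennreal (C * nsq d h ^ 3) * ennreal (indicator (annulus d x0 r \<epsilon>) (x + z + scale t h)) \<partial>\<pi>)"
        using C0 by (intro nn_integral_cong ennreal_mult) auto
      also have "\<dots> = ennreal (C * nsq d h ^ 3) * (\<integral>\<^sup>+z. ennreal (indicator (annulus d x0 r \<epsilon>) (x + z + scale t h)) \<partial>\<pi>)"
        by (intro nn_integral_cmult) measurable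
      also have "\<dots> \<le> ennreal (C * nsq d h ^ 3) * ennreal Q"
        by (intro mult_left_mono ann) auto
      finally show "(\<integral>\<^sup>+z. ennreal (C * nsq d h ^ 3 * indicator (annulus d x0 r \<epsilon>) (x + z + scale t h)) \<partial>\<pi>) \<le> ennreal (C * nsq d h ^ 3) * ennreal Q" .
    qed
    also have "\<dots> = (\<integral>\<^sup>+h. ennreal (C * Q * nsq d h ^ 3) \<partial>\<mu>)"
      using C0 Q0 by (intro nn_integral_cong) (simp add: ennreal_mult[symmetric] mult_ac)
    also have "\<dots> = ennreal (C * Q * \<beta>)"
      unfolding \<beta>_def using C0 Q0 i3 by (subst nn_integral_eq_integral) auto
    finally show "(\<integral>\<^sup>+z. ennreal \<bar>D 6 t z\<bar> \<partial>(\<pi> \<Otimes>\<^sub>M \<mu>)) \<le> ennreal (C * Q * \<beta>)" .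
  next
    show "0 \<le> C * Q * \<beta>" using C0 Q0 \<beta>0 by simp
  next
    show "integrable (\<pi> \<Otimes>\<^sub>M \<mu>) (D 0 1)" by (rule int) simp
  next
    fix i :: nat assume "i < 6"
    then show "integrable (\<pi> \<Otimes>\<^sub>M \<mu>) (D i 0)" by (intro int) simp
  qed
  moreover have "(\<integral>z. D 0 1 z \<partial>(\<pi> \<Otimes>\<^sub>M \<mu>)) = avg \<pi> (avg \<mu> (soft_ball d x0 r \<epsilon>)) x"
  proof -
    have "(\<integral>z. D 0 1 z \<partial>(\<pi> \<Otimes>\<^sub>M \<mu>)) = (\<integral>z. \<integral>h. D 0 1 (z, h) \<partial>\<mu> \<partial>\<pi>)"
      by (rule integral_fst'[symmetric], rule int) simp
    then show ?thesis by (simp only: avg_def D_def soft_deriv_0 fst_conv snd_conv scale_1)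
  qed
  moreover have "(\<integral>z. D i 0 z \<partial>(\<pi> \<Otimes>\<^sub>M \<mu>)) = (\<integral>z. \<integral>h. soft_deriv d x0 r \<epsilon> (x + z) h i \<partial>\<mu> \<partial>\<pi>)" if "i < 6" for i
  proof -
    have "x + z + scale 0 h = x + z" for z h by auto
    moreover have "(\<integral>z. D i 0 z \<partial>(\<pi> \<Otimes>\<^sub>M \<mu>)) = (\<integral>z. \<integral>h. D i 0 (z, h) \<partial>\<mu> \<partial>\<pi>)"
      by (rule integral_fst'[symmetric], rule int) (use that in simp)
    ultimately show ?thesis by (simp only: D_def fst_conv snd_conv)
  qed
  ultimately show ?thesis by (simp add: C_def \<beta>_def)
qed

lemma soft_swap_bound:
  assumes \<mu>: "sixth_moments d \<mu>" and \<nu>: "sixth_moments d \<nu>" and same: "\<And>k. k \<le> 5 \<Longrightarrow> same_moments d k \<mu> \<nu>"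
    and \<pi>: "law \<pi>" and r: "0 \<le> r" and \<epsilon>: "0 < \<epsilon>"
    and Q: "\<And>y. avg \<pi> (indicator (annulus d x0 r \<epsilon>)) y \<le> Q" and Q0: "0 \<le> Q"
  shows "\<bar>avg \<pi> (avg \<mu> (soft_ball d x0 r \<epsilon>)) x - avg \<pi> (avg \<nu> (soft_ball d x0 r \<epsilon>)) x\<bar>
    \<le> 12456000000 / \<epsilon> ^ 6 * Q * ((\<integral>h. nsq d h ^ 3 \<partial>\<mu>) + (\<integral>h. nsq d h ^ 3 \<partial>\<nu>)) / 720"
proof -
  have "(\<integral>h. soft_deriv d x0 r \<epsilon> y h i \<partial>\<mu>) = (\<integral>h. soft_deriv d x0 r \<epsilon> y h i \<partial>\<nu>)" if "i < 6" for i y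
    using that by (intro hom_poly_same_moments[OF \<mu> \<nu> soft_deriv_hom_poly[OF that] _ same]) auto
  then have "(\<Sum>i<6. (\<integral>z. \<integral>h. soft_deriv d x0 r \<epsilon> (x + z) h i \<partial>\<mu> \<partial>\<pi>) / fact i)
    = (\<Sum>i<6. (\<integral>z. \<integral>h. soft_deriv d x0 r \<epsilon> (x + z) h i \<partial>\<nu> \<partial>\<pi>) / fact i :: real)"
    by (intro sum.cong) auto
  moreover have "\<bar>a - b\<bar> \<le> C * (m + n) / 720" if "A = B" "\<bar>a - A\<bar> \<le> C * m / 720" "\<bar>b - B\<bar> \<le> C * n / 720" for a b A B C m n :: real
    using that unfolding distrib_left abs_le_iff by (simp add: abs_if)
  ultimately show ?thesis
    using soft_taylor[OF \<mu> \<pi> r \<epsilon> Q Q0, of x] soft_taylor[OF \<nu> \<pi> r \<epsilon> Q Q0, of x] by blast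
qed

section \<open>Induction on the number of summands\<close>

lemma test_fun_const: "test_fun d \<bar>c\<bar> (\<lambda>_. c)"
  by (simp add: test_fun_def)

lemma avg_const: "law \<mu> \<Longrightarrow> avg \<mu> (\<lambda>_. c) = (\<lambda>_. c)"
proof
  fix x assume "law \<mu>"
  then interpret prob_space \<mu> by (rule law_prob)
  show "avg \<mu> (\<lambda>_. c) x = c" by (simp add: avg_def prob_space)
qed

lemma avg_pow_const: "law \<mu> \<Longrightarrow> (avg \<mu> ^^ n) (\<lambda>_. c) = (\<lambda>_. c)"
  by (induction n) (simp_all add: avg_const)

lemma avg_pow_le:
  assumes "law \<mu>" "test_fun d M f" "\<And>x. f x \<le> c"
  shows "(avg \<mu> ^^ n) f x \<le> c"
  using avg_pow_mono[OF assms(2) test_fun_const assms(1), of c n x] assms(3) by (simp add: avg_pow_const[OF assms(1)])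

lemma avg_pow_ge:
  assumes "law \<mu>" "test_fun d M f" "\<And>x. c \<le> f x"
  shows "c \<le> (avg \<mu> ^^ n) f x"
  using avg_pow_mono[OF test_fun_const assms(2,1), of c n x] assms(3) by (simp add: avg_pow_const[OF assms(1)])

text \<open>Provides a single law for a sum of n summands, since the smoothed Taylor expansion
  integrates over the rest of the sum as one random vector.\<close>

lemma avg_pow_law:
  assumes \<mu>: "law \<mu>"
  shows "\<exists>\<pi>. law \<pi> \<and> (\<forall>M f. test_fun d M f \<longrightarrow> avg \<pi> f = (avg \<mu> ^^ n) f)"
proof (induction n)
  case 0
  have "law (return borel 0)" by (simp add: law_def prob_space_return)
  moreover have "avg (return borel 0) f = f" if "test_fun d M f" for M f
  proof
    fix x
    have [measurable]: "f \<in> borel_measurable borel" using that by (rule test_funD)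
    have "avg (return borel 0) f x = f (x + 0)" unfolding avg_def by (rule integral_return) auto
    then show "avg (return borel 0) f x = f x" by (simp only: add_0_right)
  qed
  ultimately show ?case by auto
next
  case (Suc n)
  then obtain \<pi> where \<pi>: "law \<pi>" "\<And>M f. test_fun d M f \<Longrightarrow> avg \<pi> f = (avg \<mu> ^^ n) f" by blast
  have "avg (conv \<mu> \<pi>) f = (avg \<mu> ^^ Suc n) f" if "test_fun d M f" for M f
    using avg_conv[OF \<mu> \<pi>(1) that] \<pi>(2)[OF that] by simp
  then show ?case using law_conv[OF \<mu> \<pi>(1)] by blast
qed

lemma avg_pow_pow_law:
  assumes \<mu>: "law \<mu>" and \<nu>: "law \<nu>"
  obtains \<pi> where "law \<pi>" "\<And>M f. test_fun d M f \<Longrightarrow> avg \<pi> f = (avg \<mu> ^^ m) ((avg \<nu> ^^ n) f)"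
proof -
  obtain \<pi> where \<pi>: "law \<pi>" "\<And>M f. test_fun d M f \<Longrightarrow> avg \<pi> f = (avg \<mu> ^^ m) f" using avg_pow_law[OF \<mu>] by blast
  obtain \<rho> where \<rho>: "law \<rho>" "\<And>M f. test_fun d M f \<Longrightarrow> avg \<rho> f = (avg \<nu> ^^ n) f" using avg_pow_law[OF \<nu>] by blast
  have "avg (conv \<pi> \<rho>) f = (avg \<mu> ^^ m) ((avg \<nu> ^^ n) f)" if f: "test_fun d M f" for M f
    using avg_conv[OF \<pi>(1) \<rho>(1) f] \<pi>(2)[OF test_fun_avg_pow[OF f \<nu>]] \<rho>(2)[OF f] by simp
  then show ?thesis using that[OF law_conv[OF \<pi>(1) \<rho>(1)]] by blast
qed

text \<open>The averages over \<tau> commute past the Gaussian ones, and the variances of the k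
  Gaussian parts add up.\<close>

lemma gauss_split_pow:
  assumes \<nu>: "law \<nu>" and \<tau>: "law \<tau>" and l: "0 \<le> l"
    and split: "\<And>M f. test_fun d M f \<Longrightarrow> avg \<nu> f = avg (gauss d l) (avg \<tau> f)"
    and f: "test_fun d M f"
  shows "(avg \<nu> ^^ k) f = avg (gauss d (l * sqrt k)) ((avg \<tau> ^^ k) f)"
proof (induction k)
  case 0
  show ?case using avg_gauss_0[OF f] by simp
next
  case (Suc k)
  let ?g = "(avg \<tau> ^^ k) f"
  have g: "test_fun d M ?g" by (rule test_fun_avg_pow[OF f \<tau>])
  have "l\<^sup>2 + (l * sqrt k)\<^sup>2 = (l * sqrt (Suc k))\<^sup>2"
    by (simp add: power_mult_distrib algebra_simps)
  then have s: "sqrt (l\<^sup>2 + (l * sqrt k)\<^sup>2) = l * sqrt (Suc k)" using l by simp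
  have "(avg \<nu> ^^ Suc k) f = avg (gauss d l) (avg \<tau> (avg (gauss d (l * sqrt k)) ?g))"
    using Suc split[OF test_fun_avg[OF g law_gauss]] by simp
  also have "\<dots> = avg (gauss d l) (avg (gauss d (l * sqrt k)) (avg \<tau> ?g))"
    by (simp only: avg_commute[OF g \<tau> law_gauss])
  also have "\<dots> = avg (gauss d (l * sqrt (Suc k))) ((avg \<tau> ^^ Suc k) f)"
    using avg_gauss_gauss[OF test_fun_avg[OF g \<tau>] l, of "l * sqrt k"] l s by simp
  finally show ?case .
qed

text \<open>Here \<tau> is what remains of \<nu> after a Gaussian of scale l has been split off, and
  b^4 is the sum of the two sixth moments in units of l^6.\<close>

locale matched_laws =
  fixes d :: nat and \<mu> \<nu> \<tau> :: "(nat \<Rightarrow> real) measure" and l C b :: real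
  assumes d: "1 \<le> d" and \<mu>6: "sixth_moments d \<mu>" and \<nu>6: "sixth_moments d \<nu>" and \<tau>: "law \<tau>"
    and same: "\<And>k. k \<le> 5 \<Longrightarrow> same_moments d k \<mu> \<nu>"
    and l: "0 < l" and split: "\<And>M f. test_fun d M f \<Longrightarrow> avg \<nu> f = avg (gauss d l) (avg \<tau> f)"
    and C: "gaussian_ball_const C"
    and b: "(\<integral>h. nsq d h ^ 3 \<partial>\<mu>) + (\<integral>h. nsq d h ^ 3 \<partial>\<nu>) = b ^ 4 * l ^ 6" and b1: "1 \<le> b"
begin

lemma \<mu>: "law \<mu>" and \<nu>: "law \<nu>"
  using \<mu>6 \<nu>6 by (auto intro: sixth_moments_law)

abbreviation "a \<equiv> max 1 C"

lemma \<nu>_pow: "test_fun d M f \<Longrightarrow> (avg \<nu> ^^ k) f = avg (gauss d (l * sqrt k)) ((avg \<tau> ^^ k) f)"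
  using gauss_split_pow[OF \<nu> \<tau> _ split] l by simp

lemma anticoncentration:
  assumes k: "1 \<le> k" and \<epsilon>: "0 < \<epsilon>" and r: "0 \<le> r"
  shows "(avg \<nu> ^^ k) (indicator (annulus d x0 r \<epsilon>)) x \<le> \<epsilon> * a / (l * sqrt k)"
proof -
  let ?f = "indicator (annulus d x0 r \<epsilon>) :: _ \<Rightarrow> real"
  have s: "0 < l * sqrt k" using l k by simp
  have "(avg \<nu> ^^ k) ?f = (avg \<tau> ^^ k) (avg (gauss d (l * sqrt k)) ?f)"
    unfolding \<nu>_pow[OF test_fun_annulus] by (rule avg_pow_commute1[OF test_fun_annulus law_gauss \<tau>])
  moreover have "avg (gauss d (l * sqrt k)) ?f y \<le> \<epsilon> * C / (l * sqrt k)" for y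
    by (rule gauss_ball_anticoncentration[OF C d s \<epsilon> r])
  ultimately have "(avg \<nu> ^^ k) ?f x \<le> \<epsilon> * C / (l * sqrt k)"
    using avg_pow_le[OF \<tau> test_fun_avg[OF test_fun_annulus law_gauss]] by simp
  also have "\<dots> \<le> \<epsilon> * a / (l * sqrt k)"
    using \<epsilon> s by (intro divide_right_mono mult_left_mono) auto
  finally show ?thesis .
qed

lemma indicator_annulus_eq:
  assumes "0 \<le> r" "0 < \<epsilon>"
  shows "indicator (annulus d x0 r \<epsilon>) = (\<lambda>x. indicator (eball d x0 (r + \<epsilon>)) x - indicator (eball d x0 r) x :: real)"
proof -
  have "eball d x0 r \<subseteq> eball d x0 (r + \<epsilon>)" using assms by (auto simp: eball_def)
  then show ?thesis by (auto simp: indicator_def fun_eq_iff)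
qed

lemma pow_annulus:
  assumes "law \<rho>" "0 \<le> r" "0 < \<epsilon>"
  shows "(avg \<rho> ^^ k) (indicator (annulus d x0 r \<epsilon>)) x = (avg \<rho> ^^ k) (indicator (eball d x0 (r + \<epsilon>))) x - (avg \<rho> ^^ k) (indicator (eball d x0 r)) x"
  unfolding indicator_annulus_eq[OF assms(2,3)] by (rule avg_pow_diff[OF test_fun_eball test_fun_eball assms(1)])

text \<open>All Taylor terms cancel, including order 4, and the remainder behind a Gaussian of scale
  l sqrt k is b^4 l^6 / (l sqrt k)^6 up to the factor. The number 26 is just below sqrt 720.\<close>

lemma gaussian_step:
  assumes e: "test_fun d M e" and k: "1 \<le> k"
  shows "\<bar>avg \<mu> ((avg \<nu> ^^ k) e) x - avg \<nu> ((avg \<nu> ^^ k) e) x\<bar> \<le> M * b ^ 4 / (26 * real k ^ 3)"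
proof -
  have s: "0 < l * sqrt k" using l k by simp
  have M: "0 \<le> M" using test_fun_bound_nonneg[OF e] .
  have te: "test_fun d M ((avg \<tau> ^^ k) e)" by (rule test_fun_avg_pow[OF e \<tau>])
  have "(\<integral>h. hermite_coeff d ((avg \<tau> ^^ k) e) (l * sqrt k) x 4 h \<partial>\<mu>) = (\<integral>h. hermite_coeff d ((avg \<tau> ^^ k) e) (l * sqrt k) x 4 h \<partial>\<nu>)"
    by (rule hom_poly_same_moments[OF \<mu>6 \<nu>6 hermite_coeff_hom_poly[OF te]]) (auto intro: same)
  then have "\<bar>avg \<mu> ((avg \<nu> ^^ k) e) x - avg \<nu> ((avg \<nu> ^^ k) e) x\<bar> \<le> M / (sqrt 720 * (l * sqrt k) ^ 6) * (b ^ 4 * l ^ 6)"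
    using gaussian_swap_bound[OF te s \<mu>6 \<nu>6 same, of x] unfolding \<nu>_pow[OF e] b by simp
  also have "(l * sqrt k) ^ 6 = l ^ 6 * real k ^ 3"
    using power_mult[of "sqrt k" 2 3] by (simp add: power_mult_distrib)
  also have "M / (sqrt 720 * (l ^ 6 * real k ^ 3)) * (b ^ 4 * l ^ 6) = M * b ^ 4 / (sqrt 720 * real k ^ 3)"
    using l by simp
  also have "\<dots> \<le> M * b ^ 4 / (26 * real k ^ 3)"
  proof -
    have "26 \<le> sqrt (720::real)" by (rule real_le_rsqrt) simp
    then show ?thesis using M b1 k by (intro divide_left_mono mult_right_mono mult_nonneg_nonneg mult_pos_pos) auto
  qed
  finally show ?thesis .
qed

text \<open>The \<mu>-part of the sum is written as the corresponding \<nu>-part plus an error of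
  size E. The main part then has n - 1 Gaussian summands behind the exchange; the error has only k,
  but carries the factor E supplied by the induction.\<close>

lemma hybrid_step:
  assumes k: "1 \<le> k" "k < n" and D: "\<And>y. \<bar>(avg \<mu> ^^ (n - 1 - k)) (indicator (eball d x0 r)) y - (avg \<nu> ^^ (n - 1 - k)) (indicator (eball d x0 r)) y\<bar> \<le> E"
  shows "\<bar>avg \<mu> ((avg \<mu> ^^ (n - 1 - k)) ((avg \<nu> ^^ k) (indicator (eball d x0 r)))) x
     - avg \<nu> ((avg \<mu> ^^ (n - 1 - k)) ((avg \<nu> ^^ k) (indicator (eball d x0 r)))) x\<bar>
     \<le> b ^ 4 / 26 * (1 / (real n - 1) ^ 3 + E / real k ^ 3)"
proof -
  let ?f = "indicator (eball d x0 r) :: _ \<Rightarrow> real" and ?j = "n - 1 - k"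
  have f: "test_fun d 1 ?f" by (rule test_fun_eball)
  define e where "e y = (avg \<mu> ^^ ?j) ?f y - (avg \<nu> ^^ ?j) ?f y" for y
  have e: "test_fun d E e"
    using test_fun_diff[OF test_fun_avg_pow[OF f \<mu>, of ?j] test_fun_avg_pow[OF f \<nu>, of ?j]] D
    by (simp add: test_fun_def e_def[abs_def])
  have "(avg \<mu> ^^ ?j) ?f = (\<lambda>y. (avg \<nu> ^^ ?j) ?f y - - e y)" by (simp add: e_def)
  have ne: "test_fun d E (\<lambda>y. - e y)" using e by (auto simp: test_fun_def)
  have "(avg \<mu> ^^ ?j) ((avg \<nu> ^^ k) ?f) = (avg \<nu> ^^ k) ((avg \<mu> ^^ ?j) ?f)"
    by (rule avg_pow_commute[OF f \<mu> \<nu>])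
  also have "\<dots> = (\<lambda>y. (avg \<nu> ^^ k) ((avg \<nu> ^^ ?j) ?f) y - (avg \<nu> ^^ k) (\<lambda>y. - e y) y)"
    unfolding \<open>(avg \<mu> ^^ ?j) ?f = (\<lambda>y. (avg \<nu> ^^ ?j) ?f y - - e y)\<close>
    by (rule ext, rule avg_pow_diff[OF test_fun_avg_pow[OF f \<nu>] ne \<nu>])
  also have "(avg \<nu> ^^ k) ((avg \<nu> ^^ ?j) ?f) = (avg \<nu> ^^ (n - 1)) ?f"
    using k by (simp add: funpow_add[symmetric, unfolded o_def, THEN fun_cong])
  finally have h: "(avg \<mu> ^^ ?j) ((avg \<nu> ^^ k) ?f) = (\<lambda>y. (avg \<nu> ^^ (n - 1)) ?f y - (avg \<nu> ^^ k) (\<lambda>y. - e y) y)" .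
  let ?u = "(avg \<nu> ^^ (n - 1)) ?f" and ?v = "(avg \<nu> ^^ k) (\<lambda>y. - e y)"
  have u: "test_fun d 1 ?u" and v: "test_fun d E ?v" by (intro test_fun_avg_pow f ne \<nu>)+
  have "avg \<mu> ((avg \<mu> ^^ ?j) ((avg \<nu> ^^ k) ?f)) x - avg \<nu> ((avg \<mu> ^^ ?j) ((avg \<nu> ^^ k) ?f)) x
    = (avg \<mu> ?u x - avg \<nu> ?u x) - (avg \<mu> ?v x - avg \<nu> ?v x)"
    unfolding h avg_diff[OF u v \<mu>] avg_diff[OF u v \<nu>] by simp
  moreover have "\<bar>avg \<mu> ?u x - avg \<nu> ?u x\<bar> \<le> 1 * b ^ 4 / (26 * real (n - 1) ^ 3)"
    using k by (intro gaussian_step f) auto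
  moreover have "\<bar>avg \<mu> ?v x - avg \<nu> ?v x\<bar> \<le> E * b ^ 4 / (26 * real k ^ 3)"
    using k by (intro gaussian_step ne) auto
  moreover have "real (n - 1) = real n - 1" using k by simp
  moreover have "b ^ 4 / 26 * (1 / (real n - 1) ^ 3 + E / real k ^ 3) = 1 * b ^ 4 / (26 * (real n - 1) ^ 3) + E * b ^ 4 / (26 * real k ^ 3)"
    by (simp add: distrib_left mult.commute)
  moreover have "\<bar>A - B\<bar> \<le> p + q" if "\<bar>A\<bar> \<le> p" "\<bar>B\<bar> \<le> q" for A B p q :: real using that by linarith
  ultimately show ?thesis by metis
qed

text \<open>The annulus is a difference of two balls, so its probability under the \<mu>-part
  exceeds that under as many copies of \<nu> by at most 2 E, and there anti-concentration applies.
  Adding the k copies of \<nu> keeps the bound, since it is uniform in the centre.\<close>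

lemma soft_step:
  assumes j: "1 \<le> n - 1 - k" and r: "0 \<le> r" and \<epsilon>: "0 < \<epsilon>"
    and D: "\<And>r y. 0 \<le> r \<Longrightarrow> \<bar>(avg \<mu> ^^ (n - 1 - k)) (indicator (eball d x0 r)) y - (avg \<nu> ^^ (n - 1 - k)) (indicator (eball d x0 r)) y\<bar> \<le> E"
    and Q: "\<epsilon> * a / (l * sqrt (n - 1 - k)) + 2 * E \<le> Q"
  shows "\<bar>avg \<mu> ((avg \<mu> ^^ (n - 1 - k)) ((avg \<nu> ^^ k) (soft_ball d x0 r \<epsilon>))) x
     - avg \<nu> ((avg \<mu> ^^ (n - 1 - k)) ((avg \<nu> ^^ k) (soft_ball d x0 r \<epsilon>))) x\<bar>
     \<le> 12456000000 / \<epsilon> ^ 6 * Q * (b ^ 4 * l ^ 6) / 720"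
proof -
  let ?j = "n - 1 - k" and ?A = "indicator (annulus d x0 r \<epsilon>) :: _ \<Rightarrow> real"
  obtain \<pi> where \<pi>: "law \<pi>" "\<And>M f. test_fun d M f \<Longrightarrow> avg \<pi> f = (avg \<mu> ^^ ?j) ((avg \<nu> ^^ k) f)"
    using avg_pow_pow_law[OF \<mu> \<nu>] by blast
  have Aj: "(avg \<mu> ^^ ?j) ?A y \<le> Q" for y
  proof -
    have "(avg \<mu> ^^ ?j) ?A y \<le> (avg \<nu> ^^ ?j) ?A y + 2 * E"
      unfolding pow_annulus[OF \<mu> r \<epsilon>] pow_annulus[OF \<nu> r \<epsilon>]
      using D[of "r + \<epsilon>" y] D[of r y] r \<epsilon> by (simp add: abs_le_iff)
    then show ?thesis using anticoncentration[OF j \<epsilon> r, of x0 y] Q by linarith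
  qed
  have A: "avg \<pi> ?A y \<le> Q" for y
    unfolding \<pi>(2)[OF test_fun_annulus] avg_pow_commute[OF test_fun_annulus \<mu> \<nu>]
    by (rule avg_pow_le[OF \<nu> test_fun_avg_pow[OF test_fun_annulus \<mu>] Aj])
  have "0 \<le> (avg \<mu> ^^ ?j) ?A 0" by (rule avg_pow_ge[OF \<mu> test_fun_annulus]) simp
  with Aj[of 0] have Q0: "0 \<le> Q" by linarith
  have "\<bar>avg \<pi> (avg \<mu> (soft_ball d x0 r \<epsilon>)) x - avg \<pi> (avg \<nu> (soft_ball d x0 r \<epsilon>)) x\<bar>
    \<le> 12456000000 / \<epsilon> ^ 6 * Q * (b ^ 4 * l ^ 6) / 720"
    unfolding b[symmetric] by (rule soft_swap_bound[OF \<mu>6 \<nu>6 same \<pi>(1) r \<epsilon> A Q0])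
  then show ?thesis
    unfolding avg_commute[OF test_fun_soft_ball \<pi>(1) \<mu>] avg_commute[OF test_fun_soft_ball \<pi>(1) \<nu>] \<pi>(2)[OF test_fun_soft_ball] .
qed

text \<open>The subtracted term makes the induction telescope, through n^3 \<ge> (m - 1) (n - 1)
  n.\<close>

lemma sum_inverse_cubes:
  assumes "2 \<le> m" "m \<le> n"
  shows "(\<Sum>k=m..<n. 1 / real k ^ 3) \<le> 1 / (real m - 1) ^ 2 - 1 / ((real m - 1) * (real n - 1))"
  using assms(2)
proof (induction n rule: dec_induct)
  case base
  show ?case by (simp add: power2_eq_square)
next
  case (step n)
  have m: "1 \<le> real m - 1" "real m \<le> real n" using assms step by auto
  have "1 / real n ^ 3 \<le> 1 / ((real m - 1) * (real n - 1) * real n)"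
    using m unfolding power3_eq_cube by (intro divide_left_mono mult_mono mult_pos_pos) auto
  also have "\<dots> = 1 / ((real m - 1) * (real n - 1)) - 1 / ((real m - 1) * (real (Suc n) - 1))"
  proof -
    have "1 / (p * q * (q + 1)) = 1 / (p * q) - 1 / (p * (q + 1))" if "0 < p" "0 < q" for p q :: real
    proof -
      have "q + 1 \<noteq> 0" using that by linarith
      then have "1 / q - 1 / (q + 1) = 1 / (q * (q + 1))" using that by (simp add: divide_simps)
      then have "(1 / q - 1 / (q + 1)) / p = 1 / (q * (q + 1)) / p" by simp
      then show ?thesis by (simp add: diff_divide_distrib mult_ac)
    qed
    from this[of "real m - 1" "real n - 1"] m show ?thesis by simp
  qed
  finally show ?case using step by simp
qed

text \<open>A ball of radius below \<epsilon> cannot be approximated from inside at distance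
  \<epsilon>. It avoids the point c at distance 2 \<epsilon> - r from its centre and lies within 2
  \<epsilon> of c, so anti-concentration with inner radius 0 bounds its probability.\<close>

lemma center_ball_in_annulus:
  assumes "0 \<le> r" "r < \<epsilon>"
  shows "\<exists>c. eball d x0 r \<subseteq> annulus d c 0 (2 * \<epsilon>)"
proof -
  define D where "D = 2 * \<epsilon> - r"
  define c where "c = x0(0 := x0 0 + D)"
  have cx: "L2_set (\<lambda>k. c k - x0 k) {..<d} = D"
  proof -
    have "(\<Sum>k<d. (c k - x0 k)\<^sup>2) = (\<Sum>k<d. if k = 0 then D\<^sup>2 else 0)"
      by (intro sum.cong) (auto simp: c_def)
    then have "(\<Sum>k<d. (c k - x0 k)\<^sup>2) = D\<^sup>2" using d by simp
    then show ?thesis using assms by (simp add: L2_set_def D_def)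
  qed
  have "y \<in> annulus d c 0 (2 * \<epsilon>)" if y: "y \<in> eball d x0 r" for y
  proof -
    have y: "L2_set (\<lambda>k. y k - x0 k) {..<d} \<le> r" using that by (simp add: eball_def)
    have neg: "L2_set (\<lambda>k. - f k) {..<d} = L2_set f {..<d}" for f :: "nat \<Rightarrow> real" by (simp add: L2_set_def)
    have "L2_set (\<lambda>k. y k - c k) {..<d} \<le> L2_set (\<lambda>k. y k - x0 k) {..<d} + L2_set (\<lambda>k. - (c k - x0 k)) {..<d}"
      using L2_set_triangle_ineq[of "\<lambda>k. y k - x0 k" "\<lambda>k. - (c k - x0 k)" "{..<d}"] by simp
    then have 1: "L2_set (\<lambda>k. y k - c k) {..<d} \<le> 2 * \<epsilon>"
      using y unfolding neg cx by (simp add: D_def)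
    have "D \<le> L2_set (\<lambda>k. y k - x0 k) {..<d} + L2_set (\<lambda>k. - (y k - c k)) {..<d}"
      using L2_set_triangle_ineq[of "\<lambda>k. y k - x0 k" "\<lambda>k. - (y k - c k)" "{..<d}"] by (simp add: cx)
    then have 2: "\<not> L2_set (\<lambda>k. y k - c k) {..<d} \<le> 0"
      using y assms unfolding neg by (simp add: D_def)
    show ?thesis using 1 2 by (simp add: eball_def)
  qed
  then show ?thesis by blast
qed


section \<open>The inductive bound for the distance on balls\<close>

lemma pow_eball_01:
  assumes "law \<rho>"
  shows "0 \<le> (avg \<rho> ^^ n) (indicator (eball d x0 r)) x" "(avg \<rho> ^^ n) (indicator (eball d x0 r)) x \<le> 1"
  by (rule avg_pow_ge[OF assms test_fun_eball]; simp) (rule avg_pow_le[OF assms test_fun_eball]; simp)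

text \<open>
  The first \<open>m \<approx> b\<^sup>2\<close> exchanges are made with a smoothed indicator, the remaining ones with the
  Gaussian component that is then available; both use the bound for shorter sums.
\<close>

lemma smooth_exchange:
  assumes IH: "\<And>j x0 r x. 1 \<le> j \<Longrightarrow> j < n \<Longrightarrow> 0 \<le> r \<Longrightarrow>
      \<bar>(avg \<mu> ^^ j) (indicator (eball d x0 r)) x - (avg \<nu> ^^ j) (indicator (eball d x0 r)) x\<bar> \<le> 87 * a * b / sqrt j"
    and n: "7569 * (a * b)\<^sup>2 < real n" and m: "real m \<le> 3 * b\<^sup>2" and r: "0 \<le> r"
  shows "\<bar>(avg \<mu> ^^ n) (soft_ball d x0 r (29 * b * l)) x - (avg \<mu> ^^ (n - m)) ((avg \<nu> ^^ m) (soft_ball d x0 r (29 * b * l))) x\<bar>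
     \<le> 19 * (a * b / sqrt n)"
proof -
  let ?\<epsilon> = "29 * b * l" and ?f = "soft_ball d x0 r (29 * b * l)"
  define S where "S = a * b / sqrt n"
  have f: "test_fun d 1 ?f" by (rule test_fun_soft_ball)
  have \<epsilon>: "0 < ?\<epsilon>" using b1 l by simp
  have b2: "1 \<le> b\<^sup>2" using b1 by simp
  \<comment> \<open>As 1 \<le> a, the threshold 7569 = 87^2 gives n > 7569 b^2; since m \<le> 3 b^2,
    m is below n / 2523.\<close>
  have "b\<^sup>2 \<le> (a * b)\<^sup>2" using b1 by (intro power_mono) (auto simp: mult_le_cancel_right1)
  then have mn: "2523 * real m < real n" and n1: "7569 < real n" using n m b2 by linarith+
  have n0: "0 < sqrt n" using n1 by simp
  have S0: "0 \<le> S" using b1 n0 by (simp add: S_def)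
  have swap: "\<bar>avg \<mu> ((avg \<mu> ^^ (n - 1 - k)) ((avg \<nu> ^^ k) ?f)) x - avg \<nu> ((avg \<mu> ^^ (n - 1 - k)) ((avg \<nu> ^^ k) ?f)) x\<bar> \<le> 6.3 * S / b\<^sup>2"
    if k: "k < m" for k
  proof -
    let ?j = "n - 1 - k"
    have jr: "real ?j = real n - 1 - real k" using k mn by (simp add: of_nat_diff)
    have j1: "1 \<le> ?j" using k mn n1 by linarith
    have "real k < real m" using k by simp
    then have jn: "real n \<le> 1.1 * real ?j" using mn n1 unfolding jr by argo
    \<comment> \<open>The square of 21/20 exceeds 1.1.\<close>
    have "sqrt n \<le> sqrt ((21/20)\<^sup>2 * real ?j)"
      by (intro real_sqrt_le_mono order_trans[OF jn mult_right_mono]) (auto simp: power2_eq_square)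
    also have "\<dots> = (21/20) * sqrt ?j"
      by (simp add: real_sqrt_mult)
    finally have sq: "sqrt n \<le> (21/20) * sqrt ?j" .
    have sj: "0 < sqrt ?j" using j1 by simp
    have inv: "a * b / sqrt ?j \<le> (21/20) * S"
    proof -
      have "a * b / sqrt ?j = (21/20) * (a * b) / ((21/20) * sqrt ?j)" by simp
      also have "\<dots> \<le> (21/20) * (a * b) / sqrt n"
        using sq sj n0 b1 by (intro divide_left_mono mult_pos_pos) auto
      finally show ?thesis by (simp add: S_def)
    qed
    \<comment> \<open>The width 29 b l contributes 29 and the two inductive errors 2 * 87; the sum
      203 times 21/20 is below 214.\<close>
    have Q: "?\<epsilon> * a / (l * sqrt ?j) + 2 * (87 * a * b / sqrt ?j) \<le> 214 * S"
    proof -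
      have "2 * (87 * a * b / sqrt ?j) = 174 * (a * b / sqrt ?j)" by simp
      moreover have "?\<epsilon> * a / (l * sqrt ?j) = 29 * (a * b / sqrt ?j)" using l by simp
      moreover have "u + v \<le> 214 * S" if "v = 174 * x" "u = 29 * x" "x \<le> 21 / 20 * S" for u v x
        using that S0 by (simp add: field_simps)
      ultimately show ?thesis using inv by blast
    qed
    have "\<bar>avg \<mu> ((avg \<mu> ^^ ?j) ((avg \<nu> ^^ k) ?f)) x - avg \<nu> ((avg \<mu> ^^ ?j) ((avg \<nu> ^^ k) ?f)) x\<bar>
      \<le> 12456000000 / ?\<epsilon> ^ 6 * (214 * S) * (b ^ 4 * l ^ 6) / 720"
      using j1 n1 by (intro soft_step[OF j1 r \<epsilon> IH Q]) auto
    \<comment> \<open>The sixth power of the width cancels l^6 and leaves b^4 / b^6; the number is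
      about 6.22.\<close>
    also have "\<dots> = (12456000000 * 214 / (29 ^ 6 * 720)) * S / b\<^sup>2"
      using b1 l by (simp add: power_mult_distrib field_simps)
    also have "\<dots> \<le> 6.3 * S / b\<^sup>2"
      using S0 b1 by (intro divide_right_mono mult_right_mono) auto
    finally show ?thesis .
  qed
  have "m \<le> n" using mn by linarith
  have "\<bar>(avg \<mu> ^^ n) ?f x - (avg \<mu> ^^ (n - m)) ((avg \<nu> ^^ m) ?f) x\<bar> \<le> (\<Sum>k<m. 6.3 * S / b\<^sup>2)"
    unfolding avg_pow_telescope[OF f \<mu> \<nu> \<open>m \<le> n\<close>]
    by (rule order_trans[OF sum_abs], rule sum_mono, rule swap) simp
  also have "\<dots> = real m * (6.3 * S / b\<^sup>2)" by simp
  also have "\<dots> \<le> (3 * b\<^sup>2) * (6.3 * S / b\<^sup>2)"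
    using m S0 by (intro mult_right_mono) auto
  also have "\<dots> \<le> 19 * S" using b1 S0 by simp
  finally show ?thesis by (simp add: S_def)
qed

text \<open>For k below n / 2 at least n / 3 copies of \<mu> remain, so the inductive error is a
  multiple of S, and the sum of k^-3 over k \<ge> m is at most b^-4. For larger k the trivial error
  1 suffices, since then k^-3 is at most 8 / n^3.\<close>

lemma gaussian_exchange:
  assumes IH: "\<And>j x0 r x. 1 \<le> j \<Longrightarrow> j < n \<Longrightarrow> 0 \<le> r \<Longrightarrow>
      \<bar>(avg \<mu> ^^ j) (indicator (eball d x0 r)) x - (avg \<nu> ^^ j) (indicator (eball d x0 r)) x\<bar> \<le> 87 * a * b / sqrt j"
    and n: "7569 * (a * b)\<^sup>2 < real n" and m: "b\<^sup>2 + 1 \<le> real m" "m \<le> n" and r: "0 \<le> r"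
  shows "\<bar>(avg \<mu> ^^ (n - m)) ((avg \<nu> ^^ m) (indicator (eball d x0 r))) x - (avg \<nu> ^^ n) (indicator (eball d x0 r)) x\<bar>
     \<le> 7 * (a * b / sqrt n)"
proof -
  let ?f = "indicator (eball d x0 r) :: _ \<Rightarrow> real"
  define S where "S = a * b / sqrt n"
  have f: "test_fun d 1 ?f" by (rule test_fun_eball)
  have b2: "1 \<le> b\<^sup>2" using b1 by simp
  have "b\<^sup>2 \<le> (a * b)\<^sup>2" using b1 by (intro power_mono) (auto simp: mult_le_cancel_right1)
  then have n1: "7569 < real n" using n b2 by linarith
  have n0: "0 < sqrt n" using n1 by simp
  have S0: "0 \<le> S" using b1 n0 by (simp add: S_def)
  \<comment> \<open>The order of the terms without inductive factor. It is at most S^4 because 1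
    \<le> a, hence negligible as 87 S < 1.\<close>
  define T where "T = b ^ 4 / real n ^ 2"
  have "(87 * (a * b))\<^sup>2 < real n" using n by (simp add: power_mult_distrib)
  then have "87 * (a * b) < sqrt n" using b1 by (intro real_less_rsqrt)
  then have S1: "87 * S < 1" using n0 by (simp add: S_def field_simps)
  have T: "T \<le> S / 87 ^ 3"
  proof -
    have "b / sqrt n \<le> S" using b1 n0 unfolding S_def by (intro divide_right_mono) (auto simp: mult_le_cancel_right1)
    then have "(b / sqrt n) ^ 4 \<le> S ^ 4" using b1 n0 by (intro power_mono) auto
    also have "S ^ 4 = S * S ^ 3" by (simp add: power_numeral_reduce)
    also have "\<dots> \<le> S * (1 / 87) ^ 3" using S0 S1 by (intro mult_left_mono power_mono) auto
    also have "(b / sqrt n) ^ 4 = T"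
      using power_mult[of "sqrt n" 2 2] by (simp add: T_def power_divide)
    finally show ?thesis by (simp add: power_divide)
  qed
  have m2: "2 \<le> m" using m b2 by linarith
  let ?t = "\<lambda>k. avg \<mu> ((avg \<mu> ^^ (n - 1 - k)) ((avg \<nu> ^^ k) ?f)) x - avg \<nu> ((avg \<mu> ^^ (n - 1 - k)) ((avg \<nu> ^^ k) ?f)) x"
  \<comment> \<open>One form for both ranges of k, where 16 = 8 + 8: one half bounds (n - 1)^-3, the
    other k^-3 when k is at least n / 2.\<close>
  have swap: "\<bar>?t k\<bar> \<le> b ^ 4 / 26 * (16 / real n ^ 3 + 151 * S * (1 / real k ^ 3))" if k: "m \<le> k" "k < n" for k
  proof -
    have k1: "1 \<le> k" using k m2 by simp
    have N: "1 / (real n - 1) ^ 3 \<le> 8 / real n ^ 3"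
    proof -
      have "(real n / 2) ^ 3 \<le> (real n - 1) ^ 3" using n1 by (intro power_mono) auto
      then have "1 / (real n - 1) ^ 3 \<le> 1 / (real n / 2) ^ 3" using n1 by (intro divide_left_mono mult_pos_pos zero_less_power) auto
      then show ?thesis by (simp add: power_divide)
    qed
    show ?thesis
    proof (cases "2 * k < n")
      case True
      let ?j = "n - 1 - k"
      have jr: "real ?j = real n - 1 - real k" using k by (simp add: of_nat_diff)
      have j1: "1 \<le> ?j" using True n1 by linarith
      have "2 * real k < real n" using True by linarith
      then have "real n \<le> 3 * real ?j" using n1 unfolding jr by argo
      then have "sqrt n \<le> sqrt (3 * real ?j)" by (rule real_sqrt_le_mono)
      \<comment> \<open>The factor is slightly above sqrt 3, and 87 * 1.7356 is slightly below
        151.\<close>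
      also have "\<dots> \<le> 1.7356 * sqrt ?j"
        unfolding real_sqrt_mult by (intro mult_right_mono real_le_lsqrt) (auto simp: power2_eq_square)
      finally have sq: "sqrt n \<le> 1.7356 * sqrt ?j" .
      have sj: "0 < sqrt ?j" using j1 by simp
      have "87 * a * b / sqrt ?j = 1.7356 * (87 * a * b) / (1.7356 * sqrt ?j)" by simp
      also have "\<dots> \<le> 1.7356 * (87 * a * b) / sqrt n"
        using sq sj n0 b1 by (intro divide_left_mono mult_pos_pos) auto
      also have "\<dots> = 150.9972 * S" by (simp add: S_def)
      also have "\<dots> \<le> 151 * S" using S0 by (intro mult_right_mono) auto
      finally have E: "87 * a * b / sqrt ?j \<le> 151 * S" .
      have "\<bar>?t k\<bar> \<le> b ^ 4 / 26 * (1 / (real n - 1) ^ 3 + (151 * S) / real k ^ 3)"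
        using j1 n1 k by (intro hybrid_step[OF k1 k(2)] order_trans[OF IH E] r) auto
      also have "\<dots> \<le> b ^ 4 / 26 * (16 / real n ^ 3 + 151 * S * (1 / real k ^ 3))"
        using N by (intro mult_left_mono) (auto intro!: order_trans[OF N] divide_right_mono)
      finally show ?thesis .
    next
      case False
      then have kn: "real n / 2 \<le> real k" by linarith
      have "\<bar>?t k\<bar> \<le> b ^ 4 / 26 * (1 / (real n - 1) ^ 3 + 1 / real k ^ 3)"
      proof (rule hybrid_step[OF k1 k(2)])
        fix y
        show "\<bar>(avg \<mu> ^^ (n - 1 - k)) ?f y - (avg \<nu> ^^ (n - 1 - k)) ?f y\<bar> \<le> 1"
          using pow_eball_01[OF \<mu>, of "n - 1 - k" x0 r y] pow_eball_01[OF \<nu>, of "n - 1 - k" x0 r y] by linarith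
      qed
      also have "1 / real k ^ 3 \<le> 8 / real n ^ 3"
      proof -
        have "(real n / 2) ^ 3 \<le> real k ^ 3" using kn by (intro power_mono) auto
        then have "1 / real k ^ 3 \<le> 1 / (real n / 2) ^ 3" using n1 k1 by (intro divide_left_mono mult_pos_pos zero_less_power) auto
        then show ?thesis by (simp add: power_divide)
      qed
      then have "b ^ 4 / 26 * (1 / (real n - 1) ^ 3 + 1 / real k ^ 3) \<le> b ^ 4 / 26 * (16 / real n ^ 3 + 151 * S * (1 / real k ^ 3))"
      proof -
        assume k3: "1 / real k ^ 3 \<le> 8 / real n ^ 3"
        have "0 \<le> 151 * S * (1 / real k ^ 3)" using S0 by simp
        moreover have "16 / real n ^ 3 = 8 / real n ^ 3 + 8 / real n ^ 3" by simp
        ultimately show ?thesis using N k3 by (intro mult_left_mono) auto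
      qed
      finally show ?thesis .
    qed
  qed
  have sum3: "(\<Sum>k=m..<n. 1 / real k ^ 3) \<le> 1 / b ^ 4"
  proof -
    have "b\<^sup>2 \<le> real m - 1" using m by simp
    then have "(b\<^sup>2)\<^sup>2 \<le> (real m - 1)\<^sup>2" by (intro power_mono) auto
    then have "1 / (real m - 1)\<^sup>2 \<le> 1 / b ^ 4"
      using b1 m2 by (intro divide_left_mono mult_pos_pos) (auto simp flip: power_mult)
    moreover have "0 \<le> 1 / ((real m - 1) * (real n - 1))" using m2 n1 by simp
    ultimately show ?thesis using sum_inverse_cubes[OF m2 m(2)] by linarith
  qed
  have "(avg \<mu> ^^ (n - m)) ((avg \<nu> ^^ m) ?f) x - (avg \<nu> ^^ n) ?f x = (\<Sum>k<n. ?t k) - (\<Sum>k<m. ?t k)"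
    using avg_pow_telescope[OF f \<mu> \<nu> m(2), of x] avg_pow_telescope[OF f \<mu> \<nu> order_refl, of n x] by simp
  also have "\<dots> = (\<Sum>k=m..<n. ?t k)"
    using sum_diff_nat_ivl[of 0 m n ?t] m(2) by (simp add: lessThan_atLeast0)
  finally have tele: "(avg \<mu> ^^ (n - m)) ((avg \<nu> ^^ m) ?f) x - (avg \<nu> ^^ n) ?f x = (\<Sum>k=m..<n. ?t k)" .
  have "\<bar>(avg \<mu> ^^ (n - m)) ((avg \<nu> ^^ m) ?f) x - (avg \<nu> ^^ n) ?f x\<bar>
     \<le> (\<Sum>k=m..<n. b ^ 4 / 26 * (16 / real n ^ 3 + 151 * S * (1 / real k ^ 3)))"
    unfolding tele by (rule order_trans[OF sum_abs], rule sum_mono, rule swap) auto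
  also have "\<dots> = b ^ 4 / 26 * (real (n - m) * (16 / real n ^ 3) + 151 * S * (\<Sum>k=m..<n. 1 / real k ^ 3))"
    by (simp only: sum_distrib_left[symmetric] sum.distrib) simp
  also have "\<dots> \<le> b ^ 4 / 26 * (real n * (16 / real n ^ 3) + 151 * S * (1 / b ^ 4))"
    using sum3 S0 by (intro mult_left_mono add_mono mult_right_mono) auto
  also have "\<dots> = 16 / 26 * T + 151 / 26 * S"
    using b1 n1 by (simp add: T_def distrib_left power2_eq_square power3_eq_cube)
  also have "\<dots> \<le> 7 * S" using T S0 by simp
  finally show ?thesis by (simp add: S_def)
qed

text \<open>In units of \<open>a * b / sqrt n\<close>, the smoothed exchanges cost 19, the Gaussian
  ones 7 and anti-concentration over the width \<epsilon> costs 29, in total 55. For lower bounds on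
  balls of radius below \<epsilon> the cost is 58. Both stay below the inductive 87.\<close>

lemma ball_distance_bound:
  assumes "1 \<le> n" "0 \<le> r"
  shows "\<bar>(avg \<mu> ^^ n) (indicator (eball d x0 r)) x - (avg \<nu> ^^ n) (indicator (eball d x0 r)) x\<bar> \<le> 87 * a * b / sqrt n"
  using assms
proof (induction n arbitrary: x0 r x rule: less_induct)
  case (less n)
  let ?I = "\<lambda>r. indicator (eball d x0 r) :: _ \<Rightarrow> real"
  show ?case
  proof (cases "7569 * (a * b)\<^sup>2 < real n")
    case False
    \<comment> \<open>For these n the claimed bound is at least 1; this also starts the
      induction.\<close>
    then have "sqrt n \<le> 87 * (a * b)" using b1 by (intro real_le_lsqrt) (auto simp: power_mult_distrib)
    then have "1 \<le> 87 * a * b / sqrt n" using less.prems by (simp add: field_simps)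
    then show ?thesis
      using pow_eball_01[OF \<mu>, of n x0 r x] pow_eball_01[OF \<nu>, of n x0 r x] by linarith
  next
    case True
    note IH = less.IH
    have IH: "\<bar>(avg \<mu> ^^ j) (indicator (eball d x0 r)) x - (avg \<nu> ^^ j) (indicator (eball d x0 r)) x\<bar> \<le> 87 * a * b / sqrt j"
      if "1 \<le> j" "j < n" "0 \<le> r" for j x0 r x
      using less.IH[OF that(2,1,3)] .
    define S where "S = a * b / sqrt n"
    define \<epsilon> where "\<epsilon> = 29 * b * l"
    have \<epsilon>: "0 < \<epsilon>" using b1 l by (simp add: \<epsilon>_def)
    have S0: "0 \<le> S" using b1 by (simp add: S_def)
    have goal: "87 * a * b / sqrt n = 87 * S" by (simp add: S_def)
    define m where "m = nat \<lceil>b\<^sup>2\<rceil> + 1"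
    have b2: "1 \<le> b\<^sup>2" using b1 by simp
    have m: "b\<^sup>2 + 1 \<le> real m" "real m \<le> 3 * b\<^sup>2" unfolding m_def using b2 by linarith+
    have "b\<^sup>2 \<le> (a * b)\<^sup>2" using b1 by (intro power_mono) (auto simp: mult_le_cancel_right1)
    then have "real m \<le> real n" using m True b2 by linarith
    then have mn: "m \<le> n" by simp
    have A: "\<bar>(avg \<mu> ^^ n) (soft_ball d x0 r' \<epsilon>) x - (avg \<mu> ^^ (n - m)) ((avg \<nu> ^^ m) (soft_ball d x0 r' \<epsilon>)) x\<bar> \<le> 19 * S" if "0 \<le> r'" for r'
      unfolding \<epsilon>_def S_def by (rule smooth_exchange[OF IH True m(2) that])
    have B: "\<bar>(avg \<mu> ^^ (n - m)) ((avg \<nu> ^^ m) (?I r')) x - (avg \<nu> ^^ n) (?I r') x\<bar> \<le> 7 * S" if "0 \<le> r'" for r'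
      unfolding S_def by (rule gaussian_exchange[OF IH True m(1) mn that])
    have hyb: "(avg \<mu> ^^ (n - m)) ((avg \<nu> ^^ m) f) x \<le> (avg \<mu> ^^ (n - m)) ((avg \<nu> ^^ m) g) x"
      if "test_fun d 1 f" "test_fun d 1 g" "\<And>y. f y \<le> g y" for f g
      by (rule avg_pow_mono[OF test_fun_avg_pow[OF that(1) \<nu>] test_fun_avg_pow[OF that(2) \<nu>] \<mu>])
         (rule avg_pow_mono[OF that(1,2) \<nu> that(3)])
    have anti: "(avg \<nu> ^^ n) (indicator (annulus d c r' e)) x \<le> e * a / (l * sqrt n)" if "0 < e" "0 \<le> r'" for c r' e
      by (rule anticoncentration[OF less.prems(1) that])
    have e1: "\<epsilon> * a / (l * sqrt n) = 29 * S" using l by (simp add: \<epsilon>_def S_def)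
    have upper: "(avg \<mu> ^^ n) (?I r) x \<le> (avg \<nu> ^^ n) (?I r) x + 55 * S"
    proof -
      have "(avg \<mu> ^^ n) (?I r) x \<le> (avg \<mu> ^^ n) (soft_ball d x0 r \<epsilon>) x"
        by (rule avg_pow_mono[OF test_fun_eball test_fun_soft_ball \<mu> soft_ball_bounds(1)[OF less.prems(2) \<epsilon>]])
      moreover have "(avg \<mu> ^^ (n - m)) ((avg \<nu> ^^ m) (soft_ball d x0 r \<epsilon>)) x \<le> (avg \<mu> ^^ (n - m)) ((avg \<nu> ^^ m) (?I (r + \<epsilon>))) x"
        by (rule hyb[OF test_fun_soft_ball test_fun_eball soft_ball_bounds(2)[OF less.prems(2) \<epsilon>]])
      moreover have "(avg \<nu> ^^ n) (?I (r + \<epsilon>)) x \<le> (avg \<nu> ^^ n) (?I r) x + 29 * S"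
        using anti[OF \<epsilon> less.prems(2), of x0] unfolding e1 pow_annulus[OF \<nu> less.prems(2) \<epsilon>] by linarith
      ultimately show ?thesis
        using A[OF less.prems(2)] B[of "r + \<epsilon>"] less.prems(2) \<epsilon> by (simp add: abs_le_iff)
    qed
    have lower: "(avg \<nu> ^^ n) (?I r) x \<le> (avg \<mu> ^^ n) (?I r) x + 58 * S"
    proof (cases "\<epsilon> \<le> r")
      case True
      then have r': "0 \<le> r - \<epsilon>" by simp
      have "(avg \<mu> ^^ n) (soft_ball d x0 (r - \<epsilon>) \<epsilon>) x \<le> (avg \<mu> ^^ n) (?I r) x"
        using soft_ball_bounds(2)[OF r' \<epsilon>] by (intro avg_pow_mono[OF test_fun_soft_ball test_fun_eball \<mu>]) simp
      moreover have "(avg \<mu> ^^ (n - m)) ((avg \<nu> ^^ m) (?I (r - \<epsilon>))) x \<le> (avg \<mu> ^^ (n - m)) ((avg \<nu> ^^ m) (soft_ball d x0 (r - \<epsilon>) \<epsilon>)) x"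
        by (rule hyb[OF test_fun_eball test_fun_soft_ball soft_ball_bounds(1)[OF r' \<epsilon>]])
      moreover have "(avg \<nu> ^^ n) (?I r) x \<le> (avg \<nu> ^^ n) (?I (r - \<epsilon>)) x + 29 * S"
        using anti[OF \<epsilon> r', of x0] unfolding e1 pow_annulus[OF \<nu> r' \<epsilon>] by simp
      ultimately show ?thesis using A[OF r'] B[OF r'] S0 by (simp add: abs_le_iff)
    next
      case False
      then obtain c where c: "eball d x0 r \<subseteq> annulus d c 0 (2 * \<epsilon>)"
        using center_ball_in_annulus[OF less.prems(2)] by (meson not_le)
      have "(avg \<nu> ^^ n) (?I r) x \<le> (avg \<nu> ^^ n) (indicator (annulus d c 0 (2 * \<epsilon>))) x"
        using c by (intro avg_pow_mono[OF test_fun_eball test_fun_annulus \<nu>]) (auto simp: indicator_def)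
      also have "\<dots> \<le> 2 * \<epsilon> * a / (l * sqrt n)" using \<epsilon> by (intro anti) auto
      also have "\<dots> = 58 * S" using e1 by simp
      finally show ?thesis using pow_eball_01(1)[OF \<mu>, of n x0 r x] by linarith
    qed
    show ?thesis unfolding goal using upper lower S0 by (simp add: abs_le_iff)
  qed
qed

end

section \<open>Exchanging two laws with a Gaussian part\<close>

text \<open>Both laws contain a Gaussian of scale l, so every exchange takes place behind one of
  scale l sqrt (n - 1), whatever k is, and no induction is involved.\<close>

lemma gaussian_pair_exchange:
  assumes \<nu>6: "sixth_moments d \<nu>" and \<rho>6: "sixth_moments d \<rho>" and \<tau>: "law \<tau>" and \<zeta>: "law \<zeta>" and l: "0 < l"
    and split\<nu>: "\<And>M f. test_fun d M f \<Longrightarrow> avg \<nu> f = avg (gauss d l) (avg \<tau> f)"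
    and split\<rho>: "\<And>M f. test_fun d M f \<Longrightarrow> avg \<rho> f = avg (gauss d l) (avg \<zeta> f)"
    and same: "\<And>k. k \<le> 5 \<Longrightarrow> k \<noteq> 4 \<Longrightarrow> same_moments d k \<nu> \<rho>"
    and n: "2 \<le> n" and f: "test_fun d 1 f"
  shows "\<bar>(avg \<nu> ^^ n) f x - (avg \<rho> ^^ n) f x\<bar> \<le>
    real n * (sqrt (\<Sum>is\<in>multi_idx d 4. (moment_gap \<nu> \<rho> is)\<^sup>2) / (sqrt 24 * l ^ 4 * (real n - 1) ^ 2)
      + ((\<integral>h. nsq d h ^ 3 \<partial>\<nu>) + (\<integral>h. nsq d h ^ 3 \<partial>\<rho>)) / (sqrt 720 * l ^ 6 * (real n - 1) ^ 3))"
proof -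
  have \<nu>: "law \<nu>" and \<rho>: "law \<rho>" using \<nu>6 \<rho>6 by (auto intro: sixth_moments_law)
  define s where "s = l * sqrt (real (n - 1))"
  have s0: "0 < s" using l n by (simp add: s_def)
  have s4: "s ^ 4 = l ^ 4 * (real n - 1) ^ 2"
    using power_mult[of "sqrt (real (n - 1))" 2 2] n by (simp add: s_def power_mult_distrib)
  have s6: "s ^ 6 = l ^ 6 * (real n - 1) ^ 3"
    using power_mult[of "sqrt (real (n - 1))" 2 3] n by (simp add: s_def power_mult_distrib)
  define F where "F = sqrt (\<Sum>is\<in>multi_idx d 4. (moment_gap \<nu> \<rho> is)\<^sup>2)"
  define \<beta> where "\<beta> = (\<integral>h. nsq d h ^ 3 \<partial>\<nu>) + (\<integral>h. nsq d h ^ 3 \<partial>\<rho>)"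
  let ?t = "\<lambda>k. avg \<nu> ((avg \<nu> ^^ (n - 1 - k)) ((avg \<rho> ^^ k) f)) x - avg \<rho> ((avg \<nu> ^^ (n - 1 - k)) ((avg \<rho> ^^ k) f)) x"
  have swap: "\<bar>?t k\<bar> \<le> F / (sqrt 24 * s ^ 4) + \<beta> / (sqrt 720 * s ^ 6)" if k: "k < n" for k
  proof -
    let ?j = "n - 1 - k"
    define e where "e = (avg \<tau> ^^ ?j) ((avg \<zeta> ^^ k) f)"
    have fz: "test_fun d 1 ((avg \<zeta> ^^ k) f)" by (rule test_fun_avg_pow[OF f \<zeta>])
    have e: "test_fun d 1 e" unfolding e_def by (rule test_fun_avg_pow[OF fz \<tau>])
    have "(l * sqrt ?j)\<^sup>2 + (l * sqrt k)\<^sup>2 = l\<^sup>2 * (real ?j + real k)"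
      by (simp add: power_mult_distrib distrib_left)
    also have "real ?j + real k = real (n - 1)" using k by simp
    finally have ss: "sqrt ((l * sqrt ?j)\<^sup>2 + (l * sqrt k)\<^sup>2) = s" using l by (simp add: s_def real_sqrt_mult)
    define g where "g = (avg \<rho> ^^ k) f"
    have eq1: "(avg \<nu> ^^ ?j) g = avg (gauss d (l * sqrt ?j)) ((avg \<tau> ^^ ?j) g)"
      unfolding g_def by (rule gauss_split_pow[OF \<nu> \<tau> _ split\<nu> test_fun_avg_pow[OF f \<rho>]]) (use l in auto)
    have eq2: "g = avg (gauss d (l * sqrt k)) ((avg \<zeta> ^^ k) f)"
      unfolding g_def by (rule gauss_split_pow[OF \<rho> \<zeta> _ split\<rho> f]) (use l in auto)
    have eq3: "(avg \<tau> ^^ ?j) g = avg (gauss d (l * sqrt k)) e"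
      unfolding eq2 e_def by (rule avg_pow_commute1[OF fz law_gauss \<tau>, symmetric])
    have "avg (gauss d (l * sqrt ?j)) (avg (gauss d (l * sqrt k)) e) = avg (gauss d s) e"
      using avg_gauss_gauss[OF e, of "l * sqrt ?j" "l * sqrt k"] l unfolding ss by simp
    then have h: "(avg \<nu> ^^ ?j) ((avg \<rho> ^^ k) f) = avg (gauss d s) e" unfolding g_def[symmetric] eq1 eq3 .
    have "\<bar>?t k\<bar> \<le> \<bar>(\<integral>h. hermite_coeff d e s x 4 h \<partial>\<nu>) - (\<integral>h. hermite_coeff d e s x 4 h \<partial>\<rho>)\<bar> / 24 + 1 / (sqrt 720 * s ^ 6) * \<beta>"
      unfolding h \<beta>_def by (rule gaussian_swap_bound[OF e s0 \<nu>6 \<rho>6 same])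
    also have "\<dots> \<le> (1 * sqrt 24 / s ^ 4 * F) / 24 + 1 / (sqrt 720 * s ^ 6) * \<beta>"
      unfolding F_def by (intro add_right_mono divide_right_mono hermite_coeff_4_gap[OF e s0 \<nu>6 \<rho>6]) simp
    also have "(1 * sqrt 24 / s ^ 4 * F) / 24 = F / (sqrt 24 * s ^ 4)"
      using s0 by (simp add: field_simps)
    finally show ?thesis by simp
  qed
  have "\<bar>(avg \<nu> ^^ n) f x - (avg \<rho> ^^ n) f x\<bar> \<le> (\<Sum>k<n. F / (sqrt 24 * s ^ 4) + \<beta> / (sqrt 720 * s ^ 6))"
  proof -
    have tele: "(avg \<nu> ^^ n) f x - (avg \<rho> ^^ n) f x = (\<Sum>k<n. ?t k)"
      using avg_pow_telescope[OF f \<nu> \<rho> order_refl, of n x] by simp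
    show ?thesis unfolding tele by (rule order_trans[OF sum_abs], rule sum_mono, rule swap) simp
  qed
  also have "\<dots> = real n * (F / (sqrt 24 * s ^ 4) + \<beta> / (sqrt 720 * s ^ 6))" by simp
  finally show ?thesis unfolding s4 s6 F_def \<beta>_def by (simp add: mult.assoc)
qed

text \<open>The term 1 / n must keep the coefficient 1, because it carries the Frobenius term with
  its sharp constant; everything else is pushed to order n^-2.\<close>

lemma excess_bounds:
  fixes n :: real
  assumes n: "2 \<le> n"
  shows "n / (n - 1) ^ 2 \<le> 1 / n + 8 / n ^ 2" "n / (n - 1) ^ 3 \<le> 8 / n ^ 2"
proof -
  have p: "0 < (n - 1) ^ 2" "0 < (n - 1) ^ 3" "0 < n" using n by auto
  have "n * n ^ 2 \<le> (n + 8) * (n - 1) ^ 2"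
  proof -
    have "(n + 8) * (n - 1) ^ 2 - n * n ^ 2 = 6 * n * n - 15 * n + 8" by (simp add: power2_eq_square algebra_simps)
    also have "\<dots> = 6 * n * (n - 2) - 3 * n + 8" by (simp add: algebra_simps)
    also have "\<dots> = (6 * n - 3) * (n - 2) + 2" by (simp add: algebra_simps)
    also have "0 \<le> \<dots>" using n by (intro add_nonneg_nonneg mult_nonneg_nonneg) auto
    finally show ?thesis by simp
  qed
  then have "n / (n - 1) ^ 2 \<le> (n + 8) / n ^ 2" using p by (simp add: divide_simps mult.commute)
  also have "\<dots> = 1 / n + 8 / n ^ 2" using p by (simp add: add_divide_distrib power2_eq_square)
  finally show "n / (n - 1) ^ 2 \<le> 1 / n + 8 / n ^ 2" .
  have "(n / 2) ^ 3 \<le> (n - 1) ^ 3" using n by (intro power_mono) auto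
  then have "n * n ^ 2 \<le> 8 * (n - 1) ^ 3" by (simp add: power_divide power3_eq_cube power2_eq_square)
  then show "n / (n - 1) ^ 3 \<le> 8 / n ^ 2" using p by (simp add: divide_simps mult.commute)
qed

lemma square_le_1_plus_cube: "0 \<le> t \<Longrightarrow> t ^ 2 \<le> 1 + t ^ (3::nat)" for t :: real
proof (cases "t \<le> 1")
  case True
  assume t: "0 \<le> t"
  then have "t ^ 2 \<le> 1" using True by (intro power_le_one) auto
  moreover have "0 \<le> t ^ 3" using t by simp
  ultimately show ?thesis by linarith
next
  case False
  then have "t ^ 2 \<le> t ^ 3" by (intro power_increasing) auto
  then show ?thesis by simp
qed

lemma fourth_moment_le:
  assumes \<mu>: "sixth_moments d \<mu>" and l: "0 < l"
  shows "(\<integral>x. (nsq d x)\<^sup>2 \<partial>\<mu>) / l ^ 4 \<le> 1 + (\<integral>x. nsq d x ^ 3 \<partial>\<mu>) / l ^ 6"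
proof -
  interpret prob_space \<mu> using \<mu> by (simp add: sixth_moments_def law_def)
  have i2: "integrable \<mu> (\<lambda>x. (nsq d x)\<^sup>2)"
    using hom_poly_integrable[OF \<mu> hom_poly_power[OF hom_poly_nsq, of d 2]] by simp
  note i3 = nsq_cube_integrable[OF \<mu>]
  have "(\<integral>x. (nsq d x)\<^sup>2 / l ^ 4 \<partial>\<mu>) \<le> (\<integral>x. 1 + nsq d x ^ 3 / l ^ 6 \<partial>\<mu>)"
  proof (intro integral_mono)
    fix x
    have "(nsq d x / l\<^sup>2) ^ 2 \<le> 1 + (nsq d x / l\<^sup>2) ^ 3" using l by (intro square_le_1_plus_cube) auto
    then show "(nsq d x)\<^sup>2 / l ^ 4 \<le> 1 + nsq d x ^ 3 / l ^ 6"
      by (simp add: power_divide flip: power_mult)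
  qed (use i2 i3 in auto)
  then show ?thesis using i3 by (simp add: prob_space)
qed

context matched_laws
begin

text \<open>The distance between \<mu> and \<nu> costs 87 units of \<open>a * b / sqrt n\<close>.
  One more unit pays for all n^-2 terms of the passage to \<rho>: the comparison of sixth moments
  makes them O(b^4 / n^2), which is below a unit as soon as 87 units are less than 1.\<close>

lemma gaussian_limit_bound:
  assumes \<rho>6: "sixth_moments d \<rho>" and \<zeta>: "law \<zeta>"
    and split\<rho>: "\<And>M f. test_fun d M f \<Longrightarrow> avg \<rho> f = avg (gauss d l) (avg \<zeta> f)"
    and same\<rho>: "\<And>k. k \<le> 5 \<Longrightarrow> k \<noteq> 4 \<Longrightarrow> same_moments d k \<mu> \<rho>"
    and m6: "(\<integral>h. nsq d h ^ 3 \<partial>\<rho>) \<le> 15 * (\<integral>h. nsq d h ^ 3 \<partial>\<mu>)"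
    and n: "1 \<le> n" and r: "0 \<le> r"
  shows "\<bar>(avg \<mu> ^^ n) (indicator (eball d x0 r)) x - (avg \<rho> ^^ n) (indicator (eball d x0 r)) x\<bar>
    \<le> sqrt (\<Sum>is\<in>multi_idx d 4. (moment_gap \<mu> \<rho> is)\<^sup>2) / (sqrt 24 * l ^ 4) / real n + 88 * a * b / sqrt n"
proof -
  define F where "F = sqrt (\<Sum>is\<in>multi_idx d 4. (moment_gap \<mu> \<rho> is)\<^sup>2)"
  let ?I = "indicator (eball d x0 r) :: _ \<Rightarrow> real"
  define S where "S = a * b / sqrt n"
  have n0: "0 < sqrt n" using n by simp
  have S0: "0 \<le> S" using b1 n0 by (simp add: S_def)
  have F0: "0 \<le> F" by (simp add: F_def sum_nonneg)
  have \<rho>: "law \<rho>" using \<rho>6 by (rule sixth_moments_law)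
  have goal: "88 * a * b / sqrt n = 88 * S" by (simp add: S_def)
  show ?thesis
  proof (cases "87 * S < 1")
    case False
    have "0 \<le> F / (sqrt 24 * l ^ 4) / real n" using F0 l by simp
    then show ?thesis
      using False S0 pow_eball_01[OF \<mu>, of n x0 r x] pow_eball_01[OF \<rho>, of n x0 r x]
      unfolding goal F_def by linarith
  next
    case True
    have aS: "87 * (a * b) < sqrt n" using True n0 by (simp add: S_def field_simps)
    moreover have "1 \<le> a * b" using b1 by (metis max.cobounded1 mult_mono' mult_1 zero_le_one)
    ultimately have "87 < sqrt n" by linarith
    then have "n \<noteq> 1" by auto
    then have "2 \<le> n" using n by simp
    then have n2: "2 \<le> real n" by simp
    define \<beta> where "\<beta> = (\<integral>h. nsq d h ^ 3 \<partial>\<nu>) + (\<integral>h. nsq d h ^ 3 \<partial>\<rho>)"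
    have same': "same_moments d k \<nu> \<rho>" if "k \<le> 5" "k \<noteq> 4" for k
      using same[OF that(1)] same\<rho>[OF that] by (auto simp: same_moments_def)
    have gap: "moment_gap \<nu> \<rho> is = moment_gap \<mu> \<rho> is" if "is \<in> multi_idx d 4" for "is"
      using same[of 4] that by (auto simp: same_moments_def moment_gap_def)
    have Feq: "sqrt (\<Sum>is\<in>multi_idx d 4. (moment_gap \<nu> \<rho> is)\<^sup>2) = F"
      by (simp add: F_def gap)
    \<comment> \<open>Here 16 = 15 + 1, for the sixth moment of \<rho> bounded through \<mu>, and
      that of \<nu>.\<close>
    have \<beta>: "\<beta> / l ^ 6 \<le> 16 * b ^ 4"
    proof -
      have "0 \<le> (\<integral>h. nsq d h ^ 3 \<partial>\<nu>)" "0 \<le> (\<integral>h. nsq d h ^ 3 \<partial>\<mu>)" by simp_all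
      moreover have "y + z \<le> 16 * (x + y)" if "0 \<le> y" "0 \<le> x" "z \<le> 15 * x" for x y z :: real
        using that by simp
      ultimately have "\<beta> \<le> 16 * (b ^ 4 * l ^ 6)" unfolding b[symmetric] \<beta>_def using m6 by blast
      then show ?thesis using l by (simp add: field_simps)
    qed
    have FB: "F / l ^ 4 \<le> 2 + \<beta> / l ^ 6"
    proof -
      have "F \<le> (\<integral>x. (nsq d x)\<^sup>2 \<partial>\<nu>) + (\<integral>x. (nsq d x)\<^sup>2 \<partial>\<rho>)"
        using moment_gap_norm_le[OF \<nu>6 \<rho>6] unfolding Feq .
      then have "F / l ^ 4 \<le> ((\<integral>x. (nsq d x)\<^sup>2 \<partial>\<nu>) + (\<integral>x. (nsq d x)\<^sup>2 \<partial>\<rho>)) / l ^ 4"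
        using l by (intro divide_right_mono) auto
      also have "\<dots> \<le> 2 + \<beta> / l ^ 6"
        using fourth_moment_le[OF \<nu>6 l] fourth_moment_le[OF \<rho>6 l] by (simp add: \<beta>_def add_divide_distrib)
      finally show ?thesis .
    qed
    define G B where "G = F / l ^ 4" and "B = \<beta> / l ^ 6"
    have GB: "0 \<le> G" "0 \<le> B" "G \<le> 2 + B" "B \<le> 16 * b ^ 4"
      using F0 l FB \<beta> by (auto simp: G_def B_def \<beta>_def)
    have r24: "1 / sqrt 24 \<le> (1/4::real)"
    proof -
      have "4 \<le> sqrt (24::real)" by (rule real_le_rsqrt) simp
      then show ?thesis by (intro divide_left_mono) auto
    qed
    have r720: "1 / sqrt 720 \<le> (1/26::real)"
    proof -
      have "26 \<le> sqrt (720::real)" by (rule real_le_rsqrt) simp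
      then show ?thesis by (intro divide_left_mono) auto
    qed
    have "\<bar>(avg \<nu> ^^ n) ?I x - (avg \<rho> ^^ n) ?I x\<bar> \<le> real n * (F / (sqrt 24 * l ^ 4 * (real n - 1) ^ 2) + \<beta> / (sqrt 720 * l ^ 6 * (real n - 1) ^ 3))"
      using gaussian_pair_exchange[OF \<nu>6 \<rho>6 \<tau> \<zeta> l split split\<rho> same' \<open>2 \<le> n\<close> test_fun_eball] unfolding Feq \<beta>_def .
    also have "\<dots> = G * (1 / sqrt 24) * (real n / (real n - 1) ^ 2) + B * (1 / sqrt 720) * (real n / (real n - 1) ^ 3)"
      by (simp add: G_def B_def distrib_left mult_ac)
    also have "\<dots> \<le> G * (1 / sqrt 24) * (1 / real n + 8 / real n ^ 2) + B * (1 / sqrt 720) * (8 / real n ^ 2)"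
      using GB excess_bounds[OF n2] by (intro add_mono mult_left_mono) auto
    also have "\<dots> = G * (1 / sqrt 24) / real n + (G * (1 / sqrt 24) + B * (1 / sqrt 720)) * (8 / real n ^ 2)"
      by (simp only: distrib_left distrib_right) (simp add: add_divide_distrib)
    also have "\<dots> \<le> G * (1 / sqrt 24) / real n + 44 * b ^ 4 / real n ^ 2"
    proof -
      have "G * (1 / sqrt 24) \<le> G * (1/4)" "B * (1 / sqrt 720) \<le> B * (1/26)"
        using GB r24 r720 by (intro mult_left_mono; simp)+
      moreover have "1 \<le> b ^ 4" using b1 by simp
      \<comment> \<open>Since 1 \<le> b^4, the factor is at most (2 + 16) / 4 + 16 / 26, below
        5.5.\<close>
      ultimately have "G * (1 / sqrt 24) + B * (1 / sqrt 720) \<le> 5.5 * b ^ 4" using GB by simp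
      then have "(G * (1 / sqrt 24) + B * (1 / sqrt 720)) * (8 / real n ^ 2) \<le> 5.5 * b ^ 4 * (8 / real n ^ 2)"
        by (intro mult_right_mono) auto
      then show ?thesis by simp
    qed
    \<comment> \<open>As b / sqrt n is at most S, its fourth power is at most S / 87^3.\<close>
    also have "44 * b ^ 4 / real n ^ 2 \<le> S"
    proof -
      have "b / sqrt n \<le> S" using b1 n0 unfolding S_def by (intro divide_right_mono) (auto simp: mult_le_cancel_right1)
      then have "(b / sqrt n) ^ 4 \<le> S ^ 4" using b1 n0 by (intro power_mono) auto
      also have "S ^ 4 = S * S ^ 3" by (simp add: power_numeral_reduce)
      also have "\<dots> \<le> S * (1 / 87) ^ 3" using S0 True by (intro mult_left_mono power_mono) auto
      also have "(b / sqrt n) ^ 4 = b ^ 4 / real n ^ 2"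
        using power_mult[of "sqrt n" 2 2] by (simp add: power_divide)
      finally show ?thesis using S0 by (simp add: power_divide)
    qed
    finally have "\<bar>(avg \<nu> ^^ n) ?I x - (avg \<rho> ^^ n) ?I x\<bar> \<le> G * (1 / sqrt 24) / real n + S" by simp
    moreover have "\<bar>(avg \<mu> ^^ n) ?I x - (avg \<nu> ^^ n) ?I x\<bar> \<le> 87 * S"
      using ball_distance_bound[OF n r, of x0 x] by (simp add: S_def mult.assoc)
    moreover have "G * (1 / sqrt 24) / real n = F / (sqrt 24 * l ^ 4) / real n" by (simp add: G_def mult.commute)
    ultimately show ?thesis unfolding goal F_def[symmetric] by linarith
  qed
qed

end

section \<open>Existence of the anti-concentration constant\<close>

lemma std_interval_le:
  assumes t: "0 \<le> t"
  shows "emeasure std_normal_distribution {c - t..c + t} \<le> ennreal t"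
proof -
  have "std_normal_density x \<le> 1 / 2" for x
  proof -
    have "2 \<le> sqrt (2 * pi)" by (rule real_le_rsqrt) (use pi_gt3 in simp)
    then have "1 / sqrt (2 * pi) \<le> 1 / 2" by (intro divide_left_mono) auto
    moreover have "1 / sqrt (2 * pi) * exp (- x\<^sup>2 / 2) \<le> 1 / sqrt (2 * pi) * 1"
      by (intro mult_left_mono) auto
    ultimately show ?thesis unfolding std_normal_density_def by linarith
  qed
  note dens = this
  have "emeasure std_normal_distribution {c - t..c + t} = (\<integral>\<^sup>+x. ennreal (std_normal_density x) * indicator {c - t..c + t} x \<partial>lborel)"
    by (rule emeasure_density) auto
  also have "\<dots> \<le> (\<integral>\<^sup>+x. ennreal (1/2) * indicator {c - t..c + t} x \<partial>lborel)"
    by (intro nn_integral_mono mult_right_mono ennreal_leI dens) simp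
  also have "\<dots> = ennreal (1/2) * ennreal (2 * t)"
    using t by (subst nn_integral_cmult_indicator) auto
  also have "\<dots> = ennreal t" by (subst ennreal_mult'[symmetric]) auto
  finally show ?thesis .
qed

text \<open>The ball lies in a cube of side 2 \<rho>, and the standard normal density is at most
  1/2.\<close>

lemma gam_ball_le:
  assumes \<rho>: "0 \<le> \<rho>"
  shows "measure (gam d) (eball d c \<rho>) \<le> \<rho> ^ d"
proof -
  interpret S: product_sigma_finite "\<lambda>_::nat. std_normal_distribution" by (rule sigma_finite_std)
  interpret P: prob_space "std_prod d" by (rule prob_std_prod)
  let ?B = "Pi\<^sub>E {..<d} (\<lambda>i. {c i - \<rho>..c i + \<rho>})"
  have "emeasure (gam d) (eball d c \<rho>) = emeasure (std_prod d) (trunc d -` eball d c \<rho> \<inter> space (std_prod d))"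
    unfolding gam_def by (rule emeasure_distr) auto
  also have "\<dots> \<le> emeasure (std_prod d) ?B"
  proof (rule emeasure_mono)
    show "trunc d -` eball d c \<rho> \<inter> space (std_prod d) \<subseteq> ?B"
    proof
      fix x assume x: "x \<in> trunc d -` eball d c \<rho> \<inter> space (std_prod d)"
      then have e: "enorm d (\<lambda>k. x k - c k) \<le> \<rho>" by (simp add: eball_trunc) (simp add: eball_def)
      have "\<bar>x i - c i\<bar> \<le> \<rho>" if "i < d" for i
      proof -
        have "\<bar>x i - c i\<bar> = sqrt ((x i - c i)\<^sup>2)" by simp
        also have "\<dots> \<le> enorm d (\<lambda>k. x k - c k)" unfolding L2_set_def real_sqrt_le_iff
          by (rule member_le_sum) (use that in auto)
        finally show ?thesis using e by simp
      qed
      then have "x i \<in> {c i - \<rho>..c i + \<rho>}" if "i < d" for i using that by (auto simp: abs_le_iff algebra_simps dest!: spec)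
      then show "x \<in> ?B" using x by (auto simp: space_PiM PiE_def)
    qed
  qed (intro sets_PiM_I_finite, auto)
  also have "\<dots> = (\<Prod>i<d. emeasure std_normal_distribution {c i - \<rho>..c i + \<rho>})"
    by (rule S.emeasure_PiM) auto
  also have "\<dots> \<le> (\<Prod>i<d. ennreal \<rho>)" by (intro prod_mono_ennreal std_interval_le \<rho>)
  also have "\<dots> = ennreal (\<rho> ^ d)" using \<rho> by (simp add: ennreal_power)
  finally show ?thesis using \<rho> by (simp add: measure_def enn2real_leI)
qed

lemma gam_nsq_deviation:
  "integrable (gam d) (\<lambda>g. (nsq d g - real d)\<^sup>2)" "(\<integral>g. (nsq d g - real d)\<^sup>2 \<partial>gam d) = 2 * real d"
proof -
  interpret G: prob_space "gam d" by (rule prob_gam)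
  define e where "e i k = (if k = i then 1 else 0 :: real)" for i k :: nat
  have de: "dot d (e i) g = g i" if "i < d" for i g
    using that by (simp add: dot_def e_def if_distrib[of "\<lambda>x. x * _"] cong: if_cong)
  have sq: "(nsq d g)\<^sup>2 = (\<Sum>i<d. \<Sum>j<d. dot d (e i) g ^ 2 * dot d (e j) g ^ 2)" for g
    by (simp add: de power2_eq_square[of "nsq d g"]) (simp add: dot_def sum_product power2_eq_square)
  have n: "nsq d g = (\<Sum>i<d. dot d (e i) g ^ 2)" for g
    by (simp add: de) (simp add: dot_def power2_eq_square)
  have i4: "integrable (gam d) (\<lambda>g. (nsq d g)\<^sup>2)" unfolding sq by (intro Bochner_Integration.integrable_sum gam_dot_powers_integrable)
  have i2: "integrable (gam d) (\<lambda>g. nsq d g)" unfolding n by (intro Bochner_Integration.integrable_sum gam_dot_power_integrable)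
  have "(\<integral>g. (nsq d g)\<^sup>2 \<partial>gam d) = (\<Sum>i<d. \<Sum>j<d. 1 + (if j = i then 2 else 0))"
    unfolding sq
    by (subst Bochner_Integration.integral_sum, intro Bochner_Integration.integrable_sum gam_dot_powers_integrable)+
       (intro sum.cong refl, subst gam_mixed_moments(1), auto simp: de, auto simp: e_def)
  then have E4: "(\<integral>g. (nsq d g)\<^sup>2 \<partial>gam d) = (real d)\<^sup>2 + 2 * d"
    by (simp add: sum.distrib power2_eq_square distrib_left)
  have E2: "(\<integral>g. nsq d g \<partial>gam d) = d"
  proof -
    have "(\<integral>g. dot d (e i) g ^ 2 \<partial>gam d) = 1" if "i < d" for i
      using gam_dot_even_moment[of d "e i" 1] de[OF that, of "e i"] by (simp add: e_def)
    then show ?thesis unfolding n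
      by (subst Bochner_Integration.integral_sum) (simp_all add: gam_dot_power_integrable)
  qed
  have ex: "(nsq d g - real d)\<^sup>2 = (nsq d g)\<^sup>2 - 2 * d * nsq d g + (real d)\<^sup>2" for g
    by (simp add: power2_diff)
  show "integrable (gam d) (\<lambda>g. (nsq d g - real d)\<^sup>2)" unfolding ex using i4 i2 by auto
  show "(\<integral>g. (nsq d g - real d)\<^sup>2 \<partial>gam d) = 2 * real d"
    unfolding ex using i4 i2 G.prob_space by (simp add: E4 E2) (simp add: power2_eq_square)
qed

lemma gam_deviation_square:
  fixes p :: real
  shows "integrable (gam d) (\<lambda>g. ((nsq d g - real d) + p * dot d c g)\<^sup>2)"
    and "(\<integral>g. ((nsq d g - real d) + p * dot d c g)\<^sup>2 \<partial>gam d) \<le> 4 * real d + 2 * p\<^sup>2 * nsq d c"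
proof -
  let ?H = "\<lambda>g. 2 * (nsq d g - real d)\<^sup>2 + 2 * p\<^sup>2 * dot d c g ^ 2"
  have H: "integrable (gam d) ?H" using gam_nsq_deviation(1) gam_dot_power_integrable[of d c 2] by auto
  have le: "((nsq d g - real d) + p * dot d c g)\<^sup>2 \<le> ?H g" for g
    using sum_squares_bound[of "nsq d g - real d" "p * dot d c g"] by (simp add: power2_sum power_mult_distrib)
  show i: "integrable (gam d) (\<lambda>g. ((nsq d g - real d) + p * dot d c g)\<^sup>2)"
    by (rule Bochner_Integration.integrable_bound[OF H]) (use le in \<open>auto simp: abs_of_nonneg intro: order_trans\<close>)
  have "(\<integral>g. ((nsq d g - real d) + p * dot d c g)\<^sup>2 \<partial>gam d) \<le> (\<integral>g. ?H g \<partial>gam d)"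
    by (rule integral_mono[OF i H le])
  also have "\<dots> = 4 * real d + 2 * p\<^sup>2 * nsq d c"
    using gam_nsq_deviation gam_dot_power_integrable[of d c 2] gam_dot_even_moment[of d c 1] by simp
  finally show "(\<integral>g. ((nsq d g - real d) + p * dot d c g)\<^sup>2 \<partial>gam d) \<le> 4 * real d + 2 * p\<^sup>2 * nsq d c" .
qed

text \<open>
  With \<open>\<delta> = 1 - s\<close> and \<open>y = g - c\<close>, the exponent \<open>\<xi>\<close> satisfies
  \<open>- \<xi> = \<delta> (d - g \<bullet> y) + d (- ln s - \<delta>) + \<delta>\<^sup>2 \<parallel>y\<parallel>\<^sup>2 / 2\<close>, so that \<open>1 - exp \<xi> \<le> - \<xi>\<close> is of order \<open>\<delta>\<close>.
\<close>

lemma gam_dilation: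
  fixes d c
  assumes s: "0 < s"
  defines "\<xi> \<equiv> \<lambda>g. real d * ln s + (nsq d g - nsq d (\<lambda>k. c k + s * (g k - c k))) / 2"
  shows "measure (gam d) (eball d c (s * \<rho>)) = (\<integral>g. indicator (eball d c \<rho>) g * exp (\<xi> g) \<partial>gam d)"
    and "integrable (gam d) (\<lambda>g. indicator (eball d c \<rho>) g * exp (\<xi> g))"
proof -
  let ?r = "\<lambda>i x. s * exp (x\<^sup>2 / 2 - (c i + s * (x - c i))\<^sup>2 / 2)"
  let ?T = "\<lambda>x. trunc d (\<lambda>i. c i + (x i - c i) / s)"
  let ?B = "eball d c \<rho>"
  have "distr std_normal_distribution borel (\<lambda>x. c i + (x - c i) / s)
      = density std_normal_distribution (\<lambda>x. ennreal (?r i x))" for i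
  proof (rule std_distr_density[where \<sigma>="1 / s" and \<beta>="c i - c i / s"])
    show "normal_density (c i - c i / s) (1 / s) x = std_normal_density x * ?r i x" for x
    proof -
      have e: "- (x - (c i - c i / s))\<^sup>2 / (2 * (1 / s)\<^sup>2) = - (c i + s * (x - c i))\<^sup>2 / 2"
        using s by (simp add: field_simps power2_eq_square)
      show ?thesis using s unfolding normal_density_def e
        by (simp add: exp_add[symmetric] real_sqrt_mult real_sqrt_divide field_simps)
    qed
  qed (use s in \<open>auto simp: field_simps\<close>)
  then have D: "distr (gam d) borel ?T = density (gam d) (\<lambda>g. \<Prod>i<d. ennreal (?r i (g i)))"
    by (intro gam_distr_density[where \<phi>="\<lambda>i x. c i + (x - c i) / s" and r="\<lambda>i x. ennreal (?r i x)"]) auto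
  have R: "(\<Prod>i<d. ennreal (?r i (g i))) = ennreal (exp (\<xi> g))" for g
    using s by (simp add: prod_ennreal prod.distrib exp_sum[symmetric] \<xi>_def dot_def sum_subtractf sum_divide_distrib
        power2_eq_square exp_add exp_of_nat_mult diff_divide_distrib)
  have [measurable]: "(\<lambda>x::nat \<Rightarrow> real. x k) \<in> borel_measurable borel" for k by measurable
  have [measurable]: "\<xi> \<in> borel_measurable borel" unfolding \<xi>_def dot_def by measurable
  have Tm: "?T \<in> borel_measurable (gam d)"
    by (rule measurable_coordinatewise_then_product) (simp add: trunc_def)
  have "?T g \<in> ?B \<longleftrightarrow> g \<in> eball d c (s * \<rho>)" for g
  proof -
    have "enorm d (\<lambda>k. c k + (g k - c k) / s - c k) = enorm d (\<lambda>k. g k - c k) / s"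
      using L2_set_right_distrib[of "1 / s" "\<lambda>k. g k - c k" "{..<d}"] s by (simp add: mult.commute field_simps)
    then show ?thesis using s unfolding eball_trunc unfolding eball_def mem_Collect_eq by (simp only:) (simp add: field_simps)
  qed
  then have "measure (gam d) (eball d c (s * \<rho>)) = measure (distr (gam d) borel ?T) ?B"
    using Tm by (subst measure_distr) (auto intro!: arg_cong[where f="measure _"])
  also have "\<dots> = (\<integral>g. indicator ?B g \<partial>density (gam d) (\<lambda>g. ennreal (exp (\<xi> g))))"
    unfolding D R by simp
  also have "\<dots> = (\<integral>g. indicator ?B g * exp (\<xi> g) \<partial>gam d)"
    by (subst integral_density) (auto simp: mult.commute)
  finally show "measure (gam d) (eball d c (s * \<rho>)) = (\<integral>g. indicator ?B g * exp (\<xi> g) \<partial>gam d)" .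
  have "prob_space (density (gam d) (\<lambda>g. ennreal (exp (\<xi> g))))"
    unfolding D[unfolded R, symmetric] by (rule prob_space.prob_space_distr[OF prob_gam Tm])
  then interpret F: prob_space "density (gam d) (\<lambda>g. ennreal (exp (\<xi> g)))" .
  have "integrable (density (gam d) (\<lambda>g. ennreal (exp (\<xi> g)))) (indicator ?B :: _ \<Rightarrow> real)"
    by (intro F.integrable_const_bound[where B=1]) auto
  then show "integrable (gam d) (\<lambda>g. indicator ?B g * exp (\<xi> g))"
    by (subst (asm) integrable_density) (auto simp: mult.commute)
qed

text \<open>Only the first-order part Q is kept under the integral, for a case distinction later on.
  The second-order parts are bounded on the ball and carry its probability as a factor; 1/2 \<le> s
  serves to bound - ln s - \<delta> by 2 \<delta>^2.\<close>

lemma gam_ball_dilation_gap: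
  fixes d c
  assumes s: "1/2 \<le> s" "s < 1" and \<rho>: "0 \<le> \<rho>"
  defines "\<gamma> \<equiv> \<lambda>\<rho>. measure (gam d) (eball d c \<rho>)"
    and "Q \<equiv> \<lambda>g. real d - dot d g (g - c)"
  shows "\<gamma> \<rho> - \<gamma> (s * \<rho>) \<le> (1 - s) * (\<integral>g. indicator (eball d c \<rho>) g * \<bar>Q g\<bar> \<partial>gam d)
     + (2 * real d * (1 - s)\<^sup>2 + (1 - s)\<^sup>2 * \<rho>\<^sup>2 / 2) * \<gamma> \<rho>"
    and "integrable (gam d) (\<lambda>g. indicator (eball d c \<rho>) g * \<bar>Q g\<bar>)"
proof -
  interpret G: prob_space "gam d" by (rule prob_gam)
  let ?I = "indicator (eball d c \<rho>) :: _ \<Rightarrow> real"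
  define \<delta> where "\<delta> = 1 - s"
  define \<xi> where "\<xi> g = real d * ln s + (nsq d g - nsq d (\<lambda>k. c k + s * (g k - c k))) / 2" for g
  note dil = gam_dilation[of s d c \<rho>, folded \<xi>_def]
  have s0: "0 < s" using s by simp
  have Q2: "integrable (gam d) (\<lambda>g. (Q g)\<^sup>2)"
  proof -
    have "(Q g)\<^sup>2 = ((nsq d g - real d) + (-1) * dot d c g)\<^sup>2" for g
    proof -
      have "Q g = - ((nsq d g - real d) + (-1) * dot d c g)"
        by (simp add: Q_def dot_def algebra_simps sum_subtractf)
      then show ?thesis by (simp only: power2_minus)
    qed
    then show ?thesis using gam_deviation_square(1)[of d "-1" c] by simp
  qed
  have [measurable]: "(\<lambda>x::nat \<Rightarrow> real. x k) \<in> borel_measurable borel" for k by measurable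
  have Qm [measurable]: "Q \<in> borel_measurable borel" unfolding Q_def dot_def by simp
  have Qi: "integrable (gam d) (\<lambda>g. \<bar>Q g\<bar>)" using prob_abs_le_sqrt(1)[OF prob_gam Q2] by simp
  have Ii: "integrable (gam d) ?I" by (intro G.integrable_const_bound[where B=1]) auto
  show IQ: "integrable (gam d) (\<lambda>g. ?I g * \<bar>Q g\<bar>)"
    by (rule Bochner_Integration.integrable_bound[OF Qi]) (auto simp: indicator_def)
  have ln_s: "- ln s - \<delta> \<le> 2 * \<delta>\<^sup>2"
  proof -
    have "ln (1 / s) \<le> 1 / s - 1" using s0 by (intro ln_le_minus_one) simp
    then have "- ln s - \<delta> \<le> 1 / s - 1 - \<delta>" using s0 by (simp add: ln_div)
    also have "\<dots> = \<delta>\<^sup>2 / s" using s0 by (simp add: \<delta>_def field_simps power2_eq_square)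
    also have "\<dots> \<le> \<delta>\<^sup>2 / (1/2)" using s by (intro divide_left_mono) auto
    finally show ?thesis by simp
  qed
  have pw: "?I g * (1 - exp (\<xi> g)) \<le> \<delta> * (?I g * \<bar>Q g\<bar>) + (2 * real d * \<delta>\<^sup>2 + \<delta>\<^sup>2 * \<rho>\<^sup>2 / 2) * ?I g" for g
  proof (cases "g \<in> eball d c \<rho>")
    case True
    then have y: "nsq d (g - c) \<le> \<rho>\<^sup>2" using eball_iff[OF \<rho>] by simp
    have "nsq d g - nsq d (\<lambda>k. c k + s * (g k - c k)) = (\<Sum>k<d. 2 * \<delta> * (g k * (g k - c k)) - \<delta>\<^sup>2 * ((g k - c k) * (g k - c k)))"
      by (simp add: dot_def sum_subtractf[symmetric] \<delta>_def algebra_simps power2_eq_square)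
    also have "\<dots> = 2 * \<delta> * dot d g (g - c) - \<delta>\<^sup>2 * nsq d (g - c)"
      by (simp add: dot_def sum_subtractf sum_distrib_left)
    finally have "- \<xi> g = real d * (- ln s - \<delta>) + \<delta> * Q g + \<delta>\<^sup>2 * nsq d (g - c) / 2"
      by (simp add: \<xi>_def Q_def algebra_simps diff_divide_distrib)
    also have "\<dots> \<le> real d * (2 * \<delta>\<^sup>2) + \<delta> * \<bar>Q g\<bar> + \<delta>\<^sup>2 * \<rho>\<^sup>2 / 2"
      using ln_s y s by (intro add_mono mult_left_mono divide_right_mono) (auto simp: \<delta>_def)
    finally have "1 - exp (\<xi> g) \<le> real d * (2 * \<delta>\<^sup>2) + \<delta> * \<bar>Q g\<bar> + \<delta>\<^sup>2 * \<rho>\<^sup>2 / 2"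
      using exp_ge_add_one_self[of "\<xi> g"] by linarith
    then show ?thesis using True by simp
  qed simp
  have eq: "\<gamma> \<rho> - \<gamma> (s * \<rho>) = (\<integral>g. ?I g * (1 - exp (\<xi> g)) \<partial>gam d)"
    using dil[OF s0] Ii by (simp add: \<gamma>_def right_diff_distrib)
  have "\<dots> \<le> (\<integral>g. \<delta> * (?I g * \<bar>Q g\<bar>) + (2 * real d * \<delta>\<^sup>2 + \<delta>\<^sup>2 * \<rho>\<^sup>2 / 2) * ?I g \<partial>gam d)"
    using dil[OF s0] Ii IQ by (intro integral_mono pw) (auto simp: right_diff_distrib)
  also have "\<dots> = \<delta> * (\<integral>g. ?I g * \<bar>Q g\<bar> \<partial>gam d) + (2 * real d * \<delta>\<^sup>2 + \<delta>\<^sup>2 * \<rho>\<^sup>2 / 2) * \<gamma> \<rho>"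
    using Ii IQ by (simp add: \<gamma>_def)
  finally show "\<gamma> \<rho> - \<gamma> (s * \<rho>) \<le> (1 - s) * (\<integral>g. ?I g * \<bar>Q g\<bar> \<partial>gam d)
     + (2 * real d * (1 - s)\<^sup>2 + (1 - s)\<^sup>2 * \<rho>\<^sup>2 / 2) * \<gamma> \<rho>"
    unfolding eq \<delta>_def[symmetric] .
qed

text \<open>
  With \<open>V = d + \<parallel>c\<parallel>\<^sup>2\<close>, both \<open>d - g \<bullet> (g - c)\<close> and \<open>\<parallel>g - c\<parallel>\<^sup>2 - V\<close> have second moment \<open>O(V)\<close>.  Hence a
  ball of radius at most \<open>sqrt V / 2\<close> has probability \<open>O(1 / V)\<close> by Chebyshev, and for larger radii
  the dilation bound already suffices.
\<close>

lemma gam_annulus_le: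
  assumes d: "1 \<le> d" and r: "0 \<le> r" and \<epsilon>: "0 < \<epsilon>"
  shows "measure (gam d) (eball d c (r + \<epsilon>)) - measure (gam d) (eball d c r) \<le> 200 * \<epsilon>"
proof -
  interpret G: prob_space "gam d" by (rule prob_gam)
  define \<gamma> where "\<gamma> \<rho> = measure (gam d) (eball d c \<rho>)" for \<rho>
  have \<gamma>01: "0 \<le> \<gamma> \<rho>" "\<gamma> \<rho> \<le> 1" for \<rho> by (auto simp: \<gamma>_def)
  have \<gamma>pow: "\<gamma> \<rho> \<le> \<rho>" if "0 \<le> \<rho>" "\<rho> \<le> 1" for \<rho>
    using gam_ball_le[OF that(1), of d c] power_decreasing[OF d, of \<rho>] that by (simp add: \<gamma>_def)
  define \<rho> where "\<rho> = r + \<epsilon>"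
  define \<delta> where "\<delta> = \<epsilon> / \<rho>"
  have \<rho>0: "0 < \<rho>" using r \<epsilon> by (simp add: \<rho>_def)
  have \<delta>0: "0 < \<delta>" using \<rho>0 \<epsilon> by (simp add: \<delta>_def)
  have \<delta>\<rho>: "\<delta> * \<rho> = \<epsilon>" using \<rho>0 by (simp add: \<delta>_def)
  define V where "V = real d + nsq d c"
  have V: "1 \<le> V" "real d \<le> V" "nsq d c \<le> V" using d by (auto simp: V_def add_increasing2)
  have dV: "0 \<le> nsq d c" by simp
  define Q where "Q g = real d - dot d g (g - c)" for g
  let ?I = "indicator (eball d c \<rho>) :: _ \<Rightarrow> real"
  define E where "E = (\<integral>g. ?I g * \<bar>Q g\<bar> \<partial>gam d)"
  have Ii: "integrable (gam d) ?I" by (intro G.integrable_const_bound[where B=1]) auto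
  have IQ: "integrable (gam d) (\<lambda>g. ?I g * \<bar>Q g\<bar>)"
    using gam_ball_dilation_gap(2)[of "1/2" \<rho> d c] \<rho>0 by (simp add: Q_def)
  have Qsq: "(Q g)\<^sup>2 = ((nsq d g - real d) + (-1) * dot d c g)\<^sup>2" for g
  proof -
    have "Q g = - ((nsq d g - real d) + (-1) * dot d c g)"
      by (simp add: Q_def dot_def algebra_simps sum_subtractf)
    then show ?thesis by (simp only: power2_minus)
  qed
  have Q2: "integrable (gam d) (\<lambda>g. (Q g)\<^sup>2)" "(\<integral>g. (Q g)\<^sup>2 \<partial>gam d) \<le> 4 * V"
    using gam_deviation_square[of d "-1" c] dV by (auto simp: Qsq V_def simp del: nsq_nonneg)
  \<comment> \<open>Young's inequality with a free weight t: t = sqrt V suits large balls, t = V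
    balls of probability O(1 / V).\<close>
  have E_le: "E \<le> (t * \<gamma> \<rho> + 4 * V / t) / 2" if t: "0 < t" for t
  proof -
    have "E \<le> (\<integral>g. (t * ?I g + (Q g)\<^sup>2 / t) / 2 \<partial>gam d)" unfolding E_def
    proof (intro integral_mono IQ)
      show "integrable (gam d) (\<lambda>g. (t * ?I g + (Q g)\<^sup>2 / t) / 2)" using Ii Q2 by simp
      fix g
      have "2 * t * \<bar>Q g\<bar> \<le> t\<^sup>2 + \<bar>Q g\<bar>\<^sup>2" by (rule sum_squares_bound)
      then have "\<bar>Q g\<bar> \<le> (t + (Q g)\<^sup>2 / t) / 2" using t by (simp add: field_simps power2_eq_square)
      moreover have "0 \<le> (Q g)\<^sup>2 / t" using t by simp
      ultimately show "?I g * \<bar>Q g\<bar> \<le> (t * ?I g + (Q g)\<^sup>2 / t) / 2" by (auto simp: indicator_def)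
    qed
    also have "\<dots> = (t * \<gamma> \<rho> + (\<integral>g. (Q g)\<^sup>2 \<partial>gam d) / t) / 2" using Ii Q2 by (simp add: \<gamma>_def)
    also have "\<dots> \<le> (t * \<gamma> \<rho> + 4 * V / t) / 2" using Q2 t by (intro divide_right_mono add_left_mono) auto
    finally show ?thesis .
  qed
  have main: "\<gamma> \<rho> - \<gamma> r \<le> \<delta> * E + 2 * (real d * \<gamma> \<rho>) * \<delta>\<^sup>2 + \<epsilon>\<^sup>2 / 2" if "\<epsilon> \<le> r"
  proof -
    have "1/2 \<le> 1 - \<delta>" using that \<rho>0 by (simp add: \<delta>_def \<rho>_def field_simps)
    moreover have "(1 - \<delta>) * \<rho> = r" using \<delta>\<rho> by (simp add: left_diff_distrib \<rho>_def)
    ultimately have "\<gamma> \<rho> - \<gamma> r \<le> \<delta> * E + (2 * real d * \<delta>\<^sup>2 + \<delta>\<^sup>2 * \<rho>\<^sup>2 / 2) * \<gamma> \<rho>"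
      using gam_ball_dilation_gap(1)[of "1 - \<delta>" \<rho> d c] \<delta>0 \<rho>0 by (simp add: \<gamma>_def E_def Q_def)
    also have "\<dots> = \<delta> * E + 2 * (real d * \<gamma> \<rho>) * \<delta>\<^sup>2 + \<epsilon>\<^sup>2 / 2 * \<gamma> \<rho>"
      by (simp add: \<delta>\<rho>[symmetric] power_mult_distrib distrib_right)
    also have "\<epsilon>\<^sup>2 / 2 * \<gamma> \<rho> \<le> \<epsilon>\<^sup>2 / 2 * 1" using \<gamma>01 by (intro mult_left_mono) auto
    finally show ?thesis by simp
  qed
  have half: "\<delta> \<le> 1/2" if "\<epsilon> \<le> r" using that \<rho>0 by (simp add: \<delta>_def \<rho>_def field_simps)
  \<comment> \<open>Here W is |g - c|^2 - V. On the ball it is at most - 3 V / 4, against a second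
    moment of at most 8 V; 128 / 9 is below 15.\<close>
  have small: "V * \<gamma> \<rho> \<le> 15" if \<rho>V: "4 * \<rho>\<^sup>2 \<le> V"
  proof -
    define W where "W g = (nsq d g - real d) + (-2) * dot d c g" for g
    have W2: "integrable (gam d) (\<lambda>g. (W g)\<^sup>2)" "(\<integral>g. (W g)\<^sup>2 \<partial>gam d) \<le> 8 * V"
      using gam_deviation_square[of d "-2" c] dV by (auto simp: W_def V_def simp del: nsq_nonneg)
    have "(9 / 16 * V\<^sup>2) * \<gamma> \<rho> = (\<integral>g. 9 / 16 * V\<^sup>2 * ?I g \<partial>gam d)" using Ii by (simp add: \<gamma>_def)
    also have "\<dots> \<le> (\<integral>g. (W g)\<^sup>2 \<partial>gam d)"
    proof (intro integral_mono)
      fix g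
      show "9 / 16 * V\<^sup>2 * ?I g \<le> (W g)\<^sup>2"
      proof (cases "g \<in> eball d c \<rho>")
        case True
        then have y: "nsq d (g - c) \<le> V / 4" using eball_iff[of \<rho>] \<rho>0 \<rho>V by simp
        have "nsq d (g - c) = W g + V"
          by (simp add: W_def V_def dot_def algebra_simps sum_subtractf sum.distrib sum_distrib_left sum_negf)
        then have "3 / 4 * V \<le> - W g" using y by simp
        then have "(3 / 4 * V)\<^sup>2 \<le> (- W g)\<^sup>2" using V by (intro power_mono) auto
        then show ?thesis using True by (simp add: power_mult_distrib power_divide)
      qed simp
    qed (use Ii W2 in auto)
    also have "\<dots> \<le> 8 * V" by (rule W2)
    finally have "V * (9 * (V * \<gamma> \<rho>)) \<le> V * 128" by (simp add: power2_eq_square mult_ac)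
    then show ?thesis using V by simp
  qed
  have "\<gamma> \<rho> - \<gamma> r \<le> 200 * \<epsilon>"
  proof (cases "1 < 2 * \<epsilon>")
    case True
    then show ?thesis using \<gamma>01[of \<rho>] \<gamma>01[of r] by simp
  next
    case e1: False
    then have "\<epsilon> * \<epsilon> \<le> \<epsilon> * 1" using \<epsilon> by (intro mult_left_mono) auto
    then have ee: "\<epsilon>\<^sup>2 \<le> \<epsilon>" by (simp add: power2_eq_square)
    show ?thesis
    proof (cases "r < \<epsilon>")
      case True
      \<comment> \<open>The dilation from \<rho> to r would have a factor below 1/2 here, so the
        whole ball is estimated instead.\<close>
      then have "\<gamma> \<rho> \<le> \<gamma> (2 * \<epsilon>)" unfolding \<gamma>_def
        by (intro G.finite_measure_mono, simp add: eball_def \<rho>_def subset_iff) (simp add: law_sets[OF law_gam])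
      also have "\<dots> \<le> 2 * \<epsilon>" using e1 \<epsilon> by (intro \<gamma>pow) auto
      finally show ?thesis using \<gamma>01[of r] \<epsilon> by simp
    next
      case False
      then have er: "\<epsilon> \<le> r" by simp
      note main = main[OF er]
      have d\<gamma>: "0 \<le> real d * \<gamma> \<rho>" "real d * \<gamma> \<rho> \<le> V * \<gamma> \<rho>" using \<gamma>01 V by (auto intro: mult_right_mono)
      \<comment> \<open>For balls large against sqrt V the product \<delta> sqrt V is O(\<epsilon>).
        Otherwise the probability is O(1 / V); then \<delta> = \<epsilon> / \<rho> is itself
        O(\<epsilon>) unless r is small, in which case E has to supply a factor \<rho>.\<close>
      consider "V < 4 * \<rho>\<^sup>2" | "4 * \<rho>\<^sup>2 \<le> V" "1/4 \<le> r" | "4 * \<rho>\<^sup>2 \<le> V" "r < 1/4" by linarith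
      then show ?thesis
      proof cases
        case 1
        have "sqrt V \<le> 2 * \<rho>" using 1 \<rho>0 by (intro real_le_lsqrt) (auto simp: power_mult_distrib)
        have "E \<le> (sqrt V * \<gamma> \<rho> + 4 * V / sqrt V) / 2" using V by (intro E_le) auto
        also have "4 * V / sqrt V = 4 * sqrt V" using V by (simp add: field_simps)
        also have "(sqrt V * \<gamma> \<rho> + 4 * sqrt V) / 2 \<le> (sqrt V * 1 + 4 * sqrt V) / 2"
          using V \<gamma>01 by (intro divide_right_mono add_right_mono mult_left_mono) auto
        also have "\<dots> \<le> 5 * \<rho>" using \<open>sqrt V \<le> 2 * \<rho>\<close> by simp
        finally have "\<delta> * E \<le> \<delta> * (5 * \<rho>)" using \<delta>0 by (intro mult_left_mono) auto
        then have 11: "\<delta> * E \<le> 5 * \<epsilon>" using \<delta>\<rho> by simp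
        have "real d * \<gamma> \<rho> \<le> 4 * \<rho>\<^sup>2" using d\<gamma> 1 \<gamma>01[of \<rho>] V mult_left_mono[of "\<gamma> \<rho>" 1 V] by linarith
        then have "2 * (real d * \<gamma> \<rho>) * \<delta>\<^sup>2 \<le> 2 * (4 * \<rho>\<^sup>2) * \<delta>\<^sup>2" by (intro mult_left_mono mult_right_mono) auto
        also have "\<dots> = 8 * \<epsilon>\<^sup>2" by (simp add: \<delta>\<rho>[symmetric] power_mult_distrib)
        finally show ?thesis using main 11 ee \<epsilon> by linarith
      next
        case 2
        note small = small[OF 2(1)]
        have "E \<le> (V * \<gamma> \<rho> + 4 * V / V) / 2" using V by (intro E_le) auto
        also have "\<dots> \<le> 19 / 2" using small V by simp
        finally have E: "E \<le> 19 / 2" .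
        have \<delta>4: "\<delta> \<le> 4 * \<epsilon>"
        proof -
          have "\<epsilon> * 1 \<le> \<epsilon> * (4 * \<rho>)" using 2 \<epsilon> by (intro mult_left_mono) (auto simp: \<rho>_def)
          then show ?thesis using \<rho>0 by (simp add: \<delta>_def field_simps)
        qed
        have "\<delta> * E \<le> \<delta> * (19 / 2)" using E \<delta>0 by (intro mult_left_mono) auto
        moreover have "\<delta>\<^sup>2 \<le> \<delta> * (1/2)" unfolding power2_eq_square using \<delta>0 half[OF er] by (intro mult_left_mono) auto
        moreover have "2 * (real d * \<gamma> \<rho>) * \<delta>\<^sup>2 \<le> 2 * 15 * \<delta>\<^sup>2" using d\<gamma> small by (intro mult_right_mono) auto
        ultimately show ?thesis using main ee \<delta>4 \<epsilon> by linarith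
      next
        case 3
        note small = small[OF 3(1)]
        have \<rho>h: "\<rho> \<le> 1/2" using 3 er by (simp add: \<rho>_def)
        \<comment> \<open>The bound \<rho>^d on the probability beats the factor d \<le> 2^(d - 1),
          because 2 \<rho> \<le> 1.\<close>
        have dg: "real d * \<gamma> \<rho> \<le> \<rho>"
        proof -
          obtain k where k: "d = Suc k" using d by (cases d) auto
          have "real d \<le> 2 ^ k" using self_le_ge2_pow[of 2 k] by (simp add: k) (metis Suc_leI less_exp of_nat_Suc of_nat_le_iff of_nat_numeral of_nat_power add.commute)
          then have "real d * \<gamma> \<rho> \<le> 2 ^ k * \<rho> ^ d" using gam_ball_le[of \<rho> d c] \<rho>0 by (intro mult_mono) (auto simp: \<gamma>_def)
          also have "\<dots> = (2 * \<rho>) ^ k * \<rho>" by (simp add: k power_mult_distrib)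
          also have "\<dots> \<le> 1 * \<rho>" using \<rho>0 \<rho>h by (intro mult_right_mono power_le_one) auto
          finally show ?thesis by simp
        qed
        \<comment> \<open>On a small ball g stays near c, so |g| is at most 3 V / 2 and |g - c| at
          most \<rho>. The factor V is compensated by the probability of the ball, and \<rho>
          remains.\<close>
        have "E \<le> (\<integral>g. (real d + 3 / 2 * \<rho> * V) * ?I g \<partial>gam d)" unfolding E_def
        proof (intro integral_mono IQ)
          fix g
          show "?I g * \<bar>Q g\<bar> \<le> (real d + 3 / 2 * \<rho> * V) * ?I g"
          proof (cases "g \<in> eball d c \<rho>")
            case True
            then have "nsq d (g - c) \<le> \<rho>\<^sup>2" using eball_iff[of \<rho>] \<rho>0 by simp
            then have y: "enorm d (g - c) \<le> \<rho>" using \<rho>0 unfolding enorm_eq by (intro real_le_lsqrt) auto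
            have "enorm d c \<le> V"
            proof -
              have "enorm d c \<le> sqrt V" unfolding enorm_eq using V by simp
              also have "\<dots> \<le> V" using V by (intro real_le_lsqrt) (auto simp: power2_eq_square)
              finally show ?thesis .
            qed
            moreover have "enorm d g \<le> enorm d (g - c) + enorm d c"
              using L2_set_triangle_ineq[of "g - c" c "{..<d}"] by simp
            ultimately have g: "enorm d g \<le> 3 / 2 * V" using y \<rho>h V by linarith
            have "\<bar>dot d g (g - c)\<bar> \<le> enorm d g * enorm d (g - c)" by (rule dot_eq_enorm_bound)
            also have "\<dots> \<le> (3 / 2 * V) * \<rho>" using g y V by (intro mult_mono) auto
            finally have "\<bar>Q g\<bar> \<le> real d + 3 / 2 * \<rho> * V" by (simp add: Q_def mult_ac)
            then show ?thesis using True by simp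
          qed simp
        qed (use Ii in auto)
        also have "\<dots> = real d * \<gamma> \<rho> + 3 / 2 * \<rho> * (V * \<gamma> \<rho>)" using Ii by (simp add: \<gamma>_def distrib_right)
        also have "\<dots> \<le> \<rho> + 3 / 2 * \<rho> * 15" using dg small \<rho>0 by (intro add_mono mult_left_mono) auto
        finally have "\<delta> * E \<le> \<delta> * (47 / 2 * \<rho>)" using \<delta>0 by (intro mult_left_mono) auto
        then have 1: "\<delta> * E \<le> 47 / 2 * \<epsilon>" using \<delta>\<rho> by simp
        have "2 * (real d * \<gamma> \<rho>) * \<delta>\<^sup>2 \<le> 2 * \<rho> * \<delta>\<^sup>2" using dg by (intro mult_right_mono) auto
        also have "\<dots> = 2 * \<epsilon> * \<delta>" by (simp add: \<delta>\<rho>[symmetric] power2_eq_square)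
        also have "\<dots> \<le> 2 * \<epsilon> * (1/2)" using half[OF er] \<epsilon> by (intro mult_left_mono) auto
        finally show ?thesis using main 1 ee \<epsilon> by linarith
      qed
    qed
  qed
  then show ?thesis by (simp add: \<gamma>_def \<rho>_def)
qed

text \<open>Splitting a Gaussian of scale l off the covariance leaves an average over shifted
  centres, and division by l reduces the rest to the standard Gaussian.\<close>

lemma gaussian_ball_const_exists: "gaussian_ball_const 200"
  unfolding gaussian_ball_const_def
proof (intro conjI allI impI; (elim conjE)?)
  fix d and M :: "(nat \<Rightarrow> real) measure" and m A Z and l \<epsilon> :: real and x0 and r :: real
  assume d: "1 \<le> d" and A: "pos_def_mat d A" and Z: "gaussian_vector M d m A Z"
    and l: "0 < l" and ev: "smallest_eigenvalue A (l\<^sup>2)" and \<epsilon>: "0 < \<epsilon>" and r: "0 \<le> r"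
  let ?I = "indicator (annulus d x0 r \<epsilon>) :: _ \<Rightarrow> real"
  obtain \<zeta> where \<zeta>: "law \<zeta>" and split: "\<And>K f. test_fun d K f \<Longrightarrow> avg (vec_law M d Z) f = avg (gauss d l) (avg \<zeta> f)"
    using gaussian_vector_split[OF Z A smallest_eigenvalue_le_quad[OF A ev d]] by metis
  have Zr: "random_vector M d Z" using Z by (simp add: gaussian_vector_def)
  have le: "avg (gauss d l) ?I x \<le> 200 * \<epsilon> / l" for x
  proof -
    interpret G: prob_space "gam d" by (rule prob_gam)
    define c where "c = scale (1 / l) (x0 - x)"
    have ball: "x + scale l g \<in> eball d x0 t \<longleftrightarrow> g \<in> eball d c (t / l)" if "0 \<le> t" for g t
    proof -
      have e: "x + scale l g - x0 = scale l (g - c)" using l by (auto simp: c_def scale_def algebra_simps)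
      have "nsq d (x + scale l g - x0) = l\<^sup>2 * nsq d (g - c)" unfolding e dot_scale by (simp add: power2_eq_square)
      then show ?thesis using l that by (simp only: eball_iff zero_le_divide_iff) (simp add: eball_iff power_divide field_simps)
    qed
    have "avg (gauss d l) ?I x = (\<integral>g. indicator (eball d c (r / l + \<epsilon> / l) - eball d c (r / l)) g \<partial>gam d)"
      unfolding avg_gauss[OF test_fun_annulus] using ball[of "r + \<epsilon>"] ball[of r] r \<epsilon>
      by (intro Bochner_Integration.integral_cong refl) (simp add: indicator_def add_divide_distrib)
    also have "\<dots> = measure (gam d) (eball d c (r / l + \<epsilon> / l)) - measure (gam d) (eball d c (r / l))"
      using \<epsilon> l by (simp, intro G.finite_measure_Diff) (simp_all add: law_sets[OF law_gam], auto simp: eball_def intro: add_increasing2)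
    also have "\<dots> \<le> 200 * (\<epsilon> / l)" using r l \<epsilon> by (intro gam_annulus_le d) auto
    finally show ?thesis by simp
  qed
  have "measure M {\<omega> \<in> space M. Z \<omega> \<in> annulus d x0 r \<epsilon>} = avg (vec_law M d Z) ?I 0"
  proof -
    interpret P: prob_space M using Zr by (simp add: random_vector_def)
    have "avg (vec_law M d Z) ?I 0 = (\<integral>\<omega>. ?I (trunc d (Z \<omega>)) \<partial>M)"
      unfolding avg_def by (subst integral_vec_law(1)[OF Zr]) auto
    also have "\<dots> = (\<integral>\<omega>. indicator {\<omega> \<in> space M. Z \<omega> \<in> annulus d x0 r \<epsilon>} \<omega> \<partial>M)"
      by (intro Bochner_Integration.integral_cong refl) (auto simp: indicator_def eball_trunc)
    finally show ?thesis by (simp add: Int_def conj_commute)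
  qed
  also have "\<dots> = avg \<zeta> (avg (gauss d l) ?I) 0"
    by (simp only: split[OF test_fun_annulus] avg_commute[OF test_fun_annulus law_gauss \<zeta>])
  also have "\<dots> \<le> 200 * \<epsilon> / l"
    using avg_pow_le[OF \<zeta> test_fun_avg[OF test_fun_annulus law_gauss] le, of 1 0] by simp
  finally show "measure M {\<omega> \<in> space M. Z \<omega> \<in> annulus d x0 r \<epsilon>} \<le> \<epsilon> * 200 / l" by (simp add: mult.commute)
qed simp

section \<open>The cutoff constants\<close>

lemma deriv_pow_cutoff: "k \<le> 6 \<Longrightarrow> (deriv ^^ k) (cutoff_deriv 0) = cutoff_deriv k"
proof (induction k)
  case (Suc k)
  then have "(deriv ^^ Suc k) (cutoff_deriv 0) = deriv (cutoff_deriv k)" by simp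
  also have "\<dots> = cutoff_deriv (Suc k)" using Suc.prems by (intro ext DERIV_imp_deriv cutoff_deriv_deriv) simp
  finally show ?case .
qed simp

lemma smooth_cutoff_exists: "smooth_cutoff (cutoff_deriv 0)"
proof -
  have "cutoff_deriv j differentiable_on UNIV" if "j < 6" for j
    using cutoff_deriv_deriv[OF that] unfolding differentiable_on_def
    by (meson real_differentiable_def differentiable_at_withinI)
  moreover from this[of 5] have "continuous_on UNIV (cutoff_deriv 5)" by (simp add: differentiable_imp_continuous_on)
  ultimately show ?thesis using cutoff_0 by (simp add: smooth_cutoff_def deriv_pow_cutoff)
qed

text \<open>Inside the ball the indicator makes the argument 0 while the level is nonpositive, and
  the cutoff is 1 at both.\<close>

lemma ball_smoother_eq:
  assumes "0 \<le> r" "0 < \<epsilon>"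
  shows "ball_smoother (cutoff_deriv 0) d x0 r \<epsilon> = soft_ball d x0 r \<epsilon>"
proof
  fix x
  have e: "(enorm d (\<lambda>k. x k - x0 k))\<^sup>2 = nsq d (x - x0)"
    using enorm_sq[of "x - x0" d] by (simp only: fun_diff_def)
  show "ball_smoother (cutoff_deriv 0) d x0 r \<epsilon> x = soft_ball d x0 r \<epsilon> x"
  proof (cases "x \<in> eball d x0 r")
    case True
    then have "ball_level d x0 r \<epsilon> x \<le> 0" using ball_level_bounds(1)[OF assms] by simp
    then show ?thesis using True by (simp add: ball_smoother_def soft_ball_def cutoff_0(1))
  next
    case False
    then show ?thesis by (simp add: ball_smoother_def soft_ball_def ball_level_def e)
  qed
qed

text \<open>The partial derivatives of the level and of its slope are 2 (x_i - x0_i) / D and 2 h_i /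
  D. Weighted with h_i they sum to p and s, so the recursion is the same as along a line.\<close>

lemma dir_deriv_soft_deriv:
  assumes k: "k < 6"
  shows "dir_deriv d h (\<lambda>y. soft_deriv d x0 r \<epsilon> y h k) x = soft_deriv d x0 r \<epsilon> x h (Suc k)"
proof -
  define D where "D = \<epsilon>\<^sup>2 + 2 * r * \<epsilon>"
  define w where "w i = cutoff_deriv i (ball_level d x0 r \<epsilon> x)" for i
  define p where "p = 2 * dot d h (x - x0) / D"
  define s where "s = 2 * nsq d h / D"
  define A where "A = quad_chain (\<lambda>i. w (Suc i)) p s k"
  define B where "B = quad_chain_p w p s k"
  have coord: "deriv (\<lambda>t. soft_deriv d x0 r \<epsilon> (x(i := t)) h k) (x i) = A * (2 * (x i - x0 i) / D) + B * (2 * h i / D)" if i: "i < d" for i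
  proof -
    have split: "dot d u v = u i * v i + dot d (u(i := 0)) v" for u v :: "nat \<Rightarrow> real"
    proof -
      have "dot d (u(i := 0)) v = (\<Sum>k\<in>{..<d} - {i}. u k * v k)"
        unfolding dot_def by (subst sum.remove[of _ i]) (use i in \<open>auto intro: sum.cong\<close>)
      then show ?thesis unfolding dot_def using i by (subst sum.remove[of _ i]) auto
    qed
    have n: "nsq d (x(i := t) - x0) = (t - x0 i)\<^sup>2 + (nsq d (x - x0) - (x i - x0 i)\<^sup>2)" for t
    proof -
      have "dot d ((y)(i := 0)) y = dot d (y(i := 0)) (y(i := u))" for y :: "nat \<Rightarrow> real" and u
        by (auto simp: dot_def intro!: sum.cong)
      from this[of "x - x0" "t - x0 i"]
      have "dot d ((x - x0)(i := 0)) (x - x0) = dot d ((x - x0)(i := 0)) (x(i := t) - x0)"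
        by (simp add: fun_upd_def fun_diff_def if_distrib cong: if_cong) (auto simp: dot_def intro!: sum.cong)
      moreover have "(x(i := t) - x0)(i := 0) = (x - x0)(i := 0)" by auto
      ultimately show ?thesis
        using split[of "x(i := t) - x0" "x(i := t) - x0"] split[of "x - x0" "x - x0"] by (simp add: power2_eq_square)
    qed
    have l: "dot d h (x(i := t) - x0) = h i * (t - x i) + dot d h (x - x0)" for t
    proof -
      have "dot d (h(i := 0)) (x(i := t) - x0) = dot d (h(i := 0)) (x - x0)"
        by (auto simp: dot_def intro!: sum.cong)
      then show ?thesis using split[of h "x(i := t) - x0"] split[of h "x - x0"] by (simp add: algebra_simps)
    qed
    define q where "q t = ball_level d x0 r \<epsilon> (x(i := t))" for t
    define P where "P t = 2 * dot d h (x(i := t) - x0) / D" for t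
    have at: "q (x i) = ball_level d x0 r \<epsilon> x" "P (x i) = p" by (simp_all add: q_def P_def p_def)
    have "((\<lambda>t. (t - x0 i)\<^sup>2 + (nsq d (x - x0) - (x i - x0 i)\<^sup>2) - r\<^sup>2) has_real_derivative 2 * (x i - x0 i)) (at (x i))"
      by (auto intro!: derivative_eq_intros)
    from DERIV_cdivide[OF this, of D] have q': "(q has_real_derivative 2 * (x i - x0 i) / D) (at (x i))"
      unfolding q_def ball_level_def n D_def[symmetric] .
    have "((\<lambda>t. 2 * (h i * (t - x i) + dot d h (x - x0))) has_real_derivative 2 * h i) (at (x i))"
      by (auto intro!: derivative_eq_intros)
    from DERIV_cdivide[OF this, of D] have p': "(P has_real_derivative 2 * h i / D) (at (x i))"
      unfolding P_def l .
    have "((\<lambda>t. quad_chain (\<lambda>j. cutoff_deriv j (q t)) (P t) s k) has_real_derivative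
      quad_chain (\<lambda>j. cutoff_deriv (Suc j) (q (x i))) (P (x i)) s k * (2 * (x i - x0 i) / D)
        + quad_chain_p (\<lambda>j. cutoff_deriv j (q (x i))) (P (x i)) s k * (2 * h i / D)) (at (x i))"
      by (intro quad_chain_deriv q' p' cutoff_deriv_deriv) (use k in auto)
    then show ?thesis
      unfolding at by (intro DERIV_imp_deriv) (simp add: soft_deriv_def q_def P_def s_def D_def A_def B_def w_def[abs_def])
  qed
  have "dir_deriv d h (\<lambda>y. soft_deriv d x0 r \<epsilon> y h k) x = (\<Sum>i<d. A * (2 * (h i * (x i - x0 i)) / D) + B * (2 * (h i * h i) / D))"
    unfolding dir_deriv_def by (intro sum.cong refl) (simp add: coord algebra_simps)
  also have "\<dots> = A * p + B * s"
    by (simp add: p_def s_def dot_def sum.distrib sum_distrib_left sum_divide_distrib)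
  also have "\<dots> = soft_deriv d x0 r \<epsilon> x h (Suc k)"
    unfolding A_def B_def quad_chain_Suc[OF k] by (simp add: soft_deriv_def w_def[abs_def] p_def s_def D_def)
  finally show ?thesis .
qed

lemma dir_deriv_pow_soft_ball:
  "k \<le> 6 \<Longrightarrow> (dir_deriv d h ^^ k) (soft_ball d x0 r \<epsilon>) = (\<lambda>y. soft_deriv d x0 r \<epsilon> y h k)"
  by (induction k) (auto simp: soft_deriv_0 dir_deriv_soft_deriv)

lemma cutoff_const_exists:
  assumes k: "1 \<le> k" "k \<le> 6"
  shows "cutoff_const (cutoff_deriv 0) k 12456000000"
  unfolding cutoff_const_def
proof (intro allI impI; elim conjE)
  fix d x0 r \<epsilon> x h
  assume r: "0 \<le> (r::real)" and \<epsilon>: "0 < (\<epsilon>::real)"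
  have "(enorm d h / \<epsilon>) ^ k \<le> (enorm d h / (\<epsilon> / 2)) ^ k"
    using \<epsilon> by (intro power_mono frac_le) auto
  then have le: "12456000000 * (enorm d h / \<epsilon>) ^ k * indicator (annulus d x0 r \<epsilon>) x
      \<le> 12456000000 * (enorm d h / (\<epsilon> / 2)) ^ k * indicator (annulus d x0 r \<epsilon>) x"
    by (intro mult_right_mono mult_left_mono) auto
  have b: "\<bar>soft_deriv d x0 r \<epsilon> x h k\<bar> \<le> 12456000000 * (enorm d h / (\<epsilon> / 2)) ^ k * indicator (annulus d x0 r \<epsilon>) x"
    using soft_deriv_bound[OF r \<epsilon> k] le by (rule order_trans)
  show "\<bar>(dir_deriv d h ^^ k) (ball_smoother (cutoff_deriv 0) d x0 r \<epsilon>) x\<bar>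
      \<le> 12456000000 * enorm d h ^ k / (\<epsilon> / 2) ^ k * indicator (annulus d x0 r \<epsilon>) x"
    using b unfolding ball_smoother_eq[OF r \<epsilon>] dir_deriv_pow_soft_ball[OF k(2)] power_divide[of "enorm d h" "\<epsilon> / 2"]
    by (simp only: times_divide_eq_right)
qed

section \<open>A lower bound for the fifth cutoff constant\<close>

lemma dir_deriv_1:
  "dir_deriv 1 (\<lambda>_. 1) (\<lambda>x. G (x 0)) = (\<lambda>x. deriv G (x 0))"
  by (auto simp: dir_deriv_def)

lemma dir_deriv_pow_1:
  "(dir_deriv 1 (\<lambda>_. 1) ^^ k) (\<lambda>x. G (x 0)) = (\<lambda>x. (deriv ^^ k) G (x 0))"
proof (induction k)
  case (Suc k)
  then show ?case using dir_deriv_1[of "(deriv ^^ k) G"] by simp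
qed simp

lemma deriv_pow_eventually_const:
  fixes f :: "real \<Rightarrow> real"
  assumes "open S" "\<And>x. x \<in> S \<Longrightarrow> f x = c" "x \<in> S"
  shows "(deriv ^^ i) f x = (if i = 0 then c else 0)"
  using assms(3)
proof (induction i arbitrary: x)
  case (Suc i)
  have "eventually (\<lambda>y. (deriv ^^ i) f y = (if i = 0 then c else 0)) (nhds x)"
    by (rule eventually_nhds_in_open[OF assms(1) Suc.prems, THEN eventually_mono]) (rule Suc.IH)
  then show ?case by (simp add: deriv_cong_ev[OF _ refl])
qed (simp add: assms(2))

text \<open>
  In dimension one with \<open>r = 0\<close> and \<open>\<epsilon> = 1\<close> the smoother is \<open>t \<mapsto> \<phi> (t\<^sup>2)\<close>, which descends from
  1 to 0 on \<open>[0, 1]\<close> with vanishing derivatives up to order 4 at both ends.  Taylor expansion of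
  order 5 from both ends to \<open>t = 1/2\<close> bounds the fifth derivative from below.
\<close>

lemma cutoff_const_5_ge:
  assumes \<phi>: "smooth_cutoff \<phi>" and c: "cutoff_const \<phi> 5 c"
  shows "60 \<le> c"
proof -
  define w where "w i = (deriv ^^ i) \<phi>" for i
  have w': "(w i has_real_derivative w (Suc i) x) (at x)" if "i < 5" for i x
  proof -
    have "w i field_differentiable at x"
      using \<phi> that unfolding smooth_cutoff_def w_def
      by (auto simp: differentiable_on_def real_differentiable_def field_differentiable_def)
    then show ?thesis by (simp add: field_differentiable_derivI w_def)
  qed
  have wc: "isCont (w i) x" if "i < 5" for i x using DERIV_isCont[OF w'[OF that]] .
  \<comment> \<open>Up to order 4 the derivatives are continuous, and they are known on the open
    half line where \<phi> is constant.\<close>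
  have left: "w i 0 = (if i = 0 then 1 else 0)" if i: "i < 5" for i
  proof (rule tendsto_unique)
    show "(w i \<longlongrightarrow> w i 0) (at_left 0)"
      by (rule tendsto_within_subset[OF wc[OF i, unfolded isCont_def]]) simp
    have "eventually (\<lambda>x. w i x = (if i = 0 then 1 else 0)) (at_left (0::real))"
      unfolding eventually_at_filter w_def using \<phi>
      by (intro always_eventually allI impI deriv_pow_eventually_const[where S="{..<0}"]) (auto simp: smooth_cutoff_def)
    then show "(w i \<longlongrightarrow> (if i = 0 then 1 else 0)) (at_left 0)" by (rule tendsto_eventually)
  qed simp
  have right: "w i 1 = 0" if i: "i < 5" for i
  proof (rule tendsto_unique)
    show "(w i \<longlongrightarrow> w i 1) (at_right 1)"
      by (rule tendsto_within_subset[OF wc[OF i, unfolded isCont_def]]) simp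
    have "eventually (\<lambda>x. w i x = (if i = 0 then 0 else 0)) (at_right (1::real))"
      unfolding eventually_at_filter w_def using \<phi>
      by (intro always_eventually allI impI deriv_pow_eventually_const[where S="{1<..}"]) (auto simp: smooth_cutoff_def)
    then show "(w i \<longlongrightarrow> 0) (at_right 1)" by (intro tendsto_eventually) simp
  qed simp
  define F where "F k t = quad_chain (\<lambda>i. w i (t\<^sup>2)) (2 * t) 2 k" for k and t :: real
  have F': "(F k has_real_derivative F (Suc k) t) (at t)" if k: "k < 5" for k t
  proof -
    have "((\<lambda>t. quad_chain (\<lambda>i. w i (t\<^sup>2)) (2 * t) 2 k) has_real_derivative
      quad_chain (\<lambda>i. w (Suc i) (t\<^sup>2)) (2 * t) 2 k * (2 * t) + quad_chain_p (\<lambda>i. w i (t\<^sup>2)) (2 * t) 2 k * 2) (at t)"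
      using k by (intro quad_chain_deriv w') (auto intro!: derivative_eq_intros)
    then show ?thesis using quad_chain_Suc[of k "\<lambda>i. w i (t\<^sup>2)" "2 * t" 2] k by (simp add: F_def[abs_def])
  qed
  have F0: "F 0 = (\<lambda>t. \<phi> (t\<^sup>2))" by (auto simp: F_def quad_chain_def w_def)
  have Fk: "(deriv ^^ k) (\<lambda>t. \<phi> (t\<^sup>2)) = F k" if "k \<le> 5" for k
    using that
  proof (induction k)
    case (Suc k)
    then have "(deriv ^^ Suc k) (\<lambda>t. \<phi> (t\<^sup>2)) = deriv (F k)" by simp
    also have "\<dots> = F (Suc k)" using Suc.prems by (intro ext DERIV_imp_deriv F') simp
    finally show ?case .
  qed (simp add: F0)
  have sm: "ball_smoother \<phi> 1 (\<lambda>_. 0) 0 1 = (\<lambda>x. \<phi> ((x 0)\<^sup>2))"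
    by (auto simp: ball_smoother_def eball_def L2_set_def indicator_def)
  \<comment> \<open>The factor 32 is (\<epsilon> / 2)^-5 for \<epsilon> = 1. The sign of c is not
    yet known, hence its absolute value.\<close>
  have F5: "\<bar>F 5 t\<bar> \<le> 32 * \<bar>c\<bar>" for t
  proof -
    have "\<bar>(dir_deriv 1 (\<lambda>_. 1) ^^ 5) (ball_smoother \<phi> 1 (\<lambda>_. 0) 0 1) (\<lambda>_. t)\<bar>
        \<le> c * enorm 1 (\<lambda>_. 1) ^ 5 / (1 / 2) ^ 5 * indicator (annulus 1 (\<lambda>_. 0) 0 1) (\<lambda>_. t)"
      by (rule c[unfolded cutoff_const_def, THEN spec[of _ 1], THEN spec[of _ "\<lambda>_. 0"], THEN spec[of _ 0],
          THEN spec[of _ 1], THEN spec[of _ "\<lambda>_. t"], THEN spec[of _ "\<lambda>_. 1"], THEN mp]) simp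
    also have "\<dots> \<le> 32 * \<bar>c\<bar>" by (auto simp: indicator_def L2_set_def power_divide)
    finally show ?thesis
      unfolding sm dir_deriv_pow_1[where G="\<lambda>t. \<phi> (t\<^sup>2)"] Fk[OF order_refl] .
  qed
  have zero: "F m 0 = 0" "F m 1 = 0" if "m = 1 \<or> m = 2 \<or> m = 3 \<or> m = 4" for m
    using that left[of 1] left[of 2] left[of 3] left[of 4] right[of 1] right[of 2] right[of 3] right[of 4]
    by (auto simp: F_def quad_chain_def)
  have s5: "(\<Sum>m<5. f m) = f 0 + f 1 + f 2 + f 3 + f (4::nat)" for f :: "nat \<Rightarrow> real"
    by (simp add: eval_nat_numeral)
  have "\<exists>t>0. t < 1/2 \<and> F 0 (1/2) = (\<Sum>m<5. F m 0 / fact m * (1/2 - 0) ^ m) + F 5 t / fact 5 * (1/2 - 0) ^ 5"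
    by (rule Taylor_up[where a=0]) (use F' in auto)
  \<comment> \<open>Here 3840 = 5! * 2^5, and 32 / 3840 = 1 / 120.\<close>
  then obtain t where "F 0 (1/2) = F 0 0 + F 5 t / 3840"
    by (auto simp: s5 zero fact_numeral power_divide)
  then have 1: "F 0 0 - F 0 (1/2) \<le> \<bar>c\<bar> / 120" using F5[of t] by linarith
  have "\<exists>t>1/2. t < 1 \<and> F 0 (1/2) = (\<Sum>m<5. F m 1 / fact m * (1/2 - 1) ^ m) + F 5 t / fact 5 * (1/2 - 1) ^ 5"
    by (rule Taylor_down[where b=1]) (use F' in auto)
  then obtain t where "F 0 (1/2) = F 0 1 - F 5 t / 3840"
    by (auto simp: s5 zero fact_numeral power_divide)
  then have 2: "F 0 (1/2) - F 0 1 \<le> \<bar>c\<bar> / 120" using F5[of t] by linarith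
  have "F 0 0 = 1" "F 0 1 = 0" using \<phi> by (auto simp: F0 smooth_cutoff_def)
  with 1 2 have "60 \<le> \<bar>c\<bar>" by linarith
  \<comment> \<open>At the point 1 of the annulus the derivative bound is itself
    nonnegative.\<close>
  moreover have "0 \<le> c"
  proof -
    have "\<bar>(dir_deriv 1 (\<lambda>_. 1) ^^ 5) (ball_smoother \<phi> 1 (\<lambda>_. 0) 0 1) (\<lambda>_. 1)\<bar>
        \<le> c * enorm 1 (\<lambda>_. 1) ^ 5 / (1 / 2) ^ 5 * indicator (annulus 1 (\<lambda>_. 0) 0 1) (\<lambda>_. 1)"
      by (rule c[unfolded cutoff_const_def, THEN spec[of _ 1], THEN spec[of _ "\<lambda>_. 0"], THEN spec[of _ 0],
          THEN spec[of _ 1], THEN spec[of _ "\<lambda>_. 1"], THEN spec[of _ "\<lambda>_. 1"], THEN mp]) simp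
    also have "\<dots> = 32 * c" by (simp add: indicator_def L2_set_def power_divide eball_def)
    finally show ?thesis by linarith
  qed
  ultimately show ?thesis by simp
qed

text \<open>The number 174 is 2.9 * 60. It leaves room for the factor 88 of the distance bound and
  for 132 in its coordinatewise form.\<close>

lemma C_B6_ge:
  assumes "admissible_consts Ct \<phi> c4 c5"
  shows "174 * max 1 Ct \<le> C_B6 Ct c4 c5"
proof -
  have "60 \<le> c5" using assms cutoff_const_5_ge by (auto simp: admissible_consts_def)
  then have "60 \<le> C_phi6 c4 c5" by (simp add: C_phi6_def)
  then have "2.9 * max 1 Ct * 60 \<le> 2.9 * max 1 Ct * C_phi6 c4 c5" by (intro mult_left_mono) auto
  then show ?thesis by (simp add: C_B6_def C_l2_def)
qed

section \<open>Sums of independent random vectors\<close>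

lemma sum_fun_apply: "(\<Sum>i\<in>I. f i) k = (\<Sum>i\<in>I. (f i k :: real))" for k :: nat
  by (induction I rule: infinite_finite_induct) auto

lemma integral_PiM_sum_trunc:
  assumes N: "prob_space N" "sets N = sets (Rd d)" and I: "finite I" and f: "test_fun d K f"
  shows "(\<integral>y. f (x + (\<Sum>i\<in>I. trunc d (y i))) \<partial>Pi\<^sub>M I (\<lambda>_. N)) = (avg (distr N borel (trunc d)) ^^ card I) f x"
  using I f
proof (induction I arbitrary: x f rule: finite_induct)
  case empty
  show ?case by (simp add: PiM_empty lebesgue_integral_count_space_finite)
next
  case (insert i I)
  interpret N: prob_space N by fact
  interpret S: product_sigma_finite "\<lambda>_. N" by (simp add: product_sigma_finite_def N.sigma_finite_measure_axioms)
  interpret P: prob_space "Pi\<^sub>M (insert i I) (\<lambda>_. N)" by (intro prob_space_PiM N(1))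
  have t [measurable]: "trunc d \<in> borel_measurable N"
    using measurable_cong_sets[OF N(2) refl] measurable_trunc_Rd by blast
  note fm [measurable] = test_funD(1)[OF insert.prems]
  have sum_m: "(\<lambda>y. \<Sum>i\<in>J. trunc d (y i)) \<in> borel_measurable (Pi\<^sub>M J (\<lambda>_. N))" if "finite J" for J
  proof (rule measurable_coordinatewise_then_product)
    fix k
    have "(\<lambda>y. trunc d (y i) k) \<in> borel_measurable (Pi\<^sub>M J (\<lambda>_. N))" if "i \<in> J" for i
      using measurable_coord[OF measurable_compose[OF measurable_component_singleton[OF that] t]] .
    then have "(\<lambda>y. \<Sum>i\<in>J. trunc d (y i) k) \<in> borel_measurable (Pi\<^sub>M J (\<lambda>_. N))" by (intro borel_measurable_sum)
    then show "(\<lambda>y. (\<Sum>i\<in>J. trunc d (y i)) k) \<in> borel_measurable (Pi\<^sub>M J (\<lambda>_. N))"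
      by (simp add: sum_fun_apply)
  qed
  have fi: "integrable (Pi\<^sub>M (insert i I) (\<lambda>_. N)) (\<lambda>y. f (x + (\<Sum>i\<in>insert i I. trunc d (y i))))"
    using test_funD(3)[OF insert.prems] sum_m[of "insert i I"] insert.hyps
    by (intro P.integrable_const_bound[where B=K] measurable_compose[OF _ fm] measurable_fun_plus) auto
  have "(\<integral>y. f (x + (\<Sum>i\<in>insert i I. trunc d (y i))) \<partial>Pi\<^sub>M (insert i I) (\<lambda>_. N))
      = (\<integral>y. \<integral>z. f (x + (\<Sum>j\<in>insert i I. trunc d ((y(i := z)) j))) \<partial>N \<partial>Pi\<^sub>M I (\<lambda>_. N))"
    using insert.hyps fi by (subst S.product_integral_insert) auto
  also have "\<dots> = (\<integral>y. avg (distr N borel (trunc d)) f (x + (\<Sum>j\<in>I. trunc d (y j))) \<partial>Pi\<^sub>M I (\<lambda>_. N))"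
  proof (intro Bochner_Integration.integral_cong refl)
    fix y
    have "(\<Sum>j\<in>insert i I. trunc d ((y(i := z)) j)) = (\<Sum>j\<in>I. trunc d (y j)) + trunc d z" for z
    proof -
      have "(\<Sum>j\<in>I. trunc d ((y(i := z)) j)) = (\<Sum>j\<in>I. trunc d (y j))"
        using insert.hyps by (intro sum.cong) auto
      then show ?thesis using insert.hyps by (simp add: add.commute del: plus_fun_apply)
    qed
    then show "(\<integral>z. f (x + (\<Sum>j\<in>insert i I. trunc d ((y(i := z)) j))) \<partial>N)
        = avg (distr N borel (trunc d)) f (x + (\<Sum>j\<in>I. trunc d (y j)))"
      unfolding avg_def by (subst integral_distr[OF t]) (simp_all only: add.assoc, measurable)
  qed
  also have "\<dots> = (avg (distr N borel (trunc d)) ^^ card I) (avg (distr N borel (trunc d)) f) x"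
    by (rule insert.IH[OF test_fun_avg[OF insert.prems law_distr[OF N(1) t]]])
  finally show ?case using insert.hyps by (simp only: card_insert_disjoint funpow_Suc_right o_apply not_False_eq_True)
qed

lemma integral_iid_sum:
  assumes M: "prob_space M" and rv: "\<And>i. i \<in> {1..n} \<Longrightarrow> random_vector M d (X i)" and n: "1 \<le> n"
    and indep: "prob_space.indep_vars M (\<lambda>_. Rd d) X {1..n}"
    and same: "\<And>i. i \<in> {1..n} \<Longrightarrow> distr M (Rd d) (X i) = distr M (Rd d) (X 1)"
    and f: "test_fun d K f"
  shows "(\<integral>\<omega>. f (\<Sum>i\<in>{1..n}. trunc d (X i \<omega>)) \<partial>M) = (avg (vec_law M d (X 1)) ^^ n) f 0"
proof -
  interpret prob_space M by fact
  let ?I = "{1..n}" and ?N = "distr M (Rd d) (X 1)"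
  have Xm: "X i \<in> measurable M (Rd d)" if "i \<in> ?I" for i using rv[OF that] by (simp add: random_vector_def)
  have X1: "X 1 \<in> measurable M (Rd d)" using Xm n by simp
  have eq: "distr M (Pi\<^sub>M ?I (\<lambda>_. Rd d)) (\<lambda>\<omega>. \<lambda>i\<in>?I. X i \<omega>) = Pi\<^sub>M ?I (\<lambda>_. ?N)"
  proof -
    have "distr M (Pi\<^sub>M ?I (\<lambda>_. Rd d)) (\<lambda>\<omega>. \<lambda>i\<in>?I. X i \<omega>) = Pi\<^sub>M ?I (\<lambda>i. distr M (Rd d) (X i))"
    proof (rule iffD1[OF indep_vars_iff_distr_eq_PiM' indep])
      show "?I \<noteq> {}" using n by auto
    qed (rule Xm)
    also have "\<dots> = Pi\<^sub>M ?I (\<lambda>_. ?N)" by (intro PiM_cong refl same)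
    finally show ?thesis .
  qed
  have N: "prob_space ?N" by (rule prob_space_distr[OF X1])
  have m: "(\<lambda>\<omega>. \<lambda>i\<in>?I. X i \<omega>) \<in> measurable M (Pi\<^sub>M ?I (\<lambda>_. Rd d))"
    using Xm by (intro measurable_restrict)
  have fm: "(\<lambda>y. f (\<Sum>i\<in>?I. trunc d (y i))) \<in> borel_measurable (Pi\<^sub>M ?I (\<lambda>_. Rd d))"
  proof (rule measurable_compose[OF measurable_coordinatewise_then_product test_funD(1)[OF f]])
    fix k
    have "(\<lambda>y. trunc d (y i) k) \<in> borel_measurable (Pi\<^sub>M ?I (\<lambda>_. Rd d))" if "i \<in> ?I" for i
      using measurable_coord[OF measurable_compose[OF measurable_component_singleton[OF that] measurable_trunc_Rd]] .
    then have "(\<lambda>y. \<Sum>i\<in>?I. trunc d (y i) k) \<in> borel_measurable (Pi\<^sub>M ?I (\<lambda>_. Rd d))" by (intro borel_measurable_sum)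
    then show "(\<lambda>y. (\<Sum>i\<in>?I. trunc d (y i)) k) \<in> borel_measurable (Pi\<^sub>M ?I (\<lambda>_. Rd d))"
      by (simp add: sum_fun_apply)
  qed
  have "(\<integral>\<omega>. f (\<Sum>i\<in>?I. trunc d (X i \<omega>)) \<partial>M)
      = (\<integral>\<omega>. f (\<Sum>i\<in>?I. trunc d ((\<lambda>i\<in>?I. X i \<omega>) i)) \<partial>M)"
    by (intro Bochner_Integration.integral_cong refl arg_cong[of _ _ f] sum.cong) auto
  also have "\<dots> = (\<integral>y. f (\<Sum>i\<in>?I. trunc d (y i)) \<partial>distr M (Pi\<^sub>M ?I (\<lambda>_. Rd d)) (\<lambda>\<omega>. \<lambda>i\<in>?I. X i \<omega>))"
    by (rule integral_distr[OF m fm, symmetric])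
  also have "\<dots> = (\<integral>y. f (0 + (\<Sum>i\<in>?I. trunc d (y i))) \<partial>Pi\<^sub>M ?I (\<lambda>_. ?N))" unfolding eq by simp
  also have "\<dots> = (avg (distr ?N borel (trunc d)) ^^ card ?I) f 0"
    by (rule integral_PiM_sum_trunc[OF N _ _ f]) auto
  also have "distr ?N borel (trunc d) = vec_law M d (X 1)"
    unfolding vec_law_def by (subst distr_distr[OF measurable_trunc_Rd X1]) (simp add: o_def)
  finally show ?thesis by (simp only: card_atLeastAtMost diff_Suc_1)
qed

lemma eball_scale:
  assumes c: "0 < c"
  shows "x \<in> eball d (scale c t) (c * r) \<longleftrightarrow> scale (1 / c) x \<in> eball d t r"
proof -
  have "enorm d (\<lambda>k. x k - c * t k) = enorm d (\<lambda>k. c * (x k / c - t k))"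
    using c by (simp add: right_diff_distrib)
  also have "\<dots> = c * enorm d (\<lambda>k. x k / c - t k)"
    using L2_set_right_distrib[of c "\<lambda>k. x k / c - t k" "{..<d}"] c by simp
  finally show ?thesis using c by (simp add: eball_def)
qed

text \<open>The normalisation 1 / sqrt n is moved from the sum to the centre and radius of the ball,
  so that averages act on unnormalised summands.\<close>

lemma iid_ball_prob:
  assumes "prob_space M" "\<And>i. i \<in> {1..n} \<Longrightarrow> random_vector M d (X i)" "1 \<le> n"
    "prob_space.indep_vars M (\<lambda>_. Rd d) X {1..n}"
    "\<And>i. i \<in> {1..n} \<Longrightarrow> distr M (Rd d) (X i) = distr M (Rd d) (X 1)"
  shows "measure M {\<omega>\<in>space M. enorm d (\<lambda>k. (\<Sum>i=1..n. X i \<omega> k) / sqrt n - t k) \<le> r}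
    = (avg (vec_law M d (X 1)) ^^ n) (indicator (eball d (scale (sqrt n) t) (sqrt n * r))) 0"
proof -
  interpret prob_space M by fact
  let ?B = "eball d (scale (sqrt n) t) (sqrt n * r)"
  let ?A = "{\<omega>\<in>space M. enorm d (\<lambda>k. (\<Sum>i=1..n. X i \<omega> k) / sqrt n - t k) \<le> r}"
  have "(\<Sum>i\<in>{1..n}. trunc d (X i \<omega>)) \<in> ?B \<longleftrightarrow> enorm d (\<lambda>k. (\<Sum>i=1..n. X i \<omega> k) / sqrt n - t k) \<le> r" for \<omega>
  proof -
    have "(\<Sum>i\<in>{1..n}. trunc d (X i \<omega>)) = trunc d (\<lambda>k. \<Sum>i=1..n. X i \<omega> k)"
      by (auto simp: sum_fun_apply trunc_def)
    then have "(\<Sum>i\<in>{1..n}. trunc d (X i \<omega>)) \<in> ?B \<longleftrightarrow> (\<lambda>k. \<Sum>i=1..n. X i \<omega> k) \<in> ?B"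
      by (simp only: eball_trunc)
    also have "\<dots> \<longleftrightarrow> scale (1 / sqrt n) (\<lambda>k. \<Sum>i=1..n. X i \<omega> k) \<in> eball d t r"
      using assms(3) by (intro eball_scale) simp
    finally show ?thesis by (simp add: eball_def)
  qed
  then have B: "(\<integral>\<omega>. indicator ?A \<omega> \<partial>M) = (\<integral>\<omega>. (indicator ?B (\<Sum>i\<in>{1..n}. trunc d (X i \<omega>)) :: real) \<partial>M)"
    by (intro Bochner_Integration.integral_cong refl) (auto simp: indicator_def)
  have "measure M ?A = (\<integral>\<omega>. indicator ?A \<omega> \<partial>M)" by (simp add: Int_def conj_commute)
  also note B
  also note integral_iid_sum[OF assms test_fun_eball]
  finally show ?thesis .
qed

text \<open>Stability of centred normal laws: convolution adds the quadratic forms, and scaling by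
  sqrt n multiplies the form by n.\<close>

lemma avg_pow_scaled:
  assumes \<rho>: "law \<rho>" and cf: "cf_eq d \<rho> 0 q" and q: "\<And>c u. q (scale c u) = c\<^sup>2 * q u" and f: "test_fun d K f"
  shows "(avg \<rho> ^^ n) f = avg (distr \<rho> borel (scale (sqrt n))) f"
proof (induction n)
  case 0
  interpret prob_space \<rho> using \<rho> by (rule law_prob)
  have z: "x + scale 0 y = x" for x y :: "nat \<Rightarrow> real" by auto
  have [measurable]: "(\<lambda>y. f (x + y)) \<in> borel_measurable borel" for x
    by (rule measurable_compose[OF _ test_funD(1)[OF f]]) measurable
  have m: "scale 0 \<in> borel_measurable \<rho>" by (rule law_measurable[OF \<rho>]) measurable
  show ?case
    unfolding avg_def by (rule ext) (simp add: integral_distr m z prob_space del: plus_fun_apply scale_apply)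
next
  case (Suc n)
  let ?R = "\<lambda>n. distr \<rho> borel (scale (sqrt n))"
  have m: "scale c \<in> borel_measurable \<rho>" for c by (rule law_measurable[OF \<rho>]) measurable
  have R: "law (?R n)" for n by (rule law_distr[OF law_prob[OF \<rho>] m])
  have cfR: "cf_eq d (?R n) 0 (\<lambda>u. real n * q u)" for n
    unfolding cf_eq_def
  proof
    fix u
    have [measurable]: "(\<lambda>x. cos (dot d u x)) \<in> borel_measurable borel" "(\<lambda>x. sin (dot d u x)) \<in> borel_measurable borel"
      by measurable
    have s: "dot d u (scale (sqrt n) x) = dot d (scale (sqrt n) u) x" for x by (simp only: dot_scale)
    have z: "dot d v 0 = 0" for v by (simp add: dot_def)
    show "(\<integral>x. cos (dot d u x) \<partial>?R n) = cos (dot d u 0) * exp (- (real n * q u) / 2) \<and>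
       (\<integral>x. sin (dot d u x) \<partial>?R n) = sin (dot d u 0) * exp (- (real n * q u) / 2)"
      using cf[unfolded cf_eq_def, rule_format, of "scale (sqrt n) u"] m[of "sqrt n"]
      by (simp add: integral_distr s z q)
  qed
  have c: "cf_eq d (conv \<rho> (?R n)) 0 (\<lambda>u. real (Suc n) * q u)"
    using cf_eq_conv[OF \<rho> R cf cfR, of n] by (simp add: distrib_right)
  have "(avg \<rho> ^^ Suc n) f = avg \<rho> (avg (?R n) f)" by (simp only: funpow.simps(2) o_apply Suc)
  also have "\<dots> = avg (conv \<rho> (?R n)) f" by (rule avg_conv[OF \<rho> R f, symmetric])
  also have "\<dots> = avg (?R (Suc n)) f"
    by (rule same_cf_avg[OF law_conv[OF \<rho> R] R cf_eq_same[OF c cfR] f])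
  finally show ?case .
qed

lemma quad_scale: "quad d a (scale c u) = c\<^sup>2 * quad d a u"
  by (simp add: quad_def sum_distrib_left power2_eq_square mult_ac)

text \<open>The Gaussian vector is itself presented as a sum of n summands, so that both
  probabilities refer to the same ball and the same number of summands.\<close>

lemma gaussian_ball_prob:
  assumes Z: "gaussian_vector M d (\<lambda>_. 0) A Z" and A: "pos_def_mat d A" and n: "1 \<le> n"
  shows "measure M {\<omega>\<in>space M. enorm d (\<lambda>k. Z \<omega> k - t k) \<le> r}
    = (avg (vec_law M d Z) ^^ n) (indicator (eball d (scale (sqrt n) t) (sqrt n * r))) 0"
proof -
  have rv: "random_vector M d Z" using Z by (simp add: gaussian_vector_def)
  interpret prob_space M using rv by (simp add: random_vector_def)
  let ?B = "eball d (scale (sqrt n) t) (sqrt n * r)" and ?\<rho> = "vec_law M d Z"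
  have cf: "cf_eq d ?\<rho> 0 (quad d (mat_form A))" using gaussian_vector_cf_eq[OF Z A] by (simp add: zero_fun_def)
  have \<rho>: "law ?\<rho>" by (rule law_vec_law[OF rv])
  have m: "scale c \<in> borel_measurable ?\<rho>" for c by (rule law_measurable[OF \<rho>]) measurable
  have "(avg ?\<rho> ^^ n) (indicator ?B) 0 = avg (distr ?\<rho> borel (scale (sqrt n))) (indicator ?B) 0"
    by (subst avg_pow_scaled[OF \<rho> cf quad_scale test_fun_eball]) simp
  also have "\<dots> = (\<integral>x. indicator ?B (scale (sqrt n) x) \<partial>?\<rho>)"
    unfolding avg_def by (subst integral_distr[OF m]) auto
  also have "\<dots> = (\<integral>\<omega>. indicator ?B (scale (sqrt n) (trunc d (Z \<omega>))) \<partial>M)"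
    by (rule integral_vec_law(1)[OF rv]) measurable
  also have "\<dots> = (\<integral>\<omega>. indicator {\<omega>\<in>space M. enorm d (\<lambda>k. Z \<omega> k - t k) \<le> r} \<omega> \<partial>M)"
  proof (intro Bochner_Integration.integral_cong refl)
    fix \<omega> assume "\<omega> \<in> space M"
    have "scale (1 / sqrt n) (scale (sqrt n) (trunc d (Z \<omega>))) = trunc d (Z \<omega>)" using n by auto
    then have "scale (sqrt n) (trunc d (Z \<omega>)) \<in> ?B \<longleftrightarrow> Z \<omega> \<in> eball d t r"
      using n by (subst eball_scale) (simp_all only: eball_trunc, simp)
    then show "indicator ?B (scale (sqrt n) (trunc d (Z \<omega>))) = (indicator {\<omega>\<in>space M. enorm d (\<lambda>k. Z \<omega> k - t k) \<le> r} \<omega> :: real)"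
      using \<open>\<omega> \<in> space M\<close> by (simp add: indicator_def eball_def)
  qed
  finally show ?thesis by (simp add: Int_def conj_commute)
qed

section \<open>Moment inequalities and symmetry\<close>

text \<open>The tangent of t^3 at s; averaging it at the mean is Jensen's inequality for
  cubes.\<close>

lemma cube_tangent: "0 \<le> s \<Longrightarrow> 0 \<le> t \<Longrightarrow> 3 * s\<^sup>2 * t \<le> t ^ 3 + 2 * s ^ 3" for s t :: real
proof -
  assume "0 \<le> s" "0 \<le> t"
  then have "0 \<le> (t - s)\<^sup>2 * (t + 2 * s)" by simp
  also have "\<dots> = t ^ 3 + 2 * s ^ 3 - 3 * s\<^sup>2 * t" by (simp add: power2_eq_square power3_eq_cube algebra_simps)
  finally show ?thesis by simp
qed

lemma weighted_mean_cube_le: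
  fixes w y :: "'a \<Rightarrow> real"
  assumes "\<And>i. i \<in> I \<Longrightarrow> 0 \<le> w i" "\<And>i. i \<in> I \<Longrightarrow> 0 \<le> y i" "(\<Sum>i\<in>I. w i) = 1"
  shows "(\<Sum>i\<in>I. w i * y i) ^ 3 \<le> (\<Sum>i\<in>I. w i * y i ^ 3)"
proof -
  define s where "s = (\<Sum>i\<in>I. w i * y i)"
  have s: "0 \<le> s" unfolding s_def using assms by (intro sum_nonneg) auto
  have "(\<Sum>i\<in>I. w i * (3 * s\<^sup>2 * y i - 2 * s ^ 3)) \<le> (\<Sum>i\<in>I. w i * y i ^ 3)"
    using cube_tangent[OF s] assms by (intro sum_mono mult_left_mono) (auto simp: algebra_simps)
  also have "(\<Sum>i\<in>I. w i * (3 * s\<^sup>2 * y i - 2 * s ^ 3)) = 3 * s\<^sup>2 * s - 2 * s ^ 3 * (\<Sum>i\<in>I. w i)"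
  proof -
    have "(\<Sum>i\<in>I. w i * (3 * s\<^sup>2 * y i - 2 * s ^ 3)) = 3 * s\<^sup>2 * (\<Sum>i\<in>I. w i * y i) - 2 * s ^ 3 * (\<Sum>i\<in>I. w i)"
      by (simp add: right_diff_distrib sum_subtractf sum_distrib_left sum_distrib_right mult_ac)
    then show ?thesis unfolding s_def[symmetric] .
  qed
  also have "\<dots> = s ^ 3" using assms(3) by (simp add: power2_eq_square power3_eq_cube)
  finally show ?thesis unfolding s_def .
qed

lemma nsq_cube_le_sixth_powers: "nsq d x ^ 3 \<le> real d ^ 2 * (\<Sum>k<d. x k ^ 6)"
proof (cases "d = 0")
  case False
  have "(\<Sum>k<d. 1 / real d * (x k)\<^sup>2) ^ 3 \<le> (\<Sum>k<d. 1 / real d * ((x k)\<^sup>2) ^ 3)"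
    using False by (intro weighted_mean_cube_le) auto
  moreover have "(\<Sum>k<d. 1 / real d * (x k)\<^sup>2) = nsq d x / d" by (simp add: dot_def sum_divide_distrib power2_eq_square)
  moreover have "(\<Sum>k<d. 1 / real d * ((x k)\<^sup>2) ^ 3) = (\<Sum>k<d. x k ^ 6) / d" by (simp add: sum_divide_distrib)
  ultimately have "nsq d x ^ 3 / real d ^ 3 \<le> (\<Sum>k<d. x k ^ 6) / d" by (simp add: power_divide)
  then show ?thesis using False by (simp add: field_simps power2_eq_square power3_eq_cube)
qed (simp add: dot_def)

lemma nsq_moment_cube_le:
  assumes \<mu>: "sixth_moments d \<mu>"
  shows "(\<integral>x. nsq d x \<partial>\<mu>) ^ 3 \<le> (\<integral>x. nsq d x ^ 3 \<partial>\<mu>)"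
proof -
  interpret prob_space \<mu> using sixth_moments_law[OF \<mu>] by (rule law_prob)
  define T where "T = (\<integral>x. nsq d x \<partial>\<mu>)"
  have T: "0 \<le> T" by (simp add: T_def)
  have i: "integrable \<mu> (\<lambda>x. nsq d x)" by (rule hom_poly_integrable[OF \<mu> hom_poly_nsq]) simp
  have "(\<integral>x. 3 * T\<^sup>2 * nsq d x \<partial>\<mu>) \<le> (\<integral>x. nsq d x ^ 3 + 2 * T ^ 3 \<partial>\<mu>)"
    using cube_tangent[OF T] nsq_cube_integrable[OF \<mu>] i by (intro integral_mono) auto
  then show ?thesis
    using nsq_cube_integrable[OF \<mu>] by (simp add: prob_space power2_eq_square power3_eq_cube flip: T_def)
qed

text \<open>Converts multi-index lists into exponents, the form in which the symmetry hypothesis is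
  stated.\<close>

lemma prod_list_eq_prod_count:
  fixes x :: "nat \<Rightarrow> real"
  assumes "set is \<subseteq> {..<d}"
  shows "(\<Prod>i\<leftarrow>is. x i) = (\<Prod>k<d. x k ^ count_list is k)"
  using assms
proof (induction "is")
  case (Cons i "is")
  have "(\<Prod>k<d. x k ^ count_list (i # is) k) = (\<Prod>k<d. (if k = i then x k else 1) * x k ^ count_list is k)"
    by (intro prod.cong) auto
  also have "\<dots> = x i * (\<Prod>k<d. x k ^ count_list is k)"
    using Cons.prems by (simp add: prod.distrib prod.delta)
  finally show ?case using Cons by simp
qed simp

lemma odd_length_odd_count:
  assumes "is \<in> multi_idx d k" "odd k"
  shows "\<exists>i<d. odd (count_list is i)"
proof (rule ccontr)
  assume "\<not> ?thesis"
  then have "even (\<Sum>i<d. count_list is i)" by (intro dvd_sum) auto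
  moreover have "(\<Sum>i<d. count_list is i) = k" using assms(1) by (auto simp: multi_idx_def intro: sum_count_set)
  ultimately show False using assms(2) by simp
qed

lemma even_counts_4:
  assumes "is \<in> multi_idx d 4" "\<And>i. i < d \<Longrightarrow> even (count_list is i)"
  shows "\<exists>i<d. \<exists>j<d. is = [i, i, j, j] \<or> is = [i, j, i, j] \<or> is = [i, j, j, i]"
proof -
  obtain a b c e where "is": "is = [a, b, c, e]"
    using assms(1) by (auto simp: multi_idx_def length_Suc_conv eval_nat_numeral)
  have lt: "a < d" "b < d" "c < d" "e < d" using assms(1) "is" by (auto simp: multi_idx_def)
  have ev: "even (count_list [a, b, c, e] a)" "even (count_list [a, b, c, e] b)" "even (count_list [a, b, c, e] c)"
    using assms(2)[OF lt(1)] assms(2)[OF lt(2)] assms(2)[OF lt(3)] unfolding "is" by blast+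
  show ?thesis unfolding "is" using lt ev by (auto split: if_splits)
qed

text \<open>Only indices that pair up survive. There are three pairings, hence at most 3 d^2 nonzero
  entries out of d^4.\<close>

lemma frob_norm_pairs_le:
  assumes d: "1 \<le> d" and D: "\<And>is. is \<in> multi_idx d 4 \<Longrightarrow> \<exists>i<d. odd (count_list is i) \<Longrightarrow> D is = 0"
  shows "frob_norm d 4 D \<le> sqrt 3 * real d * max_norm d 4 D"
proof -
  let ?m = "max_norm d 4 D" and ?I = "{..<d} \<times> {..<d}"
  let ?p = "(\<lambda>(i, j). [i, i, j, j]) ` ?I" and ?q = "(\<lambda>(i, j). [i, j, i, j]) ` ?I" and ?r = "(\<lambda>(i, j). [i, j, j, i]) ` ?I"
  let ?P = "?p \<union> ?q \<union> ?r"
  have sub: "?P \<subseteq> multi_idx d 4" by (auto simp: multi_idx_def)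
  have "card (f ` ?I) \<le> d * d" for f :: "nat \<times> nat \<Rightarrow> nat list"
    using card_image_le[of ?I f] by simp
  then have "card ?p + card ?q + card ?r \<le> d * d + d * d + d * d" by (intro add_mono)
  then have card: "card ?P \<le> 3 * (d * d)"
    using card_Un_le[of "?p \<union> ?q" ?r] card_Un_le[of ?p ?q] by linarith
  have le: "\<bar>D is\<bar> \<le> ?m" if "is \<in> multi_idx d 4" for "is"
    unfolding max_norm_def using that by (intro Max_ge) auto
  have m0: "0 \<le> ?m"
  proof -
    have "[0, 0, 0, 0] \<in> multi_idx d 4" using d by (simp add: multi_idx_def)
    from le[OF this] show ?thesis by linarith
  qed
  have "(\<Sum>is\<in>multi_idx d 4. (D is)\<^sup>2) = (\<Sum>is\<in>?P. (D is)\<^sup>2)"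
  proof (rule sum.mono_neutral_right[OF finite_multi_idx sub], intro ballI)
    fix "is" assume "is": "is \<in> multi_idx d 4 - ?P"
    have "\<exists>i<d. odd (count_list is i)"
    proof (rule ccontr)
      assume "\<not> ?thesis"
      with even_counts_4[of "is" d] "is" have "is \<in> ?P" by (fastforce simp: image_iff)
      with "is" show False by simp
    qed
    then show "(D is)\<^sup>2 = 0" using D "is" by simp
  qed
  also have "\<dots> \<le> (\<Sum>is\<in>?P. ?m\<^sup>2)"
  proof (rule sum_mono)
    fix "is" assume "is \<in> ?P"
    then have "\<bar>D is\<bar>\<^sup>2 \<le> ?m\<^sup>2" using sub by (intro power_mono le) auto
    then show "(D is)\<^sup>2 \<le> ?m\<^sup>2" by simp
  qed
  also have "\<dots> = real (card ?P) * ?m\<^sup>2" by simp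
  also have "\<dots> \<le> real (3 * (d * d)) * ?m\<^sup>2" by (intro mult_right_mono of_nat_mono card) simp
  also have "\<dots> = (sqrt 3 * real d * ?m)\<^sup>2" by (simp add: power_mult_distrib power2_eq_square)
  finally have "sqrt (\<Sum>is\<in>multi_idx d 4. (D is)\<^sup>2) \<le> sqrt ((sqrt 3 * real d * ?m)\<^sup>2)"
    by (rule real_sqrt_le_mono)
  then show ?thesis using m0 by (simp add: frob_norm_def)
qed

text \<open>Changing the sign of one coordinate preserves the characteristic function, hence the
  law, but reverses the sign of the monomial.\<close>

lemma flip_symmetric_moment:
  assumes \<rho>: "law \<rho>" and cf: "cf_eq d \<rho> 0 q" and q: "\<And>u. q (u(i := - u i)) = q u"
    and "is": "set is \<subseteq> {..<d}" and odd: "odd (count_list is i)"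
  shows "(\<integral>x. (\<Prod>j\<leftarrow>is. x j) \<partial>\<rho>) = 0"
proof -
  define T where "T x = x(i := - x i)" for x :: "nat \<Rightarrow> real"
  have Tm [measurable]: "T \<in> borel_measurable borel"
    unfolding T_def by (rule measurable_coordinatewise_then_product) (auto intro: measurable_coord)
  have Tr: "T \<in> borel_measurable \<rho>" by (rule law_measurable[OF \<rho> Tm])
  have \<rho>': "law (distr \<rho> borel T)" by (rule law_distr[OF law_prob[OF \<rho>] Tr])
  have dT: "dot d u (T x) = dot d (T u) x" for u x
    unfolding dot_def T_def by (intro sum.cong) auto
  have z: "dot d v 0 = 0" for v by (simp add: dot_def)
  have cm: "(\<lambda>x. cos (dot d u x)) \<in> borel_measurable borel" "(\<lambda>x. sin (dot d u x)) \<in> borel_measurable borel" for u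
    by measurable
  have "same_cf d (distr \<rho> borel T) \<rho>"
    unfolding same_cf_def integral_distr[OF Tr cm(1)] integral_distr[OF Tr cm(2)] dT
    using cf q by (simp add: cf_eq_def z T_def)
  then have eq: "distr (distr \<rho> borel T) borel (trunc d) = distr \<rho> borel (trunc d)"
    by (rule same_cf_distr_eq[OF \<rho>' \<rho>])
  define P where "P x = (\<Prod>j\<leftarrow>is. x j)" for x :: "nat \<Rightarrow> real"
  have P: "P x = (\<Prod>k<d. x k ^ count_list is k)" for x
    unfolding P_def by (rule prod_list_eq_prod_count[OF "is"])
  have Pm [measurable]: "P \<in> borel_measurable borel" unfolding P by measurable
  have Pt: "P (trunc d x) = P x" for x unfolding P by (intro prod.cong) (auto simp: trunc_def)
  have PT: "P (T x) = - P x" for x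
  proof (cases "i < d")
    case True
    have "P (T x) = (\<Prod>k<d. (if k = i then -1 else 1) * x k ^ count_list is k)"
      unfolding P by (intro prod.cong) (use odd in \<open>auto simp: T_def power_minus_odd\<close>)
    then show ?thesis using True by (simp add: P prod.distrib prod.delta)
  next
    case False
    then have "i \<notin> set is" using "is" by auto
    then show ?thesis using odd by (simp add: count_list_0_iff)
  qed
  have tm: "trunc d \<in> borel_measurable M" if "sets M = sets borel" for M
    using that by (intro measurable_trunc) (simp add: measurable_ident_sets)
  have "(\<integral>x. P x \<partial>\<rho>) = (\<integral>x. P x \<partial>distr \<rho> borel (trunc d))"
    by (subst integral_distr[OF tm[OF law_sets[OF \<rho>]] Pm]) (simp add: Pt)
  also have "\<dots> = (\<integral>x. P x \<partial>distr \<rho> borel T)"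
    unfolding eq[symmetric] by (subst integral_distr[OF tm Pm]) (simp_all add: Pt)
  also have "\<dots> = (\<integral>x. P (T x) \<partial>\<rho>)" by (rule integral_distr[OF Tr Pm])
  also have "\<dots> = - (\<integral>x. P x \<partial>\<rho>)" by (simp add: PT)
  finally show ?thesis by (simp add: P_def)
qed

lemma conv_vec_law:
  assumes N: "prob_space N" and Y: "random_vector N d Y" and U: "random_vector N d U"
    and ind: "prob_space.indep_var N (Rd d) Y (Rd d) U"
  shows "conv (vec_law N d Y) (vec_law N d U) = distr N borel (\<lambda>\<omega>. trunc d (Y \<omega>) + trunc d (U \<omega>))"
proof -
  interpret prob_space N by fact
  note m [measurable] = random_vector_measurable[OF Y] random_vector_measurable[OF U]
  have "indep_var borel (\<lambda>\<omega>. trunc d (Y \<omega>)) borel (\<lambda>\<omega>. trunc d (U \<omega>))"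
    using indep_var_compose[OF ind measurable_trunc_Rd measurable_trunc_Rd] by (simp add: o_def)
  then have "vec_law N d Y \<Otimes>\<^sub>M vec_law N d U = distr N (borel \<Otimes>\<^sub>M borel) (\<lambda>\<omega>. (trunc d (Y \<omega>), trunc d (U \<omega>)))"
    by (simp add: indep_var_distribution_eq vec_law_def)
  then show ?thesis unfolding conv_def by (simp add: distr_distr o_def)
qed

section \<open>Moments of Gaussian vectors\<close>

lemma gaussian_dot_moment:
  assumes Z: "gaussian_vector M d (\<lambda>_. 0) A Z" and A: "pos_def_mat d A" and u: "k < d" "u k \<noteq> 0"
  shows "integrable (vec_law M d Z) (\<lambda>x. dot d u x ^ j)"
    and "(\<integral>x. dot d u x ^ j \<partial>vec_law M d Z) = sqrt (quad d (mat_form A) u) ^ j * (\<integral>x. x ^ j \<partial>std_normal_distribution)"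
proof -
  have rv: "random_vector M d Z" using Z by (simp add: gaussian_vector_def)
  define s where "s = sqrt (quad d (mat_form A) u)"
  have s: "0 < s" using pos_def_quad_pos[where u=u and k=k, OF A u] by (simp add: s_def)
  have D: "distributed M lborel (\<lambda>\<omega>. dot d u (Z \<omega>)) (normal_density 0 s)"
    using gaussian_vector_distributed[where u=u and k=k, OF Z A u] by (simp add: s_def dot_def)
  have fm: "(\<lambda>x::real. x ^ j) \<in> borel_measurable borel" by measurable
  have dm: "(\<lambda>x. dot d u x ^ j) \<in> borel_measurable borel" by measurable
  show "integrable (vec_law M d Z) (\<lambda>x. dot d u x ^ j)"
    unfolding integral_vec_law(2)[OF rv dm] dot_trunc distributed_normal_integral(2)[OF D s fm]
    using integrable_std_normal_distribution_moment[of j] by (simp add: power_mult_distrib)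
  show "(\<integral>x. dot d u x ^ j \<partial>vec_law M d Z) = sqrt (quad d (mat_form A) u) ^ j * (\<integral>x. x ^ j \<partial>std_normal_distribution)"
    unfolding integral_vec_law(1)[OF rv dm] dot_trunc distributed_normal_integral(1)[OF D s fm]
    by (simp add: power_mult_distrib s_def)
qed

definition unit_fun :: "nat \<Rightarrow> nat \<Rightarrow> real" where
  "unit_fun i k = (if k = i then 1 else 0)"

lemma dot_unit_fun: "i < d \<Longrightarrow> dot d (unit_fun i) x = x i"
  by (simp add: dot_def unit_fun_def if_distrib[of "\<lambda>x. x * _"] cong: if_cong)

lemma quad_unit_fun: "i < d \<Longrightarrow> quad d a (unit_fun i) = a i i"
  by (simp add: quad_def unit_fun_def if_distrib[of "\<lambda>x. x * _"] if_distrib[of "\<lambda>x. _ * x"] cong: if_cong)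

lemma gaussian_coord_moments:
  assumes Z: "gaussian_vector M d (\<lambda>_. 0) A Z" and A: "pos_def_mat d A" and i: "i < d"
  shows "integrable (vec_law M d Z) (\<lambda>x. x i ^ j)"
    and "(\<integral>x. (x i)\<^sup>2 \<partial>vec_law M d Z) = A $$ (i, i)" "(\<integral>x. x i ^ 6 \<partial>vec_law M d Z) = 15 * (A $$ (i, i)) ^ 3"
proof -
  have u: "unit_fun i i \<noteq> 0" by (simp add: unit_fun_def)
  have "0 < quad d (mat_form A) (unit_fun i)" by (rule pos_def_quad_pos[where u="unit_fun i" and k=i, OF A i u])
  then have p: "0 < A $$ (i, i)" by (simp add: quad_unit_fun[OF i] mat_form_def)
  note m = gaussian_dot_moment[where u="unit_fun i" and k=i, OF Z A i u, unfolded dot_unit_fun[OF i] quad_unit_fun[OF i] mat_form_def]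
  show "integrable (vec_law M d Z) (\<lambda>x. x i ^ j)" by (rule m(1))
  show "(\<integral>x. (x i)\<^sup>2 \<partial>vec_law M d Z) = A $$ (i, i)" using m(2)[of 2] p by (simp add: std_moments)
  show "(\<integral>x. x i ^ 6 \<partial>vec_law M d Z) = 15 * (A $$ (i, i)) ^ 3"
    using m(2)[of 6] p power_mult[of "sqrt (A $$ (i, i))" 2 3] by (simp add: std_moments)
qed

lemma gaussian_sixth_moments:
  assumes Z: "gaussian_vector M d (\<lambda>_. 0) A Z" and A: "pos_def_mat d A"
  shows "sixth_moments d (vec_law M d Z)"
  using gaussian_coord_moments(1)[OF Z A] Z by (simp add: sixth_moments_def law_vec_law gaussian_vector_def)

lemma gaussian_dot_second_moment:
  assumes Z: "gaussian_vector M d (\<lambda>_. 0) A Z" and A: "pos_def_mat d A"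
  shows "(\<integral>x. (dot d u x)\<^sup>2 \<partial>vec_law M d Z) = quad d (mat_form A) u" "(\<integral>x. dot d u x \<partial>vec_law M d Z) = 0"
proof -
  have "(\<integral>x. (dot d u x)\<^sup>2 \<partial>vec_law M d Z) = quad d (mat_form A) u \<and> (\<integral>x. dot d u x \<partial>vec_law M d Z) = 0"
  proof (cases "\<exists>k<d. u k \<noteq> 0")
    case True
    then obtain k where k: "k < d" "u k \<noteq> 0" by blast
    have odd: "(\<integral>x. x \<partial>std_normal_distribution) = 0"
      using integral_std_normal_distribution_moment_odd[of 1] by simp
    note m = gaussian_dot_moment[where u=u and k=k, OF Z A k]
    show ?thesis
      using m(2)[of 1] m(2)[of 2] pos_def_quad_pos[where u=u and k=k, OF A k] by (simp add: odd std_moments)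
  next
    case False
    then have "dot d u x = 0" for x by (auto simp: dot_def)
    moreover have "quad d (mat_form A) u = 0" using False by (auto simp: quad_def)
    ultimately show ?thesis by simp
  qed
  then show "(\<integral>x. (dot d u x)\<^sup>2 \<partial>vec_law M d Z) = quad d (mat_form A) u" "(\<integral>x. dot d u x \<partial>vec_law M d Z) = 0" by auto
qed

text \<open>Jensen with weights A_ii / T, where T is the trace, so that only the coordinate moments
  15 A_ii^3 enter, whatever the correlations. For the covariance of X the trace is E |X|^2, which
  compares the sixth moment of Z with that of X.\<close>

lemma gaussian_nsq_cube_le:
  assumes Z: "gaussian_vector M d (\<lambda>_. 0) A Z" and A: "pos_def_mat d A" and d: "1 \<le> d"
  shows "(\<integral>x. nsq d x ^ 3 \<partial>vec_law M d Z) \<le> 15 * (\<Sum>i<d. A $$ (i, i)) ^ 3"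
proof -
  let ?\<rho> = "vec_law M d Z"
  define T where "T = (\<Sum>i<d. A $$ (i, i))"
  have p: "0 < A $$ (i, i)" if i: "i < d" for i
    using pos_def_quad_pos[where u="unit_fun i" and k=i, OF A i] by (simp add: quad_unit_fun[OF i] mat_form_def unit_fun_def)
  have T: "0 < T" unfolding T_def using d p by (intro sum_pos) (auto simp: lessThan_empty_iff)
  have le: "nsq d x ^ 3 \<le> T\<^sup>2 * (\<Sum>i<d. x i ^ 6 / (A $$ (i, i))\<^sup>2)" for x
  proof -
    have "(\<Sum>i<d. A $$ (i, i) / T * ((x i)\<^sup>2 / A $$ (i, i))) ^ 3 \<le> (\<Sum>i<d. A $$ (i, i) / T * ((x i)\<^sup>2 / A $$ (i, i)) ^ 3)"
      using p T by (intro weighted_mean_cube_le) (auto simp: T_def sum_divide_distrib[symmetric] less_imp_le)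
    also have "(\<Sum>i<d. A $$ (i, i) / T * ((x i)\<^sup>2 / A $$ (i, i))) = (\<Sum>i<d. x i * x i / T)"
    proof (intro sum.cong refl)
      fix i assume "i \<in> {..<d}"
      then have "A $$ (i, i) \<noteq> 0" using p[of i] by simp
      then show "A $$ (i, i) / T * ((x i)\<^sup>2 / A $$ (i, i)) = x i * x i / T" by (simp add: power2_eq_square)
    qed
    also have "\<dots> = nsq d x / T" by (simp add: dot_def sum_divide_distrib)
    also have "(\<Sum>i<d. A $$ (i, i) / T * ((x i)\<^sup>2 / A $$ (i, i)) ^ 3) = (\<Sum>i<d. x i ^ 6 / (A $$ (i, i))\<^sup>2) / T"
    proof -
      have "A $$ (i, i) / T * ((x i)\<^sup>2 / A $$ (i, i)) ^ 3 = x i ^ 6 / (A $$ (i, i))\<^sup>2 / T" if "i < d" for i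
        using p[OF that] by (simp add: power_divide) (simp add: field_simps power2_eq_square[of "A $$ (i, i)"] power3_eq_cube[of "A $$ (i, i)"])
      then show ?thesis by (simp add: sum_divide_distrib)
    qed
    finally show ?thesis using T by (simp add: power_divide field_simps power2_eq_square power3_eq_cube)
  qed
  have i6: "integrable ?\<rho> (\<lambda>x. x i ^ 6 / (A $$ (i, i))\<^sup>2)" if "i < d" for i
    using gaussian_coord_moments(1)[OF Z A that, of 6] by simp
  have "(\<integral>x. nsq d x ^ 3 \<partial>?\<rho>) \<le> (\<integral>x. T\<^sup>2 * (\<Sum>i<d. x i ^ 6 / (A $$ (i, i))\<^sup>2) \<partial>?\<rho>)"
    using i6 by (intro integral_mono le nsq_cube_integrable gaussian_sixth_moments[OF Z A] integrable_mult_right Bochner_Integration.integrable_sum) auto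
  also have "\<dots> = T\<^sup>2 * (\<Sum>i<d. 15 * A $$ (i, i))"
  proof -
    have "(\<integral>x. x i ^ 6 / (A $$ (i, i))\<^sup>2 \<partial>?\<rho>) = 15 * A $$ (i, i)" if i: "i < d" for i
      using gaussian_coord_moments(3)[OF Z A i] p[OF i] by (simp add: power2_eq_square power3_eq_cube)
    then show ?thesis using i6 by (simp add: Bochner_Integration.integral_sum)
  qed
  also have "\<dots> = 15 * T ^ 3" by (simp add: T_def sum_distrib_left[symmetric] power2_eq_square power3_eq_cube)
  finally show ?thesis unfolding T_def .
qed

section \<open>Moments of a random vector and of its law\<close>

lemma prod_list_trunc: "set is \<subseteq> {..<d} \<Longrightarrow> (\<Prod>i\<leftarrow>is. trunc d x i) = (\<Prod>i\<leftarrow>is. x i)"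
  by (intro arg_cong[where f=prod_list] map_cong) (auto simp: trunc_def)

lemma measurable_prod_list_coord: "(\<lambda>x::nat \<Rightarrow> real. \<Prod>i\<leftarrow>is. x i) \<in> borel_measurable borel"
  by (induction "is") (auto intro!: borel_measurable_times)

lemma vec_law_moment:
  assumes "random_vector M d Y" "set is \<subseteq> {..<d}"
  shows "(\<integral>x. (\<Prod>i\<leftarrow>is. x i) \<partial>vec_law M d Y) = tensor_moment M Y is"
    and "integrable (vec_law M d Y) (\<lambda>x. \<Prod>i\<leftarrow>is. x i) \<longleftrightarrow> integrable M (\<lambda>\<omega>. \<Prod>i\<leftarrow>is. Y \<omega> i)"
  using integral_vec_law[OF assms(1) measurable_prod_list_coord]
  by (simp_all add: prod_list_trunc[OF assms(2)] tensor_moment_def)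

lemma finite_moments_sixth:
  assumes Y: "random_vector M d Y" and m: "finite_moments M d 6 Y"
  shows "sixth_moments d (vec_law M d Y)"
  unfolding sixth_moments_def
proof (intro conjI allI impI law_vec_law[OF Y])
  fix i assume i: "i < d"
  then have "is": "replicate 6 i \<in> multi_idx d 6" by (simp add: multi_idx_def)
  have p: "(\<Prod>i\<leftarrow>replicate 6 i. x i) = x i ^ 6" for x :: "nat \<Rightarrow> real" by (simp add: eval_nat_numeral)
  have "integrable (vec_law M d Y) (\<lambda>x. \<Prod>i\<leftarrow>replicate 6 i. x i)"
    using m "is" by (subst vec_law_moment(2)[OF Y]) (auto simp: finite_moments_def i)
  then show "integrable (vec_law M d Y) (\<lambda>x. x i ^ 6)" unfolding p .
qed

lemma enorm_sixth_moment:
  assumes "random_vector M d Y"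
  shows "(\<integral>\<omega>. enorm d (Y \<omega>) ^ 6 \<partial>M) = (\<integral>x. nsq d x ^ 3 \<partial>vec_law M d Y)"
proof -
  have "(\<lambda>x. nsq d x ^ 3) \<in> borel_measurable borel" by measurable
  from integral_vec_law(1)[OF assms this] show ?thesis by (simp add: enorm_6)
qed

text \<open>Convexity of even powers; it passes finite sixth moments from the two parts of L to
  L.\<close>

lemma sixth_power_sum_le: "(a + b) ^ 6 \<le> 32 * (a ^ 6 + b ^ (6::nat))" for a b :: real
proof -
  have sq: "(a + b)\<^sup>2 \<le> 2 * (a\<^sup>2 + b\<^sup>2)" using sum_squares_bound[of a b] by (simp add: power2_sum)
  have "(\<Sum>i\<in>{0, 1::nat}. 1 / 2 * (if i = 0 then a\<^sup>2 else b\<^sup>2)) ^ 3 \<le> (\<Sum>i\<in>{0, 1::nat}. 1 / 2 * (if i = 0 then a\<^sup>2 else b\<^sup>2) ^ 3)"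
    by (intro weighted_mean_cube_le) auto
  then have c: "(a\<^sup>2 + b\<^sup>2) ^ 3 \<le> 4 * (a ^ 6 + b ^ 6)"
    by (simp add: add_divide_distrib[symmetric] power_divide)
  have "(a + b) ^ 6 = ((a + b)\<^sup>2) ^ 3" by (simp flip: power_mult)
  also have "\<dots> \<le> (2 * (a\<^sup>2 + b\<^sup>2)) ^ 3" by (intro power_mono sq) simp
  also have "\<dots> = 8 * (a\<^sup>2 + b\<^sup>2) ^ 3" by (simp only: power_mult_distrib) simp
  finally show ?thesis using c by linarith
qed

section \<open>The symmetric central limit theorem on balls\<close>

text \<open>The hypotheses of the theorem, with Y, A and l for \<open>Z\<^sub>L\<close>,
  \<open>\<Sigma>\<^sub>L\<close> and \<open>l\<^sub>z\<close>. Of the admissible constants only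
  \<open>Ct\<close> is fixed here; the others enter through a numerical lower bound on C.\<close>

locale symmetric_clt =
  fixes d n :: nat and M :: "'a measure" and X :: "nat \<Rightarrow> 'a \<Rightarrow> nat \<Rightarrow> real"
    and N :: "'b measure" and Y U :: "'b \<Rightarrow> nat \<Rightarrow> real" and A :: "real mat"
    and K :: "'c measure" and Z :: "'c \<Rightarrow> nat \<Rightarrow> real" and l Ct :: real
  assumes d: "1 \<le> d" and n: "1 \<le> n"
    and X: "\<And>i. i \<in> {1..n} \<Longrightarrow> random_vector M d (X i)"
    and indep: "prob_space.indep_vars M (\<lambda>_. Rd d) X {1..n}"
    and ident: "\<And>i. i \<in> {1..n} \<Longrightarrow> distr M (Rd d) (X i) = distr M (Rd d) (X 1)"
    and mean: "\<And>k. k < d \<Longrightarrow> (\<integral>\<omega>. X 1 \<omega> k \<partial>M) = 0"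
    and X6: "finite_moments M d 6 (X 1)"
    and cov_pos: "pos_def_mat d (cov_mat M d (X 1))"
    and odd_moment: "\<And>\<alpha>. (\<Sum>k<d. \<alpha> k) \<le> 5 \<Longrightarrow> \<exists>k<d. odd (\<alpha> k) \<Longrightarrow> (\<integral>\<omega>. (\<Prod>k<d. X 1 \<omega> k ^ \<alpha> k) \<partial>M) = 0"
    and U: "random_vector N d U" and U6: "finite_moments N d 6 U"
    and A: "pos_def_mat d A" and Y: "gaussian_vector N d (\<lambda>_. 0) A Y"
    and YU: "prob_space.indep_var N (Rd d) Y (Rd d) U"
    and match: "\<And>j is. j \<in> {1..5} \<Longrightarrow> is \<in> multi_idx d j \<Longrightarrow>
      tensor_moment N (\<lambda>\<omega> k. Y \<omega> k + U \<omega> k) is = tensor_moment M (X 1) is"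
    and l: "0 < l" and ev: "smallest_eigenvalue A (l\<^sup>2)"
    and Z: "gaussian_vector K d (\<lambda>_. 0) (cov_mat M d (X 1)) Z"
    and Ct: "gaussian_ball_const Ct"
begin

declare One_nat_def [simp del]

abbreviation "\<Sigma> \<equiv> cov_mat M d (X 1)"
abbreviation "L \<equiv> \<lambda>\<omega> k. Y \<omega> k + U \<omega> k"
abbreviation "\<mu> \<equiv> vec_law M d (X 1)"
abbreviation "\<rho> \<equiv> vec_law K d Z"
abbreviation "\<nu> \<equiv> distr N borel (\<lambda>\<omega>. trunc d (Y \<omega>) + trunc d (U \<omega>))"

section \<open>The laws of X, L and Z and their moments\<close>

lemma X1: "random_vector M d (X 1)" using X n by simp
lemma Y': "random_vector N d Y" using Y by (simp add: gaussian_vector_def)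
lemma Z': "random_vector K d Z" using Z by (simp add: gaussian_vector_def)

lemma YU_measurable: "(\<lambda>\<omega>. trunc d (Y \<omega>) + trunc d (U \<omega>)) \<in> borel_measurable N"
  using random_vector_measurable[OF Y'] random_vector_measurable[OF U] by measurable

lemma trunc_L: "trunc d (Y \<omega>) + trunc d (U \<omega>) = trunc d (L \<omega>)"
  by (auto simp: trunc_def)

lemma \<nu>_integral:
  fixes f :: "_ \<Rightarrow> real"
  assumes "f \<in> borel_measurable borel"
  shows "(\<integral>x. f x \<partial>\<nu>) = (\<integral>\<omega>. f (trunc d (L \<omega>)) \<partial>N)" "integrable \<nu> f \<longleftrightarrow> integrable N (\<lambda>\<omega>. f (trunc d (L \<omega>)))"
  using integral_distr[OF YU_measurable assms] integrable_distr_eq[OF YU_measurable assms] by (simp_all only: trunc_L)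

lemma law_\<nu>: "law \<nu>"
  using Y' by (intro law_distr YU_measurable) (simp add: random_vector_def)

lemma \<mu>6: "sixth_moments d \<mu>" by (rule finite_moments_sixth[OF X1 X6])
lemma \<rho>6: "sixth_moments d \<rho>" by (rule gaussian_sixth_moments[OF Z cov_pos])

lemma \<nu>6: "sixth_moments d \<nu>"
  unfolding sixth_moments_def
proof (intro conjI allI impI law_\<nu>)
  fix i assume i: "i < d"
  have m: "(\<lambda>x::nat \<Rightarrow> real. x i ^ 6) \<in> borel_measurable borel" by measurable
  have "integrable N (\<lambda>\<omega>. Y \<omega> i ^ 6)"
    using gaussian_sixth_moments[OF Y A] i integral_vec_law(2)[OF Y' m] by (simp add: sixth_moments_def trunc_def)
  moreover have "integrable N (\<lambda>\<omega>. U \<omega> i ^ 6)"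
    using finite_moments_sixth[OF U U6] i integral_vec_law(2)[OF U m] by (simp add: sixth_moments_def trunc_def)
  ultimately have I: "integrable N (\<lambda>\<omega>. 32 * (Y \<omega> i ^ 6 + U \<omega> i ^ 6))" by simp
  have "(\<lambda>\<omega>. (trunc d (Y \<omega>) + trunc d (U \<omega>)) i ^ 6) \<in> borel_measurable N"
    by (rule measurable_compose[OF YU_measurable m])
  then have meas: "(\<lambda>\<omega>. (Y \<omega> i + U \<omega> i) ^ 6) \<in> borel_measurable N" using i by (simp add: trunc_def)
  have "integrable N (\<lambda>\<omega>. (Y \<omega> i + U \<omega> i) ^ 6)"
    by (rule Bochner_Integration.integrable_bound[OF I meas]) (use sixth_power_sum_le in \<open>auto simp: abs_of_nonneg\<close>)
  then show "integrable \<nu> (\<lambda>x. x i ^ 6)" unfolding \<nu>_integral(2)[OF m] using i by (simp add: trunc_def)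
qed

lemma same_\<mu>\<nu>: "k \<le> 5 \<Longrightarrow> same_moments d k \<mu> \<nu>"
proof (cases "k = 0")
  case True
  then show ?thesis using same_moments_0[OF law_vec_law[OF X1] law_\<nu>] by simp
next
  case False
  assume k: "k \<le> 5"
  show ?thesis
    unfolding same_moments_def
  proof
    fix "is" assume "is": "is \<in> multi_idx d k"
    then have s: "set is \<subseteq> {..<d}" by (simp add: multi_idx_def)
    show "(\<integral>x. (\<Prod>i\<leftarrow>is. x i) \<partial>\<mu>) = (\<integral>x. (\<Prod>i\<leftarrow>is. x i) \<partial>\<nu>)"
      unfolding vec_law_moment(1)[OF X1 s] \<nu>_integral(1)[OF measurable_prod_list_coord] prod_list_trunc[OF s]
      using match[of k "is"] "is" k False by (simp add: tensor_moment_def)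
  qed
qed

lemma cov_entry: "i < d \<Longrightarrow> j < d \<Longrightarrow> \<Sigma> $$ (i, j) = (\<integral>x. x i * x j \<partial>\<mu>)"
proof -
  assume ij: "i < d" "j < d"
  have "(\<integral>x. x i * x j \<partial>\<mu>) = tensor_moment M (X 1) [i, j]"
    using vec_law_moment(1)[OF X1, of "[i, j]"] ij by simp
  then show ?thesis using ij mean by (simp add: cov_mat_def tensor_moment_def)
qed

lemma cov_quad: "quad d (mat_form \<Sigma>) u = (\<integral>x. (dot d u x)\<^sup>2 \<partial>\<mu>)"
proof -
  have i: "integrable \<mu> (\<lambda>x. x i * x j)" if "i < d" "j < d" for i j
    using monomial_integrable[OF \<mu>6, of "[i, j]" 2] that by (simp add: multi_idx_def)
  have "(\<integral>x. (dot d u x)\<^sup>2 \<partial>\<mu>) = (\<integral>x. (\<Sum>i<d. \<Sum>j<d. u i * u j * (x i * x j)) \<partial>\<mu>)"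
    by (simp add: dot_def power2_eq_square sum_product mult_ac)
  also have "\<dots> = (\<Sum>i<d. \<Sum>j<d. u i * u j * (\<integral>x. x i * x j \<partial>\<mu>))"
  proof -
    have "integrable \<mu> (\<lambda>x. u i * u j * (x i * x j))" if "i < d" "j < d" for i j
      using i[OF that] by simp
    then show ?thesis
      by (subst Bochner_Integration.integral_sum, force intro: Bochner_Integration.integrable_sum,
          intro sum.cong refl, subst Bochner_Integration.integral_sum) auto
  qed
  finally show ?thesis by (simp add: quad_def mat_form_def cov_entry mult_ac)
qed

text \<open>Matching second moments make \<Sigma> the second moment of L. The cross term of Y and U
  vanishes by independence and centring, so \<Sigma> dominates A and thus l^2 I; hence Z contains a
  Gaussian of scale l as well.\<close>

lemma quad_cov_ge: "l\<^sup>2 * nsq d u \<le> quad d (mat_form \<Sigma>) u"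
proof -
  have N: "prob_space N" using U by (simp add: random_vector_def)
  interpret N: prob_space N by (rule N)
  have dm: "(\<lambda>x. dot d u x) \<in> borel_measurable borel" "(\<lambda>x. (dot d u x)\<^sup>2) \<in> borel_measurable borel" by measurable
  note U6' = finite_moments_sixth[OF U U6] and Y6 = gaussian_sixth_moments[OF Y A]
  have hp: "hom_poly d 2 (\<lambda>h. (dot d u h)\<^sup>2)" using hom_poly_power[OF hom_poly_dot, of d 2 u] by simp
  have Yi: "integrable N (\<lambda>\<omega>. dot d u (Y \<omega>))" "integrable N (\<lambda>\<omega>. (dot d u (Y \<omega>))\<^sup>2)"
    using hom_poly_integrable[OF Y6 hom_poly_dot] hom_poly_integrable[OF Y6 hp] integral_vec_law(2)[OF Y' dm(1)] integral_vec_law(2)[OF Y' dm(2)] by auto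
  have Ui: "integrable N (\<lambda>\<omega>. dot d u (U \<omega>))" "integrable N (\<lambda>\<omega>. (dot d u (U \<omega>))\<^sup>2)"
    using hom_poly_integrable[OF U6' hom_poly_dot] hom_poly_integrable[OF U6' hp] integral_vec_law(2)[OF U dm(1)] integral_vec_law(2)[OF U dm(2)] by auto
  have "N.indep_var borel (\<lambda>\<omega>. dot d u (trunc d (Y \<omega>))) borel (\<lambda>\<omega>. dot d u (trunc d (U \<omega>)))"
    using N.indep_var_compose[OF YU measurable_compose[OF measurable_trunc_Rd dm(1)] measurable_compose[OF measurable_trunc_Rd dm(1)]]
    by (simp add: o_def)
  then have ind: "N.indep_var borel (\<lambda>\<omega>. dot d u (Y \<omega>)) borel (\<lambda>\<omega>. dot d u (U \<omega>))" by simp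
  have Y0: "(\<integral>\<omega>. dot d u (Y \<omega>) \<partial>N) = 0"
    using gaussian_dot_second_moment(2)[OF Y A, of u] integral_vec_law(1)[OF Y' dm(1)] by simp
  have YU0: "(\<integral>\<omega>. dot d u (Y \<omega>) * dot d u (U \<omega>) \<partial>N) = 0"
    using N.indep_var_lebesgue_integral[OF ind Yi(1) Ui(1)] Y0 by simp
  have YUi: "integrable N (\<lambda>\<omega>. dot d u (Y \<omega>) * dot d u (U \<omega>))"
    by (rule N.indep_var_integrable[OF ind Yi(1) Ui(1)])
  have "l\<^sup>2 * nsq d u \<le> quad d (mat_form A) u" by (rule smallest_eigenvalue_le_quad[OF A ev d])
  also have "\<dots> = (\<integral>\<omega>. (dot d u (Y \<omega>))\<^sup>2 \<partial>N)"
    using gaussian_dot_second_moment(1)[OF Y A, of u] integral_vec_law(1)[OF Y' dm(2)] by simp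
  also have "\<dots> \<le> (\<integral>\<omega>. (dot d u (Y \<omega>))\<^sup>2 \<partial>N) + 2 * (\<integral>\<omega>. dot d u (Y \<omega>) * dot d u (U \<omega>) \<partial>N) + (\<integral>\<omega>. (dot d u (U \<omega>))\<^sup>2 \<partial>N)"
    by (simp add: YU0)
  also have "\<dots> = (\<integral>\<omega>. (dot d u (Y \<omega>))\<^sup>2 + 2 * (dot d u (Y \<omega>) * dot d u (U \<omega>)) + (dot d u (U \<omega>))\<^sup>2 \<partial>N)"
    using Yi(2) Ui(2) YUi by simp
  also have "\<dots> = (\<integral>\<omega>. (dot d u (trunc d (L \<omega>)))\<^sup>2 \<partial>N)"
  proof (intro Bochner_Integration.integral_cong refl)
    fix \<omega>
    have "dot d u (trunc d (L \<omega>)) = dot d u (Y \<omega>) + dot d u (U \<omega>)"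
      unfolding trunc_L[symmetric] dot_add dot_trunc ..
    then show "(dot d u (Y \<omega>))\<^sup>2 + 2 * (dot d u (Y \<omega>) * dot d u (U \<omega>)) + (dot d u (U \<omega>))\<^sup>2 = (dot d u (trunc d (L \<omega>)))\<^sup>2"
      by (simp add: power2_sum)
  qed
  also have "\<dots> = (\<integral>x. (dot d u x)\<^sup>2 \<partial>\<nu>)" by (rule \<nu>_integral(1)[OF dm(2), symmetric])
  also have "\<dots> = (\<integral>x. (dot d u x)\<^sup>2 \<partial>\<mu>)"
    by (rule hom_poly_same_moments[OF \<mu>6 \<nu>6 hp _ same_\<mu>\<nu>, symmetric]) auto
  finally show ?thesis by (simp add: cov_quad)
qed

text \<open>The lower bound leads to 1 \<le> b; the identity turns the trace in the bound on the
  sixth moment of Z into a moment of X.\<close>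

lemma cov_trace_ge: "l\<^sup>2 \<le> (\<integral>x. nsq d x \<partial>\<mu>)" and cov_trace: "(\<Sum>i<d. \<Sigma> $$ (i, i)) = (\<integral>x. nsq d x \<partial>\<mu>)"
proof -
  have i: "integrable \<mu> (\<lambda>x. x i * x i)" if "i < d" for i
    using monomial_integrable[OF \<mu>6, of "[i, i]" 2] that by (simp add: multi_idx_def)
  show t: "(\<Sum>i<d. \<Sigma> $$ (i, i)) = (\<integral>x. nsq d x \<partial>\<mu>)"
    unfolding dot_def using i by (simp add: cov_entry Bochner_Integration.integral_sum)
  have "l\<^sup>2 \<le> \<Sigma> $$ (i, i)" if "i < d" for i
    using quad_cov_ge[of "unit_fun i"] by (simp add: quad_unit_fun[OF that] dot_unit_fun[OF that] mat_form_def) (simp add: unit_fun_def)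
  then have "(\<Sum>i<d. l\<^sup>2) \<le> (\<Sum>i<d. \<Sigma> $$ (i, i))" by (intro sum_mono) auto
  moreover have "1 * l\<^sup>2 \<le> real d * l\<^sup>2" using d by (intro mult_right_mono) auto
  ultimately show "l\<^sup>2 \<le> (\<integral>x. nsq d x \<partial>\<mu>)" unfolding t[symmetric] by simp
qed

lemma \<mu>_odd:
  assumes "is \<in> multi_idx d k" "k \<le> 5" "\<exists>i<d. odd (count_list is i)"
  shows "(\<integral>x. (\<Prod>i\<leftarrow>is. x i) \<partial>\<mu>) = 0"
proof -
  have s: "set is \<subseteq> {..<d}" "length is = k" using assms(1) by (auto simp: multi_idx_def)
  have "(\<Sum>i<d. count_list is i) = k" using s by (auto intro: sum_count_set)
  then show ?thesis
    unfolding vec_law_moment(1)[OF X1 s(1)] tensor_moment_def unfolding prod_list_eq_prod_count[OF s(1)]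
    using odd_moment[of "count_list is"] assms by simp
qed

lemma cov_diagonal: "i < d \<Longrightarrow> j < d \<Longrightarrow> i \<noteq> j \<Longrightarrow> \<Sigma> $$ (i, j) = 0"
proof -
  assume ij: "i < d" "j < d" "i \<noteq> j"
  then have "odd (count_list [i, j] i)" by simp
  moreover have "[i, j] \<in> multi_idx d 2" using ij by (simp add: multi_idx_def)
  ultimately have "(\<integral>x. (\<Prod>i\<leftarrow>[i, j]. x i) \<partial>\<mu>) = 0" using ij by (intro \<mu>_odd) auto
  then show ?thesis using ij cov_entry by simp
qed

text \<open>The symmetry of X makes \<Sigma> diagonal, so the quadratic form of Z is invariant under
  a change of sign of one coordinate.\<close>

lemma \<rho>_odd:
  assumes "is \<in> multi_idx d k" "\<exists>i<d. odd (count_list is i)"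
  shows "(\<integral>x. (\<Prod>i\<leftarrow>is. x i) \<partial>\<rho>) = 0"
proof -
  have s: "set is \<subseteq> {..<d}" using assms(1) by (auto simp: multi_idx_def)
  obtain i where i: "i < d" "odd (count_list is i)" using assms(2) by blast
  let ?q = "quad d (mat_form \<Sigma>)"
  have q: "?q u = (\<Sum>j<d. \<Sigma> $$ (j, j) * (u j)\<^sup>2)" for u
  proof -
    have "(\<Sum>k<d. u j * mat_form \<Sigma> j k * u k) = (\<Sum>k<d. if k = j then \<Sigma> $$ (j, j) * (u j)\<^sup>2 else 0)" if "j < d" for j
      using that by (intro sum.cong) (auto simp: mat_form_def cov_diagonal power2_eq_square)
    then show ?thesis by (simp add: quad_def)
  qed
  have "?q (u(i := - u i)) = ?q u" for u unfolding q by (intro sum.cong) auto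
  moreover have "cf_eq d \<rho> 0 ?q" using gaussian_vector_cf_eq[OF Z cov_pos] by (simp add: zero_fun_def)
  ultimately show ?thesis using flip_symmetric_moment[OF law_vec_law[OF Z'] _ _ s i(2)] by blast
qed

text \<open>Multi-indices with an odd count give 0 on both sides, which settles odd k, and k = 2 is
  the covariance. Order 4 is left over and produces the Frobenius term.\<close>

lemma same_\<mu>\<rho>:
  assumes k: "k \<le> 5" "k \<noteq> 4"
  shows "same_moments d k \<mu> \<rho>"
proof (cases "k = 0")
  case True
  then show ?thesis using same_moments_0[OF law_vec_law[OF X1] law_vec_law[OF Z']] by simp
next
  case k0: False
  show ?thesis
    unfolding same_moments_def
  proof
    fix "is" assume "is": "is \<in> multi_idx d k"
    show "(\<integral>x. (\<Prod>i\<leftarrow>is. x i) \<partial>\<mu>) = (\<integral>x. (\<Prod>i\<leftarrow>is. x i) \<partial>\<rho>)"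
    proof (cases "\<exists>i<d. odd (count_list is i)")
      case True
      then show ?thesis using \<mu>_odd[OF "is" k(1)] \<rho>_odd[OF "is"] by simp
    next
      case False
      then have "even k" using odd_length_odd_count[OF "is"] by blast
      then have "k = 2" using k k0 by presburger
      with "is" have "length is = 2" "set is \<subseteq> {..<d}" by (simp_all add: multi_idx_def)
      then obtain i j where ij: "is = [i, j]" "i < d" "j < d"
        by (auto simp: length_Suc_conv numeral_2_eq_2)
      have "i = j"
      proof (rule ccontr)
        assume "i \<noteq> j"
        then have "odd (count_list is i)" using ij by simp
        then show False using False ij by blast
      qed
      then have "is": "is = [i, i]" using ij by simp
      show ?thesis
        unfolding "is" using cov_entry[OF ij(2) ij(2)] gaussian_coord_moments(2)[OF Z cov_pos ij(2)] by (simp add: power2_eq_square)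
    qed
  qed
qed

abbreviation "D4 \<equiv> \<lambda>is. tensor_moment M (X 1) is - tensor_moment K Z is"

lemma D4_eq: "is \<in> multi_idx d 4 \<Longrightarrow> D4 is = moment_gap \<mu> \<rho> is"
  using vec_law_moment(1)[OF X1] vec_law_moment(1)[OF Z'] by (simp add: moment_gap_def multi_idx_def)

lemma D4_odd: "is \<in> multi_idx d 4 \<Longrightarrow> \<exists>i<d. odd (count_list is i) \<Longrightarrow> D4 is = 0"
  unfolding D4_eq moment_gap_def using \<mu>_odd \<rho>_odd by simp

definition "\<beta> = (\<integral>x. nsq d x ^ 3 \<partial>\<mu>) + (\<integral>x. nsq d x ^ 3 \<partial>\<nu>)"
definition "b = (\<beta> / l ^ 6) powr (1 / 4)"

lemma \<beta>_eq: "\<beta> = (\<integral>\<omega>. enorm d (X 1 \<omega>) ^ 6 \<partial>M) + (\<integral>\<omega>. enorm d (L \<omega>) ^ 6 \<partial>N)"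
proof -
  have m: "(\<lambda>x. nsq d x ^ 3) \<in> borel_measurable borel" by measurable
  show ?thesis unfolding \<beta>_def enorm_sixth_moment[OF X1] \<nu>_integral(1)[OF m] by (simp add: enorm_6)
qed

lemma \<beta>_ge: "l ^ 6 \<le> \<beta>"
proof -
  have "(l\<^sup>2) ^ 3 \<le> (\<integral>x. nsq d x \<partial>\<mu>) ^ 3" by (intro power_mono cov_trace_ge) simp
  also have "\<dots> \<le> (\<integral>x. nsq d x ^ 3 \<partial>\<mu>)" by (rule nsq_moment_cube_le[OF \<mu>6])
  also have "\<dots> \<le> \<beta>" by (simp add: \<beta>_def)
  finally show ?thesis by simp
qed

lemma b_props: "b ^ 4 * l ^ 6 = \<beta>" "1 \<le> b"
proof -
  have \<beta>0: "0 \<le> \<beta>" by (rule order_trans[OF _ \<beta>_ge]) simp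
  have g: "1 \<le> \<beta> / l ^ 6" using \<beta>_ge l by simp
  then show "1 \<le> b" unfolding b_def by (intro ge_one_powr_ge_zero) auto
  have "b ^ 4 = ((\<beta> / l ^ 6) powr (1 / 4)) powr 4" by (simp add: b_def)
  also have "\<dots> = \<beta> / l ^ 6" unfolding powr_powr using \<beta>0 by simp
  finally have "b ^ 4 = \<beta> / l ^ 6" .
  then show "b ^ 4 * l ^ 6 = \<beta>" using l by simp
qed

text \<open>The Gaussian part of L splits into one of scale l and a rest that joins U in the
  residual law; Z splits in the same way because its covariance dominates l^2 I.\<close>

lemma ball_bound:
  assumes r: "0 \<le> r"
  shows "\<bar>measure M {\<omega>\<in>space M. enorm d (\<lambda>k. (\<Sum>i=1..n. X i \<omega> k) / sqrt n - t k) \<le> r}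
      - measure K {\<omega>\<in>space K. enorm d (\<lambda>k. Z \<omega> k - t k) \<le> r}\<bar>
    \<le> frob_norm d 4 D4 / (sqrt 24 * l ^ 4) / n + 88 * max 1 Ct * b / sqrt n"
proof -
  have N: "prob_space N" using U by (simp add: random_vector_def)
  obtain \<eta> where \<eta>: "law \<eta>" and splitY: "\<And>K f. test_fun d K f \<Longrightarrow> avg (vec_law N d Y) f = avg (gauss d l) (avg \<eta> f)"
    using gaussian_vector_split[OF Y A smallest_eigenvalue_le_quad[OF A ev d]] by metis
  obtain \<zeta> where \<zeta>: "law \<zeta>" and split\<rho>: "\<And>K f. test_fun d K f \<Longrightarrow> avg \<rho> f = avg (gauss d l) (avg \<zeta> f)"
    using gaussian_vector_split[OF Z cov_pos quad_cov_ge] by metis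
  have lU: "law (vec_law N d U)" and lY: "law (vec_law N d Y)" using law_vec_law U Y' by auto
  have \<tau>: "law (conv \<eta> (vec_law N d U))" by (rule law_conv[OF \<eta> lU])
  have split\<nu>: "avg \<nu> f = avg (gauss d l) (avg (conv \<eta> (vec_law N d U)) f)" if f: "test_fun d K f" for K f
    unfolding conv_vec_law[OF N Y' U YU, symmetric] avg_conv[OF lY lU f] avg_conv[OF \<eta> lU f]
    by (rule splitY[OF test_fun_avg[OF f lU]])
  interpret matched_laws d \<mu> \<nu> "conv \<eta> (vec_law N d U)" l Ct b
    using d \<mu>6 \<nu>6 \<tau> same_\<mu>\<nu> l split\<nu> Ct b_props by unfold_locales (auto simp: \<beta>_def)
  have m6: "(\<integral>x. nsq d x ^ 3 \<partial>\<rho>) \<le> 15 * (\<integral>x. nsq d x ^ 3 \<partial>\<mu>)"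
  proof -
    have "(\<integral>x. nsq d x ^ 3 \<partial>\<rho>) \<le> 15 * (\<integral>x. nsq d x \<partial>\<mu>) ^ 3"
      using gaussian_nsq_cube_le[OF Z cov_pos d] unfolding cov_trace .
    then show ?thesis using nsq_moment_cube_le[OF \<mu>6] by linarith
  qed
  have F: "sqrt (\<Sum>is\<in>multi_idx d 4. (moment_gap \<mu> \<rho> is)\<^sup>2) = frob_norm d 4 D4"
    unfolding frob_norm_def by (intro arg_cong[where f=sqrt] sum.cong refl) (simp only: D4_eq)
  have r': "0 \<le> sqrt n * r" using r by simp
  have M: "prob_space M" using X1 by (simp add: random_vector_def)
  have PX: "measure M {\<omega>\<in>space M. enorm d (\<lambda>k. (\<Sum>i=1..n. X i \<omega> k) / sqrt n - t k) \<le> r}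
    = (avg \<mu> ^^ n) (indicator (eball d (scale (sqrt n) t) (sqrt n * r))) 0"
    by (rule iid_ball_prob[OF M X n indep ident])
  show ?thesis
    unfolding PX gaussian_ball_prob[OF Z cov_pos n] F[symmetric]
    by (rule gaussian_limit_bound[OF \<rho>6 \<zeta> _ _ m6 n r']) (rule split\<rho> same_\<mu>\<rho>; assumption)+
qed

section \<open>From the uniform ball bound to the three inequalities\<close>

abbreviation "S \<equiv> \<lambda>\<omega> k. (\<Sum>i=1..n. X i \<omega> k) / sqrt (real n)"

lemma ball_dist_bound:
  "ball_dist d M S K Z \<le> frob_norm d 4 D4 / (sqrt 24 * l ^ 4) / n + 88 * max 1 Ct * b / sqrt n"
  unfolding ball_dist_def by (rule cSUP_least) (use ball_bound in auto)

abbreviation "m6 \<equiv> max_sixth_moment d M (X 1) N L K Z"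

lemma m6_ge: "k < d \<Longrightarrow> (\<integral>x. x k ^ 6 \<partial>\<mu>) \<le> m6" "k < d \<Longrightarrow> (\<integral>x. x k ^ 6 \<partial>\<nu>) \<le> m6" "0 \<le> m6"
proof -
  have m: "(\<lambda>x::nat \<Rightarrow> real. x k ^ 6) \<in> borel_measurable borel" for k by measurable
  have a: "(\<integral>x. x k ^ 6 \<partial>\<mu>) = (\<integral>\<omega>. X 1 \<omega> k ^ 6 \<partial>M)" "(\<integral>x. x k ^ 6 \<partial>\<nu>) = (\<integral>\<omega>. L \<omega> k ^ 6 \<partial>N)" if "k < d" for k
    using integral_vec_law(1)[OF X1 m] \<nu>_integral(1)[OF m] that by (simp_all add: trunc_def)
  have ge: "(\<integral>x. x k ^ 6 \<partial>\<mu>) \<le> m6" "(\<integral>x. x k ^ 6 \<partial>\<nu>) \<le> m6" if "k < d" for k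
    unfolding a[OF that] max_sixth_moment_def using that by (auto intro!: Max_ge)
  then show "k < d \<Longrightarrow> (\<integral>x. x k ^ 6 \<partial>\<mu>) \<le> m6" "k < d \<Longrightarrow> (\<integral>x. x k ^ 6 \<partial>\<nu>) \<le> m6" by blast+
  have "0 \<le> (\<integral>x. x 0 ^ 6 \<partial>\<mu>)" by simp
  also have "\<dots> \<le> m6" using ge(1) d by simp
  finally show "0 \<le> m6" .
qed

lemma \<beta>_le: "\<beta> \<le> 2 * real d ^ 3 * m6"
proof -
  have le: "(\<integral>x. nsq d x ^ 3 \<partial>\<kappa>) \<le> real d ^ 3 * m6"
    if \<kappa>: "sixth_moments d \<kappa>" and m: "\<And>k. k < d \<Longrightarrow> (\<integral>x. x k ^ 6 \<partial>\<kappa>) \<le> m6" for \<kappa>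
  proof -
    have i: "integrable \<kappa> (\<lambda>x. x k ^ 6)" if "k < d" for k using \<kappa> that by (simp add: sixth_moments_def)
    have "(\<integral>x. nsq d x ^ 3 \<partial>\<kappa>) \<le> (\<integral>x. real d ^ 2 * (\<Sum>k<d. x k ^ 6) \<partial>\<kappa>)"
      using i by (intro integral_mono nsq_cube_integrable[OF \<kappa>] nsq_cube_le_sixth_powers) auto
    also have "\<dots> = real d ^ 2 * (\<Sum>k<d. (\<integral>x. x k ^ 6 \<partial>\<kappa>))"
      using i by (simp add: Bochner_Integration.integral_sum)
    also have "\<dots> \<le> real d ^ 2 * (\<Sum>k<d. m6)" using m by (intro mult_left_mono sum_mono) auto
    also have "\<dots> = real d ^ 3 * m6" by (simp add: power2_eq_square power3_eq_cube)
    finally show ?thesis .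
  qed
  show ?thesis using le[OF \<mu>6 m6_ge(1)] le[OF \<nu>6 m6_ge(2)] by (simp add: \<beta>_def)
qed

text \<open>The fourth power of b is at most 2 d^3 m6 / l^6, and 2^(1/4) is below 3/2.\<close>

lemma b_le: "b \<le> 3 / 2 * ((m6 / l ^ 6) powr (1 / 4) * real d powr (3 / 4))"
proof -
  have y: "0 \<le> m6 / l ^ 6" using m6_ge(3) l by simp
  have "\<beta> / l ^ 6 \<le> 2 * real d ^ 3 * m6 / l ^ 6" using \<beta>_le l by (intro divide_right_mono) auto
  then have "b \<le> (2 * (real d ^ 3 * (m6 / l ^ 6))) powr (1 / 4)"
    unfolding b_def using b_props(1) b_props(2) l by (intro powr_mono2) (auto simp: mult_ac simp flip: b_props(1))
  also have "\<dots> = 2 powr (1 / 4) * (real d powr (3 / 4) * (m6 / l ^ 6) powr (1 / 4))"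
  proof -
    have "(real d ^ 3) powr (1 / 4) = real d powr (3 / 4)"
      using d powr_powr[of "real d" 3 "1 / 4"] by (simp add: powr_numeral)
    then show ?thesis using y by (simp only: powr_mult zero_le_numeral zero_le_power of_nat_0_le_iff mult_nonneg_nonneg)
  qed
  also have "\<dots> \<le> 3 / 2 * (real d powr (3 / 4) * (m6 / l ^ 6) powr (1 / 4))"
  proof -
    have "(2::real) powr (1 / 4) \<le> 2 powr (1 / 2)" by (intro powr_mono) auto
    also have "\<dots> = sqrt 2" by (simp add: powr_half_sqrt)
    also have "\<dots> \<le> 3 / 2" by (rule real_le_lsqrt) (auto simp: power2_eq_square)
    finally show ?thesis by (intro mult_right_mono) auto
  qed
  finally show ?thesis by (simp add: mult_ac)
qed

lemma n_powr: "real n powr (-1/2) = 1 / sqrt n"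
  using powr_minus[of "real n" "1/2"] by (simp add: powr_half_sqrt inverse_eq_divide)

lemma fourth_order_eq: "frob_norm d 4 D4 / (sqrt 24 * l ^ 4) / n = 1 / sqrt (fact 4) / l ^ 4 * frob_norm d 4 D4 / real n"
  by (simp add: fact_numeral)

text \<open>The factor 88 is below 174, and the n^-2 term is nonnegative.\<close>

lemma first_bound:
  assumes C: "174 * max 1 Ct \<le> C"
  shows "ball_dist d M S K Z
    \<le> C * (((\<integral>\<omega>. enorm d (X 1 \<omega>) ^ 6 \<partial>M) + (\<integral>\<omega>. enorm d (L \<omega>) ^ 6 \<partial>N)) / l ^ 6) powr (1/4) * real n powr (-1/2)
      + 1 / sqrt (fact 4) / l ^ 4 * frob_norm d 4 D4 / real n
      + 1 / sqrt (fact 6) / l ^ 6 * ((\<integral>\<omega>. enorm d (U \<omega>) ^ 6 \<partial>N) + (\<integral>\<omega>. enorm d (Z \<omega>) ^ 6 \<partial>K)) / (real n)\<^sup>2"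
proof -
  have "88 * max 1 Ct * b \<le> C * b" using C b_props by (intro mult_right_mono) auto
  then have "88 * max 1 Ct * b / sqrt n \<le> C * b * real n powr (-1/2)"
    unfolding n_powr by (simp add: divide_right_mono)
  moreover have "0 \<le> 1 / sqrt (fact 6) / l ^ 6 * ((\<integral>\<omega>. enorm d (U \<omega>) ^ 6 \<partial>N) + (\<integral>\<omega>. enorm d (Z \<omega>) ^ 6 \<partial>K)) / (real n)\<^sup>2"
    by simp
  ultimately show ?thesis
    using ball_dist_bound unfolding fourth_order_eq \<beta>_eq[symmetric] b_def[symmetric] by linarith
qed

text \<open>The coordinatewise estimate of b raises the factor to 88 * 3/2 = 132, still below
  174.\<close>

lemma second_bound:
  assumes C: "174 * max 1 Ct \<le> C"
  shows "ball_dist d M S K Z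
    \<le> 1 / sqrt (fact 4) / l ^ 4 * frob_norm d 4 D4 / real n
      + C * (m6 / l ^ 6) powr (1/4) * real d powr (3/4) * real n powr (-1/2)
      + 1 / sqrt (fact 6) * (m6 / l ^ 6) * real d ^ 3 / (real n)\<^sup>2"
proof -
  define y where "y = (m6 / l ^ 6) powr (1 / 4) * real d powr (3 / 4)"
  have y: "0 \<le> y" by (simp add: y_def)
  have "88 * max 1 Ct * b \<le> 88 * max 1 Ct * (3 / 2 * y)" using b_le unfolding y_def by (intro mult_left_mono) auto
  also have "\<dots> = 132 * max 1 Ct * y" by simp
  also have "\<dots> \<le> C * y" using C y by (intro mult_right_mono) auto
  finally have "88 * max 1 Ct * b / sqrt n \<le> C * y * real n powr (-1/2)"
    unfolding n_powr by (simp add: divide_right_mono)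
  moreover have "0 \<le> 1 / sqrt (fact 6) * (m6 / l ^ 6) * real d ^ 3 / (real n)\<^sup>2" using m6_ge(3) l by simp
  ultimately show ?thesis
    using ball_dist_bound unfolding fourth_order_eq y_def mult.assoc by linarith
qed

text \<open>The factor sqrt 3 from the pairings turns 1 / sqrt (4!) into 1 / sqrt 8.\<close>

lemma third_bound:
  "1 / sqrt (fact 4) / l ^ 4 * frob_norm d 4 D4 / real n \<le> 1 / sqrt 8 / l ^ 4 * max_norm d 4 D4 * real d / real n"
proof -
  have s: "sqrt (fact 4) = sqrt 3 * sqrt (8::real)" by (simp add: fact_numeral flip: real_sqrt_mult)
  have "frob_norm d 4 D4 \<le> sqrt 3 * real d * max_norm d 4 D4"
    by (rule frob_norm_pairs_le[OF d D4_odd])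
  then have "1 / sqrt (fact 4) / l ^ 4 * frob_norm d 4 D4 / real n \<le> 1 / sqrt (fact 4) / l ^ 4 * (sqrt 3 * real d * max_norm d 4 D4) / real n"
    using l by (intro divide_right_mono mult_left_mono) auto
  also have "\<dots> = 1 / sqrt 8 / l ^ 4 * max_norm d 4 D4 * real d / real n" unfolding s by simp
  finally show ?thesis .
qed

end

text \<open>The inequalities are claimed for every admissible choice of constants, and the separate
  existence claim guards against vacuity. Its witnesses are the Beta cutoff and the
  anti-concentration constant 200.\<close>

theorem theorem4p1:
  shows
  "(\<exists>Ct \<phi> c4 c5. admissible_consts Ct \<phi> c4 c5) \<and>
   (\<forall>Ct \<phi> c4 c5. admissible_consts Ct \<phi> c4 c5 \<longrightarrow>
      C_B6 Ct c4 c5 \<ge> 2.9 \<and>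
      (\<forall>(d::nat) (n::nat)
          (M :: 'a measure) (X :: nat \<Rightarrow> 'a \<Rightarrow> nat \<Rightarrow> real)
          (N :: 'b measure) (Z\<^sub>L :: 'b \<Rightarrow> nat \<Rightarrow> real) (U :: 'b \<Rightarrow> nat \<Rightarrow> real) (\<Sigma>\<^sub>L :: real mat)
          (K :: 'c measure) (Z :: 'c \<Rightarrow> nat \<Rightarrow> real) (l\<^sub>z :: real).
        let \<Sigma> = cov_mat M d (X 1);
            L = (\<lambda>\<omega> k. Z\<^sub>L \<omega> k + U \<omega> k);
            S = (\<lambda>\<omega> k. (\<Sum>i=1..n. X i \<omega> k) / sqrt (real n));
            D4 = (\<lambda>is. tensor_moment M (X 1) is - tensor_moment K Z is);
            m6 = max_sixth_moment d M (X 1) N L K Z;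
            C = C_B6 Ct c4 c5
        in
        d \<ge> 1 \<longrightarrow> n \<ge> 1 \<longrightarrow>
        (\<forall>i\<in>{1..n}. random_vector M d (X i)) \<longrightarrow>
        prob_space.indep_vars M (\<lambda>_. Rd d) X {1..n} \<longrightarrow>
        (\<forall>i\<in>{1..n}. distr M (Rd d) (X i) = distr M (Rd d) (X 1)) \<longrightarrow>
        (\<forall>k<d. (\<integral>\<omega>. X 1 \<omega> k \<partial>M) = 0) \<longrightarrow>
        finite_moments M d 6 (X 1) \<longrightarrow>
        pos_def_mat d \<Sigma> \<longrightarrow>
        (\<forall>\<alpha> :: nat \<Rightarrow> nat. (\<Sum>k<d. \<alpha> k) \<le> 5 \<and> (\<exists>k<d. odd (\<alpha> k)) \<longrightarrow>
           (\<integral>\<omega>. (\<Prod>k<d. X 1 \<omega> k ^ \<alpha> k) \<partial>M) = 0) \<longrightarrow>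
        random_vector N d U \<longrightarrow>
        finite_moments N d 6 U \<longrightarrow>
        pos_def_mat d \<Sigma>\<^sub>L \<longrightarrow>
        gaussian_vector N d (\<lambda>_. 0) \<Sigma>\<^sub>L Z\<^sub>L \<longrightarrow>
        prob_space.indep_var N (Rd d) Z\<^sub>L (Rd d) U \<longrightarrow>
        (\<forall>j\<in>{1..5}. \<forall>is\<in>multi_idx d j. tensor_moment N L is = tensor_moment M (X 1) is) \<longrightarrow>
        l\<^sub>z > 0 \<longrightarrow>
        smallest_eigenvalue \<Sigma>\<^sub>L (l\<^sub>z\<^sup>2) \<longrightarrow>
        gaussian_vector K d (\<lambda>_. 0) \<Sigma> Z \<longrightarrow>
        ball_dist d M S K Z
          \<le> C * (((\<integral>\<omega>. enorm d (X 1 \<omega>) ^ 6 \<partial>M) + (\<integral>\<omega>. enorm d (L \<omega>) ^ 6 \<partial>N)) / l\<^sub>z ^ 6)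
                  powr (1/4) * real n powr (-1/2)
            + 1 / sqrt (fact 4) / l\<^sub>z ^ 4 * frob_norm d 4 D4 / real n
            + 1 / sqrt (fact 6) / l\<^sub>z ^ 6
                * ((\<integral>\<omega>. enorm d (U \<omega>) ^ 6 \<partial>N) + (\<integral>\<omega>. enorm d (Z \<omega>) ^ 6 \<partial>K)) / (real n)\<^sup>2
        \<and>
        ball_dist d M S K Z
          \<le> 1 / sqrt (fact 4) / l\<^sub>z ^ 4 * frob_norm d 4 D4 / real n
            + C * (m6 / l\<^sub>z ^ 6) powr (1/4) * real d powr (3/4) * real n powr (-1/2)
            + 1 / sqrt (fact 6) * (m6 / l\<^sub>z ^ 6) * real d ^ 3 / (real n)\<^sup>2
        \<and>
        1 / sqrt (fact 4) / l\<^sub>z ^ 4 * frob_norm d 4 D4 / real n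
            + C * (m6 / l\<^sub>z ^ 6) powr (1/4) * real d powr (3/4) * real n powr (-1/2)
            + 1 / sqrt (fact 6) * (m6 / l\<^sub>z ^ 6) * real d ^ 3 / (real n)\<^sup>2
          \<le> 1 / sqrt 8 / l\<^sub>z ^ 4 * max_norm d 4 D4 * real d / real n
            + C * (m6 / l\<^sub>z ^ 6) powr (1/4) * real d powr (3/4) * real n powr (-1/2)
            + 1 / sqrt (fact 6) * (m6 / l\<^sub>z ^ 6) * real d ^ 3 / (real n)\<^sup>2))"
proof (intro conjI allI impI; (unfold Let_def)?; (intro impI)?)
  have "admissible_consts 200 (cutoff_deriv 0) 12456000000 12456000000"
    by (simp add: admissible_consts_def gaussian_ball_const_exists smooth_cutoff_exists cutoff_const_exists)
  then show "\<exists>Ct \<phi> c4 c5. admissible_consts Ct \<phi> c4 c5" by blast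
next
  fix Ct \<phi> c4 c5
  assume "admissible_consts Ct \<phi> c4 c5"
  from C_B6_ge[OF this] show "2.9 \<le> C_B6 Ct c4 c5" by simp
next
  fix Ct \<phi> c4 c5 and d n :: nat and M :: "'a measure" and X and N :: "'b measure" and Z\<^sub>L U \<Sigma>\<^sub>L
    and K :: "'c measure" and Z l\<^sub>z
  assume adm: "admissible_consts Ct \<phi> c4 c5"
    and h: "1 \<le> d" "1 \<le> n" "\<forall>i\<in>{1..n}. random_vector M d (X i)" "prob_space.indep_vars M (\<lambda>_. Rd d) X {1..n}"
      "\<forall>i\<in>{1..n}. distr M (Rd d) (X i) = distr M (Rd d) (X 1)" "\<forall>k<d. (\<integral>\<omega>. X 1 \<omega> k \<partial>M) = 0"
      "finite_moments M d 6 (X 1)" "pos_def_mat d (cov_mat M d (X 1))"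
      "\<forall>\<alpha> :: nat \<Rightarrow> nat. (\<Sum>k<d. \<alpha> k) \<le> 5 \<and> (\<exists>k<d. odd (\<alpha> k)) \<longrightarrow> (\<integral>\<omega>. (\<Prod>k<d. X 1 \<omega> k ^ \<alpha> k) \<partial>M) = 0"
      "random_vector N d U" "finite_moments N d 6 U" "pos_def_mat d \<Sigma>\<^sub>L" "gaussian_vector N d (\<lambda>_. 0) \<Sigma>\<^sub>L Z\<^sub>L"
      "prob_space.indep_var N (Rd d) Z\<^sub>L (Rd d) U"
      "\<forall>j\<in>{1..5}. \<forall>is\<in>multi_idx d j. tensor_moment N (\<lambda>\<omega> k. Z\<^sub>L \<omega> k + U \<omega> k) is = tensor_moment M (X 1) is"
      "0 < l\<^sub>z" "smallest_eigenvalue \<Sigma>\<^sub>L (l\<^sub>z\<^sup>2)" "gaussian_vector K d (\<lambda>_. 0) (cov_mat M d (X 1)) Z"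
  have Ct: "gaussian_ball_const Ct" using adm by (simp add: admissible_consts_def)
  interpret symmetric_clt d n M X N Z\<^sub>L U \<Sigma>\<^sub>L K Z l\<^sub>z Ct
    by (intro symmetric_clt.intro Ct h) (use h in blast)+
  note C = C_B6_ge[OF adm]
  let ?goal = "ball_dist d M S K Z"
  show "?goal \<le> C_B6 Ct c4 c5 * (((\<integral>\<omega>. enorm d (X 1 \<omega>) ^ 6 \<partial>M) + (\<integral>\<omega>. enorm d (L \<omega>) ^ 6 \<partial>N)) / l\<^sub>z ^ 6) powr (1/4) * real n powr (-1/2)
      + 1 / sqrt (fact 4) / l\<^sub>z ^ 4 * frob_norm d 4 D4 / real n
      + 1 / sqrt (fact 6) / l\<^sub>z ^ 6 * ((\<integral>\<omega>. enorm d (U \<omega>) ^ 6 \<partial>N) + (\<integral>\<omega>. enorm d (Z \<omega>) ^ 6 \<partial>K)) / (real n)\<^sup>2 \<and>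
    ?goal \<le> 1 / sqrt (fact 4) / l\<^sub>z ^ 4 * frob_norm d 4 D4 / real n
      + C_B6 Ct c4 c5 * (m6 / l\<^sub>z ^ 6) powr (1/4) * real d powr (3/4) * real n powr (-1/2)
      + 1 / sqrt (fact 6) * (m6 / l\<^sub>z ^ 6) * real d ^ 3 / (real n)\<^sup>2 \<and>
    1 / sqrt (fact 4) / l\<^sub>z ^ 4 * frob_norm d 4 D4 / real n
      + C_B6 Ct c4 c5 * (m6 / l\<^sub>z ^ 6) powr (1/4) * real d powr (3/4) * real n powr (-1/2)
      + 1 / sqrt (fact 6) * (m6 / l\<^sub>z ^ 6) * real d ^ 3 / (real n)\<^sup>2
    \<le> 1 / sqrt 8 / l\<^sub>z ^ 4 * max_norm d 4 D4 * real d / real n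
      + C_B6 Ct c4 c5 * (m6 / l\<^sub>z ^ 6) powr (1/4) * real d powr (3/4) * real n powr (-1/2)
      + 1 / sqrt (fact 6) * (m6 / l\<^sub>z ^ 6) * real d ^ 3 / (real n)\<^sup>2"
    using first_bound[OF C] second_bound[OF C] third_bound by (intro conjI add_right_mono)
qed

end
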